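(* There exists $\delta_0>0$ such that for every $0<\delta\le\delta_0$ the following holds. Let $\mathcal{D}\subset\mathbb{R}^2$ be a V-state with angular velocity $\Omega$. Assume that the boundary $\partial\mathcal{D}$ is a $C^{1,\frac12}$ graph over the polar angle $\theta$, i.e. $\partial\mathcal{D}=\{R(\theta)(\cos\theta,\sin\theta):\theta\in\mathbb{T}\}$ with $R\in C^{1,\frac12}(\mathbb{T})$, $R>0$. If $$|R-1|_{C^{1,\frac12}(\mathbb{T})}\le\delta\qquad\text{and}\qquad\left|\Omega-\tfrac14\right|\le\delta,$$ then $\mathcal{D}$ is a (rotating) disk or a (rotating) ellipse.
   Context: The 2D incompressible Euler equations on $\mathbb{R}^2$ in vorticity form are $\omega_t+u\cdot\nabla\omega=0$, $u=\nabla^\perp\Delta^{-1}\omega$, $\omega(0,\cdot)=\omega_0$, where $\nabla^\perp=(-\partial_2,\partial_1)$ and $\Delta^{-1}\omega=\frac{1}{2\pi}\log|\cdot|*\omega$. For $\omega_0\in L^1\cap L^\infty(\mathbb{R}^2)$ there is a unique global (Yudovich) weak solution. A bounded set $\mathcal{D}\subset\mathbb{R}^2$ is called a V-state (uniformly rotating vortex patch) with angular velocity $\Omega\in\mathbb{R}$ and center of rotation $x_0\in\mathbb{R}^2$ if the solution with initial data $\chi_{\mathcal{D}}$ (the characteristic function of $\mathcal{D}$) is $\omega(t,x)=\chi_{\mathcal{D}_t}(x)$ with $\mathcal{D}_t=x_0+e^{i\Omega t}(\mathcal{D}-x_0)$ for all $t$, where $\mathbb{R}^2$ is identified with $\mathbb{C}$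 so that $e^{i\Omega t}$ is the rotation by angle $\Omega t$. In the graph setting, $\mathcal{D}$ is the region enclosed by the curve $\partial\mathcal{D}$. "Disk" and "ellipse" refer to the region enclosed by a circle or an ellipse. $\mathbb{T}$ is the interval $[-\pi,\pi]$ with endpoints identified, and $C^{1,\frac12}(\mathbb{T})$ is the usual Hölder space. *)

theory Defs
  imports "HOL-Analysis.Analysis"
begin

text \<open>The plane \<open>\<real>\<^sup>2\<close> is the type \<^typ>\<open>complex\<close>; the coordinate directions are \<open>1\<close> and \<open>\<i>\<close>.\<close>

definition grad :: "(complex \<Rightarrow> real) \<Rightarrow> complex \<Rightarrow> complex" where
  "grad f x = Complex (frechet_derivative f (at x) 1) (frechet_derivative f (at x) \<i>)"

definition grad_perp :: "(complex \<Rightarrow> real) \<Rightarrow> complex \<Rightarrow> complex" where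
  "grad_perp f x = Complex (- frechet_derivative f (at x) \<i>) (frechet_derivative f (at x) 1)"

text \<open>The convolution of \<open>ln \<bar>\<cdot>\<bar> / (2\<pi>)\<close> with \<open>\<omega>\<close>. It converges absolutely when
  \<open>\<omega>\<close> is bounded with compact support, as it is for a vortex patch, but not for every
  integrable bounded \<open>\<omega>\<close>, since the kernel is unbounded at infinity.\<close>

definition inv_laplacian :: "(complex \<Rightarrow> real) \<Rightarrow> complex \<Rightarrow> real" where
  "inv_laplacian \<omega> x = 1 / (2 * pi) * (LINT y|lborel. ln (norm (x - y)) * \<omega> y)"

definition velocity :: "(complex \<Rightarrow> real) \<Rightarrow> complex \<Rightarrow> complex" where
  "velocity \<omega> = grad_perp (inv_laplacian \<omega>)"

definition L1_Linf_bounded :: "real \<Rightarrow> (complex \<Rightarrow> real) \<Rightarrow> bool" where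
  "L1_Linf_bounded M f \<longleftrightarrow>
     integrable lborel f \<and> (LINT x|lborel. \<bar>f x\<bar>) \<le> M \<and> (AE x in lborel. \<bar>f x\<bar> \<le> M)"

text \<open>Test functions on \<open>[0,\<infinity>) \<times> \<real>\<^sup>2\<close> are the restrictions of the compactly supported
  \<open>C\<^sup>1\<close> functions on \<open>\<real> \<times> \<real>\<^sup>2\<close>; in particular they need not vanish at \<open>t = 0\<close>.\<close>

definition test_function :: "(real \<Rightarrow> complex \<Rightarrow> real) \<Rightarrow> bool" where
  "test_function \<phi> \<longleftrightarrow>
     (\<forall>p. case_prod \<phi> differentiable (at p)) \<and>
     (\<forall>v. continuous_on UNIV (\<lambda>p. frechet_derivative (case_prod \<phi>) (at p) v)) \<and>
     bounded {p. case_prod \<phi> p \<noteq> 0}"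

text \<open>\<open>\<omega>\<close> is the Yudovich weak solution of the Euler equations with initial data \<open>\<omega>\<^sub>0\<close>. Only
  the values \<open>\<omega> t\<close> with \<open>t \<ge> 0\<close> matter. The last conjunct is the weak form, with the initial
  data built in, of \<open>\<omega>\<^sub>t + u \<cdot> \<nabla>\<omega> = 0\<close>, where \<open>u\<close> is divergence free.\<close>

definition yudovich_solution :: "(complex \<Rightarrow> real) \<Rightarrow> (real \<Rightarrow> complex \<Rightarrow> real) \<Rightarrow> bool" where
  "yudovich_solution \<omega>\<^sub>0 \<omega> \<longleftrightarrow>
     (\<exists>M. L1_Linf_bounded M \<omega>\<^sub>0) \<and>
     set_borel_measurable lborel ({0..} \<times> UNIV) (case_prod \<omega>) \<and>
     (\<exists>M. \<forall>t\<ge>0. L1_Linf_bounded M (\<omega> t)) \<and>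
     (\<forall>\<phi>. test_function \<phi> \<longrightarrow>
        (LINT t:{0..}|lborel.
           (LINT x|lborel.
              \<omega> t x * (deriv (\<lambda>s. \<phi> s x) t + velocity (\<omega> t) x \<bullet> grad (\<phi> t) x)))
        + (LINT x|lborel. \<omega>\<^sub>0 x * \<phi> 0 x) = 0)"

definition V_state :: "complex set \<Rightarrow> real \<Rightarrow> complex \<Rightarrow> bool" where
  "V_state D \<Omega> x\<^sub>0 \<longleftrightarrow>
     bounded D \<and>
     yudovich_solution (indicat_real D)
       (\<lambda>t. indicat_real ((\<lambda>z. x\<^sub>0 + exp (\<i> * of_real (\<Omega> * t)) * (z - x\<^sub>0)) ` D))"

text \<open>Functions on \<open>\<T>\<close> are \<open>2\<pi>\<close>-periodic functions on \<open>\<real>\<close>. For these, the supremum in the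
  Hoelder seminorm over all \<open>x \<noteq> y\<close> in \<open>\<real>\<close> equals the one taken with the distance on the
  circle, since that distance is the smallest distance between lifts.\<close>

definition C1_holder_torus :: "real \<Rightarrow> (real \<Rightarrow> real) \<Rightarrow> bool" where
  "C1_holder_torus \<alpha> f \<longleftrightarrow>
     (\<forall>x. f (x + 2 * pi) = f x) \<and>
     (\<forall>x. f differentiable (at x)) \<and>
     (\<exists>C. \<forall>x y. \<bar>deriv f x - deriv f y\<bar> \<le> C * \<bar>x - y\<bar> powr \<alpha>)"

definition C1_holder_norm :: "real \<Rightarrow> (real \<Rightarrow> real) \<Rightarrow> real" where
  "C1_holder_norm \<alpha> f =
     (SUP x. \<bar>f x\<bar>) + (SUP x. \<bar>deriv f x\<bar>) +
     (SUP (x, y)\<in>{(x, y). x \<noteq> y}. \<bar>deriv f x - deriv f y\<bar> / \<bar>x - y\<bar> powr \<alpha>)"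

text \<open>The region enclosed by a closed curve is taken to be open.\<close>

definition is_disk :: "complex set \<Rightarrow> bool" where
  "is_disk D \<longleftrightarrow> (\<exists>c r. r > 0 \<and> D = inside (sphere c r))"

definition ellipse_curve :: "complex \<Rightarrow> real \<Rightarrow> real \<Rightarrow> real \<Rightarrow> complex set" where
  "ellipse_curve c \<beta> a b = range (\<lambda>s. c + cis \<beta> * Complex (a * cos s) (b * sin s))"

definition is_ellipse :: "complex set \<Rightarrow> bool" where
  "is_ellipse D \<longleftrightarrow> (\<exists>c \<beta> a b. a > 0 \<and> b > 0 \<and> D = inside (ellipse_curve c \<beta> a b))"

end

theory Submission
  imports Defs
begin

text \<open>
  Test the weak equation with functions carried along by the rotation: on \<open>D\<close>, the velocity in the
  rotating frame is orthogonal to all gradients. The gradients of \<open>z\<close> and \<open>z\<^sup>2 / 2\<close> show that \<open>x\<^sub>0\<close>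
  is the centroid of \<open>D\<close> and that \<open>Q = \<integral> (z - x\<^sub>0)\<^sup>2\<close> satisfies
  \<open>4 \<pi> \<Omega> Q = \<integral>\<integral> (z - w) / cnj (z - w)\<close>; functions of the polar angle show that the relative stream
  function \<open>\<Delta>\<^sup>-\<^sup>1 1\<^sub>D - \<Omega> \<bar>z - x\<^sub>0\<bar>\<^sup>2 / 2\<close> is constant on the boundary. Let \<open>E\<close> be the ellipse
  with the area, the centroid and the second moment \<open>Q\<close> of \<open>D\<close>. It satisfies the same relations with
  Kirchhoff's angular velocity \<open>\<Omega>\<^sub>E\<close> in place of \<open>\<Omega>\<close>.

  Let \<open>\<Psi>\<close> be the difference of the two relative stream functions and let \<open>m \<theta>\<close> be the integral of
  \<open>1\<^sub>D - 1\<^sub>E\<close> along the ray \<open>\<theta>\<close>. Each stream function is constant on its boundary and has radial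
  slope close to \<open>1/4\<close>, so \<open>\<integral> \<Psi> (1\<^sub>D - 1\<^sub>E)\<close> is at most about \<open>- 1/4 \<integral> m\<^sup>2\<close>. On the other hand,
  it is the logarithmic energy of \<open>1\<^sub>D - 1\<^sub>E\<close> up to a term with the factor \<open>\<Omega> - \<Omega>\<^sub>E\<close>, which is negligible
  because the equations for \<open>Q\<close> bound \<open>(\<Omega> - \<Omega>\<^sub>E) Q\<close>. Since the moments of order up to \<open>2\<close>
  agree, the Fourier modes \<open>0\<close>, \<open>1\<close>, \<open>2\<close> of \<open>m\<close> are negligible, and the other modes make the
  logarithmic energy at least about \<open>- 1/6 \<integral> m\<^sup>2\<close>. Hence \<open>m = 0\<close> and \<open>D = E\<close>.
\<close>

section \<open>Polar coordinates and linear changes of variables\<close>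

text \<open>The velocity 1/4 is critical. Near the unit disk a perturbation in mode n contributes
  -1/(2n) times its square to the logarithmic energy, to be compared with the radial slope 1/2 -
  \<Omega>. At \<Omega> = 1/4 the two balance exactly for n = 2: this is where the ellipses branch
  off, and no estimate against the disk alone can succeed. Removing mode 2 requires an ellipse with
  the same second moment; equal centroids remove mode 1, and equal areas remove the unknown
  constants of the two stream functions. From n = 3 on there is a true gap, 1/6 against 1/4, kept in
  the form 17/100 against 21/100, and all errors are made small by the width of the annulus. The
  other obstacle is that the two patches rotate with different velocities, and their difference need
  not be as small as m. It multiplies the integral of |z - x0|^2 (1_D - 1_E). To first order in m
  this integral only sees how much |z - x0|^2 varies on the ellipse, a multiple of |\<beta>|, and
  |\<beta>| is at most |Q|. So the factor |Q| |\<Omega> - \<Omega>E|, small by the kernel identity,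
  appears and makes the term quadratic in m.\<close>

lemma measurable_Complex [measurable (raw)]:
  "f \<in> borel_measurable M \<Longrightarrow> g \<in> borel_measurable M \<Longrightarrow> (\<lambda>x. Complex (f x) (g x)) \<in> borel_measurable M"
  by (simp add: Complex_eq)

lemma measurable_cis [measurable (raw)]:
  "f \<in> borel_measurable M \<Longrightarrow> (\<lambda>x. cis (f x)) \<in> borel_measurable M"
  by (simp add: cis.code measurable_Complex)

lemma measurable_cnj [measurable (raw)]:
  "f \<in> borel_measurable M \<Longrightarrow> (\<lambda>x. cnj (f x)) \<in> borel_measurable M"
  by (rule borel_measurable_continuous_on[OF continuous_on_cnj[OF continuous_on_id]])

lemma lborel_complex_eq_distr:
  "(lborel :: complex measure) = distr (lborel \<Otimes>\<^sub>M lborel) borel (\<lambda>(x, y). Complex x y)"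
proof (rule lborel_eqI)
  fix l u :: complex
  assume le: "\<And>b. b \<in> Basis \<Longrightarrow> l \<bullet> b \<le> u \<bullet> b"
  have "(\<lambda>(x, y). Complex x y) -` box l u \<inter> space (lborel \<Otimes>\<^sub>M lborel) = {Re l<..<Re u} \<times> {Im l<..<Im u}"
    by (auto simp: in_box_complex_iff space_pair_measure)
  moreover have "Re l \<le> Re u" "Im l \<le> Im u"
    using le[of 1] le[of \<i>] by (auto simp: Basis_complex_def)
  ultimately show "emeasure (distr (lborel \<Otimes>\<^sub>M lborel) borel (\<lambda>(x, y). Complex x y)) (box l u) =
      ennreal (\<Prod>b\<in>Basis. (u - l) \<bullet> b)"
    by (subst emeasure_distr)
       (auto simp: lborel.emeasure_pair_measure_Times Basis_complex_def ennreal_mult)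
qed simp

lemma nn_integral_complex:
  assumes [measurable]: "f \<in> borel_measurable borel"
  shows "(\<integral>\<^sup>+z. f z \<partial>lborel) = (\<integral>\<^sup>+x. \<integral>\<^sup>+y. f (Complex x y) \<partial>lborel \<partial>lborel)"
  unfolding lborel_complex_eq_distr
  by (simp add: nn_integral_distr lborel.nn_integral_fst[symmetric])

lemma nn_integral_complex':
  assumes [measurable]: "f \<in> borel_measurable borel"
  shows "(\<integral>\<^sup>+z. f z \<partial>lborel) = (\<integral>\<^sup>+y. \<integral>\<^sup>+x. f (Complex x y) \<partial>lborel \<partial>lborel)"
  by (subst nn_integral_complex) (auto intro!: lborel_pair.Fubini')

section \<open>Linear substitutions in the plane, by elimination of one variable at a time\<close>

lemma nn_integral_linear:
  fixes c d :: complex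
  assumes f[measurable]: "f \<in> borel_measurable borel"
    and det: "cmod d < cmod c" and nz: "Re (c + d) \<noteq> 0"
  shows "(\<integral>\<^sup>+z. f z \<partial>lborel) = ((cmod c)\<^sup>2 - (cmod d)\<^sup>2) * (\<integral>\<^sup>+z. f (c * z + d * cnj z) \<partial>lborel)"
proof -
  define p q r s where "p = Re c + Re d" and "q = Im d - Im c" and "r = Im c + Im d" and "s = Re c - Re d"
  have eq: "c * Complex x y + d * cnj (Complex x y) = Complex (p * x + q * y) (r * x + s * y)" for x y
    by (simp add: complex_eq_iff p_def q_def r_def s_def algebra_simps)
  have D: "(cmod c)\<^sup>2 - (cmod d)\<^sup>2 = p * s - q * r"
    unfolding cmod_power2 p_def q_def r_def s_def by (simp add: power2_eq_square algebra_simps)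
  have Dpos: "p * s - q * r > 0"
    using det D by (metis diff_gt_0_iff_gt norm_ge_zero pos2 power_strict_mono)
  have p: "p \<noteq> 0" using nz by (simp add: p_def)
  \<comment> \<open>The second pivot of the real 2 x 2 matrix after elimination with the pivot
    \<open>p\<close>, so that \<open>p * t\<close> is the determinant. The hypothesis
    \<open>nz\<close> is exactly \<open>p\<close> being nonzero.\<close>
  define t where "t = s - r * q / p"
  have t: "t \<noteq> 0" using Dpos p by (auto simp: t_def field_simps)
  have pt: "\<bar>p\<bar> * \<bar>t\<bar> = p * s - q * r"
    using Dpos p by (simp add: t_def abs_mult[symmetric] field_simps)
  have "(\<integral>\<^sup>+z. f (c * z + d * cnj z) \<partial>lborel) =
      (\<integral>\<^sup>+y. \<integral>\<^sup>+x. f (Complex (p * x + q * y) (r * x + s * y)) \<partial>lborel \<partial>lborel)"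
    by (subst nn_integral_complex') (simp_all add: eq del: complex_cnj)
  also have "ennreal \<bar>p\<bar> * \<dots> = (\<integral>\<^sup>+y. \<bar>p\<bar> * (\<integral>\<^sup>+x. f (Complex (p * x + q * y) (r * x + s * y)) \<partial>lborel) \<partial>lborel)"
    by (rule nn_integral_cmult[symmetric]) simp
  also have "\<dots> = (\<integral>\<^sup>+y. (\<integral>\<^sup>+x. f (Complex x (r / p * x + t * y)) \<partial>lborel) \<partial>lborel)"
  proof (intro nn_integral_cong)
    fix y
    have e: "r / p * (q * y + p * x) + t * y = r * x + s * y" for x
      using p by (simp add: t_def field_simps)
    show "\<bar>p\<bar> * (\<integral>\<^sup>+x. f (Complex (p * x + q * y) (r * x + s * y)) \<partial>lborel)
        = (\<integral>\<^sup>+x. f (Complex x (r / p * x + t * y)) \<partial>lborel)"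
      using e by (subst nn_integral_real_affine[OF _ p, of "\<lambda>x. f (Complex x (r / p * x + t * y))" "q * y"])
         (simp_all add: add.commute)
  qed
  also have "\<dots> = (\<integral>\<^sup>+x. (\<integral>\<^sup>+y. f (Complex x (r / p * x + t * y)) \<partial>lborel) \<partial>lborel)"
    by (rule lborel_pair.Fubini') simp
  also have "ennreal \<bar>t\<bar> * \<dots> = (\<integral>\<^sup>+x. \<bar>t\<bar> * (\<integral>\<^sup>+y. f (Complex x (r / p * x + t * y)) \<partial>lborel) \<partial>lborel)"
    by (rule nn_integral_cmult[symmetric]) simp
  also have "\<dots> = (\<integral>\<^sup>+x. (\<integral>\<^sup>+y. f (Complex x y) \<partial>lborel) \<partial>lborel)"
    by (intro nn_integral_cong nn_integral_real_affine[OF _ t, symmetric]) simp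
  also have "\<dots> = (\<integral>\<^sup>+z. f z \<partial>lborel)"
    by (rule nn_integral_complex[symmetric]) simp
  finally show ?thesis
    unfolding D pt[symmetric] by (simp add: ennreal_mult mult.assoc mult.left_commute)
qed

lemma nn_integral_rotate:
  fixes u :: complex
  assumes f[measurable]: "f \<in> borel_measurable borel" and u: "cmod u = 1"
  shows "(\<integral>\<^sup>+z. f (u * z) \<partial>lborel) = (\<integral>\<^sup>+z. f z \<partial>lborel)"
proof -
  have 1: "(\<integral>\<^sup>+z. f (u * z) \<partial>lborel) = (\<integral>\<^sup>+z. f z \<partial>lborel)"
    if "cmod u = 1" "Re u \<noteq> 0" "f \<in> borel_measurable borel" for u :: complex and f :: "complex \<Rightarrow> ennreal"
    using nn_integral_linear[of f 0 u] that by simp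
  (* nn_integral_linear does not cover u = i and u = -i, but these are squares of admissible rotations *)
  define v where "v = csqrt u"
  have v2: "v * v = u" by (simp add: v_def flip: power2_eq_square)
  have nv: "cmod v = 1" using u by (simp add: v_def)
  show ?thesis
  proof (cases "Re u = 0")
    case True
    have "Re v \<noteq> 0"
    proof
      assume "Re v = 0"
      then have "u = of_real (- (Im v)\<^sup>2)" using v2 by (auto simp: complex_eq_iff power2_eq_square)
      with True have "u = 0" by simp
      with u show False by simp
    qed
    then have "(\<integral>\<^sup>+z. f (v * (v * z)) \<partial>lborel) = (\<integral>\<^sup>+z. f z \<partial>lborel)"
      using 1[OF nv, of "\<lambda>z. f (v * z)"] 1[OF nv, of f] by simp
    then show ?thesis by (simp add: v2 flip: mult.assoc)
  qed (use 1 u in auto)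
qed

text \<open>Not normalised: the total mass is 2 pi. Keeping both endpoints is harmless, as they form
  a null set.\<close>

definition circ :: "real measure" where
  "circ = density lborel (indicator {-pi..pi})"

text \<open>Since \<open>ennreal r = 0\<close> for \<open>r \<le> 0\<close>, this is \<open>r dr\<close> on the half line.\<close>

definition rad :: "real measure" where
  "rad = density lborel ennreal"

lemma sets_circ [simp, measurable_cong]: "sets circ = sets borel"
  and space_circ [simp]: "space circ = UNIV"
  and sets_rad [simp, measurable_cong]: "sets rad = sets borel"
  and space_rad [simp]: "space rad = UNIV"
  by (auto simp: circ_def rad_def)

lemma emeasure_circ_UNIV: "emeasure circ UNIV = ennreal (2 * pi)"
  by (simp add: circ_def emeasure_density)

interpretation circ: finite_measure circ
  by standard (simp add: emeasure_circ_UNIV)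

interpretation rad: sigma_finite_measure rad
  unfolding rad_def by (subst sigma_finite_measure.sigma_finite_iff_density_finite[OF sigma_finite_lborel]) auto

interpretation circ_rad: pair_sigma_finite circ rad ..

text \<open>The substitution is done on [-n, n], and n tends to infinity by monotone convergence on
  both sides.\<close>

lemma nn_integral_arctan_indicator:
  fixes A :: "real set"
  assumes [measurable]: "A \<in> sets borel"
  defines "h \<equiv> \<lambda>x. ennreal (indicator A x)"
  shows "(\<integral>\<^sup>+t. h (arctan t) * ennreal (1 / (1 + t\<^sup>2)) \<partial>lborel) = (\<integral>\<^sup>+x. h x * indicator {-(pi/2)<..<pi/2} x \<partial>lborel)"
proof -
  have [measurable]: "h \<in> borel_measurable borel" by (simp add: h_def)
  have 1: "(\<integral>\<^sup>+x. h x * indicator {arctan (- real n)..arctan (real n)} x \<partial>lborel) =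
      (\<integral>\<^sup>+t. h (arctan t) * ennreal (1 / (1 + t\<^sup>2)) * indicator {- real n..real n} t \<partial>lborel)" for n
  proof -
    have c: "continuous_on {- real n..real n} (\<lambda>t::real. 1 / (1 + t\<^sup>2))"
      by (intro continuous_intros ballI) (smt (verit) zero_le_power2)
    have m: "set_borel_measurable borel {arctan (- real n)..arctan (real n)} (indicator A :: real \<Rightarrow> real)"
      by (simp add: set_borel_measurable_def)
    have d: "(arctan has_real_derivative 1 / (1 + x\<^sup>2)) (at x)" for x
      by (auto intro!: derivative_eq_intros simp: divide_inverse)
    have "(\<integral>\<^sup>+x. ennreal (indicator A x * indicator {arctan (- real n)..arctan (real n)} x) \<partial>lborel) =
      (\<integral>\<^sup>+t. ennreal (indicator A (arctan t) * (1 / (1 + t\<^sup>2)) * indicator {- real n..real n} t) \<partial>lborel)"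
      by (rule nn_integral_substitution[OF m d c]) auto
    then show ?thesis
      by (simp add: h_def ennreal_mult' ennreal_indicator divide_inverse mult.assoc)
  qed
  have 2: "(\<lambda>n. \<integral>\<^sup>+x. h x * indicator {arctan (- real n)..arctan (real n)} x \<partial>lborel)
      \<longlonglongrightarrow> (\<integral>\<^sup>+x. h x * indicator {-(pi/2)<..<pi/2} x \<partial>lborel)"
  proof (rule nn_integral_LIMSEQ)
    show "incseq (\<lambda>n x. h x * indicator {arctan (- real n)..arctan (real n)} x)"
    proof (rule incseq_SucI, rule le_funI)
      fix n :: nat and x :: real
      have "arctan (- real (Suc n)) \<le> arctan (- real n)" "arctan (real n) \<le> arctan (real (Suc n))"
        by (simp_all only: arctan_le_iff)
      then have "{arctan (- real n)..arctan (real n)} \<subseteq> {arctan (- real (Suc n))..arctan (real (Suc n))}"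
        by (simp only: atLeastatMost_subset_iff) simp
      then show "h x * indicator {arctan (- real n)..arctan (real n)} x
          \<le> h x * indicator {arctan (- real (Suc n))..arctan (real (Suc n))} x"
        by (intro mult_left_mono indicator_leI zero_le) blast
    qed
    fix x
    show "(\<lambda>n. h x * indicator {arctan (- real n)..arctan (real n)} x) \<longlonglongrightarrow> h x * indicator {-(pi/2)<..<pi/2} x"
    proof (cases "x \<in> {-(pi/2)<..<pi/2}")
      case True
      obtain N :: nat where N: "\<bar>tan x\<bar> \<le> real N" using real_arch_simple by blast
      have "x \<in> {arctan (- real n)..arctan (real n)}" if "n \<ge> N" for n
      proof -
        have "- real n \<le> tan x" "tan x \<le> real n" using N that by auto
        then have "arctan (- real n) \<le> arctan (tan x)" "arctan (tan x) \<le> arctan (real n)"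
          by (simp_all only: arctan_le_iff)
        moreover have "arctan (tan x) = x" using True by (intro arctan_tan) auto
        ultimately show ?thesis by simp
      qed
      then have "eventually (\<lambda>n. h x * indicator {arctan (- real n)..arctan (real n)} x = h x * indicator {-(pi/2)<..<pi/2} x) sequentially"
        using True by (intro eventually_sequentiallyI[of N]) (auto simp: indicator_def)
      then show ?thesis by (rule tendsto_eventually)
    next
      case False
      have "x \<notin> {arctan (- real n)..arctan (real n)}" for n
        using False arctan_bounded[of "- real n"] arctan_bounded[of "real n"] by auto
      then show ?thesis using False by simp
    qed
  qed simp
  have 3: "(\<lambda>n. \<integral>\<^sup>+t. h (arctan t) * ennreal (1 / (1 + t\<^sup>2)) * indicator {- real n..real n} t \<partial>lborel)
      \<longlonglongrightarrow> (\<integral>\<^sup>+t. h (arctan t) * ennreal (1 / (1 + t\<^sup>2)) \<partial>lborel)"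
  proof (rule nn_integral_LIMSEQ)
    show "incseq (\<lambda>n t. h (arctan t) * ennreal (1 / (1 + t\<^sup>2)) * indicator {- real n..real n} t)"
      by (auto simp: incseq_def le_fun_def split: split_indicator)
    fix t
    obtain N :: nat where N: "\<bar>t\<bar> \<le> real N" using real_arch_simple by blast
    then have "eventually (\<lambda>n. h (arctan t) * ennreal (1 / (1 + t\<^sup>2)) * indicator {- real n..real n} t
        = h (arctan t) * ennreal (1 / (1 + t\<^sup>2))) sequentially"
      by (intro eventually_sequentiallyI[of N]) (auto simp: indicator_def)
    then show "(\<lambda>n. h (arctan t) * ennreal (1 / (1 + t\<^sup>2)) * indicator {- real n..real n} t)
        \<longlonglongrightarrow> h (arctan t) * ennreal (1 / (1 + t\<^sup>2))"
      by (rule tendsto_eventually)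
  qed simp
  show ?thesis by (rule LIMSEQ_unique[OF 3 2[unfolded 1]])
qed

text \<open>Indicators suffice: they show that \<open>arctan\<close> carries the density 1 / (1 +
  t^2) to Lebesgue measure on (-pi/2, pi/2), and an equality of measures covers every
  integrand.\<close>

lemma nn_integral_arctan:
  assumes [measurable]: "h \<in> borel_measurable borel"
  shows "(\<integral>\<^sup>+t. h (arctan t) * ennreal (1 / (1 + t\<^sup>2)) \<partial>lborel) = (\<integral>\<^sup>+x. h x * indicator {-(pi/2)<..<pi/2} x \<partial>lborel)"
proof -
  have eq: "distr (density lborel (\<lambda>t. ennreal (1 / (1 + t\<^sup>2)))) borel arctan = density lborel (indicator {-(pi/2)<..<pi/2})"
    (is "?M = ?N")
  proof (rule measure_eqI)
    fix A :: "real set" assume "A \<in> sets ?M"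
    then have [measurable]: "A \<in> sets borel" by simp
    have "emeasure ?M A = (\<integral>\<^sup>+x. indicator A x \<partial>?M)"
      by (subst nn_integral_indicator) auto
    also have "\<dots> = (\<integral>\<^sup>+t. ennreal (indicator A (arctan t)) * ennreal (1 / (1 + t\<^sup>2)) \<partial>lborel)"
      by (subst nn_integral_distr) (auto simp: nn_integral_density ennreal_indicator mult.commute)
    also have "\<dots> = (\<integral>\<^sup>+x. ennreal (indicator A x) * indicator {-(pi/2)<..<pi/2} x \<partial>lborel)"
      by (rule nn_integral_arctan_indicator) simp
    also have "\<dots> = emeasure ?N A"
      by (auto simp: emeasure_density ennreal_indicator mult.commute)
    finally show "emeasure ?M A = emeasure ?N A" .
  qed simp
  have "(\<integral>\<^sup>+t. h (arctan t) * ennreal (1 / (1 + t\<^sup>2)) \<partial>lborel) = (\<integral>\<^sup>+x. h x \<partial>?M)"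
    by (subst nn_integral_distr) (auto simp: nn_integral_density mult.commute)
  also have "\<dots> = (\<integral>\<^sup>+x. h x * indicator {-(pi/2)<..<pi/2} x \<partial>lborel)"
    unfolding eq by (auto simp: nn_integral_density mult.commute)
  finally show ?thesis .
qed

lemma nn_integral_right_half_plane:
  fixes f :: "complex \<Rightarrow> ennreal"
  assumes [measurable]: "f \<in> borel_measurable borel"
  shows "(\<integral>\<^sup>+z. f z * indicator {z. Re z > 0} z \<partial>lborel) =
    (\<integral>\<^sup>+\<theta>. (\<integral>\<^sup>+r. f (of_real r * cis \<theta>) \<partial>rad) * indicator {-(pi/2)<..<pi/2} \<theta> \<partial>lborel)"
proof -
  have [measurable]: "{z. Re z > 0} \<in> sets borel" by measurable
  have "(\<integral>\<^sup>+z. f z * indicator {z. Re z > 0} z \<partial>lborel) =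
      (\<integral>\<^sup>+x. \<integral>\<^sup>+y. f (Complex x y) * indicator {0<..} x \<partial>lborel \<partial>lborel)"
    by (subst nn_integral_complex) (auto intro!: nn_integral_cong simp: indicator_def)
  (* y = x t, and below t = tan \<theta> and x = r cos \<theta> *)
  also have "\<dots> = (\<integral>\<^sup>+x. \<integral>\<^sup>+t. f (Complex x (x * t)) * ennreal x * indicator {0<..} x \<partial>lborel \<partial>lborel)"
  proof (rule nn_integral_cong)
    fix x :: real
    show "(\<integral>\<^sup>+y. f (Complex x y) * indicator {0<..} x \<partial>lborel) = (\<integral>\<^sup>+t. f (Complex x (x * t)) * ennreal x * indicator {0<..} x \<partial>lborel)"
    proof (cases "x > 0")
      case True
      then show ?thesis
        by (subst nn_integral_real_affine[where c=x and t=0])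
           (auto simp: nn_integral_cmult[symmetric] mult.commute[of x] mult.commute[of _ "ennreal x"])
    qed (simp add: indicator_def)
  qed
  also have "\<dots> = (\<integral>\<^sup>+t. \<integral>\<^sup>+x. f (Complex x (x * t)) * ennreal x * indicator {0<..} x \<partial>lborel \<partial>lborel)"
    by (rule lborel_pair.Fubini') simp
  also have "\<dots> = (\<integral>\<^sup>+t. (\<integral>\<^sup>+r. f (of_real r * cis (arctan t)) \<partial>rad) * ennreal (1 / (1 + t\<^sup>2)) \<partial>lborel)"
  proof (rule nn_integral_cong)
    fix t :: real
    define c where "c = 1 / sqrt (1 + t\<^sup>2)"
    have pos: "0 < 1 + t\<^sup>2" by (simp add: add_pos_nonneg)
    have c: "c > 0" "c * c = 1 / (1 + t\<^sup>2)" using pos by (auto simp: c_def real_sqrt_mult_self)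
    have cis: "of_real r * cis (arctan t) = Complex (c * r) (c * r * t)" for r
      by (simp add: complex_eq_iff cos_arctan sin_arctan c_def)
    have "(\<integral>\<^sup>+x. f (Complex x (x * t)) * ennreal x * indicator {0<..} x \<partial>lborel) =
       ennreal c * (\<integral>\<^sup>+r. f (Complex (c * r) (c * r * t)) * ennreal (c * r) * indicator {0<..} (c * r) \<partial>lborel)"
      using c by (subst nn_integral_real_affine[where c=c and t=0]) auto
    also have "\<dots> = ennreal c * (\<integral>\<^sup>+r. ennreal c * (f (of_real r * cis (arctan t)) * ennreal r) \<partial>lborel)"
      unfolding cis
    proof (rule arg_cong[OF nn_integral_cong])
      fix r :: real
      show "f (Complex (c * r) (c * r * t)) * ennreal (c * r) * indicator {0<..} (c * r) =
          ennreal c * (f (Complex (c * r) (c * r * t)) * ennreal r)"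
        using c by (cases "r > 0") (auto simp: indicator_def ennreal_mult zero_less_mult_iff ac_simps ennreal_neg)
    qed
    also have "\<dots> = (ennreal c * ennreal c) * (\<integral>\<^sup>+r. (f (of_real r * cis (arctan t)) * ennreal r) \<partial>lborel)"
      by (subst nn_integral_cmult) (auto simp: mult.assoc)
    also have "\<dots> = (\<integral>\<^sup>+r. f (of_real r * cis (arctan t)) \<partial>rad) * ennreal (1 / (1 + t\<^sup>2))"
      using c by (simp add: rad_def nn_integral_density ennreal_mult[symmetric] mult.commute)
    finally show "(\<integral>\<^sup>+x. f (Complex x (x * t)) * ennreal x * indicator {0<..} x \<partial>lborel) =
      (\<integral>\<^sup>+r. f (of_real r * cis (arctan t)) \<partial>rad) * ennreal (1 / (1 + t\<^sup>2))" .
  qed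
  also have "\<dots> = (\<integral>\<^sup>+\<theta>. (\<integral>\<^sup>+r. f (of_real r * cis \<theta>) \<partial>rad) * indicator {-(pi/2)<..<pi/2} \<theta> \<partial>lborel)"
    by (rule nn_integral_arctan) simp
  finally show ?thesis .
qed

lemma AE_Re_neq_0: "AE z in (lborel :: complex measure). Re z \<noteq> 0"
proof -
  have "emeasure (lborel :: complex measure) {z. Re z = 0} = (\<integral>\<^sup>+z. indicator {z. Re z = 0} z \<partial>lborel)"
    by simp
  also have "\<dots> = (\<integral>\<^sup>+x. \<integral>\<^sup>+y. indicator {0::real} x \<partial>(lborel::real measure) \<partial>lborel)"
    by (subst nn_integral_complex) (auto intro!: nn_integral_cong simp: indicator_def)
  also have "\<dots> = (\<integral>\<^sup>+y. \<integral>\<^sup>+x. indicator {0::real} x \<partial>(lborel::real measure) \<partial>(lborel::real measure))"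
    by (rule lborel_pair.Fubini') simp
  also have "\<dots> = 0" by simp
  finally show ?thesis by (intro AE_I[of _ _ "{z. Re z = 0}"]) auto
qed

text \<open>The slope parametrises only a half plane. The half turn z -> -z brings the left half
  plane to the right one and shifts angles by pi; the two quarter pieces are then moved into (pi/2,
  pi) and (-pi, -pi/2), the second by periodicity.\<close>

lemma nn_integral_polar:
  fixes f :: "complex \<Rightarrow> ennreal"
  assumes [measurable]: "f \<in> borel_measurable borel"
  shows "(\<integral>\<^sup>+z. f z \<partial>lborel) = (\<integral>\<^sup>+\<theta>. \<integral>\<^sup>+r. f (of_real r * cis \<theta>) \<partial>rad \<partial>circ)"
proof -
  define F where "F = (\<lambda>\<theta>. \<integral>\<^sup>+r. f (of_real r * cis \<theta>) \<partial>rad)"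
  have [measurable]: "F \<in> borel_measurable borel" unfolding F_def by measurable
  have per: "F (\<theta> + 2 * pi) = F \<theta>" for \<theta>
    by (simp add: F_def flip: cis_mult)
  have [measurable]: "{z. Re z > 0} \<in> sets borel" "{z. Re z < 0} \<in> sets borel" by measurable
  have L: "(\<integral>\<^sup>+z. f z * indicator {z. Re z < 0} z \<partial>lborel) = (\<integral>\<^sup>+\<theta>. F (\<theta> + pi) * indicator {-(pi/2)<..<pi/2} \<theta> \<partial>lborel)"
  proof -
    have "(\<integral>\<^sup>+z. f z * indicator {z. Re z < 0} z \<partial>lborel) = (\<integral>\<^sup>+z. f (-1 * z) * indicator {z. Re z < 0} (-1 * z) \<partial>lborel)"
      by (rule nn_integral_rotate[symmetric]) auto
    also have "\<dots> = (\<integral>\<^sup>+z. f (- z) * indicator {z. Re z > 0} z \<partial>lborel)"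
      by (auto intro!: nn_integral_cong simp: indicator_def)
    also have "\<dots> = (\<integral>\<^sup>+\<theta>. F (\<theta> + pi) * indicator {-(pi/2)<..<pi/2} \<theta> \<partial>lborel)"
      by (subst nn_integral_right_half_plane) (auto simp: F_def simp flip: cis_mult)
    finally show ?thesis .
  qed
  have L1: "(\<integral>\<^sup>+\<theta>. F (\<theta> + pi) * indicator {-(pi/2)<..<0} \<theta> \<partial>lborel) = (\<integral>\<^sup>+\<theta>. F \<theta> * indicator {pi/2<..<pi} \<theta> \<partial>lborel)"
    by (subst (2) nn_integral_real_affine[where c=1 and t=pi])
       (auto intro!: nn_integral_cong simp: indicator_def add.commute)
  have L2: "(\<integral>\<^sup>+\<theta>. F (\<theta> + pi) * indicator {0<..<pi/2} \<theta> \<partial>lborel) = (\<integral>\<^sup>+\<theta>. F \<theta> * indicator {-pi<..<-(pi/2)} \<theta> \<partial>lborel)"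
    using per[of "_ - pi"]
    by (subst (2) nn_integral_real_affine[where c=1 and t="-pi"])
       (auto intro!: nn_integral_cong simp: indicator_def algebra_simps)
  have "(\<integral>\<^sup>+z. f z \<partial>lborel) = (\<integral>\<^sup>+z. f z * indicator {z. Re z > 0} z + f z * indicator {z. Re z < 0} z \<partial>lborel)"
    using AE_Re_neq_0 by (intro nn_integral_cong_AE) (auto simp: indicator_def)
  also have "\<dots> = (\<integral>\<^sup>+\<theta>. F \<theta> * indicator {-(pi/2)<..<pi/2} \<theta> \<partial>lborel)
      + (\<integral>\<^sup>+\<theta>. F (\<theta> + pi) * indicator {-(pi/2)<..<pi/2} \<theta> \<partial>lborel)"
    by (subst nn_integral_add) (auto simp: L nn_integral_right_half_plane F_def)
  also have "(\<integral>\<^sup>+\<theta>. F (\<theta> + pi) * indicator {-(pi/2)<..<pi/2} \<theta> \<partial>lborel) =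
      (\<integral>\<^sup>+\<theta>. F (\<theta> + pi) * indicator {-(pi/2)<..<0} \<theta> + F (\<theta> + pi) * indicator {0<..<pi/2} \<theta> \<partial>lborel)"
    using AE_lborel_singleton[of 0] by (intro nn_integral_cong_AE) (auto simp: indicator_def)
  also have "\<dots> = (\<integral>\<^sup>+\<theta>. F \<theta> * indicator {pi/2<..<pi} \<theta> + F \<theta> * indicator {-pi<..<-(pi/2)} \<theta> \<partial>lborel)"
    by (simp add: nn_integral_add L1 L2)
  also have "(\<integral>\<^sup>+\<theta>. F \<theta> * indicator {-(pi/2)<..<pi/2} \<theta> \<partial>lborel) + \<dots> =
      (\<integral>\<^sup>+\<theta>. F \<theta> * indicator {-(pi/2)<..<pi/2} \<theta> + (F \<theta> * indicator {pi/2<..<pi} \<theta> + F \<theta> * indicator {-pi<..<-(pi/2)} \<theta>) \<partial>lborel)"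
    by (rule nn_integral_add[symmetric]) auto
  also have "\<dots> = (\<integral>\<^sup>+\<theta>. F \<theta> * indicator {-pi..pi} \<theta> \<partial>lborel)"
    using AE_lborel_singleton[of "pi/2"] AE_lborel_singleton[of "-(pi/2)"] AE_lborel_singleton[of "pi"] AE_lborel_singleton[of "-pi"]
    by (intro nn_integral_cong_AE, eventually_elim) (use pi_gt_zero in \<open>auto simp: indicator_def\<close>)
  also have "\<dots> = (\<integral>\<^sup>+\<theta>. F \<theta> \<partial>circ)"
    by (simp add: circ_def nn_integral_density mult.commute)
  finally show ?thesis by (simp add: F_def)
qed

lemma lborel_polar: "(lborel :: complex measure) = distr (circ \<Otimes>\<^sub>M rad) borel (\<lambda>(\<theta>, r). of_real r * cis \<theta>)"
proof (rule measure_eqI)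
  fix A :: "complex set" assume "A \<in> sets lborel"
  then have [measurable]: "A \<in> sets borel" by simp
  have "emeasure lborel A = (\<integral>\<^sup>+z. indicator A z \<partial>lborel)" by simp
  also have "\<dots> = (\<integral>\<^sup>+\<theta>. \<integral>\<^sup>+r. indicator A (of_real r * cis \<theta>) \<partial>rad \<partial>circ)"
    by (rule nn_integral_polar) simp
  also have "\<dots> = (\<integral>\<^sup>+p. indicator A ((\<lambda>(\<theta>, r). of_real r * cis \<theta>) p) \<partial>(circ \<Otimes>\<^sub>M rad))"
    by (subst rad.nn_integral_fst[symmetric]) (auto simp: case_prod_unfold)
  also have "\<dots> = (\<integral>\<^sup>+p. indicator A p \<partial>distr (circ \<Otimes>\<^sub>M rad) borel (\<lambda>(\<theta>, r). of_real r * cis \<theta>))"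
    by (subst nn_integral_distr) auto
  also have "\<dots> = emeasure (distr (circ \<Otimes>\<^sub>M rad) borel (\<lambda>(\<theta>, r). of_real r * cis \<theta>)) A"
    by (subst nn_integral_indicator) auto
  finally show "emeasure lborel A = emeasure (distr (circ \<Otimes>\<^sub>M rad) borel (\<lambda>(\<theta>, r). of_real r * cis \<theta>)) A" .
qed simp

lemma integrable_polar:
  fixes f :: "complex \<Rightarrow> 'a :: {banach, second_countable_topology}"
  assumes [measurable]: "f \<in> borel_measurable borel"
  shows "integrable lborel f \<longleftrightarrow> integrable (circ \<Otimes>\<^sub>M rad) (\<lambda>(\<theta>, r). f (of_real r * cis \<theta>))"
  by (subst lborel_polar, subst integrable_distr_eq) (auto simp: case_prod_unfold)

lemma integral_polar:
  fixes f :: "complex \<Rightarrow> 'a :: {banach, second_countable_topology}"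
  assumes f: "integrable lborel f"
  shows "(LINT z|lborel. f z) = (LINT \<theta>|circ. LINT r|rad. f (of_real r * cis \<theta>))"
proof -
  have [measurable]: "f \<in> borel_measurable borel" using f by auto
  have i: "integrable (circ \<Otimes>\<^sub>M rad) (\<lambda>(\<theta>, r). f (of_real r * cis \<theta>))"
    using f by (simp add: integrable_polar)
  have "(LINT z|lborel. f z) = (LINT p|(circ \<Otimes>\<^sub>M rad). (\<lambda>(\<theta>, r). f (of_real r * cis \<theta>)) p)"
    by (subst lborel_polar, subst integral_distr) (auto simp: case_prod_unfold)
  also have "\<dots> = (LINT \<theta>|circ. LINT r|rad. f (of_real r * cis \<theta>))"
    by (rule circ_rad.integral_fst'[OF i, symmetric, unfolded prod.case])
  finally show ?thesis .
qed

lemma lborel_linear: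
  fixes c d t :: complex
  assumes det: "cmod d < cmod c" and nz: "Re (c + d) \<noteq> 0"
  shows "lborel = density (distr lborel borel (\<lambda>z. t + (c * z + d * cnj z))) (\<lambda>_. ennreal ((cmod c)\<^sup>2 - (cmod d)\<^sup>2))"
proof (rule measure_eqI)
  fix A :: "complex set" assume "A \<in> sets lborel"
  then have [measurable]: "A \<in> sets borel" by simp
  have "emeasure lborel A = (\<integral>\<^sup>+z. indicator A z \<partial>distr lborel borel ((+) t))" by (simp add: lborel_distr_plus)
  also have "\<dots> = (\<integral>\<^sup>+z. indicator A (t + z) \<partial>lborel)" by (subst nn_integral_distr) auto
  also have "\<dots> = ((cmod c)\<^sup>2 - (cmod d)\<^sup>2) * (\<integral>\<^sup>+z. indicator A (t + (c * z + d * cnj z)) \<partial>lborel)"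
    by (rule nn_integral_linear[OF _ assms]) simp
  also have "\<dots> = (\<integral>\<^sup>+z. ennreal ((cmod c)\<^sup>2 - (cmod d)\<^sup>2) * indicator A (t + (c * z + d * cnj z)) \<partial>lborel)"
    by (rule nn_integral_cmult[symmetric]) measurable
  also have "\<dots> = (\<integral>\<^sup>+z. ennreal ((cmod c)\<^sup>2 - (cmod d)\<^sup>2) * indicator A z \<partial>(distr lborel borel (\<lambda>z. t + (c * z + d * cnj z))))"
    by (subst nn_integral_distr) auto
  also have "\<dots> = emeasure (density (distr lborel borel (\<lambda>z. t + (c * z + d * cnj z))) (\<lambda>_. ennreal ((cmod c)\<^sup>2 - (cmod d)\<^sup>2))) A"
    by (subst emeasure_density) auto
  finally show "emeasure lborel A = emeasure (density (distr lborel borel (\<lambda>z. t + (c * z + d * cnj z))) (\<lambda>_. ennreal ((cmod c)\<^sup>2 - (cmod d)\<^sup>2))) A" .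
qed simp

lemma integrable_scaleR_right_iff:
  fixes f :: "'a \<Rightarrow> 'b :: {banach, second_countable_topology}"
  assumes "c > 0"
  shows "integrable M (\<lambda>x. c *\<^sub>R f x) \<longleftrightarrow> integrable M f"
  using integrable_scaleR_right[of c M f] integrable_scaleR_right[of "1/c" M "\<lambda>x. c *\<^sub>R f x"] assms by auto

lemma integral_linear:
  fixes f :: "complex \<Rightarrow> 'a :: {banach, second_countable_topology}"
  assumes [measurable]: "f \<in> borel_measurable borel"
    and det: "cmod d < cmod c" and nz: "Re (c + d) \<noteq> 0"
  shows "(LINT z|lborel. f z) = ((cmod c)\<^sup>2 - (cmod d)\<^sup>2) *\<^sub>R (LINT z|lborel. f (t + (c * z + d * cnj z)))"
    and "integrable lborel f \<longleftrightarrow> integrable lborel (\<lambda>z. f (t + (c * z + d * cnj z)))"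
proof -
  have pos: "(cmod c)\<^sup>2 - (cmod d)\<^sup>2 > 0" using det by (simp add: power_strict_mono)
  have AE: "AE x in M. 0 \<le> (cmod c)\<^sup>2 - (cmod d)\<^sup>2" for M :: "complex measure" using pos by (intro AE_I2) linarith
  show "(LINT z|lborel. f z) = ((cmod c)\<^sup>2 - (cmod d)\<^sup>2) *\<^sub>R (LINT z|lborel. f (t + (c * z + d * cnj z)))"
    by (subst lborel_linear[OF det nz, of t], subst integral_density[OF _ _ AE]) (auto simp: integral_distr)
  have "integrable lborel f \<longleftrightarrow> integrable lborel (\<lambda>z. ((cmod c)\<^sup>2 - (cmod d)\<^sup>2) *\<^sub>R f (t + (c * z + d * cnj z)))"
    by (subst lborel_linear[OF det nz, of t], subst integrable_density[OF _ _ AE]) (auto simp: integrable_distr_eq)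
  then show "integrable lborel f \<longleftrightarrow> integrable lborel (\<lambda>z. f (t + (c * z + d * cnj z)))"
    using pos by (simp only: integrable_scaleR_right_iff)
qed

lemma lborel_rotate:
  fixes u t :: complex
  assumes u: "cmod u = 1"
  shows "distr lborel borel (\<lambda>z. t + u * z) = lborel"
proof (rule measure_eqI)
  fix A :: "complex set" assume "A \<in> sets (distr lborel borel (\<lambda>z. t + u * z))"
  then have [measurable]: "A \<in> sets borel" by simp
  have "emeasure (distr lborel borel (\<lambda>z. t + u * z)) A = (\<integral>\<^sup>+z. indicator A z \<partial>(distr lborel borel (\<lambda>z. t + u * z)))"
    by (subst nn_integral_indicator) auto
  also have "\<dots> = (\<integral>\<^sup>+z. indicator A (t + u * z) \<partial>lborel)"
    by (subst nn_integral_distr) auto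
  also have "\<dots> = (\<integral>\<^sup>+z. indicator A (t + z) \<partial>lborel)"
    by (rule nn_integral_rotate[OF _ u]) simp
  also have "\<dots> = (\<integral>\<^sup>+z. indicator A z \<partial>distr lborel borel ((+) t))" by (subst nn_integral_distr) auto
  also have "\<dots> = emeasure lborel A" by (simp add: lborel_distr_plus)
  finally show "emeasure (distr lborel borel (\<lambda>z. t + u * z)) A = emeasure lborel A" .
qed simp

lemma integral_rotate:
  fixes f :: "complex \<Rightarrow> 'a :: {banach, second_countable_topology}"
  assumes [measurable]: "f \<in> borel_measurable borel" and u: "cmod u = 1"
  shows "(LINT z|lborel. f (t + u * z)) = (LINT z|lborel. f z)"
    and "integrable lborel (\<lambda>z. f (t + u * z)) \<longleftrightarrow> integrable lborel f"
proof -
  show "(LINT z|lborel. f (t + u * z)) = (LINT z|lborel. f z)"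
    by (subst (2) lborel_rotate[OF u, of t, symmetric], subst integral_distr) auto
  show "integrable lborel (\<lambda>z. f (t + u * z)) \<longleftrightarrow> integrable lborel f"
    by (subst (2) lborel_rotate[OF u, of t, symmetric], subst integrable_distr_eq) auto
qed

section \<open>The logarithmic potential\<close>

text \<open>Negative \<open>s\<close> is allowed as well: \<open>s = -2\<close> later gives the
  second moment of the unit disk.\<close>

lemma nn_integral_norm_powr_ball:
  assumes s: "s < 2" and t: "t \<ge> 0"
  shows "(\<integral>\<^sup>+y. ennreal (norm y powr -s) * indicator (ball 0 t) y \<partial>(lborel :: complex measure))
    = ennreal (2 * pi * (t powr (2 - s) / (2 - s)))"
proof -
  have [measurable]: "ball (0::complex) t \<in> sets borel" by simp
  have "(\<integral>\<^sup>+r. ennreal (norm (of_real r * cis \<theta>) powr -s) * indicator (ball 0 t) (of_real r * cis \<theta>) \<partial>rad)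
      = ennreal (t powr (2 - s) / (2 - s))" for \<theta>
  proof -
    have "(\<integral>\<^sup>+r. ennreal (norm (of_real r * cis \<theta>) powr -s) * indicator (ball 0 t) (of_real r * cis \<theta>) \<partial>rad)
        = (\<integral>\<^sup>+r. ennreal r * (ennreal (norm (of_real r * cis \<theta>) powr -s) * indicator (ball 0 t) (of_real r * cis \<theta>)) \<partial>lborel)"
      by (simp add: rad_def nn_integral_density)
    also have "\<dots> = (\<integral>\<^sup>+r. ennreal (r powr (1 - s)) * indicator {0..t} r \<partial>lborel)"
    proof (rule nn_integral_cong_AE)
      show "AE r in lborel. ennreal r * (ennreal (norm (of_real r * cis \<theta>) powr -s) * indicator (ball 0 t) (of_real r * cis \<theta>))
          = ennreal (r powr (1 - s)) * indicator {0..t} r"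
        using AE_lborel_singleton[of t] AE_lborel_singleton[of "0::real"]
      proof eventually_elim
        case (elim r)
        have "r > 0 \<Longrightarrow> r * r powr -s = r powr (1 - s)"
          using powr_add[of r 1 "-s"] by simp
        then show ?case
          using elim by (cases "r > 0") (auto simp: indicator_def norm_mult ennreal_neg simp flip: ennreal_mult)
      qed
    qed
    also have "\<dots> = ennreal (t powr (2 - s) / (2 - s))"
      using has_integral_powr_from_0[of "1 - s" t] s t
      by (intro nn_integral_has_integral_lebesgue') (auto simp: algebra_simps)
    finally show ?thesis .
  qed
  then have "(\<integral>\<^sup>+y. ennreal (norm y powr -s) * indicator (ball 0 t) y \<partial>(lborel :: complex measure))
    = (\<integral>\<^sup>+\<theta>. ennreal (t powr (2 - s) / (2 - s)) \<partial>circ)"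
    by (subst nn_integral_polar) auto
  then show ?thesis
    using s by (simp add: emeasure_circ_UNIV mult.commute flip: ennreal_mult ennreal_mult'')
qed

lemma nn_integral_norm_powr_translate:
  assumes "s < 2" "t \<ge> 0"
  shows "(\<integral>\<^sup>+y. ennreal (norm (x - y) powr -s) * indicator (ball x t) y \<partial>(lborel :: complex measure))
    = ennreal (2 * pi * (t powr (2 - s) / (2 - s)))"
proof -
  have [measurable]: "ball (0::complex) t \<in> sets borel" by simp
  have "(\<integral>\<^sup>+y. ennreal (norm y powr -s) * indicator (ball 0 t) y \<partial>(lborel :: complex measure)) =
      (\<integral>\<^sup>+y. ennreal (norm y powr -s) * indicator (ball 0 t) y \<partial>distr lborel borel (\<lambda>y. x + (-1) * y))"
    by (subst lborel_rotate) auto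
  also have "\<dots> = (\<integral>\<^sup>+y. ennreal (norm (x - y) powr -s) * indicator (ball x t) y \<partial>lborel)"
    by (subst nn_integral_distr) (auto simp: indicator_def dist_norm norm_minus_commute)
  finally show ?thesis using nn_integral_norm_powr_ball[OF assms] by simp
qed

text \<open>Cut at distance \<open>t\<close> from \<open>x\<close>: inside, the singularity is
  integrated over a full disk; outside, the kernel is at most \<open>t powr -s\<close> and only the
  area counts.\<close>

lemma
  fixes A :: "complex set"
  assumes A[measurable]: "A \<in> sets borel" and a: "emeasure lborel A \<le> ennreal a" "a \<ge> 0"
    and s: "0 < s" "s < 2" and t: "t > 0"
  shows integrable_norm_powr: "integrable lborel (\<lambda>y. norm (x - y) powr -s * indicat_real A y)"
    and integral_norm_powr_le: "(LINT y|lborel. norm (x - y) powr -s * indicat_real A y)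
      \<le> 2 * pi * (t powr (2 - s) / (2 - s)) + t powr -s * a"
proof -
  have [measurable]: "ball x t \<in> sets borel" by simp
  have "(\<integral>\<^sup>+y. ennreal (norm (x - y) powr -s * indicat_real A y) \<partial>lborel) \<le>
     (\<integral>\<^sup>+y. ennreal (norm (x - y) powr -s) * indicator (ball x t) y + ennreal (t powr -s) * indicator A y \<partial>lborel)"
  proof (rule nn_integral_mono)
    fix y
    show "ennreal (norm (x - y) powr -s * indicat_real A y) \<le>
        ennreal (norm (x - y) powr -s) * indicator (ball x t) y + ennreal (t powr -s) * indicator A y"
    proof (cases "y \<in> A \<and> y \<notin> ball x t")
      case True
      then have "norm (x - y) powr -s \<le> t powr -s"
        using s t by (intro powr_mono2') (auto simp: dist_norm)
      then show ?thesis using True by (simp add: ennreal_leI)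
    qed (auto simp: indicator_def)
  qed
  also have "\<dots> = ennreal (2 * pi * (t powr (2 - s) / (2 - s))) + ennreal (t powr -s) * emeasure lborel A"
    using s t by (subst nn_integral_add) (auto simp: nn_integral_norm_powr_translate nn_integral_cmult_indicator)
  also have "\<dots> \<le> ennreal (2 * pi * (t powr (2 - s) / (2 - s))) + ennreal (t powr -s) * ennreal a"
    by (intro add_left_mono mult_left_mono a) auto
  also have "\<dots> = ennreal (2 * pi * (t powr (2 - s) / (2 - s)) + t powr -s * a)"
    using s a by (simp flip: ennreal_mult ennreal_plus)
  finally have le: "(\<integral>\<^sup>+y. ennreal (norm (x - y) powr -s * indicat_real A y) \<partial>lborel)
     \<le> ennreal (2 * pi * (t powr (2 - s) / (2 - s)) + t powr -s * a)" .
  show *: "integrable lborel (\<lambda>y. norm (x - y) powr -s * indicat_real A y)"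
    using le by (intro integrableI_nonneg) (auto simp: top.not_eq_extremum[symmetric] top_unique)
  show "(LINT y|lborel. norm (x - y) powr -s * indicat_real A y) \<le> 2 * pi * (t powr (2 - s) / (2 - s)) + t powr -s * a"
    using le s a by (subst integral_eq_nn_integral) (auto intro!: enn2real_leI)
qed

lemma
  fixes A :: "complex set"
  assumes A[measurable]: "A \<in> sets borel" and a: "emeasure lborel A \<le> ennreal a" "a \<ge> 0"
  shows integrable_inverse_norm: "integrable lborel (\<lambda>y. 1 / norm (x - y) * indicat_real A y)"
    and integral_inverse_norm_le: "(LINT y|lborel. 1 / norm (x - y) * indicat_real A y) \<le> (2 * pi + 1) * sqrt a"
proof -
  have eq: "norm (x - y) powr -1 = 1 / norm (x - y)" for y
    by (cases "x = y") (auto simp: powr_minus_divide)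
  show "integrable lborel (\<lambda>y. 1 / norm (x - y) * indicat_real A y)"
    using integrable_norm_powr[OF A a, of 1 1 x] by (simp add: eq)
  show "(LINT y|lborel. 1 / norm (x - y) * indicat_real A y) \<le> (2 * pi + 1) * sqrt a"
  proof (cases "a = 0")
    case True
    then have "A \<in> null_sets lborel" using a by (auto simp: null_sets_def)
    then have "AE y in lborel. y \<notin> A" by (rule AE_not_in)
    then have "AE y in lborel. 1 / norm (x - y) * indicat_real A y = 0"
      by eventually_elim simp
    then have "(LINT y|lborel. 1 / norm (x - y) * indicat_real A y) = 0"
      by (intro integral_eq_zero_AE)
    then show ?thesis using True by simp
  next
    case False
    \<comment> \<open>The cut at radius \<open>sqrt a\<close> makes the two contributions
      comparable.\<close>
    then have "(LINT y|lborel. norm (x - y) powr -1 * indicat_real A y)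
        \<le> 2 * pi * (sqrt a powr (2 - 1) / (2 - 1)) + sqrt a powr -1 * a"
      using a by (intro integral_norm_powr_le[OF A a]) auto
    also have "sqrt a powr -1 * a = sqrt a"
      using False a by (simp add: powr_minus_divide real_div_sqrt)
    finally show ?thesis using a by (simp add: eq algebra_simps)
  qed
qed

text \<open>The sum \<open>1 / a + 1 / b\<close> takes the place of the reciprocal of the minimum,
  so that each summand becomes an integrable kernel of its own.\<close>

lemma abs_ln_diff_le:
  fixes a b :: real
  assumes "a > 0" "b > 0"
  shows "\<bar>ln a - ln b\<bar> \<le> \<bar>a - b\<bar> * (1 / a + 1 / b)"
proof -
  have 1: "ln b - ln a \<le> \<bar>a - b\<bar> * (1 / a)" if "a > 0" "b > 0" for a b :: real
  proof -
    have "ln b - ln a = ln (b / a)" using that by (simp add: ln_div)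
    also have "\<dots> \<le> b / a - 1" using that by (intro ln_le_minus_one) auto
    also have "\<dots> = (b - a) * (1 / a)" using that by (simp add: field_simps)
    also have "\<dots> \<le> \<bar>a - b\<bar> * (1 / a)" using that by (intro mult_right_mono) auto
    finally show ?thesis .
  qed
  have "0 \<le> \<bar>a - b\<bar> * (1 / a)" "0 \<le> \<bar>a - b\<bar> * (1 / b)" using assms by auto
  with 1[of a b] 1[of b a] assms show ?thesis
    unfolding distrib_left abs_minus_commute[of b a] by linarith
qed

lemma abs_ln_le_add_inverse:
  fixes u :: real
  assumes "u \<ge> 0"
  shows "\<bar>ln u\<bar> \<le> u + 1 / u"
proof (cases "u = 0")
  case False
  then have u: "u > 0" using assms by simp
  have "ln u \<le> u" using ln_le_minus_one[OF u] by simp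
  moreover have "- ln u \<le> 1 / u" using ln_le_minus_one[of "1 / u"] u by (simp add: ln_div)
  moreover have "0 \<le> 1 / u" using u by simp
  ultimately show ?thesis using u by linarith
qed simp

lemma emeasure_bounded_le:
  fixes A :: "complex set"
  assumes "bounded A" "A \<in> sets borel"
  shows "emeasure lborel A \<le> ennreal (measure lborel A)" "emeasure lborel A < \<infinity>" "emeasure lborel A \<noteq> \<infinity>"
  using emeasure_bounded_finite[OF assms(1)] by (auto simp: emeasure_eq_ennreal_measure)

lemma integrable_indicator_bounded:
  fixes A :: "complex set"
  assumes "bounded A" "A \<in> sets borel"
  shows "integrable lborel (indicat_real A)"
  using assms emeasure_bounded_le[OF assms] by simp

lemma integrable_bounded_mult_indicator:
  fixes f :: "complex \<Rightarrow> 'a :: {banach, second_countable_topology}"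
  assumes A: "bounded A" "A \<in> sets borel" and [measurable]: "f \<in> borel_measurable borel"
    and B: "\<And>y. y \<in> A \<Longrightarrow> norm (f y) \<le> B"
  shows "integrable lborel (\<lambda>y. indicat_real A y *\<^sub>R f y)"
proof -
  have [measurable]: "A \<in> sets borel" by fact
  show ?thesis
    by (rule Bochner_Integration.integrable_bound[OF integrable_mult_left[OF integrable_indicator_bounded[OF A], of B]])
       (use B in \<open>auto simp: indicator_def intro: order_trans[OF _ abs_ge_self]\<close>)
qed

lemma integrable_ln_norm:
  fixes A :: "complex set"
  assumes A: "bounded A" "A \<in> sets borel"
  shows "integrable lborel (\<lambda>y. ln (norm (x - y)) * indicat_real A y)"
proof -
  have [measurable]: "A \<in> sets borel" by fact
  obtain M where M: "\<And>y. y \<in> A \<Longrightarrow> norm (x - y) \<le> M"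
    using A(1) by (metis bounded_any_center dist_norm)
  have "integrable lborel (\<lambda>y. M * indicat_real A y + 1 / norm (x - y) * indicat_real A y)"
    by (intro Bochner_Integration.integrable_add integrable_mult_right integrable_indicator_bounded[OF A]
        integrable_inverse_norm[OF A(2) emeasure_bounded_le(1)[OF A]]) auto
  then show ?thesis
  proof (rule Bochner_Integration.integrable_bound)
    show "AE y in lborel. norm (ln (norm (x - y)) * indicat_real A y)
        \<le> norm (M * indicat_real A y + 1 / norm (x - y) * indicat_real A y)"
    proof (rule AE_I2)
      fix y
      show "norm (ln (norm (x - y)) * indicat_real A y)
        \<le> norm (M * indicat_real A y + 1 / norm (x - y) * indicat_real A y)"
      proof (cases "y \<in> A")
        case True
        then show ?thesis
          using abs_ln_le_add_inverse[of "norm (x - y)"] M[OF True] norm_ge_zero[of "x - y"]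
          by (simp add: abs_of_nonneg)
      qed simp
    qed
  qed measurable
qed

section \<open>Lipschitz bound and gradient of the potential\<close>

abbreviation pot :: "complex set \<Rightarrow> complex \<Rightarrow> real" where
  "pot U \<equiv> inv_laplacian (indicat_real U)"

lemma pot_Un:
  assumes "bounded A" "A \<in> sets borel" "bounded B" "B \<in> sets borel" "A \<inter> B = {}"
  shows "pot (A \<union> B) x = pot A x + pot B x"
proof -
  have "indicat_real (A \<union> B) y = indicat_real A y + indicat_real B y" for y
    using assms(5) by (auto simp: indicator_def)
  then show ?thesis
    using integrable_ln_norm[OF assms(1,2)] integrable_ln_norm[OF assms(3,4)]
    by (simp add: inv_laplacian_def distrib_left Bochner_Integration.integral_add)
qed

text \<open>What matters is the dependence on the area: a thin shell has a potential with small
  slope, which lets \<open>radial_slope\<close> treat everything but a disk as an error.\<close>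

lemma pot_lipschitz:
  assumes A: "bounded A" "A \<in> sets borel"
  shows "\<bar>pot A x - pot A x'\<bar> \<le> (2 * pi + 1) / pi * sqrt (measure lborel A) * norm (x - x')"
proof -
  note m = emeasure_bounded_le(1)[OF A]
  note i = integrable_ln_norm[OF A]
  have "pot A x - pot A x' = 1 / (2 * pi) *
      (LINT y|lborel. ln (norm (x - y)) * indicat_real A y - ln (norm (x' - y)) * indicat_real A y)"
    unfolding inv_laplacian_def using i by (simp add: algebra_simps)
  also have "\<bar>\<dots>\<bar> \<le> 1 / (2 * pi) * (norm (x - x') *
     ((LINT y|lborel. 1 / norm (x - y) * indicat_real A y) + (LINT y|lborel. 1 / norm (x' - y) * indicat_real A y)))"
  proof -
    have "\<bar>LINT y|lborel. ln (norm (x - y)) * indicat_real A y - ln (norm (x' - y)) * indicat_real A y\<bar> \<le>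
        (LINT y|lborel. norm (x - x') * (1 / norm (x - y) * indicat_real A y + 1 / norm (x' - y) * indicat_real A y))"
    proof (rule integral_abs_bound[THEN order_trans], rule integral_mono_AE)
      show "AE y in lborel. \<bar>ln (norm (x - y)) * indicat_real A y - ln (norm (x' - y)) * indicat_real A y\<bar>
        \<le> norm (x - x') * (1 / norm (x - y) * indicat_real A y + 1 / norm (x' - y) * indicat_real A y)"
        using AE_lborel_singleton[of x] AE_lborel_singleton[of x']
      proof eventually_elim
        case (elim y)
        show ?case
        proof (cases "y \<in> A")
          case True
          have "\<bar>ln (norm (x - y)) - ln (norm (x' - y))\<bar> \<le> \<bar>norm (x - y) - norm (x' - y)\<bar> * (1 / norm (x - y) + 1 / norm (x' - y))"
            using elim by (intro abs_ln_diff_le) auto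
          also have "\<dots> \<le> norm (x - x') * (1 / norm (x - y) + 1 / norm (x' - y))"
            using norm_triangle_ineq3[of "x - y" "x' - y"] by (intro mult_right_mono) auto
          finally show ?thesis using True by simp
        qed simp
      qed
    qed (use i integrable_inverse_norm[OF A(2) m] in auto)
    also have "\<dots> = norm (x - x') *
     ((LINT y|lborel. 1 / norm (x - y) * indicat_real A y) + (LINT y|lborel. 1 / norm (x' - y) * indicat_real A y))"
      using integrable_inverse_norm[OF A(2) m] by simp
    finally show ?thesis by (simp add: abs_mult divide_right_mono)
  qed
  also have "\<dots> \<le> 1 / (2 * pi) * (norm (x - x') * ((2 * pi + 1) * sqrt (measure lborel A) + (2 * pi + 1) * sqrt (measure lborel A)))"
    by (intro mult_left_mono add_mono integral_inverse_norm_le[OF A(2) m]) auto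
  also have "\<dots> = (2 * pi + 1) / pi * sqrt (measure lborel A) * norm (x - x')"
    by (simp add: field_simps)
  finally show ?thesis .
qed

text \<open>Since |1 + w|^2 = 1 + x with x = 2 Re w + |w|^2, the difference is half of ln (1 + x) -
  x plus |w|^2 / 2.\<close>

lemma abs_ln_norm_one_plus_le:
  fixes w :: complex
  assumes "norm w \<le> 1 / 5"
  shows "\<bar>ln (norm (1 + w)) - Re w\<bar> \<le> 6 * (norm w)\<^sup>2"
proof -
  define x where "x = 2 * Re w + (norm w)\<^sup>2"
  define n where "n = norm w"
  have n: "0 \<le> n" "n \<le> 1/5" using assms by (auto simp: n_def)
  have R: "\<bar>Re w\<bar> \<le> n" by (simp add: n_def abs_Re_le_cmod)
  have nn: "n\<^sup>2 \<le> n * (1/5)" unfolding power2_eq_square using n by (intro mult_left_mono) auto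
  \<comment> \<open>From |x| <= 2 n + n / 5. In particular |x| <= 11/25 < 1/2, the range in which ln
    (1 + x) - x is bounded by 2 x^2.\<close>
  have x: "\<bar>x\<bar> \<le> 11/5 * n" using R nn n zero_le_power2[of n] unfolding x_def n_def[symmetric] by linarith
  have sq: "(norm (1 + w))\<^sup>2 = 1 + x"
    unfolding x_def cmod_power2 by (simp add: power2_eq_square algebra_simps)
  have "1 + x > 0" using x n by auto
  then have "norm (1 + w) > 0" using sq by (metis norm_ge_zero order_less_le power_zero_numeral less_irrefl)
  then have "ln (norm (1 + w)) = ln (1 + x) / 2"
    by (simp add: sq[symmetric] ln_realpow)
  moreover have "\<bar>ln (1 + x) - x\<bar> \<le> 2 * x\<^sup>2"
    using x n by (intro abs_ln_one_plus_x_minus_x_bound) auto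
  moreover have "x\<^sup>2 \<le> (11/5 * n)\<^sup>2" using x n by (metis abs_ge_zero power2_abs power_mono)
  moreover have "Re w = (x - n\<^sup>2) / 2" by (simp add: x_def n_def)
  ultimately have "\<bar>ln (norm (1 + w)) - Re w\<bar> \<le> (11/5 * n)\<^sup>2 + n\<^sup>2 / 2"
    using zero_le_power2[of n] by (simp only: abs_le_iff) argo
  also have "\<dots> \<le> 6 * n\<^sup>2" by (simp add: power_mult_distrib power_divide)
  finally show ?thesis by (simp add: n_def)
qed

lemma self_le_powr:
  fixes u :: real
  assumes "u \<ge> 1/9"
  shows "u \<le> 3 * u powr (3/2)"
proof -
  have "1/3 \<le> sqrt u" using assms by (intro real_le_rsqrt) (auto simp: power_divide)
  then have "u * 1 \<le> u * (3 * sqrt u)" using assms by (intro mult_left_mono) auto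
  also have "u * (3 * sqrt u) = 3 * (u * sqrt u)" by simp
  also have "u * sqrt u = u powr (3/2)"
    using powr_add[of u 1 "1/2"] assms by (simp add: powr_half_sqrt)
  finally show ?thesis by (simp add: mult.left_commute)
qed

text \<open>The exponent \<open>3/2\<close> exceeds \<open>1\<close>, so the error is \<open>o(k)\<close>, and is below \<open>2\<close>, so the
  singularity is locally integrable in the plane.\<close>

lemma ln_norm_expansion:
  fixes a k :: complex
  assumes a: "a \<noteq> 0" "a + k \<noteq> 0"
  shows "\<bar>ln (norm (a + k)) - ln (norm a) - inverse (cnj a) \<bullet> k\<bar> \<le>
    6 * norm k powr (3/2) * (norm a powr -(3/2) + norm (a + k) powr -(3/2))"
proof -
  define u where "u = norm k / norm a"
  define v where "v = norm k / norm (a + k)"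
  have uv: "u \<ge> 0" "v \<ge> 0" by (auto simp: u_def v_def)
  have inner: "inverse (cnj a) \<bullet> k = Re (k / a)"
    by (simp add: inner_complex_def divide_complex_def complex_mult_cnj inverse_complex.code power2_eq_square algebra_simps)
  have rhs: "6 * norm k powr (3/2) * (norm a powr -(3/2) + norm (a + k) powr -(3/2)) = 6 * u powr (3/2) + 6 * v powr (3/2)"
    by (simp add: u_def v_def powr_divide powr_minus_divide algebra_simps)
  have "\<bar>ln (norm (a + k)) - ln (norm a) - Re (k / a)\<bar> \<le> 6 * u powr (3/2) + 6 * v powr (3/2)"
  proof (cases "u \<le> 1/5")
    case True
    have "norm (a + k) = norm a * norm (1 + k / a)"
      using a by (simp add: norm_mult[symmetric] distrib_left)
    moreover have "1 + k / a \<noteq> 0" using a by (auto simp: field_simps)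
    ultimately have "ln (norm (a + k)) - ln (norm a) = ln (norm (1 + k / a))"
      using a by (simp add: ln_mult)
    then have "\<bar>ln (norm (a + k)) - ln (norm a) - Re (k / a)\<bar> \<le> 6 * (norm (k / a))\<^sup>2"
      using abs_ln_norm_one_plus_le[of "k / a"] True by (simp add: u_def norm_divide)
    also have "(norm (k / a))\<^sup>2 = u\<^sup>2" by (simp add: u_def norm_divide)
    also have "u\<^sup>2 \<le> u powr (3/2)"
    proof (cases "u = 0")
      case False
      then have "u powr 2 \<le> u powr (3/2)" using True uv by (intro powr_mono') auto
      then show ?thesis using uv False by (simp add: powr_numeral)
    qed simp
    finally show ?thesis using powr_ge_zero[of v "3/2"] by linarith
  next
    case False
    then have "norm a < 5 * norm k" using a by (simp add: u_def field_simps)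
    then have "norm (a + k) \<le> 6 * norm k" using norm_triangle_ineq[of a k] by simp
    \<comment> \<open>A perfect square in place of 6, for the square root in
      \<open>self_le_powr\<close>.\<close>
    also have "\<dots> \<le> 9 * norm k" by simp
    finally have v: "v \<ge> 1/9" using a by (simp add: v_def field_simps)
    have "\<bar>ln (norm (a + k)) - ln (norm a)\<bar> \<le> \<bar>norm (a + k) - norm a\<bar> * (1 / norm (a + k) + 1 / norm a)"
      using a by (intro abs_ln_diff_le) auto
    also have "\<dots> \<le> norm k * (1 / norm (a + k) + 1 / norm a)"
      using norm_triangle_ineq3[of "a + k" a] by (intro mult_right_mono) auto
    also have "\<dots> = u + v" by (simp add: u_def v_def algebra_simps)
    finally have "\<bar>ln (norm (a + k)) - ln (norm a)\<bar> \<le> u + v" .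
    moreover have "\<bar>Re (k / a)\<bar> \<le> u" using abs_Re_le_cmod[of "k / a"] by (simp add: u_def norm_divide)
    moreover have "u \<le> 3 * u powr (3/2)" "v \<le> 3 * v powr (3/2)"
      using False v by (auto intro!: self_le_powr)
    ultimately show ?thesis using powr_ge_zero[of v "3/2"] by linarith
  qed
  then show ?thesis by (simp only: rhs inner)
qed

text \<open>The gradient of ln |a| is a / |a|^2, which as a complex number is
  \<open>inverse (cnj a)\<close>.\<close>

definition grad_pot :: "complex set \<Rightarrow> complex \<Rightarrow> complex" where
  "grad_pot U x = (1 / (2 * pi)) *\<^sub>R (LINT y|lborel. indicat_real U y *\<^sub>R inverse (cnj (x - y)))"

lemma integrable_inverse_kernel:
  fixes A :: "complex set"
  assumes A: "bounded A" "A \<in> sets borel"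
  shows "integrable lborel (\<lambda>y. indicat_real A y *\<^sub>R inverse (cnj (x - y)))"
proof -
  have [measurable]: "A \<in> sets borel" by fact
  show ?thesis
    by (rule Bochner_Integration.integrable_bound[OF integrable_inverse_norm[OF A(2) emeasure_bounded_le(1)[OF A], of x]])
       (auto simp: indicator_def norm_inverse divide_inverse simp del: complex_cnj_diff)
qed

text \<open>Integrates the pointwise expansion. The constant does not depend on the base point, so
  one lemma gives differentiability of the potential and Hoelder continuity, with exponent 1/2, of
  its gradient.\<close>

lemma pot_expansion:
  assumes A: "bounded A" "A \<in> sets borel"
  obtains C where "C \<ge> 0" "\<And>x k. \<bar>pot A (x + k) - pot A x - grad_pot A x \<bullet> k\<bar> \<le> C * norm k powr (3/2)"
    "\<And>x k. norm (grad_pot A (x + k) - grad_pot A x) \<le> C * sqrt (norm k)"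
proof -
  note m = emeasure_bounded_le(1)[OF A]
  note i = integrable_ln_norm[OF A] and ik = integrable_inverse_kernel[OF A]
  note ip = integrable_norm_powr[OF A(2) m measure_nonneg, of "3/2" 1, simplified]
  have [measurable]: "A \<in> sets borel" by fact
  define J where "J x = (LINT y|lborel. norm (x - y) powr -(3/2) * indicat_real A y)" for x
  \<comment> \<open>The bound of \<open>integral_norm_powr_le\<close> for the exponent 3/2 and the
    cut at radius 1.\<close>
  define c where "c = 4 * pi + measure lborel A"
  have J: "J x \<le> c" for x
    unfolding J_def c_def
    using integral_norm_powr_le[OF A(2) m measure_nonneg, of "3/2" 1 x] by simp
  define C where "C = 12 * c / (2 * pi)"
  have "c \<ge> 0" by (simp add: c_def)
  show ?thesis
  proof (rule that[of C])
    show "C \<ge> 0" using \<open>c \<ge> 0\<close> by (simp add: C_def)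
    fix x k :: complex
    have "pot A (x + k) - pot A x - grad_pot A x \<bullet> k = 1 / (2 * pi) *
      (LINT y|lborel. ln (norm (x + k - y)) * indicat_real A y - ln (norm (x - y)) * indicat_real A y
         - (indicat_real A y *\<^sub>R inverse (cnj (x - y))) \<bullet> k)"
    proof -
      have "(LINT y|lborel. ln (norm (x + k - y)) * indicat_real A y - ln (norm (x - y)) * indicat_real A y
         - (indicat_real A y *\<^sub>R inverse (cnj (x - y))) \<bullet> k) =
         (LINT y|lborel. ln (norm (x + k - y)) * indicat_real A y - ln (norm (x - y)) * indicat_real A y)
         - (LINT y|lborel. (indicat_real A y *\<^sub>R inverse (cnj (x - y))) \<bullet> k)"
        by (intro Bochner_Integration.integral_diff Bochner_Integration.integrable_diff i integrable_inner_left ik)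
      also have "\<dots> = (LINT y|lborel. ln (norm (x + k - y)) * indicat_real A y) - (LINT y|lborel. ln (norm (x - y)) * indicat_real A y)
         - (LINT y|lborel. indicat_real A y *\<^sub>R inverse (cnj (x - y))) \<bullet> k"
        by (intro arg_cong2[where f=minus] Bochner_Integration.integral_diff i integral_inner_left ik)
      finally show ?thesis
        unfolding inv_laplacian_def grad_pot_def by (simp add: right_diff_distrib diff_divide_distrib del: complex_cnj_diff)
    qed
    also have "\<bar>\<dots>\<bar> \<le> 1 / (2 * pi) * (6 * norm k powr (3/2) * (J x + J (x + k)))"
    proof -
      have "\<bar>LINT y|lborel. ln (norm (x + k - y)) * indicat_real A y - ln (norm (x - y)) * indicat_real A y
         - (indicat_real A y *\<^sub>R inverse (cnj (x - y))) \<bullet> k\<bar> \<le>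
         (LINT y|lborel. 6 * norm k powr (3/2) * (norm (x - y) powr -(3/2) * indicat_real A y + norm (x + k - y) powr -(3/2) * indicat_real A y))"
      proof (rule integral_abs_bound[THEN order_trans], rule integral_mono_AE)
        show "AE y in lborel. \<bar>ln (norm (x + k - y)) * indicat_real A y - ln (norm (x - y)) * indicat_real A y
          - (indicat_real A y *\<^sub>R inverse (cnj (x - y))) \<bullet> k\<bar> \<le>
          6 * norm k powr (3/2) * (norm (x - y) powr -(3/2) * indicat_real A y + norm (x + k - y) powr -(3/2) * indicat_real A y)"
          using AE_lborel_singleton[of x] AE_lborel_singleton[of "x + k"]
        proof eventually_elim
          case (elim y)
          then show ?case
            using ln_norm_expansion[of "x - y" k] by (cases "y \<in> A") (auto simp: algebra_simps)
        qed
      qed ((intro integrable_abs Bochner_Integration.integrable_diff i integrable_inner_left ik)[1],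
           (intro integrable_mult_right Bochner_Integration.integrable_add ip)[1])
      also have "\<dots> = 6 * norm k powr (3/2) * (J x + J (x + k))"
        using ip by (simp add: J_def)
      finally show ?thesis unfolding abs_mult by (intro mult_mono) simp_all
    qed
    also have "\<dots> \<le> 1 / (2 * pi) * (6 * norm k powr (3/2) * (c + c))"
      by (intro mult_left_mono add_mono J) auto
    finally show "\<bar>pot A (x + k) - pot A x - grad_pot A x \<bullet> k\<bar> \<le> C * norm k powr (3/2)"
      by (simp add: C_def field_simps)
    have "grad_pot A (x + k) - grad_pot A x = (1 / (2 * pi)) *\<^sub>R
      (LINT y|lborel. indicat_real A y *\<^sub>R inverse (cnj (x + k - y)) - indicat_real A y *\<^sub>R inverse (cnj (x - y)))"
      by (simp only: grad_pot_def Bochner_Integration.integral_diff[OF ik ik] scaleR_diff_right)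
    also have "norm \<dots> \<le> 1 / (2 * pi) * (2 * sqrt (norm k) * (J x + J (x + k)))"
    proof -
      have "norm (LINT y|lborel. indicat_real A y *\<^sub>R inverse (cnj (x + k - y)) - indicat_real A y *\<^sub>R inverse (cnj (x - y))) \<le>
         (LINT y|lborel. 2 * sqrt (norm k) * (norm (x - y) powr -(3/2) * indicat_real A y + norm (x + k - y) powr -(3/2) * indicat_real A y))"
      proof (rule integral_norm_bound[THEN order_trans], rule integral_mono_AE)
        show "AE y in lborel. norm (indicat_real A y *\<^sub>R inverse (cnj (x + k - y)) - indicat_real A y *\<^sub>R inverse (cnj (x - y)))
          \<le> 2 * sqrt (norm k) * (norm (x - y) powr -(3/2) * indicat_real A y + norm (x + k - y) powr -(3/2) * indicat_real A y)"
          using AE_lborel_singleton[of x] AE_lborel_singleton[of "x + k"]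
        proof eventually_elim
          case (elim y)
          define a b where "a = x - y" and "b = x + k - y"
          have ab: "a \<noteq> 0" "b \<noteq> 0" using elim by (auto simp: a_def b_def)
          \<comment> \<open>In these variables the claim becomes polynomial: half of |b - a| is
            spent on \<open>sqrt (norm k)\<close>, the other half on 1/p + 1/q, and p q^2 + p^2 q <=
            p^3 + q^3 remains.\<close>
          define p q where "p = 1 / sqrt (norm a)" and "q = 1 / sqrt (norm b)"
          have pq: "p > 0" "q > 0" using ab by (auto simp: p_def q_def)
          have cube: "z powr -(3/2) = (1 / sqrt z) ^ 3" if "z > 0" for z :: real
          proof -
            have "(1 / sqrt z) ^ 3 = (z powr -(1/2)) powr 3"
              using that by (simp add: powr_minus_divide powr_half_sqrt powr_numeral)
            also have "\<dots> = z powr -(3/2)" by (simp add: powr_powr)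
            finally show ?thesis by simp
          qed
          have kab: "norm (b - a) = norm k" by (simp add: a_def b_def)
          have "norm (inverse (cnj b) - inverse (cnj a)) = norm (b - a) / (norm a * norm b)"
          proof -
            have "inverse (cnj b) - inverse (cnj a) = cnj ((a - b) / (a * b))"
              using ab by (simp add: field_simps)
            then have "norm (inverse (cnj b) - inverse (cnj a)) = norm ((a - b) / (a * b))"
              by (simp only: complex_mod_cnj)
            then show ?thesis by (simp only: norm_divide norm_mult norm_minus_commute)
          qed
          also have "\<dots> = sqrt (norm k) * sqrt (norm (b - a)) * (p * p) * (q * q)"
            using ab by (simp add: p_def q_def kab)
          also have "\<dots> \<le> sqrt (norm k) * (1 / p + 1 / q) * (p * p) * (q * q)"
          proof (intro mult_left_mono mult_right_mono)
            have "sqrt (norm (b - a)) \<le> sqrt (norm a + norm b)"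
              using norm_triangle_ineq4[of b a] by simp
            also have "\<dots> \<le> sqrt (norm a) + sqrt (norm b)" by (rule sqrt_add_le_add_sqrt) auto
            finally show "sqrt (norm (b - a)) \<le> 1 / p + 1 / q" by (simp add: p_def q_def)
          qed (use pq in auto)
          also have "\<dots> = sqrt (norm k) * (p * q\<^sup>2 + p\<^sup>2 * q)"
            using pq by (simp add: field_simps power2_eq_square)
          also have "\<dots> \<le> sqrt (norm k) * (2 * (p ^ 3 + q ^ 3))"
          proof (rule mult_left_mono)
            have "0 \<le> (p + q) * (p - q)\<^sup>2" using pq by simp
            then have "p * q\<^sup>2 + p\<^sup>2 * q \<le> p ^ 3 + q ^ 3"
              by (simp add: power2_eq_square power3_eq_cube algebra_simps)
            also have "\<dots> \<le> 2 * (p ^ 3 + q ^ 3)" using pq by simp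
            finally show "p * q\<^sup>2 + p\<^sup>2 * q \<le> 2 * (p ^ 3 + q ^ 3)" .
          qed simp
          also have "\<dots> = 2 * sqrt (norm k) * (norm a powr -(3/2) + norm b powr -(3/2))"
            using cube[of "norm a"] cube[of "norm b"] ab by (simp add: p_def q_def mult.assoc mult.left_commute)
          finally show ?case unfolding a_def b_def by (cases "y \<in> A") (auto simp del: complex_cnj_diff)
        qed
      qed ((intro integrable_norm Bochner_Integration.integrable_diff ik)[1],
           (intro integrable_mult_right Bochner_Integration.integrable_add ip)[1])
      also have "\<dots> = 2 * sqrt (norm k) * (J x + J (x + k))"
        using ip by (simp add: J_def)
      finally show ?thesis unfolding norm_scaleR by (intro mult_mono) simp_all
    qed
    also have "\<dots> \<le> 1 / (2 * pi) * (2 * sqrt (norm k) * (c + c))"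
      by (intro mult_left_mono add_mono J) auto
    also have "\<dots> \<le> C * sqrt (norm k)"
      using \<open>c \<ge> 0\<close> by (simp add: C_def field_simps)
    finally show "norm (grad_pot A (x + k) - grad_pot A x) \<le> C * sqrt (norm k)" .
  qed
qed

lemma has_derivative_pot:
  assumes A: "bounded A" "A \<in> sets borel"
  shows "(pot A has_derivative (\<lambda>k. grad_pot A x \<bullet> k)) (at x)"
proof -
  obtain C where C: "C \<ge> 0" "\<And>x k. \<bar>pot A (x + k) - pot A x - grad_pot A x \<bullet> k\<bar> \<le> C * norm k powr (3/2)"
    using pot_expansion[OF A] by metis
  show ?thesis unfolding has_derivative_at_alt
  proof (intro conjI allI impI)
    show "bounded_linear (\<lambda>k. grad_pot A x \<bullet> k)" by (rule bounded_linear_inner_right)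
    fix e :: real assume e: "e > 0"
    define d where "d = (e / (C + 1))\<^sup>2"
    show "\<exists>d>0. \<forall>y. norm (y - x) < d \<longrightarrow> norm (pot A y - pot A x - grad_pot A x \<bullet> (y - x)) \<le> e * norm (y - x)"
    proof (intro exI[of _ d] conjI allI impI)
      show "d > 0" using e C(1) by (simp add: d_def)
      fix y assume y: "norm (y - x) < d"
      have "sqrt (norm (y - x)) \<le> sqrt d" using y by simp
      also have "sqrt d = e / (C + 1)" using e C(1) by (simp add: d_def real_sqrt_abs)
      finally have s: "sqrt (norm (y - x)) \<le> e / (C + 1)" .
      have "norm (pot A y - pot A x - grad_pot A x \<bullet> (y - x)) \<le> C * norm (y - x) powr (3/2)"
        using C(2)[of x "y - x"] by simp
      also have "\<dots> = C * sqrt (norm (y - x)) * norm (y - x)"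
        using powr_add[of "norm (y - x)" 1 "1/2"] by (simp add: powr_half_sqrt)
      also have "\<dots> \<le> e * norm (y - x)"
      proof (rule mult_right_mono)
        have "C * sqrt (norm (y - x)) \<le> C * (e / (C + 1))" using s C(1) by (rule mult_left_mono)
        also have "\<dots> \<le> e" using e C(1) by (simp add: field_simps)
        finally show "C * sqrt (norm (y - x)) \<le> e" .
      qed simp
      finally show "norm (pot A y - pot A x - grad_pot A x \<bullet> (y - x)) \<le> e * norm (y - x)" .
    qed
  qed
qed

lemma continuous_grad_pot:
  assumes A: "bounded A" "A \<in> sets borel"
  shows "continuous_on UNIV (grad_pot A)"
proof -
  obtain C where C: "C \<ge> 0" "\<And>x k. norm (grad_pot A (x + k) - grad_pot A x) \<le> C * sqrt (norm k)"
    using pot_expansion[OF A] by metis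
  have "(grad_pot A \<longlongrightarrow> grad_pot A x) (at x)" for x
  proof (rule Lim_null[THEN iffD2, OF Lim_null_comparison])
    show "\<forall>\<^sub>F y in at x. norm (grad_pot A y - grad_pot A x) \<le> C * sqrt (norm (y - x))"
      using C(2)[of x "_ - x"] by (intro always_eventually) simp
    have "((\<lambda>y. C * sqrt (norm (y - x))) \<longlongrightarrow> C * sqrt (norm (x - x))) (at x)"
      by (intro tendsto_intros)
    then show "((\<lambda>y. C * sqrt (norm (y - x))) \<longlongrightarrow> 0) (at x)" by simp
  qed
  then show ?thesis by (simp add: continuous_on_def)
qed

lemma continuous_pot:
  assumes A: "bounded A" "A \<in> sets borel"
  shows "continuous_on UNIV (pot A)"
  using has_derivative_pot[OF A] by (meson continuous_at_imp_continuous_on has_derivative_continuous)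

lemma velocity_eq:
  assumes A: "bounded A" "A \<in> sets borel"
  shows "velocity (indicat_real A) x = \<i> * grad_pot A x"
proof -
  have "frechet_derivative (pot A) (at x) = (\<lambda>k. grad_pot A x \<bullet> k)"
    using has_derivative_pot[OF A] by (rule frechet_derivative_at[symmetric])
  then show ?thesis
    by (simp add: velocity_def grad_perp_def complex_eq_iff inner_complex_def)
qed

section \<open>The logarithmic kernel on the circle\<close>

lemma integral_circ:
  fixes f :: "real \<Rightarrow> 'a :: {banach, second_countable_topology}"
  assumes [measurable]: "f \<in> borel_measurable borel"
  shows "(LINT t|circ. f t) = (LINT t|lborel. indicator {-pi..pi} t *\<^sub>R f t)"
proof -
  have eq: "circ = density lborel (\<lambda>t. ennreal (indicator {-pi..pi} t))"
    unfolding circ_def by (simp add: ennreal_indicator)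
  show ?thesis unfolding eq by (subst integral_density) auto
qed

lemma AE_circ_I: "AE t in lborel. P t \<Longrightarrow> AE t in circ. P t"
  unfolding circ_def by (subst AE_density) auto

lemma integral_circ_FTC:
  fixes f F :: "real \<Rightarrow> 'a :: euclidean_space"
  assumes F: "\<And>t. (F has_vector_derivative f t) (at t)" and c: "continuous_on UNIV f"
  shows "(LINT t|circ. f t) = F pi - F (- pi)"
proof -
  have "f \<in> borel_measurable borel" using c by (rule borel_measurable_continuous_onI)
  moreover have "(LINT t|lborel. indicator {-pi..pi} t *\<^sub>R f t) = F pi - F (- pi)"
    using F c by (intro integral_FTC_Icc) (auto intro: has_vector_derivative_at_within continuous_on_subset)
  ultimately show ?thesis by (simp add: integral_circ)
qed

lemma integrable_circ_bounded:
  fixes f :: "real \<Rightarrow> 'a :: {banach, second_countable_topology}"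
  assumes "f \<in> borel_measurable borel" "\<And>t. norm (f t) \<le> B"
  shows "integrable circ f"
  using assms by (intro circ.integrable_const_bound[of _ B]) auto

lemma measure_circ: "measure circ UNIV = 2 * pi"
  by (simp add: measure_def emeasure_circ_UNIV)

lemma integral_circ_cis: "(LINT t|circ. cis (of_int k * t)) = (if k = 0 then 2 * pi else 0)"
proof (cases "k = 0")
  case True
  then show ?thesis by (simp add: measure_circ scaleR_conv_of_real)
next
  case False
  define F where "F t = cis (of_int k * t) / (\<i> * of_int k)" for t
  have d: "(F has_vector_derivative cis (of_int k * t)) (at t)" for t
    unfolding F_def using False
    by (auto simp: cis_conv_exp has_field_derivative_def field_simps intro!: derivative_eq_intros has_vector_derivative_real_field)
  have "(LINT t|circ. cis (of_int k * t)) = F pi - F (- pi)"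
    by (rule integral_circ_FTC[OF d]) (auto intro!: continuous_intros simp: cis_conv_exp)
  also have "\<dots> = 0"
  proof -
    have "cis (of_int k * pi) = cis (of_int k * (- pi)) * cis (2 * pi * of_int k)"
      by (simp add: cis_mult algebra_simps)
    also have "cis (2 * pi * of_int k) = 1" by (rule cis_multiple_2pi) auto
    finally show ?thesis by (simp add: F_def)
  qed
  finally show ?thesis using False by simp
qed

section \<open>Fourier expansion of the logarithmic kernel\<close>

lemma ln_norm_one_minus_sums:
  fixes z :: complex
  assumes "norm z < 1"
  shows "(\<lambda>n. - Re (z ^ Suc n) / Suc n) sums ln (norm (1 - z))"
proof -
  have "(\<lambda>n. - (z ^ n) / of_nat n) sums ln (1 - z)"
    using Ln_series'[of "- z"] assms by simp
  then have "(\<lambda>n. - (z ^ Suc n) / of_nat (Suc n)) sums ln (1 - z)"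
    by (subst sums_Suc_iff) simp
  then have "(\<lambda>n. Re (- (z ^ Suc n) / of_nat (Suc n))) sums Re (ln (1 - z))"
    by (rule sums_Re)
  moreover have "Re (- (z ^ Suc n) / of_nat (Suc n)) = - Re (z ^ Suc n) / Suc n" for n
    by (simp only: Re_divide_of_nat) simp
  moreover have "Re (ln (1 - z)) = ln (norm (1 - z))"
    using assms by (intro Re_Ln) auto
  ultimately show ?thesis by simp
qed

lemma abs_ln_norm_one_minus_le:
  fixes z :: complex
  assumes "norm z < 1"
  shows "\<bar>ln (norm (1 - z))\<bar> \<le> - ln (1 - norm z)"
proof -
  have pos: "1 - norm z > 0" "1 - norm z \<le> norm (1 - z)" "norm (1 - z) \<le> 1 + norm z"
    using assms norm_triangle_ineq2[of 1 z] norm_triangle_ineq4[of 1 z] by auto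
  have "ln (1 - norm z) \<le> ln (norm (1 - z))" using pos by (intro ln_mono) auto
  moreover have "ln (norm (1 - z)) \<le> ln (1 / (1 - norm z))"
  proof (intro ln_mono)
    have "1 + norm z \<le> 1 / (1 - norm z)"
      using pos assms by (simp add: pos_le_divide_eq algebra_simps)
    then show "norm (1 - z) \<le> 1 / (1 - norm z)" using pos by linarith
  qed (use pos in auto)
  ultimately show ?thesis using pos by (simp add: ln_div abs_le_iff)
qed

lemma
  fixes f :: "nat \<Rightarrow> real \<Rightarrow> 'a :: {banach, second_countable_topology}"
  assumes [measurable]: "\<And>n. f n \<in> borel_measurable borel"
    and b: "\<And>n t. norm (f n t) \<le> b n" "summable b"
  shows integral_circ_suminf: "(LINT t|circ. (\<Sum>n. f n t)) = (\<Sum>n. LINT t|circ. f n t)"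
    and summable_integral_circ: "summable (\<lambda>n. LINT t|circ. f n t)"
proof -
  have 1: "integrable circ (f n)" for n
    using b(1) by (intro integrable_circ_bounded) auto
  have 2: "AE t in circ. summable (\<lambda>n. norm (f n t))"
    using b by (intro AE_I2 summable_comparison_test'[OF b(2)]) auto
  have 3: "summable (\<lambda>n. LINT t|circ. norm (f n t))"
  proof (rule summable_comparison_test')
    show "summable (\<lambda>n. 2 * pi * b n)" using b(2) by (rule summable_mult)
    fix n :: nat
    have "(LINT t|circ. norm (f n t)) \<le> (LINT t|circ. b n)"
      using 1 b by (intro integral_mono) auto
    then show "norm (LINT t|circ. norm (f n t)) \<le> 2 * pi * b n"
      by (simp add: measure_circ)
  qed
  show "(LINT t|circ. (\<Sum>n. f n t)) = (\<Sum>n. LINT t|circ. f n t)"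
    by (rule integral_suminf[OF 1 2 3])
  have "(\<lambda>n. LINT t|circ. f n t) sums (LINT t|circ. (\<Sum>n. f n t))"
    by (rule sums_integral[OF 1 2 3])
  then show "summable (\<lambda>n. LINT t|circ. f n t)" by (rule sums_summable)
qed

lemma Re_mult_of_real: "Re (z * of_real a) = Re z * a"
  by simp

text \<open>Without the factor 1/(2 pi) and with positive exponent, so that it is the angular part
  of the moment of z^n. For real \<open>m\<close> the nonnegative modes determine the
  others.\<close>

definition fcoeff :: "(real \<Rightarrow> real) \<Rightarrow> nat \<Rightarrow> complex" where
  "fcoeff m n = (LINT t|circ. of_real (m t) * cis (real n * t))"

context
  fixes m :: "real \<Rightarrow> real" and B :: real
  assumes m[measurable]: "m \<in> borel_measurable borel" and B: "\<And>t. \<bar>m t\<bar> \<le> B"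
begin

lemma B_nonneg: "B \<ge> 0"
proof -
  have "0 \<le> \<bar>m 0\<bar>" by (rule abs_ge_zero)
  also have "\<dots> \<le> B" by (rule B)
  finally show ?thesis .
qed

lemma integrable_circ_cis: "integrable circ (\<lambda>t. of_real (m t) * cis (real n * t))"
  by (rule integrable_circ_bounded[of _ B]) (auto simp: norm_mult B B_nonneg)

lemma norm_fcoeff_le: "norm (fcoeff m n) \<le> (LINT t|circ. \<bar>m t\<bar>)"
  unfolding fcoeff_def
  by (rule integral_norm_bound[THEN order_trans]) (auto simp: norm_mult)

lemma norm_fcoeff_le': "norm (fcoeff m n) \<le> 2 * pi * B"
proof -
  have "(LINT t|circ. \<bar>m t\<bar>) \<le> (LINT t|circ. B)"
    using B by (intro integral_mono integrable_circ_bounded[of _ B]) (auto simp: B_nonneg)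
  then show ?thesis using norm_fcoeff_le[of n] by (simp add: measure_circ)
qed

text \<open>The series of ln |1 - z| is integrated term by term; strictly inside the disk it is
  dominated by a geometric series.\<close>

lemma log_kernel_pairing:
  fixes w :: complex
  assumes w: "norm w < 1"
  shows "(LINT t|circ. ln (norm (1 - w * cis t)) * m t) = (\<Sum>n. - Re (w ^ Suc n * fcoeff m (Suc n)) / Suc n)"
    and "summable (\<lambda>n. - Re (w ^ Suc n * fcoeff m (Suc n)) / Suc n)"
proof -
  define f where "f n t = - Re ((w * cis t) ^ Suc n) / Suc n * m t" for n t
  have fm [measurable]: "f n \<in> borel_measurable borel" for n
    unfolding f_def by (intro borel_measurable_times borel_measurable_divide borel_measurable_uminus
      borel_measurable_Re borel_measurable_power) measurable
  have bd: "norm (f n t) \<le> norm w ^ n * B" for n t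
  proof -
    have "\<bar>Re ((w * cis t) ^ Suc n)\<bar> \<le> norm w ^ Suc n"
      using abs_Re_le_cmod[of "(w * cis t) ^ Suc n"] by (simp add: norm_mult norm_power)
    also have "\<dots> \<le> norm w ^ n * 1" using w by (simp add: mult_left_le_one_le)
    finally have "\<bar>Re ((w * cis t) ^ Suc n)\<bar> / Suc n \<le> norm w ^ n / 1"
      by (intro frac_le) auto
    then have "\<bar>Re ((w * cis t) ^ Suc n)\<bar> / Suc n * \<bar>m t\<bar> \<le> norm w ^ n * B"
      using B by (intro mult_mono) auto
    then show ?thesis
      unfolding f_def real_norm_def by (simp only: abs_mult abs_divide abs_minus_cancel abs_of_nat)
  qed
  have sb: "summable (\<lambda>n. norm w ^ n * B)" using w by (intro summable_mult2 summable_geometric) auto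
  have int: "(LINT t|circ. f n t) = - Re (w ^ Suc n * fcoeff m (Suc n)) / Suc n" for n
  proof -
    have "f n t = - Re (w ^ Suc n * (of_real (m t) * cis (real (Suc n) * t))) / Suc n" for t
    proof -
      have "(w * cis t) ^ Suc n * of_real (m t) = w ^ Suc n * (of_real (m t) * cis (real (Suc n) * t))"
        by (simp only: power_mult_distrib Complex.DeMoivre mult_ac)
      then have "Re ((w * cis t) ^ Suc n) * m t = Re (w ^ Suc n * (of_real (m t) * cis (real (Suc n) * t)))"
        by (metis Re_mult_of_real)
      then show ?thesis unfolding f_def by (simp add: field_simps)
    qed
    then have "(LINT t|circ. f n t) = (LINT t|circ. - Re (w ^ Suc n * (of_real (m t) * cis (real (Suc n) * t))) / Suc n)"
      by simp
    also have "\<dots> = - Re (w ^ Suc n * fcoeff m (Suc n)) / Suc n"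
      unfolding fcoeff_def using integrable_circ_cis[of "Suc n"]
      by (simp only: Bochner_Integration.integral_minus Bochner_Integration.integral_divide_zero
          integral_Re integrable_mult_right integral_mult_right_zero)
    finally show ?thesis .
  qed
  have "ln (norm (1 - w * cis t)) * m t = (\<Sum>n. f n t)" for t
  proof -
    have "(\<lambda>n. f n t) sums (ln (norm (1 - w * cis t)) * m t)"
      unfolding f_def using w by (intro sums_mult2 ln_norm_one_minus_sums) (simp add: norm_mult)
    then show ?thesis by (rule sums_unique)
  qed
  then show "(LINT t|circ. ln (norm (1 - w * cis t)) * m t) = (\<Sum>n. - Re (w ^ Suc n * fcoeff m (Suc n)) / Suc n)"
    using integral_circ_suminf[OF fm bd sb] by (simp only: int)
  show "summable (\<lambda>n. - Re (w ^ Suc n * fcoeff m (Suc n)) / Suc n)"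
    using summable_integral_circ[OF fm bd sb] by (simp only: int)
qed

text \<open>The kernel depends on \<open>t - \<theta>\<close> only, so it is diagonal in Fourier
  modes: \<open>log_kernel_pairing\<close> with w = \<rho> cis (-\<theta>) does the inner integral,
  and pairing with \<open>m\<close> once more squares the coefficients.\<close>

lemma log_energy:
  assumes \<rho>: "0 \<le> \<rho>" "\<rho> < 1"
  shows "(LINT \<theta>|circ. m \<theta> * (LINT t|circ. ln (norm (1 - of_real \<rho> * cis (t - \<theta>))) * m t)) =
      (\<Sum>n. - (\<rho> ^ Suc n * (norm (fcoeff m (Suc n)))\<^sup>2) / Suc n)"
    and "summable (\<lambda>n. - (\<rho> ^ Suc n * (norm (fcoeff m (Suc n)))\<^sup>2) / Suc n)"
proof -
  define C where "C = fcoeff m"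
  define f where "f n \<theta> = m \<theta> * (- Re ((of_real \<rho> * cis (- \<theta>)) ^ Suc n * C (Suc n)) / Suc n)" for n \<theta>
  have fm [measurable]: "f n \<in> borel_measurable borel" for n
    unfolding f_def by (intro borel_measurable_times borel_measurable_divide borel_measurable_uminus
      borel_measurable_Re borel_measurable_power) measurable
  have bd: "norm (f n \<theta>) \<le> \<rho> ^ n * (2 * pi * B * B)" for n \<theta>
  proof -
    have "\<bar>Re ((of_real \<rho> * cis (- \<theta>)) ^ Suc n * C (Suc n))\<bar> \<le> \<rho> ^ Suc n * norm (C (Suc n))"
      using abs_Re_le_cmod[of "(of_real \<rho> * cis (- \<theta>)) ^ Suc n * C (Suc n)"] \<rho> by (simp add: norm_mult norm_power)
    also have "\<dots> \<le> \<rho> ^ n * (2 * pi * B)"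
      using \<rho> B_nonneg norm_fcoeff_le'[of "Suc n"] unfolding C_def
      by (intro mult_mono) (auto simp: mult_left_le_one_le)
    finally have "\<bar>Re ((of_real \<rho> * cis (- \<theta>)) ^ Suc n * C (Suc n))\<bar> / Suc n \<le> \<rho> ^ n * (2 * pi * B) / 1"
      using \<rho> B_nonneg by (intro frac_le) auto
    then have "\<bar>m \<theta>\<bar> * (\<bar>Re ((of_real \<rho> * cis (- \<theta>)) ^ Suc n * C (Suc n))\<bar> / Suc n) \<le> B * (\<rho> ^ n * (2 * pi * B))"
      using B \<rho> B_nonneg by (intro mult_mono) auto
    also have "B * (\<rho> ^ n * (2 * pi * B)) = \<rho> ^ n * (2 * pi * B * B)" by simp
    finally show ?thesis
      unfolding f_def real_norm_def by (simp only: abs_mult abs_divide abs_minus_cancel abs_of_nat)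
  qed
  have sb: "summable (\<lambda>n. \<rho> ^ n * (2 * pi * B * B))" using \<rho> by (intro summable_mult2 summable_geometric) auto
  have int: "(LINT \<theta>|circ. f n \<theta>) = - (\<rho> ^ Suc n * (norm (C (Suc n)))\<^sup>2) / Suc n" for n
  proof -
    have "f n \<theta> = - (\<rho> ^ Suc n * Re (cnj (of_real (m \<theta>) * cis (real (Suc n) * \<theta>)) * C (Suc n))) / Suc n" for \<theta>
    proof -
      have h: "(of_real \<rho> * cis (- \<theta>)) ^ Suc n = of_real (\<rho> ^ Suc n) * cnj (cis (real (Suc n) * \<theta>))"
        by (simp only: power_mult_distrib Complex.DeMoivre of_real_power cis_cnj mult_minus_right)
      have "of_real (m \<theta>) * ((of_real \<rho> * cis (- \<theta>)) ^ Suc n * C (Suc n)) =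
          of_real (\<rho> ^ Suc n) * (cnj (of_real (m \<theta>) * cis (real (Suc n) * \<theta>)) * C (Suc n))"
        by (simp only: h complex_cnj_mult complex_cnj_complex_of_real mult_ac)
      then have "m \<theta> * Re ((of_real \<rho> * cis (- \<theta>)) ^ Suc n * C (Suc n)) =
          \<rho> ^ Suc n * Re (cnj (of_real (m \<theta>) * cis (real (Suc n) * \<theta>)) * C (Suc n))"
        by (metis Re_mult_of_real mult.commute)
      then show ?thesis unfolding f_def by (simp add: field_simps)
    qed
    then have "(LINT \<theta>|circ. f n \<theta>) = (LINT \<theta>|circ. - (\<rho> ^ Suc n * Re (cnj (of_real (m \<theta>) * cis (real (Suc n) * \<theta>)) * C (Suc n))) / Suc n)"
      by simp
    also have "\<dots> = - (\<rho> ^ Suc n * Re (cnj (fcoeff m (Suc n)) * C (Suc n))) / Suc n"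
    proof -
      have i: "integrable circ (\<lambda>\<theta>. cnj (of_real (m \<theta>) * cis (real (Suc n) * \<theta>)) * C (Suc n))"
        by (intro integrable_mult_left integrable_cnj integrable_circ_cis)
      have "(LINT \<theta>|circ. - (\<rho> ^ Suc n * Re (cnj (of_real (m \<theta>) * cis (real (Suc n) * \<theta>)) * C (Suc n))) / Suc n)
          = - (\<rho> ^ Suc n * (LINT \<theta>|circ. Re (cnj (of_real (m \<theta>) * cis (real (Suc n) * \<theta>)) * C (Suc n)))) / Suc n"
        by (simp only: Bochner_Integration.integral_minus Bochner_Integration.integral_divide_zero integral_mult_right_zero)
      also have "(LINT \<theta>|circ. Re (cnj (of_real (m \<theta>) * cis (real (Suc n) * \<theta>)) * C (Suc n)))
          = Re (LINT \<theta>|circ. cnj (of_real (m \<theta>) * cis (real (Suc n) * \<theta>)) * C (Suc n))"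
        by (rule integral_Re[OF i])
      also have "(LINT \<theta>|circ. cnj (of_real (m \<theta>) * cis (real (Suc n) * \<theta>)) * C (Suc n)) = cnj (fcoeff m (Suc n)) * C (Suc n)"
        unfolding fcoeff_def by (simp only: integral_mult_left_zero integral_bounded_linear[OF bounded_linear_cnj integrable_circ_cis])
      finally show ?thesis .
    qed
    also have "Re (cnj (fcoeff m (Suc n)) * C (Suc n)) = (norm (C (Suc n)))\<^sup>2"
      by (simp add: C_def cmod_power2) (simp add: power2_eq_square)
    finally show ?thesis .
  qed
  have "m \<theta> * (LINT t|circ. ln (norm (1 - of_real \<rho> * cis (t - \<theta>))) * m t) = (\<Sum>n. f n \<theta>)" for \<theta>
  proof -
    have "of_real \<rho> * cis (t - \<theta>) = (of_real \<rho> * cis (- \<theta>)) * cis t" for t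
      by (simp add: cis_mult algebra_simps)
    moreover have "norm (of_real \<rho> * cis (- \<theta>)) < 1" using \<rho> by (simp add: norm_mult)
    ultimately show ?thesis
      using log_kernel_pairing[of "of_real \<rho> * cis (- \<theta>)"]
      by (simp only: f_def C_def suminf_mult)
  qed
  then show "(LINT \<theta>|circ. m \<theta> * (LINT t|circ. ln (norm (1 - of_real \<rho> * cis (t - \<theta>))) * m t)) =
      (\<Sum>n. - (\<rho> ^ Suc n * (norm (fcoeff m (Suc n)))\<^sup>2) / Suc n)"
    using integral_circ_suminf[OF fm bd sb] by (simp only: int C_def)
  show "summable (\<lambda>n. - (\<rho> ^ Suc n * (norm (fcoeff m (Suc n)))\<^sup>2) / Suc n)"
    using summable_integral_circ[OF fm bd sb] by (simp only: int C_def)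
qed

text \<open>The constant is pi and not 2 pi because \<open>m\<close> is real: the modes n and -n
  contribute equally and only the positive ones are summed.\<close>

lemma bessel_inequality: "(\<Sum>n<N. (norm (fcoeff m (Suc n)))\<^sup>2) \<le> pi * (LINT t|circ. (m t)\<^sup>2)"
proof -
  define C where "C n = fcoeff m (Suc n)" for n
  define S where "S = (\<Sum>n<N. (norm (C n))\<^sup>2)"
  define g where "g n t = Re (C n * cis (- (real (Suc n) * t)))" for n t
  \<comment> \<open>The orthogonal projection of \<open>m\<close> to the modes 1 to N; cosines and
    sines have square norm pi on the circle. The inequality is that the integral of (m - p)^2 is
    nonnegative.\<close>
  define p where "p t = (1 / pi) * (\<Sum>n<N. g n t)" for t
  have g_meas [measurable]: "g n \<in> borel_measurable borel" for n
    unfolding g_def by measurable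
  have gb: "\<bar>g n t\<bar> \<le> norm (C n)" for n t
    unfolding g_def using abs_Re_le_cmod[of "C n * cis (- (real (Suc n) * t))"] by (simp add: norm_mult)
  have gg: "(LINT t|circ. g n t * g k t) = (if n = k then pi * (norm (C n))\<^sup>2 else 0)" for n k
  proof -
    define a b :: int where "a = - int (Suc n + Suc k)" and "b = int k - int n"
    have "g n t * g k t = Re (C n * C k / 2 * cis (of_int a * t)) + Re (C n * cnj (C k) / 2 * cis (of_int b * t))" for t
    proof -
      have R: "Re x * Re y = Re (x * y / 2) + Re (x * cnj y / 2)" for x y :: complex
        by (simp add: add_divide_distrib diff_divide_distrib)
      have "C n * cis (- (real (Suc n) * t)) * (C k * cis (- (real (Suc k) * t))) / 2 = C n * C k / 2 * cis (of_int a * t)"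
      proof -
        have "- (real (Suc n) * t) + - (real (Suc k) * t) = of_int a * t"
          by (simp add: a_def algebra_simps)
        then have "cis (- (real (Suc n) * t)) * cis (- (real (Suc k) * t)) = cis (of_int a * t)"
          by (simp only: cis_mult)
        then show ?thesis by (simp add: mult_ac)
      qed
      moreover have "C n * cis (- (real (Suc n) * t)) * cnj (C k * cis (- (real (Suc k) * t))) / 2 = C n * cnj (C k) / 2 * cis (of_int b * t)"
      proof -
        have "- (real (Suc n) * t) + - (- (real (Suc k) * t)) = of_int b * t"
          by (simp add: b_def algebra_simps)
        then have "cis (- (real (Suc n) * t)) * cnj (cis (- (real (Suc k) * t))) = cis (of_int b * t)"
          by (simp only: cis_cnj cis_mult)
        then show ?thesis by (simp add: mult_ac)
      qed
      ultimately show ?thesis unfolding g_def R[of "C n * _"] by (simp only:)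
    qed
    moreover have i: "integrable circ (\<lambda>t. c * cis (of_int j * t))" for c and j :: int
      by (rule integrable_circ_bounded[of _ "norm c"]) (auto simp: norm_mult)
    ultimately have "(LINT t|circ. g n t * g k t) =
       Re (C n * C k / 2 * (LINT t|circ. cis (of_int a * t))) + Re (C n * cnj (C k) / 2 * (LINT t|circ. cis (of_int b * t)))"
      by (simp only: Bochner_Integration.integral_add integrable_Re integral_Re integral_mult_right_zero)
    moreover have "a \<noteq> 0" "b = 0 \<longleftrightarrow> n = k" by (auto simp: a_def b_def)
    ultimately show ?thesis
      using cmod_power2[of "C k"]
      by (cases "n = k") (auto simp: integral_circ_cis complex_mult_cnj power2_eq_square)
  qed
  have mg: "(LINT t|circ. m t * g n t) = (norm (C n))\<^sup>2" for n
  proof -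
    have "m t * g n t = Re (C n * cnj (of_real (m t) * cis (real (Suc n) * t)))" for t
    proof -
      have "C n * cnj (of_real (m t) * cis (real (Suc n) * t)) = of_real (m t) * (C n * cis (- (real (Suc n) * t)))"
        by (simp add: cis_cnj)
      then show ?thesis unfolding g_def by (metis Re_mult_of_real mult.commute)
    qed
    moreover have "integrable circ (\<lambda>t. C n * cnj (of_real (m t) * cis (real (Suc n) * t)))"
      by (intro integrable_mult_right integrable_cnj integrable_circ_cis)
    ultimately have "(LINT t|circ. m t * g n t) = Re (C n * cnj (C n))"
      unfolding C_def fcoeff_def by (simp only: integral_Re integral_mult_right_zero integral_bounded_linear[OF bounded_linear_cnj integrable_circ_cis])
    then show ?thesis by (simp add: complex_mult_cnj cmod_power2)
  qed
  have p_meas [measurable]: "p \<in> borel_measurable borel" unfolding p_def by measurable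
  have ig: "integrable circ (\<lambda>t. m t * g n t)" for n
    by (rule integrable_circ_bounded[of _ "B * norm (C n)"]) (auto simp: abs_mult intro!: mult_mono B gb B_nonneg)
  have igg: "integrable circ (\<lambda>t. g n t * g k t)" for n k
    by (rule integrable_circ_bounded[of _ "norm (C n) * norm (C k)"]) (auto simp: abs_mult intro!: mult_mono gb)
  have mp: "(LINT t|circ. m t * p t) = S / pi"
    unfolding p_def S_def using ig
    by (simp add: sum_distrib_left mult.left_commute[of "m _"] Bochner_Integration.integral_sum mg sum_divide_distrib)
  have pp: "(LINT t|circ. p t * p t) = S / pi"
  proof -
    have "p t * p t = (1 / pi)\<^sup>2 * (\<Sum>n<N. \<Sum>k<N. g n t * g k t)" for t
      by (simp add: p_def sum_product power2_eq_square)
    then have "(LINT t|circ. p t * p t) = (1 / pi)\<^sup>2 * (\<Sum>n<N. \<Sum>k<N. (if n = k then pi * (norm (C n))\<^sup>2 else 0))"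
      using igg by (simp add: Bochner_Integration.integral_sum gg)
    also have "\<dots> = S / pi" by (simp add: S_def power2_eq_square sum_divide_distrib flip: sum_distrib_left)
    finally show ?thesis .
  qed
  have imp: "integrable circ (\<lambda>t. m t * p t)"
    unfolding p_def using ig by (simp add: sum_distrib_left mult.left_commute[of "m _"])
  have ipp: "integrable circ (\<lambda>t. p t * p t)"
    unfolding p_def using igg by (simp add: sum_product)
  have imm: "integrable circ (\<lambda>t. (m t)\<^sup>2)"
    by (rule integrable_circ_bounded[of _ "B\<^sup>2"]) (use power_mono[OF B abs_ge_zero, of _ 2] in auto)
  have "0 \<le> (LINT t|circ. (m t - p t)\<^sup>2)" by (intro integral_nonneg_AE) auto
  also have "(\<lambda>t. (m t - p t)\<^sup>2) = (\<lambda>t. (m t)\<^sup>2 - 2 * (m t * p t) + p t * p t)"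
    by (auto simp: power2_eq_square algebra_simps)
  also have "(LINT t|circ. (m t)\<^sup>2 - 2 * (m t * p t) + p t * p t) = (LINT t|circ. (m t)\<^sup>2) - 2 * (S / pi) + S / pi"
    using imp ipp imm by (simp add: mp pp)
  finally show ?thesis by (simp add: S_def C_def field_simps)
qed

text \<open>The mode \<open>n\<close> has weight \<open>1/n\<close>; the modes \<open>1\<close> and \<open>2\<close> are split off because they are
  controlled by the moments of the patches.\<close>

lemma log_energy_ge:
  assumes \<rho>: "0 \<le> \<rho>" "\<rho> < 1"
  shows "(LINT \<theta>|circ. m \<theta> * (LINT t|circ. ln (norm (1 - of_real \<rho> * cis (t - \<theta>))) * m t)) \<ge>
     - (pi / 3 * (LINT t|circ. (m t)\<^sup>2) + (norm (fcoeff m 1))\<^sup>2 + (norm (fcoeff m 2))\<^sup>2)"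
proof -
  \<comment> \<open>Shifted by one: \<open>a 0\<close> and \<open>a 1\<close> belong to the modes 1
    and 2, and from \<open>n = 2\<close> on the weight 1 / (n + 1) is at most 1/3.\<close>
  define a where "a n = (norm (fcoeff m (Suc n)))\<^sup>2" for n
  define K where "K = pi / 3 * (LINT t|circ. (m t)\<^sup>2) + a 0 + a 1"
  have a0: "a n \<ge> 0" for n by (simp add: a_def)
  have sm: "summable (\<lambda>n. \<rho> ^ Suc n * a n / Suc n)"
    using summable_minus[OF log_energy(2)[OF \<rho>]] by (simp add: a_def)
  have le: "\<rho> ^ Suc n * a n / Suc n \<le> a n / 3 + (if n = 0 then a 0 else 0) + (if n = 1 then a 1 else 0)" for n
  proof -
    have p: "\<rho> ^ Suc n \<le> 1" using \<rho> by (intro power_le_one) auto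
    then have "\<rho> ^ Suc n * a n \<le> 1 * a n" using a0 by (intro mult_right_mono) auto
    then have 1: "\<rho> ^ Suc n * a n / Suc n \<le> a n / Suc n" by (intro divide_right_mono) auto
    consider "n = 0" | "n = 1" | "Suc n \<ge> 3" by linarith
    then show ?thesis
    proof cases
      case 3
      then have "a n / Suc n \<le> a n / 3" using a0 by (intro divide_left_mono) auto
      then have "\<rho> ^ Suc n * a n / Suc n \<le> a n / 3" using 1 by linarith
      moreover have "n \<noteq> 0" "n \<noteq> 1" using 3 by auto
      ultimately show ?thesis using 1 by simp
    qed (use 1 a0[of 0] a0[of 1] in auto)
  qed
  have "(\<Sum>n. \<rho> ^ Suc n * a n / Suc n) \<le> K"
  proof (rule suminf_le_const[OF sm])
    fix N
    have "(\<Sum>n<N. \<rho> ^ Suc n * a n / Suc n) \<le> (\<Sum>n<N. a n / 3 + (if n = 0 then a 0 else 0) + (if n = 1 then a 1 else 0))"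
      by (intro sum_mono le)
    also have "\<dots> = (\<Sum>n<N. a n) / 3 + (\<Sum>n<N. if n = 0 then a 0 else 0) + (\<Sum>n<N. if n = 1 then a 1 else 0)"
      by (simp add: sum.distrib sum_divide_distrib)
    also have "\<dots> \<le> pi * (LINT t|circ. (m t)\<^sup>2) / 3 + a 0 + a 1"
      using bessel_inequality[of N] a0[of 0] a0[of 1] by (intro add_mono) (auto simp: a_def)
    finally show "(\<Sum>n<N. \<rho> ^ Suc n * a n / Suc n) \<le> K" by (simp add: K_def)
  qed
  moreover have "(\<Sum>n. - (\<rho> ^ Suc n * (norm (fcoeff m (Suc n)))\<^sup>2) / Suc n) = - (\<Sum>n. \<rho> ^ Suc n * a n / Suc n)"
    using suminf_minus[OF sm] by (simp add: a_def)
  ultimately show ?thesis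
    unfolding log_energy(1)[OF \<rho>] by (simp add: K_def a_def numeral_2_eq_2)
qed

end

text \<open>The mean value property of the harmonic function ln |1 - z| in the unit disk.\<close>

lemma log_kernel_mean:
  fixes w :: complex
  assumes w: "norm w < 1"
  shows "(LINT t|circ. ln (norm (1 - w * cis t))) = 0"
    and "integrable circ (\<lambda>t. ln (norm (1 - w * cis t)))"
proof -
  have z: "fcoeff (\<lambda>_. 1) (Suc n) = 0" for n
    using integral_circ_cis[of "int (Suc n)"] by (simp add: fcoeff_def del: of_nat_Suc)
  show "(LINT t|circ. ln (norm (1 - w * cis t))) = 0"
    using log_kernel_pairing(1)[of "\<lambda>_. 1" 1 w] w by (simp add: z)
  show "integrable circ (\<lambda>t. ln (norm (1 - w * cis t)))"
    using abs_ln_norm_one_minus_le[of "w * cis _"] w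
    by (intro integrable_circ_bounded[of _ "- ln (1 - norm w)"]) (auto simp: norm_mult)
qed

text \<open>Only mode 1 of the series meets the cosine. This term produces the angular dependence of
  the potential on the boundary of an ellipse.\<close>

lemma log_kernel_cos:
  fixes w :: complex
  assumes w: "norm w < 1"
  shows "(LINT t|circ. ln (norm (1 - w * cis t)) * cos t) = - (pi * Re w)"
proof -
  have z: "fcoeff cos (Suc n) = (if n = 0 then pi else 0)" for n
  proof -
    have "of_real (cos t) * cis (real (Suc n) * t) = 1/2 * (cis (of_int (int n + 2) * t)) + 1/2 * cis (of_int (int n) * t)" for t
    proof -
      have "of_real (cos t) = (cis t + cis (- t)) / 2" by (simp add: complex_eq_iff)
      then have "of_real (cos t) * cis (real (Suc n) * t) = (cis t * cis (real (Suc n) * t) + cis (- t) * cis (real (Suc n) * t)) / 2"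
        by (simp only: distrib_right times_divide_eq_left)
      then show ?thesis by (simp add: cis_mult algebra_simps add_divide_distrib)
    qed
    moreover have i: "integrable circ (\<lambda>t. c * cis (of_int j * t))" for c :: complex and j :: int
      by (rule integrable_circ_bounded[of _ "norm c"]) (auto simp: norm_mult)
    ultimately have "fcoeff cos (Suc n) = 1/2 * (LINT t|circ. cis (of_int (int n + 2) * t)) + 1/2 * (LINT t|circ. cis (of_int (int n) * t))"
      unfolding fcoeff_def by (simp only: Bochner_Integration.integral_add integral_mult_right_zero)
    moreover have "int n + 2 \<noteq> 0" by simp
    ultimately show ?thesis by (simp only: integral_circ_cis) simp
  qed
  have "(LINT t|circ. ln (norm (1 - w * cis t)) * cos t) = (\<Sum>n. - Re (w ^ Suc n * fcoeff cos (Suc n)) / Suc n)"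
    by (rule log_kernel_pairing(1)[where B=1, OF _ _ w]) auto
  also have "\<dots> = (\<Sum>n\<in>{0}. - Re (w ^ Suc n * fcoeff cos (Suc n)) / Suc n)"
    by (rule suminf_finite) (auto simp: z)
  finally show ?thesis by (simp add: z mult.commute)
qed

section \<open>From the kernel inside the disk to an annulus around the unit circle\<close>

lemma norm_one_minus_cis: "(norm (1 - of_real t * cis \<alpha>))\<^sup>2 = (1 - t)\<^sup>2 + t * (norm (1 - cis \<alpha>))\<^sup>2"
proof -
  have "(norm (1 - of_real t * cis \<alpha>))\<^sup>2 = 1 - 2 * t * cos \<alpha> + t\<^sup>2 * ((sin \<alpha>)\<^sup>2 + (cos \<alpha>)\<^sup>2)" for t
    unfolding cmod_power2 by (simp add: power2_eq_square algebra_simps del: sin_cos_squared_add3 cos_squared_eq)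
  then have eq: "(norm (1 - of_real t * cis \<alpha>))\<^sup>2 = 1 - 2 * t * cos \<alpha> + t\<^sup>2" for t
    by (simp only: sin_cos_squared_add mult_1_right)
  have "2 * cos \<alpha> = 2 - (norm (1 - cis \<alpha>))\<^sup>2" using eq[of 1] by simp
  then have "t * (2 * cos \<alpha>) = t * (2 - (norm (1 - cis \<alpha>))\<^sup>2)" by (rule arg_cong)
  then show ?thesis unfolding eq by (simp add: power2_eq_square algebra_simps)
qed

lemma AE_cis_neq_1: "AE t in circ. cis (t - \<theta>) \<noteq> 1"
proof (rule AE_circ_I)
  have "{t. cis (t - \<theta>) = 1} \<subseteq> range (\<lambda>n::int. \<theta> + 2 * pi * of_int n)"
  proof
    fix t assume "t \<in> {t. cis (t - \<theta>) = 1}"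
    then have "cos (t - \<theta>) = 1" by (simp add: complex_eq_iff)
    then obtain n :: int where "t - \<theta> = of_int n * 2 * pi" unfolding cos_one_2pi_int by auto
    then show "t \<in> range (\<lambda>n::int. \<theta> + 2 * pi * of_int n)"
      by (intro image_eqI[of _ _ n]) (auto simp: algebra_simps)
  qed
  then have "countable {t. cis (t - \<theta>) = 1}" by (rule countable_subset) auto
  then have "{t. cis (t - \<theta>) = 1} \<in> null_sets lborel" by (rule countable_imp_null_set_lborel)
  from AE_not_in[OF this] show "AE t in lborel. cis (t - \<theta>) \<noteq> 1" by simp
qed

lemma ln_norm_one_minus_lower:
  assumes "0 < t" "cis \<alpha> \<noteq> 1"
  shows "ln (norm (1 - cis \<alpha>)) + ln t / 2 \<le> ln (norm (1 - of_real t * cis \<alpha>))"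
proof -
  have a: "norm (1 - cis \<alpha>) > 0" using assms by simp
  have le: "t * (norm (1 - cis \<alpha>))\<^sup>2 \<le> (norm (1 - of_real t * cis \<alpha>))\<^sup>2"
    unfolding norm_one_minus_cis by simp
  have p: "0 < t * (norm (1 - cis \<alpha>))\<^sup>2" using assms a by simp
  then have "norm (1 - of_real t * cis \<alpha>) > 0"
    using le by (metis less_le_trans norm_ge_zero order_less_le power_zero_numeral)
  moreover have "ln (t * (norm (1 - cis \<alpha>))\<^sup>2) \<le> ln ((norm (1 - of_real t * cis \<alpha>))\<^sup>2)"
    using le p by (intro ln_mono) auto
  ultimately show ?thesis using assms a by (simp add: ln_mult ln_realpow)
qed

text \<open>Dividing by t separates radius and angle: |1 - t cis \<alpha>|^2 / t = (1 - t)^2 / t +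
  |1 - cis \<alpha>|^2, and the first summand decreases on (0, 1].\<close>

lemma ln_norm_one_minus_antimono:
  assumes "0 < s" "s \<le> t" "t \<le> 1" "cis \<alpha> \<noteq> 1"
  shows "ln (norm (1 - of_real t * cis \<alpha>)) - ln t / 2 \<le> ln (norm (1 - of_real s * cis \<alpha>)) - ln s / 2"
proof -
  define a where "a = (norm (1 - cis \<alpha>))\<^sup>2"
  have a: "a > 0" using assms by (simp add: a_def)
  have eq: "ln (norm (1 - of_real u * cis \<alpha>)) - ln u / 2 = ln ((1 - u)\<^sup>2 / u + a) / 2" if "u > 0" for u
  proof -
    have pos: "(1 - u)\<^sup>2 + u * a > 0" using that a by (intro add_nonneg_pos) auto
    have n: "norm (1 - of_real u * cis \<alpha>) > 0"
      using pos norm_one_minus_cis[of u \<alpha>] unfolding a_def[symmetric]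
      by (metis less_irrefl norm_ge_zero order_less_le power_zero_numeral)
    have "ln ((1 - u)\<^sup>2 / u + a) = ln (((1 - u)\<^sup>2 + u * a) / u)" using that by (simp add: field_simps)
    also have "\<dots> = ln ((1 - u)\<^sup>2 + u * a) - ln u" using that pos by (simp add: ln_div)
    also have "ln ((1 - u)\<^sup>2 + u * a) = 2 * ln (norm (1 - of_real u * cis \<alpha>))"
      using n by (simp add: norm_one_minus_cis[of u \<alpha>, folded a_def, symmetric] ln_realpow)
    finally show ?thesis by simp
  qed
  have "(1 - t)\<^sup>2 / t \<le> (1 - s)\<^sup>2 / s"
    using assms by (intro frac_le power_mono) auto
  then have "ln ((1 - t)\<^sup>2 / t + a) \<le> ln ((1 - s)\<^sup>2 / s + a)"
    using a assms by (intro ln_mono add_nonneg_pos) auto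
  then show ?thesis using eq[of t] eq[of s] assms by simp
qed

text \<open>The mean over the singular kernel is the limit of the means over radii below 1.
  Subtracting half of ln \<rho> makes the approximation monotone, so monotone convergence also
  yields integrability.\<close>

lemma log_kernel_mean_boundary:
  shows "integrable circ (\<lambda>t. ln (norm (1 - cis (t - \<theta>))))"
    and "(LINT t|circ. ln (norm (1 - cis (t - \<theta>)))) = 0"
proof -
  \<comment> \<open>The offset 2 keeps all radii positive, so that their logarithms make
    sense.\<close>
  define \<rho> where "\<rho> n = 1 - 1 / real (n + 2)" for n
  have \<rho>: "0 < \<rho> n" "\<rho> n < 1" for n by (auto simp: \<rho>_def)
  have \<rho>mono: "\<rho> i \<le> \<rho> j" if "i \<le> j" for i j
    using that by (auto simp: \<rho>_def intro!: divide_left_mono)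
  have \<rho>lim: "\<rho> \<longlonglongrightarrow> 1" unfolding \<rho>_def
    using tendsto_diff[OF tendsto_const LIMSEQ_ignore_initial_segment[OF lim_1_over_n[where 'a=real], of 2], of 1] by simp
  define f where "f n t = - (ln (norm (1 - of_real (\<rho> n) * cis (t - \<theta>))) - ln (\<rho> n) / 2)" for n t
  define u where "u t = - ln (norm (1 - cis (t - \<theta>)))" for t
  have eq: "of_real (\<rho> n) * cis (t - \<theta>) = (of_real (\<rho> n) * cis (- \<theta>)) * cis t" for n t
    by (simp add: cis_mult algebra_simps)
  have nw: "norm (of_real (\<rho> n) * cis (- \<theta>)) < 1" for n using \<rho>[of n] by (simp add: norm_mult)
  have i: "integrable circ (f n)" for n
    unfolding f_def eq by (intro integrable_minus Bochner_Integration.integrable_diff log_kernel_mean nw) auto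
  have I: "(LINT t|circ. f n t) = pi * ln (\<rho> n)" for n
    unfolding f_def eq using log_kernel_mean[OF nw[of n]] by (simp add: measure_circ)
  have mono: "AE t in circ. mono (\<lambda>n. f n t)"
    using AE_cis_neq_1[of \<theta>]
  proof eventually_elim
    case (elim t)
    show ?case
    proof (rule monoI)
      fix i j :: nat assume "i \<le> j"
      then show "f i t \<le> f j t"
        using ln_norm_one_minus_antimono[of "\<rho> i" "\<rho> j" "t - \<theta>"] \<rho>[of i] \<rho>[of j] \<rho>mono elim by (simp add: f_def)
    qed
  qed
  have lim: "AE t in circ. (\<lambda>n. f n t) \<longlonglongrightarrow> u t"
    using AE_cis_neq_1[of \<theta>]
  proof eventually_elim
    case (elim t)
    have "(\<lambda>n. f n t) \<longlonglongrightarrow> - (ln (norm (1 - of_real 1 * cis (t - \<theta>))) - ln 1 / 2)"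
      unfolding f_def using elim \<rho>lim by (intro tendsto_intros) auto
    then show ?case by (simp add: u_def)
  qed
  have ilim: "(\<lambda>n. LINT t|circ. f n t) \<longlonglongrightarrow> pi * ln 1"
    unfolding I using \<rho>lim by (intro tendsto_intros) auto
  have um: "u \<in> borel_measurable circ" unfolding u_def by measurable
  have "integrable circ u" "(LINT t|circ. u t) = pi * ln 1"
    using integrable_monotone_convergence[OF i mono lim ilim um] integral_monotone_convergence[OF i mono lim ilim um] by auto
  then show "integrable circ (\<lambda>t. ln (norm (1 - cis (t - \<theta>))))" "(LINT t|circ. ln (norm (1 - cis (t - \<theta>)))) = 0"
    unfolding u_def by simp_all
qed

text \<open>Bounds the error when the logarithmic kernel in an annulus around the unit circle is replaced
  by a translation invariant kernel on the circle. Its mean is of order \<open>\<kappa>\<close>.\<close>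

definition log_error :: "real \<Rightarrow> real \<Rightarrow> real" where
  "log_error \<kappa> \<alpha> = ln (norm (1 - of_real ((1 - \<kappa>) / (1 + \<kappa>)) * cis \<alpha>)) - ln (norm (1 - cis \<alpha>))
     - ln ((1 - \<kappa>) / (1 + \<kappa>)) - ln (1 - \<kappa>)"

lemma measurable_log_error [measurable]: "log_error \<kappa> \<in> borel_measurable borel"
  unfolding log_error_def by measurable

lemma log_error_minus: "log_error \<kappa> (- \<alpha>) = log_error \<kappa> \<alpha>"
proof -
  have "norm (1 - of_real t * cis (- \<alpha>)) = norm (1 - of_real t * cis \<alpha>)" for t
    using complex_mod_cnj[of "1 - of_real t * cis \<alpha>"] by (simp add: cis_cnj)
  note 1 = this
  have 2: "norm (1 - cis (- \<alpha>)) = norm (1 - cis \<alpha>)" using 1[of 1] by simp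
  show ?thesis unfolding log_error_def 1 2 ..
qed

lemma
  assumes \<kappa>: "0 < \<kappa>" "\<kappa> < 1"
  shows integrable_log_error: "integrable circ (\<lambda>t. log_error \<kappa> (t - \<theta>))"
    and integral_log_error: "(LINT t|circ. log_error \<kappa> (t - \<theta>)) = - 2 * pi * (ln ((1 - \<kappa>) / (1 + \<kappa>)) + ln (1 - \<kappa>))"
proof -
  define \<rho> where "\<rho> = (1 - \<kappa>) / (1 + \<kappa>)"
  have \<rho>: "0 < \<rho>" "\<rho> < 1" using \<kappa> by (auto simp: \<rho>_def)
  have eq: "of_real \<rho> * cis (t - \<theta>) = (of_real \<rho> * cis (- \<theta>)) * cis t" for t
    by (simp add: cis_mult algebra_simps)
  have nw: "norm (of_real \<rho> * cis (- \<theta>)) < 1" using \<rho> by (simp add: norm_mult)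
  note L = log_kernel_mean[OF nw, folded eq] and B = log_kernel_mean_boundary[of \<theta>]
  show "integrable circ (\<lambda>t. log_error \<kappa> (t - \<theta>))"
    unfolding log_error_def \<rho>_def[symmetric] using L B by (intro Bochner_Integration.integrable_diff) auto
  show "(LINT t|circ. log_error \<kappa> (t - \<theta>)) = - 2 * pi * (ln ((1 - \<kappa>) / (1 + \<kappa>)) + ln (1 - \<kappa>))"
    unfolding log_error_def \<rho>_def[symmetric] using L B
    by (simp add: measure_circ algebra_simps)
qed

lemma norm_polar_diff:
  assumes "0 < s" "s \<le> r"
  shows "norm (of_real r * cis \<theta> - of_real s * cis \<phi>) = r * norm (1 - of_real (s / r) * cis (\<phi> - \<theta>))"
    and "norm (of_real s * cis \<theta> - of_real r * cis \<phi>) = r * norm (1 - of_real (s / r) * cis (\<phi> - \<theta>))"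
proof -
  have r: "r > 0" using assms by simp
  have "of_real r * cis \<theta> - of_real s * cis \<phi> = of_real r * cis \<theta> * (1 - of_real (s / r) * cis (\<phi> - \<theta>))"
    using r by (simp add: algebra_simps cis_mult)
  then show "norm (of_real r * cis \<theta> - of_real s * cis \<phi>) = r * norm (1 - of_real (s / r) * cis (\<phi> - \<theta>))"
    using r by (simp add: norm_mult del: of_real_divide)
  have "of_real s * cis \<theta> - of_real r * cis \<phi> = - (of_real r * cis \<phi>) * (1 - of_real (s / r) * cis (\<theta> - \<phi>))"
    using r by (simp add: algebra_simps cis_mult)
  then have "norm (of_real s * cis \<theta> - of_real r * cis \<phi>) = r * norm (1 - of_real (s / r) * cis (\<theta> - \<phi>))"
    using r by (simp add: norm_mult del: of_real_divide)
  also have "norm (1 - of_real (s / r) * cis (\<theta> - \<phi>)) = norm (1 - of_real (s / r) * cis (\<phi> - \<theta>))"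
    using complex_mod_cnj[of "1 - of_real (s / r) * cis (\<theta> - \<phi>)"] by (simp add: cis_cnj)
  finally show "norm (of_real s * cis \<theta> - of_real r * cis \<phi>) = r * norm (1 - of_real (s / r) * cis (\<phi> - \<theta>))" .
qed

text \<open>The distance is the larger radius times |1 - t cis (\<phi> - \<theta>)|, where
  \<open>t\<close> is the ratio of the radii. This ratio lies between (1 - \<kappa>) / (1 +
  \<kappa>) and 1, and the preceding bounds control the dependence on \<open>t\<close>; the larger
  radius contributes at most - ln (1 - \<kappa>).\<close>

lemma log_kernel_compare:
  assumes \<kappa>: "0 < \<kappa>" "\<kappa> < 1" and r: "1 - \<kappa> \<le> r" "r \<le> 1 + \<kappa>" and s: "1 - \<kappa> \<le> s" "s \<le> 1 + \<kappa>"
    and ne: "cis (\<phi> - \<theta>) \<noteq> 1"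
  shows "\<bar>ln (norm (of_real r * cis \<theta> - of_real s * cis \<phi>))
     - ln (norm (1 - of_real ((1 - \<kappa>) / (1 + \<kappa>)) * cis (\<phi> - \<theta>)))\<bar> \<le> log_error \<kappa> (\<phi> - \<theta>)"
proof -
  define \<rho> where "\<rho> = (1 - \<kappa>) / (1 + \<kappa>)"
  have \<rho>: "0 < \<rho>" "\<rho> < 1" using \<kappa> by (auto simp: \<rho>_def)
  define M where "M = max r s"
  define t where "t = min r s / max r s"
  have pos: "r > 0" "s > 0" "M > 0" using r s \<kappa> by (auto simp: M_def)
  have t: "\<rho> \<le> t" "t \<le> 1" "0 < t" using r s pos \<kappa> by (auto simp: \<rho>_def t_def intro!: frac_le)
  have n: "norm (of_real r * cis \<theta> - of_real s * cis \<phi>) = M * norm (1 - of_real t * cis (\<phi> - \<theta>))"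
    using norm_polar_diff(1)[of s r \<theta> \<phi>] norm_polar_diff(2)[of r s \<theta> \<phi>] pos
    by (cases "s \<le> r") (auto simp: M_def t_def max_def min_def)
  have lower: "ln (norm (1 - cis (\<phi> - \<theta>))) + ln t / 2 \<le> ln (norm (1 - of_real t * cis (\<phi> - \<theta>)))"
    by (rule ln_norm_one_minus_lower[OF t(3) ne])
  have lower0: "ln (norm (1 - cis (\<phi> - \<theta>))) + ln \<rho> / 2 \<le> ln (norm (1 - of_real \<rho> * cis (\<phi> - \<theta>)))"
    by (rule ln_norm_one_minus_lower[OF \<rho>(1) ne])
  have upper: "ln (norm (1 - of_real t * cis (\<phi> - \<theta>))) - ln t / 2 \<le> ln (norm (1 - of_real \<rho> * cis (\<phi> - \<theta>))) - ln \<rho> / 2"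
    using t \<rho> ne by (intro ln_norm_one_minus_antimono) auto
  have lt: "ln \<rho> \<le> ln t" "ln t \<le> 0" using t \<rho> by (auto intro: ln_mono)
  have M1: "ln (1 - \<kappa>) \<le> ln M" using r \<kappa> by (intro ln_mono) (auto simp: M_def)
  have "(1 + \<kappa>) * (1 - \<kappa>) \<le> 1" by (simp add: algebra_simps)
  then have "ln (1 + \<kappa>) \<le> ln (1 / (1 - \<kappa>))" using \<kappa> by (intro ln_mono) (auto simp: field_simps)
  moreover have "ln M \<le> ln (1 + \<kappa>)" using r s pos by (intro ln_mono) (auto simp: M_def)
  ultimately have M2: "ln M \<le> - ln (1 - \<kappa>)" using \<kappa> by (simp add: ln_div)
  have nz: "norm (1 - of_real t * cis (\<phi> - \<theta>)) > 0"
  proof -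
    have "0 < t * (norm (1 - cis (\<phi> - \<theta>)))\<^sup>2" using t ne by simp
    also have "\<dots> \<le> (norm (1 - of_real t * cis (\<phi> - \<theta>)))\<^sup>2" unfolding norm_one_minus_cis by simp
    finally show ?thesis by (metis less_irrefl norm_ge_zero order_less_le power_zero_numeral)
  qed
  have "ln (norm (of_real r * cis \<theta> - of_real s * cis \<phi>)) = ln M + ln (norm (1 - of_real t * cis (\<phi> - \<theta>)))"
    unfolding n using pos nz by (simp add: ln_mult)
  then show ?thesis
    unfolding log_error_def \<rho>_def[symmetric] using lower lower0 upper lt M1 M2 by (auto simp: abs_le_iff)
qed

section \<open>Ellipses\<close>

lemma emeasure_complex_ball:
  "r \<ge> 0 \<Longrightarrow> emeasure lborel (ball (c::complex) r) = ennreal (pi * r\<^sup>2)"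
  using emeasure_ball[of r c] by (simp add: unit_ball_vol_2)

lemma measure_complex_ball:
  "r \<ge> 0 \<Longrightarrow> measure lborel (ball (c::complex) r) = pi * r\<^sup>2"
  by (simp add: measure_def emeasure_complex_ball)

lemma integral_rad:
  fixes f :: "real \<Rightarrow> 'a :: {banach, second_countable_topology}"
  assumes [measurable]: "f \<in> borel_measurable borel"
  shows "(LINT r|rad. f r) = (LINT r|lborel. (indicator {0..} r * r) *\<^sub>R f r)"
    and "integrable rad f \<longleftrightarrow> integrable lborel (\<lambda>r. (indicator {0..} r * r) *\<^sub>R f r)"
proof -
  have eq: "rad = density lborel (\<lambda>r. ennreal (indicator {0..} r * r))"
    unfolding rad_def by (intro arg_cong[where f="density lborel"] ext) (auto simp: indicator_def ennreal_neg)
  show "(LINT r|rad. f r) = (LINT r|lborel. (indicator {0..} r * r) *\<^sub>R f r)"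
    unfolding eq by (subst integral_density) (auto simp: indicator_def)
  show "integrable rad f \<longleftrightarrow> integrable lborel (\<lambda>r. (indicator {0..} r * r) *\<^sub>R f r)"
    unfolding eq by (subst integrable_density) (auto simp: indicator_def)
qed

lemma integral_rad_interval:
  fixes c :: "'a :: {banach, second_countable_topology}"
  assumes "0 \<le> a" "a \<le> b"
  shows "has_bochner_integral rad (\<lambda>r. indicat_real {a<..<b} r *\<^sub>R c) (((b\<^sup>2 - a\<^sup>2) / 2) *\<^sub>R c)"
proof -
  have "has_bochner_integral lborel (\<lambda>r. r * indicat_real {a..b} r) (b\<^sup>2 / 2 - a\<^sup>2 / 2)"
    using assms by (intro has_bochner_integral_FTC_Icc_real) (auto intro!: derivative_eq_intros)
  moreover have "AE r in lborel. r * indicat_real {a..b} r = indicator {0..} r * r * indicat_real {a<..<b} r"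
    using AE_lborel_singleton[of a] AE_lborel_singleton[of b]
    by eventually_elim (use assms in \<open>auto simp: indicator_def\<close>)
  ultimately have "has_bochner_integral lborel (\<lambda>r. indicator {0..} r * r * indicat_real {a<..<b} r) (b\<^sup>2 / 2 - a\<^sup>2 / 2)"
    by (subst (asm) has_bochner_integral_cong_AE) auto
  then have "has_bochner_integral lborel (\<lambda>r. (indicator {0..} r * r * indicat_real {a<..<b} r) *\<^sub>R c) ((b\<^sup>2 / 2 - a\<^sup>2 / 2) *\<^sub>R c)"
    by (rule has_bochner_integral_scaleR_left)
  then show ?thesis
    using integral_rad[of "\<lambda>r. indicat_real {a<..<b} r *\<^sub>R c"]
    unfolding has_bochner_integral_iff by (simp add: diff_divide_distrib)
qed

text \<open>By 2 cos^2 \<phi> = 1 + cos 2\<phi>, and because 2\<phi> runs once through the circle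
  while \<phi> runs through the directions with positive cosine.\<close>

lemma integral_half_circle:
  fixes f :: "real \<Rightarrow> 'a :: {banach, second_countable_topology}"
  assumes [measurable]: "f \<in> borel_measurable borel"
  shows "(LINT \<phi>|circ. (if cos \<phi> > 0 then 2 * (cos \<phi>)\<^sup>2 else 0) *\<^sub>R f (2 * \<phi>)) =
    (1 / 2) *\<^sub>R (LINT t|circ. (1 + cos t) *\<^sub>R f t)"
proof -
  have c2: "1 + cos (2 * \<phi>) = 2 * (cos \<phi>)\<^sup>2" for \<phi> :: real
    by (simp add: cos_double_cos)
  have "(LINT \<phi>|circ. (if cos \<phi> > 0 then 2 * (cos \<phi>)\<^sup>2 else 0) *\<^sub>R f (2 * \<phi>)) =
    (LINT \<phi>|lborel. indicator {-pi..pi} \<phi> *\<^sub>R (if cos \<phi> > 0 then 2 * (cos \<phi>)\<^sup>2 else 0) *\<^sub>R f (2 * \<phi>))"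
    by (rule integral_circ) measurable
  also have "\<dots> = (LINT \<phi>|lborel. indicator {-pi..pi} (2 * \<phi>) *\<^sub>R (1 + cos (2 * \<phi>)) *\<^sub>R f (2 * \<phi>))"
  proof (rule Bochner_Integration.integral_cong[OF refl])
    fix \<phi> :: real
    consider "\<bar>\<phi>\<bar> < pi/2" | "\<bar>\<phi>\<bar> = pi/2" | "pi/2 < \<bar>\<phi>\<bar>" "\<bar>\<phi>\<bar> \<le> pi" | "\<bar>\<phi>\<bar> > pi" by linarith
    then show "indicator {-pi..pi} \<phi> *\<^sub>R (if cos \<phi> > 0 then 2 * (cos \<phi>)\<^sup>2 else 0) *\<^sub>R f (2 * \<phi>)
       = indicator {-pi..pi} (2 * \<phi>) *\<^sub>R (1 + cos (2 * \<phi>)) *\<^sub>R f (2 * \<phi>)"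
    proof cases
      case 1
      then have "cos \<phi> > 0" using cos_gt_zero_pi[of \<phi>] by auto
      moreover have "\<phi> \<in> {-pi..pi}" "2 * \<phi> \<in> {-pi..pi}" using 1 by auto
      ultimately show ?thesis by (simp add: c2)
    next
      case 2
      have "cos \<bar>\<phi>\<bar> = 0" by (simp only: 2 cos_pi_half)
      then have "cos \<phi> = 0" by simp
      then show ?thesis by (simp add: c2)
    next
      case 3
      have "cos \<bar>\<phi>\<bar> \<le> cos (pi/2)" using 3 by (intro cos_monotone_0_pi_le) auto
      then have "\<not> cos \<phi> > 0" by simp
      then show ?thesis using 3 by (auto simp: indicator_def)
    next
      case 4
      then show ?thesis by (auto simp: indicator_def)
    qed
  qed
  also have "\<dots> = (1 / 2) *\<^sub>R (LINT t|lborel. indicator {-pi..pi} t *\<^sub>R (1 + cos t) *\<^sub>R f t)"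
    by (subst lborel_integral_real_affine[of 2 "\<lambda>t. indicator {-pi..pi} t *\<^sub>R (1 + cos t) *\<^sub>R f t" 0]) auto
  also have "(LINT t|lborel. indicator {-pi..pi} t *\<^sub>R (1 + cos t) *\<^sub>R f t) = (LINT t|circ. (1 + cos t) *\<^sub>R f t)"
    by (rule integral_circ[symmetric]) measurable
  finally show ?thesis .
qed

text \<open>In polar coordinates centred at a boundary point \<open>\<zeta>\<close>, the unit disk is \<open>{0 < r < 2 cos \<phi>}\<close>.
  So the integral over the disk of a function of the direction of \<open>\<zeta> - w\<close> is an integral
  over the circle against \<open>1 + cos t\<close>, which sees only the first two Fourier modes.\<close>

text \<open>In polar coordinates centred at the boundary point \<open>\<zeta>\<close> the unit disk is
  \<open>{r < 2 cos \<phi>}\<close>.\<close>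

lemma integral_ball_boundary_polar:
  fixes F :: "complex \<Rightarrow> 'a :: {banach, second_countable_topology}"
  assumes [measurable]: "F \<in> borel_measurable borel" "h \<in> borel_measurable borel"
    and \<zeta>: "norm \<zeta> = 1" and B: "\<And>z. norm (F z) \<le> B"
    and F: "\<And>r \<phi>. r > 0 \<Longrightarrow> F (\<zeta> * (of_real r * cis \<phi>)) = h (2 * \<phi>)"
  shows "(LINT w|lborel. indicat_real (ball 0 1) w *\<^sub>R F (\<zeta> - w)) = (1 / 2) *\<^sub>R (LINT t|circ. (1 + cos t) *\<^sub>R h t)"
proof -
  have [measurable]: "ball (0::complex) 1 \<in> sets borel" by simp
  have i: "integrable lborel (\<lambda>w. indicat_real (ball 0 1) w *\<^sub>R F (\<zeta> - w))"
    using B by (intro integrable_bounded_mult_indicator[of _ _ B]) auto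
  have "(LINT w|lborel. indicat_real (ball 0 1) w *\<^sub>R F (\<zeta> - w)) =
      (LINT w|lborel. indicat_real (ball 0 1) (\<zeta> + (-\<zeta>) * w) *\<^sub>R F (\<zeta> - (\<zeta> + (-\<zeta>) * w)))"
    using \<zeta> by (intro integral_rotate(1)[symmetric, where f="\<lambda>w. indicat_real (ball 0 1) w *\<^sub>R F (\<zeta> - w)"]) auto
  also have "\<dots> = (LINT \<phi>|circ. LINT r|rad. indicat_real (ball 0 1) (\<zeta> + (-\<zeta>) * (of_real r * cis \<phi>)) *\<^sub>R
      F (\<zeta> - (\<zeta> + (-\<zeta>) * (of_real r * cis \<phi>))))"
  proof (rule integral_polar)
    show "integrable lborel (\<lambda>w. indicat_real (ball 0 1) (\<zeta> + (-\<zeta>) * w) *\<^sub>R F (\<zeta> - (\<zeta> + (-\<zeta>) * w)))"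
      using \<zeta> i by (subst integral_rotate(2)[where f="\<lambda>w. indicat_real (ball 0 1) w *\<^sub>R F (\<zeta> - w)"]) auto
  qed
  also have "\<dots> = (LINT \<phi>|circ. (if cos \<phi> > 0 then 2 * (cos \<phi>)\<^sup>2 else 0) *\<^sub>R h (2 * \<phi>))"
  proof (rule Bochner_Integration.integral_cong[OF refl])
    fix \<phi> :: real
    define b where "b = (if cos \<phi> > 0 then 2 * cos \<phi> else 0)"
    have b: "0 \<le> b" by (simp add: b_def)
    have ind: "\<zeta> + (-\<zeta>) * (of_real r * cis \<phi>) \<in> ball 0 1 \<longleftrightarrow> r < 2 * cos \<phi>" if "r > 0" for r
    proof -
      have "\<zeta> + (-\<zeta>) * (of_real r * cis \<phi>) = \<zeta> * (1 - of_real r * cis \<phi>)" by (simp add: algebra_simps)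
      then have "\<zeta> + (-\<zeta>) * (of_real r * cis \<phi>) \<in> ball 0 1 \<longleftrightarrow> norm (1 - of_real r * cis \<phi>) < 1"
        using \<zeta> by (simp add: norm_mult)
      also have "\<dots> \<longleftrightarrow> (norm (1 - of_real r * cis \<phi>))\<^sup>2 < 1"
        by (simp add: power_less_one_iff abs_square_less_1)
      also have "(norm (1 - of_real r * cis \<phi>))\<^sup>2 = 1 - 2 * r * cos \<phi> + r\<^sup>2 * ((sin \<phi>)\<^sup>2 + (cos \<phi>)\<^sup>2)"
        unfolding cmod_power2 by (simp add: power2_eq_square algebra_simps del: sin_cos_squared_add3)
      also have "\<dots> = 1 + r * (r - 2 * cos \<phi>)" by (simp add: power2_eq_square algebra_simps)
      also have "\<dots> < 1 \<longleftrightarrow> r < 2 * cos \<phi>" using that by (simp add: mult_less_0_iff)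
      finally show ?thesis .
    qed
    have "(LINT r|rad. indicat_real (ball 0 1) (\<zeta> + (-\<zeta>) * (of_real r * cis \<phi>)) *\<^sub>R F (\<zeta> - (\<zeta> + (-\<zeta>) * (of_real r * cis \<phi>))))
       = (LINT r|rad. indicat_real {0<..<b} r *\<^sub>R h (2 * \<phi>))"
    proof (rule integral_cong_AE)
      show "AE r in rad. indicat_real (ball 0 1) (\<zeta> + (-\<zeta>) * (of_real r * cis \<phi>)) *\<^sub>R F (\<zeta> - (\<zeta> + (-\<zeta>) * (of_real r * cis \<phi>)))
        = indicat_real {0<..<b} r *\<^sub>R h (2 * \<phi>)"
        unfolding rad_def
      proof (subst AE_density, simp, rule AE_I2, rule impI)
        fix r :: real assume "0 < ennreal r"
        then have r: "r > 0" by (simp add: ennreal_less_zero_iff)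
        have "r \<in> {0<..<b} \<longleftrightarrow> r < 2 * cos \<phi>" using r by (auto simp: b_def)
        moreover have "\<zeta> - (\<zeta> + (-\<zeta>) * (of_real r * cis \<phi>)) = \<zeta> * (of_real r * cis \<phi>)" by simp
        ultimately show "indicat_real (ball 0 1) (\<zeta> + (-\<zeta>) * (of_real r * cis \<phi>)) *\<^sub>R F (\<zeta> - (\<zeta> + (-\<zeta>) * (of_real r * cis \<phi>)))
          = indicat_real {0<..<b} r *\<^sub>R h (2 * \<phi>)"
          using ind[OF r] F[OF r, of \<phi>] unfolding indicator_def by (simp only:)
      qed
    qed measurable
    also have "\<dots> = ((b\<^sup>2 - 0\<^sup>2) / 2) *\<^sub>R h (2 * \<phi>)"
      using integral_rad_interval[OF order_refl b] by (rule has_bochner_integral_integral_eq)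
    also have "(b\<^sup>2 - 0\<^sup>2) / 2 = (if cos \<phi> > 0 then 2 * (cos \<phi>)\<^sup>2 else 0)"
      by (simp add: b_def power2_eq_square)
    finally show "(LINT r|rad. indicat_real (ball 0 1) (\<zeta> + (-\<zeta>) * (of_real r * cis \<phi>)) *\<^sub>R
      F (\<zeta> - (\<zeta> + (-\<zeta>) * (of_real r * cis \<phi>)))) = (if cos \<phi> > 0 then 2 * (cos \<phi>)\<^sup>2 else 0) *\<^sub>R h (2 * \<phi>)" .
  qed
  also have "\<dots> = (1 / 2) *\<^sub>R (LINT t|circ. (1 + cos t) *\<^sub>R h t)"
    by (rule integral_half_circle) simp
  finally show ?thesis .
qed

section \<open>The kernel z / cnj z integrated over the unit disk\<close>

lemma cis_over_cnj:
  assumes "r > 0"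
  shows "(of_real r * cis \<phi>) / cnj (of_real r * cis \<phi>) = cis (2 * \<phi>)"
proof -
  have "cis (2 * \<phi>) * cis (- \<phi>) = cis \<phi>" by (simp add: cis_mult)
  then have "cis \<phi> / cis (- \<phi>) = cis (2 * \<phi>)" by (simp add: divide_eq_eq)
  then show ?thesis using assms by (simp add: cis_cnj)
qed

lemma integral_circ_cis_cos: "(LINT t|circ. (1 + cos t) *\<^sub>R cis t) = of_real pi"
proof -
  have e: "(1 + cos t) *\<^sub>R cis t = cis (of_int 1 * t) + 1/2 * cis (of_int 2 * t) + 1/2 * cis (of_int 0 * t)" for t
  proof -
    have "of_real (cos t) = (cis t + cis (- t)) / 2" by (simp add: complex_eq_iff)
    then have "of_real (cos t) * cis t = (cis t * cis t + cis (- t) * cis t) / 2"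
      by (simp only: distrib_right times_divide_eq_left)
    then show ?thesis by (simp add: scaleR_conv_of_real distrib_right cis_mult add_divide_distrib)
  qed
  have i: "integrable circ (\<lambda>t. c * cis (of_int j * t))" for c :: complex and j :: int
    by (rule integrable_circ_bounded[of _ "norm c"]) (auto simp: norm_mult)
  have i1: "integrable circ (\<lambda>t. cis (of_int j * t))" for j :: int
    using i[of 1 j] by simp
  have "(LINT t|circ. (1 + cos t) *\<^sub>R cis t) =
    (LINT t|circ. cis (of_int 1 * t)) + 1/2 * (LINT t|circ. cis (of_int 2 * t)) + 1/2 * (LINT t|circ. cis (of_int 0 * t))"
    unfolding e by (simp only: Bochner_Integration.integral_add Bochner_Integration.integrable_add i i1 integral_mult_right_zero)
  then show ?thesis by (simp only: integral_circ_cis) simp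
qed

text \<open>Antisymmetrising \<open>z / cnj (z - w)\<close>, the first moment of the velocity kernel, gives half of
  this kernel at \<open>z - w\<close>.\<close>

definition kratio :: "complex \<Rightarrow> complex" where "kratio z = z / cnj z"

lemma measurable_kratio [measurable]: "kratio \<in> borel_measurable borel"
  unfolding kratio_def by measurable

lemma norm_kratio_le: "norm (kratio z) \<le> 1"
  by (cases "z = 0") (auto simp: kratio_def norm_divide)

text \<open>Seen from \<zeta> the kernel is \<zeta>^2 cis (2\<phi>), independent of the distance.
  The weight 1 + cos t picks out its first mode.\<close>

lemma integral_ball_kratio:
  assumes "norm \<zeta> = 1"
  shows "(LINT w|lborel. indicat_real (ball 0 1) w *\<^sub>R kratio (\<zeta> - w)) = (pi / 2) *\<^sub>R \<zeta>\<^sup>2"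
proof -
  have z: "cnj \<zeta> = inverse \<zeta>" using assms
    by (metis complex_norm_square inverse_unique mult.commute of_real_1 power_one)
  have "\<zeta> \<noteq> 0" using assms by auto
  have "(LINT w|lborel. indicat_real (ball 0 1) w *\<^sub>R kratio (\<zeta> - w)) = (1 / 2) *\<^sub>R (LINT t|circ. (1 + cos t) *\<^sub>R (\<zeta>\<^sup>2 * cis t))"
  proof (rule integral_ball_boundary_polar[OF _ _ assms norm_kratio_le])
    fix r \<phi> :: real assume r: "r > 0"
    have "kratio (\<zeta> * (of_real r * cis \<phi>)) = (\<zeta> / cnj \<zeta>) * ((of_real r * cis \<phi>) / cnj (of_real r * cis \<phi>))"
      unfolding kratio_def complex_cnj_mult[of \<zeta>] by (simp only: times_divide_times_eq)
    also have "\<dots> = \<zeta>\<^sup>2 * cis (2 * \<phi>)"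
      unfolding cis_over_cnj[OF r] z by (simp add: power2_eq_square divide_inverse)
    finally show "kratio (\<zeta> * (of_real r * cis \<phi>)) = \<zeta>\<^sup>2 * cis (2 * \<phi>)" .
  qed measurable
  also have "(LINT t|circ. (1 + cos t) *\<^sub>R (\<zeta>\<^sup>2 * cis t)) = \<zeta>\<^sup>2 * (LINT t|circ. (1 + cos t) *\<^sub>R cis t)"
    by (simp only: mult_scaleR_right[symmetric] integral_mult_right_zero)
  finally show ?thesis unfolding integral_circ_cis_cos by (simp add: scaleR_conv_of_real)
qed

lemma norm_kratio_diff_le:
  assumes "a \<noteq> 0" "b \<noteq> 0"
  shows "norm (kratio a - kratio b) \<le> 2 * norm (a - b) * (1 / norm a)"
proof -
  have "kratio a - kratio b = ((a - b) * cnj b - b * cnj (a - b)) / (cnj a * cnj b)"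
    using assms by (simp add: kratio_def field_simps)
  then have "norm (kratio a - kratio b) = norm ((a - b) * cnj b - b * cnj (a - b)) / (norm a * norm b)"
    by (simp only: norm_divide norm_mult complex_mod_cnj)
  also have "\<dots> \<le> (norm ((a - b) * cnj b) + norm (b * cnj (a - b))) / (norm a * norm b)"
    by (intro divide_right_mono norm_triangle_ineq4) auto
  also have "norm ((a - b) * cnj b) + norm (b * cnj (a - b)) = 2 * norm (a - b) * norm b"
    by (simp only: norm_mult complex_mod_cnj) simp
  also have "2 * norm (a - b) * norm b / (norm a * norm b) = 2 * norm (a - b) * (1 / norm a)"
    using assms by simp
  finally show ?thesis .
qed

lemma ball_kratio_lipschitz:
  "norm ((LINT w|lborel. indicat_real (ball 0 1) w *\<^sub>R kratio (x - w)) - (LINT w|lborel. indicat_real (ball 0 1) w *\<^sub>R kratio (x' - w)))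
    \<le> 2 * norm (x - x') * ((2 * pi + 1) * sqrt pi)"
proof -
  have [measurable]: "ball (0::complex) 1 \<in> sets borel" by simp
  have m: "emeasure lborel (ball (0::complex) 1) \<le> ennreal pi" by (simp add: emeasure_complex_ball)
  have i: "integrable lborel (\<lambda>w. indicat_real (ball 0 1) w *\<^sub>R kratio (x - w))" for x
    by (intro integrable_bounded_mult_indicator[of _ _ 1]) (auto simp: norm_kratio_le)
  have ii: "integrable lborel (\<lambda>w. 1 / norm (x - w) * indicat_real (ball 0 1) w)"
    by (rule integrable_inverse_norm[OF _ m]) auto
  have "norm ((LINT w|lborel. indicat_real (ball 0 1) w *\<^sub>R kratio (x - w)) - (LINT w|lborel. indicat_real (ball 0 1) w *\<^sub>R kratio (x' - w)))
     = norm (LINT w|lborel. indicat_real (ball 0 1) w *\<^sub>R kratio (x - w) - indicat_real (ball 0 1) w *\<^sub>R kratio (x' - w))"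
    by (simp only: Bochner_Integration.integral_diff[OF i i])
  also have "\<dots> \<le> (LINT w|lborel. 2 * norm (x - x') * (1 / norm (x - w) * indicat_real (ball 0 1) w))"
  proof (rule integral_norm_bound[THEN order_trans], rule integral_mono_AE)
    show "AE w in lborel. norm (indicat_real (ball 0 1) w *\<^sub>R kratio (x - w) - indicat_real (ball 0 1) w *\<^sub>R kratio (x' - w))
        \<le> 2 * norm (x - x') * (1 / norm (x - w) * indicat_real (ball 0 1) w)"
      using AE_lborel_singleton[of x] AE_lborel_singleton[of x']
    proof eventually_elim
      case (elim w)
      then show ?case using norm_kratio_diff_le[of "x - w" "x' - w"] by (cases "w \<in> ball 0 1") auto
    qed
  qed ((intro integrable_norm Bochner_Integration.integrable_diff i)[1], (intro integrable_mult_right ii)[1])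
  also have "\<dots> = 2 * norm (x - x') * (LINT w|lborel. 1 / norm (x - w) * indicat_real (ball 0 1) w)"
    by (simp only: integral_mult_right_zero)
  also have "\<dots> \<le> 2 * norm (x - x') * ((2 * pi + 1) * sqrt pi)"
    by (intro mult_left_mono integral_inverse_norm_le[OF _ m]) auto
  finally show ?thesis .
qed

text \<open>Moves the exact value on the circle radially by at most \<kappa>: 36 \<kappa> for the
  Lipschitz dependence of the integral and 5 \<kappa> for the change of x^2.\<close>

lemma ball_kratio_near_circle:
  assumes \<kappa>: "0 \<le> \<kappa>" "\<kappa> \<le> 1/2" and x: "1 - \<kappa> \<le> norm x" "norm x \<le> 1 + \<kappa>"
  shows "norm ((LINT w|lborel. indicat_real (ball 0 1) w *\<^sub>R kratio (x - w)) - (pi / 2) *\<^sub>R x\<^sup>2) \<le> 41 * \<kappa>"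
proof -
  define \<zeta> where "\<zeta> = x / norm x"
  have "x \<noteq> 0" using x \<kappa> by auto
  then have \<zeta>: "norm \<zeta> = 1" by (simp add: \<zeta>_def norm_divide)
  have "x - \<zeta> = (of_real (norm x) - 1) * \<zeta>" using \<open>x \<noteq> 0\<close> by (simp add: \<zeta>_def field_simps)
  then have "x - \<zeta> = of_real (norm x - 1) * \<zeta>" by simp
  then have "norm (x - \<zeta>) = \<bar>norm x - 1\<bar>" using \<zeta> by (simp only: norm_mult norm_of_real mult_1_right)
  then have d: "norm (x - \<zeta>) \<le> \<kappa>" using x by linarith
  have s: "norm (x + \<zeta>) \<le> 5/2" using norm_triangle_ineq[of x \<zeta>] x \<kappa> \<zeta> by linarith
  have "sqrt pi \<le> 2" using pi_less_4 by (intro real_le_lsqrt) auto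
  then have "(2 * pi + 1) * sqrt pi \<le> 9 * 2" using pi_less_4 by (intro mult_mono) auto
  from mult_mono[OF _ this, of "2 * norm (x - \<zeta>)" "2 * \<kappa>"]
  have "2 * norm (x - \<zeta>) * ((2 * pi + 1) * sqrt pi) \<le> 2 * \<kappa> * (9 * 2)"
    using d \<kappa> by simp
  then have 1: "norm ((LINT w|lborel. indicat_real (ball 0 1) w *\<^sub>R kratio (x - w)) - (pi / 2) *\<^sub>R \<zeta>\<^sup>2) \<le> 36 * \<kappa>"
    using order_trans[OF ball_kratio_lipschitz[of x \<zeta>]] unfolding integral_ball_kratio[OF \<zeta>] by simp
  have "x\<^sup>2 - \<zeta>\<^sup>2 = (x - \<zeta>) * (x + \<zeta>)" by (simp add: power2_eq_square algebra_simps)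
  then have "norm (\<zeta>\<^sup>2 - x\<^sup>2) = norm (x - \<zeta>) * norm (x + \<zeta>)" by (metis norm_minus_commute norm_mult)
  also have "\<dots> \<le> \<kappa> * (5/2)" using mult_mono[OF d s \<kappa>(1)] by simp
  finally have "norm (\<zeta>\<^sup>2 - x\<^sup>2) \<le> \<kappa> * (5/2)" .
  then have "norm ((pi / 2) *\<^sub>R \<zeta>\<^sup>2 - (pi / 2) *\<^sub>R x\<^sup>2) \<le> pi / 2 * (\<kappa> * (5/2))"
    by (simp flip: scaleR_diff_right)
  also have "pi / 2 * (\<kappa> * (5/2)) \<le> 4 / 2 * (\<kappa> * (5/2))"
    using pi_less_4 \<kappa> by (intro mult_right_mono divide_right_mono) auto
  finally have 2: "norm ((pi / 2) *\<^sub>R \<zeta>\<^sup>2 - (pi / 2) *\<^sub>R x\<^sup>2) \<le> 5 * \<kappa>" by simp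
  show ?thesis using norm_triangle_le[OF add_mono[OF 1 2]] by simp
qed

section \<open>The potential of an ellipse on its boundary\<close>

lemma ball_log_rotate:
  fixes \<zeta> :: complex
  assumes "norm \<zeta> = 1"
  shows "(LINT w|lborel. ln (norm (\<zeta> - w)) * indicat_real (ball 0 1) w) = (LINT w|lborel. ln (norm (1 - w)) * indicat_real (ball (0::complex) 1) w)"
proof -
  have [measurable]: "ball (0::complex) 1 \<in> sets borel" by simp
  have "norm (\<zeta> - \<zeta> * w) = norm (1 - w)" for w
    using assms by (metis mult.right_neutral mult_cancel_right1 norm_mult right_diff_distrib)
  then have "(LINT w|lborel. ln (norm (1 - w)) * indicat_real (ball (0::complex) 1) w) =
     (LINT w|lborel. ln (norm (\<zeta> - (0 + \<zeta> * w))) * indicat_real (ball 0 1) (0 + \<zeta> * w))"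
    using assms by (intro Bochner_Integration.integral_cong) (auto simp: indicator_def norm_mult)
  also have "\<dots> = (LINT w|lborel. ln (norm (\<zeta> - w)) * indicat_real (ball 0 1) w)"
    using assms by (intro integral_rotate(1)) auto
  finally show ?thesis by simp
qed

text \<open>With \<eta> = \<zeta> - w, the modulus of \<alpha> \<eta> + \<beta> cnj \<eta> factors
  into |\<eta>| and a function of the direction of \<eta>. The logarithm of the first is independent
  of \<zeta>; the second is integrated in polar coordinates around \<zeta>, where only the mean and
  the first mode count.\<close>

lemma ball_log_linear:
  assumes \<zeta>: "norm \<zeta> = 1" and \<alpha>: "\<alpha> > 0" and \<beta>: "norm \<beta> < \<alpha>"
  shows "(LINT w|lborel. ln (norm (of_real \<alpha> * (\<zeta> - w) + \<beta> * cnj (\<zeta> - w))) * indicat_real (ball 0 1) w) =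
    (LINT w|lborel. ln (norm (1 - w)) * indicat_real (ball (0::complex) 1) w) + pi * ln \<alpha> + pi / 2 * (Re (\<beta> * cnj \<zeta> ^ 2) / \<alpha>)"
proof -
  have [measurable]: "ball (0::complex) 1 \<in> sets borel" by simp
  \<comment> \<open>The value 0 at the origin agrees with the convention \<open>ln 0 = 0\<close>, so
    that the splitting below holds without exception.\<close>
  define F where "F \<eta> = (if \<eta> = 0 then 0 else ln (norm (of_real \<alpha> + \<beta> * cnj (kratio \<eta>))))" for \<eta>
  define w where "w = - (cnj \<beta> * \<zeta>\<^sup>2 / of_real \<alpha>)"
  define h where "h t = ln \<alpha> + ln (norm (1 - w * cis t))" for t
  have w: "norm w < 1" using \<alpha> \<beta> \<zeta> by (simp add: w_def norm_divide norm_mult norm_power)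
  have Fm [measurable]: "F \<in> borel_measurable borel" unfolding F_def by measurable
  have [measurable]: "h \<in> borel_measurable borel" unfolding h_def by measurable
  have Fb: "norm (F \<eta>) \<le> \<bar>ln (\<alpha> - norm \<beta>)\<bar> + \<bar>ln (\<alpha> + norm \<beta>)\<bar>" for \<eta>
  proof (cases "\<eta> = 0")
    case False
    have le: "norm (\<beta> * cnj (kratio \<eta>)) \<le> norm \<beta>"
      using norm_kratio_le[of \<eta>] by (simp add: norm_mult mult_left_le)
    have u: "norm (of_real \<alpha> + \<beta> * cnj (kratio \<eta>)) \<le> \<alpha> + norm \<beta>"
      using norm_triangle_ineq[of "of_real \<alpha>" "\<beta> * cnj (kratio \<eta>)"] le \<alpha> by simp
    have l: "\<alpha> - norm \<beta> \<le> norm (of_real \<alpha> + \<beta> * cnj (kratio \<eta>))"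
      using norm_diff_ineq[of "of_real \<alpha>" "\<beta> * cnj (kratio \<eta>)"] le \<alpha> by simp
    have "ln (\<alpha> - norm \<beta>) \<le> ln (norm (of_real \<alpha> + \<beta> * cnj (kratio \<eta>)))"
      "ln (norm (of_real \<alpha> + \<beta> * cnj (kratio \<eta>))) \<le> ln (\<alpha> + norm \<beta>)"
      using u l \<beta> by (auto intro!: ln_mono)
    then show ?thesis using False by (simp add: F_def)
  qed (simp add: F_def)
  have hF: "F (\<zeta> * (of_real r * cis \<phi>)) = h (2 * \<phi>)" if r: "r > 0" for r \<phi> :: real
  proof -
    have nz: "\<zeta> * (of_real r * cis \<phi>) \<noteq> 0" using r \<zeta> by auto
    have z: "cnj \<zeta> = inverse \<zeta>" using \<zeta>
      by (metis complex_norm_square inverse_unique mult.commute of_real_1 power_one)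
    have "kratio (\<zeta> * (of_real r * cis \<phi>)) = (\<zeta> / cnj \<zeta>) * ((of_real r * cis \<phi>) / cnj (of_real r * cis \<phi>))"
      unfolding kratio_def complex_cnj_mult[of \<zeta>] by (simp only: times_divide_times_eq)
    also have "\<dots> = \<zeta>\<^sup>2 * cis (2 * \<phi>)"
      unfolding cis_over_cnj[OF r] z by (simp add: power2_eq_square divide_inverse)
    finally have k: "kratio (\<zeta> * (of_real r * cis \<phi>)) = \<zeta>\<^sup>2 * cis (2 * \<phi>)" .
    have "cnj (of_real \<alpha> + \<beta> * cnj (\<zeta>\<^sup>2 * cis (2 * \<phi>))) = of_real \<alpha> * (1 - w * cis (2 * \<phi>))"
      using \<alpha> by (simp add: w_def algebra_simps)
    then have "norm (of_real \<alpha> + \<beta> * cnj (\<zeta>\<^sup>2 * cis (2 * \<phi>))) = \<alpha> * norm (1 - w * cis (2 * \<phi>))"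
      using \<alpha> by (metis abs_of_pos complex_mod_cnj norm_mult norm_of_real)
    moreover have "norm (1 - w * cis (2 * \<phi>)) > 0"
    proof -
      have "1 - norm w \<le> norm (1 - w * cis (2 * \<phi>))"
        using norm_triangle_ineq2[of 1 "w * cis (2 * \<phi>)"] by (simp add: norm_mult)
      then show ?thesis using w by linarith
    qed
    ultimately show ?thesis
      unfolding F_def h_def k using nz \<alpha> by (simp add: ln_mult)
  qed
  have split: "ln (norm (of_real \<alpha> * \<eta> + \<beta> * cnj \<eta>)) = ln (norm \<eta>) + F \<eta>" for \<eta>
  proof (cases "\<eta> = 0")
    case False
    have "of_real \<alpha> * \<eta> + \<beta> * cnj \<eta> = \<eta> * (of_real \<alpha> + \<beta> * cnj (kratio \<eta>))"
      using False by (simp add: kratio_def field_simps)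
    moreover have "\<alpha> - norm \<beta> \<le> norm (of_real \<alpha> + \<beta> * cnj (kratio \<eta>))"
      using norm_diff_ineq[of "of_real \<alpha>" "\<beta> * cnj (kratio \<eta>)"] norm_kratio_le[of \<eta>] \<alpha>
        mult_left_le[OF norm_kratio_le[of \<eta>] norm_ge_zero[of \<beta>]] by (simp add: norm_mult)
    moreover from this have "norm (of_real \<alpha> + \<beta> * cnj (kratio \<eta>)) > 0" using \<beta> by linarith
    ultimately show ?thesis using False \<beta> by (simp add: F_def norm_mult ln_mult)
  qed (simp add: F_def)
  have iF: "integrable lborel (\<lambda>v. indicat_real (ball 0 1) v *\<^sub>R F (\<zeta> - v))"
    using Fb by (intro integrable_bounded_mult_indicator) auto
  have il: "integrable lborel (\<lambda>v. ln (norm (\<zeta> - v)) * indicat_real (ball 0 1) v)"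
    by (intro integrable_ln_norm) auto
  have "(LINT v|lborel. ln (norm (of_real \<alpha> * (\<zeta> - v) + \<beta> * cnj (\<zeta> - v))) * indicat_real (ball 0 1) v) =
    (LINT v|lborel. ln (norm (\<zeta> - v)) * indicat_real (ball 0 1) v + indicat_real (ball 0 1) v *\<^sub>R F (\<zeta> - v))"
    unfolding split by (simp add: algebra_simps)
  also have "\<dots> = (LINT v|lborel. ln (norm (\<zeta> - v)) * indicat_real (ball 0 1) v) + (LINT v|lborel. indicat_real (ball 0 1) v *\<^sub>R F (\<zeta> - v))"
    by (rule Bochner_Integration.integral_add[OF il iF])
  also have "(LINT v|lborel. indicat_real (ball 0 1) v *\<^sub>R F (\<zeta> - v)) = (1 / 2) *\<^sub>R (LINT t|circ. (1 + cos t) *\<^sub>R h t)"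
    by (rule integral_ball_boundary_polar[OF Fm _ \<zeta> Fb hF]) auto
  also have "(LINT t|circ. (1 + cos t) *\<^sub>R h t) = 2 * pi * ln \<alpha> - pi * Re w"
  proof -
    have e: "(1 + cos t) *\<^sub>R h t = ln \<alpha> * (1 + cos t) + ln (norm (1 - w * cis t)) + ln (norm (1 - w * cis t)) * cos t" for t
      by (simp add: h_def algebra_simps)
    have ic: "integrable circ cos" by (rule integrable_circ_bounded[of _ 1]) auto
    have c0: "(LINT t|circ. cos t) = 0"
      using integral_circ_FTC[of sin cos, OF _ continuous_on_cos[OF continuous_on_id]]
      by (simp add: has_real_derivative_iff_has_vector_derivative[symmetric])
    have ii: "integrable circ (\<lambda>t. ln (norm (1 - w * cis t)) * cos t)"
    proof (rule integrable_circ_bounded[of _ "- ln (1 - norm w)"])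
      fix t
      have "\<bar>ln (norm (1 - w * cis t))\<bar> * \<bar>cos t\<bar> \<le> - ln (1 - norm w) * 1"
        using abs_ln_norm_one_minus_le[of "w * cis t"] w abs_cos_le_one[of t] by (intro mult_mono) (auto simp: norm_mult)
      then show "norm (ln (norm (1 - w * cis t)) * cos t) \<le> - ln (1 - norm w)" by (simp add: abs_mult)
    qed measurable
    show ?thesis
      unfolding e using ic ii log_kernel_mean[OF w] by (simp add: c0 log_kernel_cos[OF w] measure_circ)
  qed
  also have "Re w = - (Re (\<beta> * cnj \<zeta> ^ 2) / \<alpha>)"
  proof -
    have "w = - (cnj (\<beta> * cnj \<zeta> ^ 2) / of_real \<alpha>)" by (simp add: w_def)
    moreover have "Re (- (cnj q / of_real \<alpha>)) = - (Re q / \<alpha>)" for q by (simp add: Re_divide_of_real)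
    ultimately show ?thesis by (simp only:)
  qed
  finally have "(LINT v|lborel. ln (norm (of_real \<alpha> * (\<zeta> - v) + \<beta> * cnj (\<zeta> - v))) * indicat_real (ball 0 1) v) =
    (LINT w|lborel. ln (norm (1 - w)) * indicat_real (ball (0::complex) 1) w)
      + (1 / 2) *\<^sub>R (2 * pi * ln \<alpha> - pi * - (Re (\<beta> * cnj \<zeta> ^ 2) / \<alpha>))"
    unfolding ball_log_rotate[OF \<zeta>] .
  moreover have "x + (1 / 2) *\<^sub>R (2 * pi * l - pi * - q) = x + pi * l + pi / 2 * q" for x l q :: real
    by simp
  ultimately show ?thesis by (simp only:)
qed

text \<open>Every ellipse is the image of the unit disk under such a real linear map: \<alpha> and
  |\<beta>| are half the sum and half the difference of the semi-axes, and half of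
  \<open>Arg \<beta>\<close> is the inclination. In this form moments and potential are polynomial
  or rational in \<alpha> and \<beta>.\<close>

locale ellipse =
  fixes c :: complex and \<alpha> :: real and \<beta> :: complex
  assumes \<alpha>_pos: "\<alpha> > 0" and \<beta>_less: "norm \<beta> < \<alpha>"
begin

definition T :: "complex \<Rightarrow> complex" where "T w = c + (of_real \<alpha> * w + \<beta> * cnj w)"
definition E :: "complex set" where "E = T ` ball 0 1"
definition Dt :: real where "Dt = \<alpha>\<^sup>2 - (norm \<beta>)\<^sup>2"
text \<open>With the semi-axes \<open>a = \<alpha> + \<bar>\<beta>\<bar>\<close> and \<open>b = \<alpha> - \<bar>\<beta>\<bar>\<close> this is Kirchhoff's angular velocity
  \<open>a b / (a + b)\<^sup>2\<close>.\<close>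

definition \<Omega>E :: real where "\<Omega>E = Dt / (4 * \<alpha>\<^sup>2)"

lemma Dt_pos: "Dt > 0"
  using \<beta>_less by (simp add: Dt_def power_strict_mono)

lemma T_diff: "T w - T v = of_real \<alpha> * (w - v) + \<beta> * cnj (w - v)"
  by (simp add: T_def algebra_simps)

lemma norm_linear_ge: "(\<alpha> - norm \<beta>) * norm w \<le> norm (of_real \<alpha> * w + \<beta> * cnj w)"
  using norm_diff_ineq[of "of_real \<alpha> * w" "\<beta> * cnj w"] \<alpha>_pos by (simp add: norm_mult algebra_simps)

lemma norm_linear_le: "norm (of_real \<alpha> * w + \<beta> * cnj w) \<le> (\<alpha> + norm \<beta>) * norm w"
  using norm_triangle_ineq[of "of_real \<alpha> * w" "\<beta> * cnj w"] \<alpha>_pos by (simp add: norm_mult algebra_simps)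

lemma inj_T: "inj T"
proof (rule injI)
  fix w v assume "T w = T v"
  then have "(\<alpha> - norm \<beta>) * norm (w - v) \<le> 0"
    using norm_linear_ge[of "w - v"] T_diff[of w v] by simp
  then show "w = v" using \<beta>_less by (simp add: mult_le_0_iff)
qed

definition Tinv :: "complex \<Rightarrow> complex" where
  "Tinv z = (of_real \<alpha> * (z - c) - \<beta> * cnj (z - c)) / of_real Dt"

lemma T_Tinv: "T (Tinv z) = z"
proof -
  define u where "u = z - c"
  have D: "of_real Dt = of_real \<alpha> * of_real \<alpha> - \<beta> * cnj \<beta>"
    unfolding Dt_def of_real_diff complex_norm_square by (simp add: power2_eq_square)
  have "of_real \<alpha> * (of_real \<alpha> * u - \<beta> * cnj u) + \<beta> * cnj (of_real \<alpha> * u - \<beta> * cnj u) = of_real Dt * u"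
    by (simp add: D algebra_simps)
  then have "(of_real \<alpha> * (of_real \<alpha> * u - \<beta> * cnj u) + \<beta> * cnj (of_real \<alpha> * u - \<beta> * cnj u)) / of_real Dt = u"
    using Dt_pos by simp
  then show ?thesis unfolding T_def Tinv_def u_def[symmetric] by (simp add: u_def add_divide_distrib)
qed

lemma Tinv_T: "Tinv (T w) = w"
  using T_Tinv[of "T w"] inj_T by (auto dest: injD)

lemma mem_E_iff: "z \<in> E \<longleftrightarrow> norm (Tinv z) < 1"
  unfolding E_def using T_Tinv Tinv_T by (metis dist_0_norm image_iff mem_ball)

lemma continuous_T: "continuous_on A T" and continuous_Tinv: "continuous_on A Tinv"
  unfolding T_def Tinv_def using Dt_pos by (auto intro!: continuous_intros)

lemma open_E: "open E"
proof -
  have "E = {z. norm (Tinv z) < 1}" using mem_E_iff by auto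
  also have "open \<dots>"
    by (rule open_Collect_less) (intro continuous_intros continuous_Tinv)+
  finally show ?thesis .
qed

lemma measurable_E [measurable]: "E \<in> sets borel"
  using open_E by simp

lemma bounded_E: "bounded E"
proof -
  have "norm (T w) \<le> norm c + (\<alpha> + norm \<beta>)" if "w \<in> ball 0 1" for w
  proof -
    have "norm (T w) \<le> norm c + norm (of_real \<alpha> * w + \<beta> * cnj w)"
      unfolding T_def by (rule norm_triangle_ineq)
    also have "\<dots> \<le> norm c + (\<alpha> + norm \<beta>) * norm w"
      by (intro add_left_mono norm_linear_le)
    also have "\<dots> \<le> norm c + (\<alpha> + norm \<beta>) * 1"
      using that \<alpha>_pos by (intro add_left_mono mult_left_mono) auto
    finally show ?thesis by simp
  qed
  then show ?thesis unfolding E_def by (auto intro!: boundedI)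
qed

lemma cov:
  fixes f :: "complex \<Rightarrow> 'a :: {banach, second_countable_topology}"
  assumes "f \<in> borel_measurable borel"
  shows "(LINT z|lborel. indicat_real E z *\<^sub>R f z) = Dt *\<^sub>R (LINT w|lborel. indicat_real (ball 0 1) w *\<^sub>R f (T w))"
proof -
  have ind: "indicat_real E (T w) = indicat_real (ball 0 1) w" for w
    using Tinv_T by (simp add: indicator_def mem_E_iff)
  have "\<bar>Re \<beta>\<bar> < \<alpha>" using \<beta>_less abs_Re_le_cmod[of \<beta>] by linarith
  then have nz: "Re (of_real \<alpha> + \<beta>) \<noteq> 0" by auto
  have "(LINT z|lborel. indicat_real E z *\<^sub>R f z) =
      ((norm (of_real \<alpha> :: complex))\<^sup>2 - (norm \<beta>)\<^sup>2) *\<^sub>R (LINT w|lborel. indicat_real E (T w) *\<^sub>R f (T w))"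
    unfolding T_def using \<alpha>_pos \<beta>_less assms nz by (intro integral_linear(1)) auto
  then show ?thesis using \<alpha>_pos by (simp add: ind Dt_def)
qed

lemma pot_boundary:
  assumes "norm \<zeta> = 1"
  shows "pot E (T \<zeta>) = Dt / (2 * pi) * ((LINT w|lborel. ln (norm (1 - w)) * indicat_real (ball (0::complex) 1) w) + pi * ln \<alpha>)
     + Dt / 4 * (Re (\<beta> * cnj \<zeta> ^ 2) / \<alpha>)"
proof -
  have "(LINT y|lborel. ln (norm (T \<zeta> - y)) * indicat_real E y) =
      Dt * (LINT w|lborel. ln (norm (T \<zeta> - T w)) * indicat_real (ball 0 1) w)"
    using cov[of "\<lambda>y. ln (norm (T \<zeta> - y))"] by (simp add: mult.commute)
  also have "\<dots> = Dt * ((LINT w|lborel. ln (norm (1 - w)) * indicat_real (ball (0::complex) 1) w) + pi * ln \<alpha> + pi / 2 * (Re (\<beta> * cnj \<zeta> ^ 2) / \<alpha>))"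
    unfolding T_diff ball_log_linear[OF assms \<alpha>_pos \<beta>_less] ..
  finally have e: "(LINT y|lborel. ln (norm (T \<zeta> - y)) * indicat_real E y) = \<dots>" .
  have "1 / (2 * pi) * (Dt * (x + pi * y + pi / 2 * z)) = Dt / (2 * pi) * (x + pi * y) + Dt / 4 * z" for x y z :: real
    by (simp add: field_simps)
  then show ?thesis unfolding inv_laplacian_def e by (simp only:)
qed

text \<open>On the boundary both the potential and |z - c|^2 vary only through Re (\<beta> cnj
  \<zeta>^2), with coefficients Dt / (4 \<alpha>) and 2 \<alpha>. The value of
  \<open>\<Omega>E\<close> is the one for which these variations cancel.\<close>

lemma steady:
  assumes "norm \<zeta> = 1"
  shows "pot E (T \<zeta>) - \<Omega>E / 2 * (norm (T \<zeta> - c))\<^sup>2 =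
     Dt / (2 * pi) * ((LINT w|lborel. ln (norm (1 - w)) * indicat_real (ball (0::complex) 1) w) + pi * ln \<alpha>) - \<Omega>E / 2 * (\<alpha>\<^sup>2 + (norm \<beta>)\<^sup>2)"
proof -
  have "of_real ((norm (T \<zeta> - c))\<^sup>2) = (of_real \<alpha> * \<zeta> + \<beta> * cnj \<zeta>) * cnj (of_real \<alpha> * \<zeta> + \<beta> * cnj \<zeta>)"
    unfolding T_def by (simp only: add_diff_cancel_left' complex_norm_square)
  also have "\<dots> = of_real \<alpha> * of_real \<alpha> * (\<zeta> * cnj \<zeta>) + \<beta> * cnj \<beta> * (\<zeta> * cnj \<zeta>)
     + of_real \<alpha> * (\<beta> * cnj \<zeta> ^ 2 + cnj (\<beta> * cnj \<zeta> ^ 2))"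
    by (simp add: algebra_simps power2_eq_square)
  also have "\<zeta> * cnj \<zeta> = 1" using assms by (metis complex_norm_square of_real_1 power_one)
  also have "\<beta> * cnj \<beta> = of_real ((norm \<beta>)\<^sup>2)" by (simp only: complex_norm_square)
  also have "\<beta> * cnj \<zeta> ^ 2 + cnj (\<beta> * cnj \<zeta> ^ 2) = of_real (2 * Re (\<beta> * cnj \<zeta> ^ 2))"
    by (rule complex_add_cnj)
  finally have "complex_of_real ((norm (T \<zeta> - c))\<^sup>2) = of_real (\<alpha>\<^sup>2 + (norm \<beta>)\<^sup>2 + \<alpha> * (2 * Re (\<beta> * cnj \<zeta> ^ 2)))"
    by (simp add: power2_eq_square)
  then have n: "(norm (T \<zeta> - c))\<^sup>2 = \<alpha>\<^sup>2 + (norm \<beta>)\<^sup>2 + \<alpha> * (2 * Re (\<beta> * cnj \<zeta> ^ 2))"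
    by (simp only: of_real_eq_iff)
  have "\<Omega>E / 2 * (\<alpha> * (2 * R)) = Dt / 4 * (R / \<alpha>)" for R
    using \<alpha>_pos by (simp add: \<Omega>E_def power2_eq_square)
  then have e: "\<Omega>E / 2 * (S + \<alpha> * (2 * R)) = \<Omega>E / 2 * S + Dt / 4 * (R / \<alpha>)" for S R
    by (simp only: distrib_left)
  have "k + p - (q + p) = k - q" for k p q :: real by simp
  then show ?thesis unfolding pot_boundary[OF assms] n e .
qed

end

section \<open>Moments and kernel integral of an ellipse\<close>

definition patch :: "complex set \<Rightarrow> complex measure" where
  "patch U = density lborel (indicator U)"

lemma sets_patch [simp, measurable_cong]: "sets (patch U) = sets borel"
  and space_patch [simp]: "space (patch U) = UNIV"
  by (auto simp: patch_def)

lemma integral_patch: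
  fixes f :: "complex \<Rightarrow> 'a :: {banach, second_countable_topology}"
  assumes [measurable]: "U \<in> sets borel" "f \<in> borel_measurable borel"
  shows "(LINT z|patch U. f z) = (LINT z|lborel. indicat_real U z *\<^sub>R f z)"
    and "integrable (patch U) f \<longleftrightarrow> integrable lborel (\<lambda>z. indicat_real U z *\<^sub>R f z)"
proof -
  have eq: "patch U = density lborel (\<lambda>z. ennreal (indicator U z))"
    unfolding patch_def by (simp add: ennreal_indicator)
  show "(LINT z|patch U. f z) = (LINT z|lborel. indicat_real U z *\<^sub>R f z)"
    unfolding eq by (subst integral_density) auto
  show "integrable (patch U) f \<longleftrightarrow> integrable lborel (\<lambda>z. indicat_real U z *\<^sub>R f z)"
    unfolding eq by (subst integrable_density) auto
qed

lemma finite_measure_patch: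
  assumes U: "bounded U" "U \<in> sets borel"
  shows "finite_measure (patch U)"
proof
  have "emeasure (patch U) UNIV = emeasure lborel U"
    using U by (simp add: patch_def emeasure_density)
  then show "emeasure (patch U) (space (patch U)) \<noteq> \<infinity>" using emeasure_bounded_le[OF U] by simp
qed

lemma measure_patch:
  assumes "U \<in> sets borel"
  shows "measure (patch U) UNIV = measure lborel U"
  using assms by (simp add: measure_def patch_def emeasure_density)

lemma AE_patch_I: "U \<in> sets borel \<Longrightarrow> AE z in lborel. P z \<Longrightarrow> AE z in patch U. P z"
  unfolding patch_def by (subst AE_density) auto

lemma integral_patch_ball_rotate:
  fixes f :: "complex \<Rightarrow> 'a :: {banach, second_countable_topology}"
  assumes [measurable]: "f \<in> borel_measurable borel" and u: "norm u = 1"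
  shows "(LINT z|patch (ball 0 1). f (u * z)) = (LINT z|patch (ball 0 1). f z)"
proof -
  have [measurable]: "ball (0::complex) 1 \<in> sets borel" by simp
  have ind: "indicat_real (ball 0 1) (u * z) = indicat_real (ball 0 1) z" for z
    using u by (simp add: indicator_def norm_mult)
  have "(LINT z|patch (ball 0 1). f (u * z)) = (LINT z|lborel. indicat_real (ball 0 1) (0 + u * z) *\<^sub>R f (0 + u * z))"
    by (subst integral_patch) (auto simp: ind)
  also have "\<dots> = (LINT z|lborel. indicat_real (ball 0 1) z *\<^sub>R f z)"
    by (rule integral_rotate(1)[where f="\<lambda>z. indicat_real (ball 0 1) z *\<^sub>R f z"]) (use u in auto)
  finally show ?thesis by (subst integral_patch) auto
qed

text \<open>A function of u = v cis (2 \<psi>) that is holomorphic on the closed disk has its value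
  at u = 0 as mean; here by the geometric series, whose terms all have positive frequency.\<close>

lemma geometric_circle_mean:
  fixes v p a b :: complex
  assumes v: "norm v = 1" and p: "norm p < 1"
  shows "(LINT \<psi>|circ. a + b * (v * cis (2 * \<psi>)) / (1 - p * (v * cis (2 * \<psi>)))) = 2 * pi * a"
proof -
  define f where "f n \<psi> = b * p ^ n * (v * cis (2 * \<psi>)) ^ Suc n" for n \<psi>
  have fm [measurable]: "f n \<in> borel_measurable borel" for n
    unfolding f_def by (intro borel_measurable_times borel_measurable_power) measurable
  have bd: "norm (f n \<psi>) \<le> norm b * norm p ^ n" for n \<psi>
    using v by (simp add: f_def norm_mult norm_power)
  have sb: "summable (\<lambda>n. norm b * norm p ^ n)" using p by (intro summable_mult summable_geometric) auto
  have sums: "(\<lambda>n. f n \<psi>) sums (b * (v * cis (2 * \<psi>)) / (1 - p * (v * cis (2 * \<psi>))))" for \<psi>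
  proof -
    define u where "u = v * cis (2 * \<psi>)"
    have "norm (p * u) < 1" using p v by (simp add: u_def norm_mult)
    then have "(\<lambda>n. b * u * (p * u) ^ n) sums (b * u * (1 / (1 - p * u)))"
      by (intro sums_mult geometric_sums)
    moreover have "f n \<psi> = b * u * (p * u) ^ n" for n
    proof -
      have "f n \<psi> = b * p ^ n * u ^ Suc n" by (simp only: f_def u_def)
      then show ?thesis by (simp add: power_mult_distrib mult_ac)
    qed
    ultimately show ?thesis unfolding u_def[symmetric] by simp
  qed
  have int: "(LINT \<psi>|circ. f n \<psi>) = 0" for n
  proof -
    have "f n \<psi> = (b * p ^ n * v ^ Suc n) * cis (of_int (2 * int (Suc n)) * \<psi>)" for \<psi>
      unfolding f_def by (simp only: power_mult_distrib Complex.DeMoivre) (simp add: mult_ac)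
    then have "(LINT \<psi>|circ. f n \<psi>) = (b * p ^ n * v ^ Suc n) * (LINT \<psi>|circ. cis (of_int (2 * int (Suc n)) * \<psi>))"
      by (simp only: integral_mult_right_zero)
    then show ?thesis unfolding integral_circ_cis by simp
  qed
  have S: "(LINT \<psi>|circ. b * (v * cis (2 * \<psi>)) / (1 - p * (v * cis (2 * \<psi>)))) = 0"
    using integral_circ_suminf[OF fm bd sb] by (simp add: int sums_unique[OF sums, symmetric])
  have nb: "norm (b * (v * cis (2 * \<psi>)) / (1 - p * (v * cis (2 * \<psi>)))) \<le> norm b / (1 - norm p)" for \<psi>
  proof -
    have "1 - norm p \<le> norm (1 - p * (v * cis (2 * \<psi>)))"
      using norm_triangle_ineq2[of 1 "p * (v * cis (2 * \<psi>))"] v by (simp add: norm_mult)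
    then show ?thesis using v p by (simp add: norm_divide norm_mult frac_le)
  qed
  have "integrable circ (\<lambda>\<psi>. b * (v * cis (2 * \<psi>)) / (1 - p * (v * cis (2 * \<psi>))))"
    by (rule integrable_circ_bounded[OF _ nb]) measurable
  then show ?thesis by (simp add: S measure_circ scaleR_conv_of_real)
qed

context ellipse begin

definition F :: "complex \<Rightarrow> complex" where
  "F \<eta> = kratio (of_real \<alpha> * \<eta> + \<beta> * cnj \<eta>)"

lemma measurable_F [measurable]: "F \<in> borel_measurable borel"
  unfolding F_def by measurable

text \<open>As \<eta> is rotated, \<open>F\<close> becomes the fractional linear function (\<alpha>
  u + \<beta>) / (\<alpha> + cnj \<beta> u) of a point u on the unit circle. Its pole is outside the
  disk since |\<beta>| < \<alpha>, so the mean is the value \<beta> / \<alpha> at u = 0.\<close>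

lemma F_circle_mean:
  assumes "\<eta> \<noteq> 0"
  shows "(LINT \<psi>|circ. F (cis \<psi> * \<eta>)) = 2 * pi * (\<beta> / of_real \<alpha>)"
proof -
  define v where "v = \<eta> / cnj \<eta>"
  define p where "p = - (cnj \<beta> / of_real \<alpha>)"
  have v: "norm v = 1" using assms by (simp add: v_def norm_divide)
  have p: "norm p < 1" using \<alpha>_pos \<beta>_less by (simp add: p_def norm_divide)
  have "F (cis \<psi> * \<eta>) = \<beta> / of_real \<alpha> + of_real (Dt / \<alpha>\<^sup>2) * (v * cis (2 * \<psi>)) / (1 - p * (v * cis (2 * \<psi>)))" for \<psi>
  proof -
    define u where "u = v * cis (2 * \<psi>)"
    define z where "z = cis \<psi> * \<eta>"
    have z0: "cnj z \<noteq> 0" using assms by (simp add: z_def)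
    have "cis (2 * \<psi>) * cis (- \<psi>) = cis \<psi>" by (simp add: cis_mult)
    then have zu: "z = u * cnj z"
      using assms by (simp add: z_def u_def v_def cis_cnj field_simps)
    have nz: "1 - p * u \<noteq> 0"
    proof
      assume "1 - p * u = 0"
      then have "p * u = 1" by simp
      then have "norm (p * u) = 1" by simp
      then show False using p v by (simp add: u_def norm_mult)
    qed
    have den: "of_real \<alpha> * (1 - p * u) = of_real \<alpha> + cnj \<beta> * u"
      using \<alpha>_pos by (simp add: p_def field_simps)
    have "F z = (of_real \<alpha> * z + \<beta> * cnj z) / (of_real \<alpha> * cnj z + cnj \<beta> * z)"
      by (simp add: F_def kratio_def)
    also have "\<dots> = ((of_real \<alpha> * u + \<beta>) * cnj z) / ((of_real \<alpha> + cnj \<beta> * u) * cnj z)"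
      by (subst (1 3) zu) (simp add: algebra_simps)
    also have "\<dots> = (of_real \<alpha> * u + \<beta>) / (of_real \<alpha> * (1 - p * u))"
      using z0 by (simp add: den)
    also have "\<dots> = \<beta> / of_real \<alpha> + of_real (Dt / \<alpha>\<^sup>2) * u / (1 - p * u)"
    proof -
      have D: "complex_of_real Dt = of_real \<alpha> * of_real \<alpha> - \<beta> * cnj \<beta>"
        unfolding Dt_def of_real_diff complex_norm_square by (simp add: power2_eq_square)
      have a: "complex_of_real \<alpha> \<noteq> 0" using \<alpha>_pos by simp
      have "of_real \<alpha> * p = - cnj \<beta>" using a by (simp add: p_def)
      then have "of_real Dt = of_real \<alpha> * of_real \<alpha> + of_real \<alpha> * (\<beta> * p)"
        by (simp add: D) (metis mult.left_commute mult_minus_right add_uminus_conv_diff)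
      then have "(of_real \<alpha> * u + \<beta>) * of_real \<alpha> = \<beta> * (of_real \<alpha> * (1 - p * u)) + of_real Dt * u"
        by (simp add: algebra_simps)
      then have e: "of_real \<alpha> * u + \<beta> = (\<beta> * (of_real \<alpha> * (1 - p * u)) + of_real Dt * u) / of_real \<alpha>"
        using a by (simp add: field_simps)
      show ?thesis unfolding e using a nz by (simp add: add_divide_distrib power2_eq_square)
    qed
    finally show ?thesis by (simp add: z_def u_def)
  qed
  then show ?thesis using geometric_circle_mean[OF v p, of "\<beta> / of_real \<alpha>" "of_real (Dt / \<alpha>\<^sup>2)"] by simp
qed

text \<open>Pulled back to the disk, the double integral does not change if both variables are
  rotated by the same angle. Averaging over the angle replaces the kernel by the constant \<beta> /
  \<alpha>.\<close>

lemma kratio_double_integral: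
  "(LINT z|patch E. LINT w|patch E. kratio (z - w)) = of_real (Dt\<^sup>2 * pi\<^sup>2) * (\<beta> / of_real \<alpha>)"
proof -
  have [measurable]: "ball (0::complex) 1 \<in> sets borel" by simp
  define PB where "PB = patch (ball 0 1)"
  have fin: "finite_measure PB" unfolding PB_def by (rule finite_measure_patch) auto
  interpret PB: finite_measure PB by (rule fin)
  interpret PE: finite_measure "patch E" by (rule finite_measure_patch[OF bounded_E measurable_E])
  interpret cP: pair_sigma_finite circ PB ..
  have sPB [simp]: "space PB = UNIV" and [measurable_cong]: "sets PB = sets borel" by (auto simp: PB_def)
  have mPB: "measure PB UNIV = pi" by (simp add: PB_def measure_patch measure_complex_ball)
  have cov': "(LINT z|patch E. f z) = Dt *\<^sub>R (LINT w|PB. f (T w))" if [measurable]: "f \<in> borel_measurable borel" for f :: "complex \<Rightarrow> complex"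
  proof -
    have [measurable]: "T \<in> borel_measurable borel" by (intro borel_measurable_continuous_onI continuous_T)
    show ?thesis unfolding PB_def by (subst (1 2) integral_patch) (auto simp: cov)
  qed
  have Fb: "norm (F z) \<le> 1" for z by (simp add: F_def norm_kratio_le)
  define I where "I = (LINT z|PB. LINT w|PB. F (z - w))"
  have "(LINT z|patch E. LINT w|patch E. kratio (z - w)) = Dt *\<^sub>R (LINT z|PB. LINT w|patch E. kratio (T z - w))"
    by (rule cov') measurable
  also have "\<dots> = Dt *\<^sub>R (LINT z|PB. Dt *\<^sub>R (LINT w|PB. kratio (T z - T w)))"
    by (subst cov') auto
  also have "\<dots> = Dt *\<^sub>R (Dt *\<^sub>R I)"
    unfolding T_diff I_def F_def by simp
  finally have 1: "(LINT z|patch E. LINT w|patch E. kratio (z - w)) = Dt *\<^sub>R (Dt *\<^sub>R I)" .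
  have rot: "I = (LINT z|PB. LINT w|PB. F (cis \<psi> * (z - w)))" for \<psi>
  proof -
    have "I = (LINT z|PB. LINT w|PB. F (cis \<psi> * z - w))"
      unfolding I_def unfolding PB_def
      by (rule integral_patch_ball_rotate[symmetric]) (simp_all add: PB_def[symmetric])
    also have "\<dots> = (LINT z|PB. LINT w|PB. F (cis \<psi> * z - cis \<psi> * w))"
      unfolding PB_def
      by (intro Bochner_Integration.integral_cong refl integral_patch_ball_rotate[symmetric]) simp_all
    finally show ?thesis by (simp add: right_diff_distrib)
  qed
  have "of_real (2 * pi) * I = (LINT \<psi>|circ. I)"
    by (simp add: measure_circ scaleR_conv_of_real)
  also have "\<dots> = (LINT \<psi>|circ. LINT z|PB. LINT w|PB. F (cis \<psi> * (z - w)))"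
    using rot by simp
  also have "\<dots> = (LINT z|PB. LINT \<psi>|circ. LINT w|PB. F (cis \<psi> * (z - w)))"
  proof (rule cP.Fubini_integral[symmetric])
    have fp: "finite_measure (circ \<Otimes>\<^sub>M PB)"
      by (rule finite_measure_pair_measure) unfold_locales
    have "norm (LINT w|PB. F (cis \<psi> * (z - w))) \<le> pi" for \<psi> z
    proof -
      have "norm (LINT w|PB. F (cis \<psi> * (z - w))) \<le> (LINT w|PB. 1)"
        by (rule integral_norm_bound[THEN order_trans], rule integral_mono)
           (auto intro!: PB.integrable_const_bound[of _ 1] simp: Fb)
      then show ?thesis by (simp add: mPB)
    qed
    then show "integrable (circ \<Otimes>\<^sub>M PB) (\<lambda>(\<psi>, z). LINT w|PB. F (cis \<psi> * (z - w)))"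
      by (intro finite_measure.integrable_const_bound[OF fp, of _ pi]) auto
  qed
  also have "\<dots> = (LINT z|PB. LINT w|PB. LINT \<psi>|circ. F (cis \<psi> * (z - w)))"
  proof (rule Bochner_Integration.integral_cong[OF refl])
    fix z
    have fp: "finite_measure (circ \<Otimes>\<^sub>M PB)"
      by (rule finite_measure_pair_measure) unfold_locales
    have "integrable (circ \<Otimes>\<^sub>M PB) (\<lambda>(\<psi>, w). F (cis \<psi> * (z - w)))"
      by (intro finite_measure.integrable_const_bound[OF fp, of _ 1]) (auto simp: Fb)
    from cP.Fubini_integral[OF this]
    show "(LINT \<psi>|circ. LINT w|PB. F (cis \<psi> * (z - w))) = (LINT w|PB. LINT \<psi>|circ. F (cis \<psi> * (z - w)))"
      by simp
  qed
  also have "\<dots> = (LINT z|PB. LINT w|PB. 2 * pi * (\<beta> / of_real \<alpha>))"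
  proof (rule Bochner_Integration.integral_cong[OF refl])
    fix z
    have "AE w in PB. w \<noteq> z"
      unfolding PB_def by (intro AE_patch_I AE_lborel_singleton) auto
    then have "AE w in PB. (LINT \<psi>|circ. F (cis \<psi> * (z - w))) = 2 * pi * (\<beta> / of_real \<alpha>)"
      by eventually_elim (rule F_circle_mean, simp)
    then show "(LINT w|PB. LINT \<psi>|circ. F (cis \<psi> * (z - w))) = (LINT w|PB. 2 * pi * (\<beta> / of_real \<alpha>))"
      by (intro integral_cong_AE) measurable
  qed
  also have "\<dots> = of_real (2 * pi) * (of_real (pi\<^sup>2) * (\<beta> / of_real \<alpha>))"
    by (simp add: mPB scaleR_conv_of_real power2_eq_square)
  finally have e: "of_real (2 * pi) * I = of_real (2 * pi) * (of_real (pi\<^sup>2) * (\<beta> / of_real \<alpha>))" .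
  have "complex_of_real (2 * pi) \<noteq> 0" by simp
  from mult_left_cancel[OF this, THEN iffD1, OF e]
  have "I = of_real (pi\<^sup>2) * (\<beta> / of_real \<alpha>)" .
  then show ?thesis unfolding 1 by (simp add: scaleR_conv_of_real power2_eq_square)
qed

text \<open>Pulled back to the disk, the terms w, cnj w, w^2 and (cnj w)^2 are multiplied by -1
  under a half or quarter turn and integrate to 0. Only w cnj w survives, with integral pi /
  2.\<close>

lemma second_moment: "(LINT z|patch E. (z - c)\<^sup>2) = of_real (pi * \<alpha> * Dt) * \<beta>"
  and first_moment: "(LINT z|patch E. (z - c)) = 0"
  and area: "measure lborel E = pi * Dt"
proof -
  have [measurable]: "ball (0::complex) 1 \<in> sets borel" by simp
  have [measurable]: "T \<in> borel_measurable borel" by (intro borel_measurable_continuous_onI continuous_T)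
  have cov': "(LINT z|patch E. f z) = Dt *\<^sub>R (LINT w|patch (ball 0 1). f (T w))" if [measurable]: "f \<in> borel_measurable borel" for f :: "complex \<Rightarrow> complex"
    by (subst (1 2) integral_patch) (auto simp: cov)
  have ib: "integrable (patch (ball 0 1)) f" if [measurable]: "f \<in> borel_measurable borel" and "\<And>z. z \<in> ball 0 1 \<Longrightarrow> norm (f z) \<le> 1"
    for f :: "complex \<Rightarrow> complex"
    using that by (subst integral_patch(2)) (auto intro!: integrable_bounded_mult_indicator[of _ _ 1])
  have n1: "norm w * norm w \<le> 1" if "norm w < 1" for w :: complex
    using mult_mono[of "norm w" 1 "norm w" 1] that by auto
  have i: "integrable (patch (ball 0 1)) (\<lambda>w. w)" "integrable (patch (ball 0 1)) (\<lambda>w. cnj w)"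
    "integrable (patch (ball 0 1)) (\<lambda>w. w\<^sup>2)" "integrable (patch (ball 0 1)) (\<lambda>w. cnj w ^ 2)" "integrable (patch (ball 0 1)) (\<lambda>w. w * cnj w)"
    by (auto intro!: ib simp: norm_mult norm_power power2_eq_square n1)
  have z: "(LINT w|patch (ball 0 1). f w) = 0" if [measurable]: "f \<in> borel_measurable borel" and e: "\<And>w. f (u * w) = v * f w" and "norm u = 1" "v \<noteq> 1"
    for f :: "complex \<Rightarrow> complex" and u v
    using integral_patch_ball_rotate[of f u] that by (simp add: e)
  have z1: "(LINT w|patch (ball 0 1). w) = 0" by (rule z[of _ "-1" "-1"]) auto
  have z2: "(LINT w|patch (ball 0 1). cnj w) = 0" by (rule z[of _ "-1" "-1"]) auto
  have z3: "(LINT w|patch (ball 0 1). w\<^sup>2) = 0" by (rule z[of _ "\<i>" "-1"]) (auto simp: power_mult_distrib)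
  have z4: "(LINT w|patch (ball 0 1). cnj w ^ 2) = 0" by (rule z[of _ "\<i>" "-1"]) (auto simp: power_mult_distrib)
  have z5: "(LINT w|patch (ball 0 1). w * cnj w) = of_real (pi / 2)"
  proof -
    have "(LINT w|patch (ball 0 1). w * cnj w) = (LINT w|lborel. of_real (indicat_real (ball (0::complex) 1) w * (norm w)\<^sup>2))"
      by (subst integral_patch) (auto simp: complex_norm_square[symmetric] scaleR_conv_of_real)
    also have "\<dots> = of_real (LINT w|lborel. indicat_real (ball (0::complex) 1) w * (norm w)\<^sup>2)" by (rule integral_complex_of_real)
    also have "(LINT w|lborel. indicat_real (ball (0::complex) 1) w * (norm w)\<^sup>2) =
        enn2real (\<integral>\<^sup>+w. ennreal (norm w powr -(-2)) * indicator (ball (0::complex) 1) w \<partial>lborel)"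
      by (subst integral_eq_nn_integral)
         (auto intro!: arg_cong[where f=enn2real] nn_integral_cong simp: indicator_def powr_numeral)
    also have "\<dots> = pi / 2" by (subst nn_integral_norm_powr_ball) auto
    finally show ?thesis .
  qed
  have "(LINT z|patch E. (z - c)) = Dt *\<^sub>R (LINT w|patch (ball 0 1). of_real \<alpha> * w + \<beta> * cnj w)"
    using cov'[of "\<lambda>z. z - c"] by (simp add: T_def)
  also have "(LINT w|patch (ball 0 1). of_real \<alpha> * w + \<beta> * cnj w) =
      (LINT w|patch (ball 0 1). of_real \<alpha> * w) + (LINT w|patch (ball 0 1). \<beta> * cnj w)"
    by (intro Bochner_Integration.integral_add integrable_mult_right i)
  finally show "(LINT z|patch E. (z - c)) = 0"
    unfolding integral_mult_right_zero z1 z2 by simp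
  have "(T w - c)\<^sup>2 = of_real (\<alpha>\<^sup>2) * w\<^sup>2 + 2 * of_real \<alpha> * \<beta> * (w * cnj w) + \<beta>\<^sup>2 * cnj w ^ 2" for w
    by (simp add: T_def power2_eq_square algebra_simps)
  then have "(LINT z|patch E. (z - c)\<^sup>2) = Dt *\<^sub>R (LINT w|patch (ball 0 1). of_real (\<alpha>\<^sup>2) * w\<^sup>2 + 2 * of_real \<alpha> * \<beta> * (w * cnj w) + \<beta>\<^sup>2 * cnj w ^ 2)"
    using cov'[of "\<lambda>z. (z - c)\<^sup>2"] by simp
  also have "(LINT w|patch (ball 0 1). of_real (\<alpha>\<^sup>2) * w\<^sup>2 + 2 * of_real \<alpha> * \<beta> * (w * cnj w) + \<beta>\<^sup>2 * cnj w ^ 2) =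
      (LINT w|patch (ball 0 1). of_real (\<alpha>\<^sup>2) * w\<^sup>2) + (LINT w|patch (ball 0 1). 2 * of_real \<alpha> * \<beta> * (w * cnj w))
      + (LINT w|patch (ball 0 1). \<beta>\<^sup>2 * cnj w ^ 2)"
    by (simp only: Bochner_Integration.integral_add Bochner_Integration.integrable_add integrable_mult_right i)
  finally show "(LINT z|patch E. (z - c)\<^sup>2) = of_real (pi * \<alpha> * Dt) * \<beta>"
    unfolding integral_mult_right_zero z3 z4 z5 by (simp add: scaleR_conv_of_real)
  have "measure lborel E = Dt * measure lborel (ball (0::complex) 1)"
    using cov[of "\<lambda>_. 1::real"] by simp
  then show "measure lborel E = pi * Dt" by (simp add: measure_complex_ball)
qed

end

text \<open>Newton's theorem: by the mean value property each circle acts on exterior points as if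
  its mass were at the centre.\<close>

lemma pot_ball_outside:
  assumes s: "0 \<le> s" "s < norm x"
  shows "pot (ball 0 s) x = s\<^sup>2 / 2 * ln (norm x)"
proof -
  have [measurable]: "ball (0::complex) s \<in> sets borel" by simp
  have i: "integrable lborel (\<lambda>y. ln (norm (x - y)) * indicat_real (ball 0 s) y)"
    by (rule integrable_ln_norm) auto
  then have ip: "integrable (circ \<Otimes>\<^sub>M rad) (\<lambda>(\<theta>, r). ln (norm (x - of_real r * cis \<theta>)) * indicat_real (ball 0 s) (of_real r * cis \<theta>))"
    by (subst (asm) integrable_polar) auto
  have m: "(LINT \<theta>|circ. ln (norm (x - of_real r * cis \<theta>))) = 2 * pi * ln (norm x)" if "0 \<le> r" "r < norm x" for r
  proof -
    have x: "x \<noteq> 0" using that by auto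
    have w: "norm (of_real r / x) < 1" using that x by (simp add: norm_divide pos_divide_less_eq)
    have "ln (norm (x - of_real r * cis \<theta>)) = ln (norm x) + ln (norm (1 - of_real r / x * cis \<theta>))" for \<theta>
    proof -
      have "x - of_real r * cis \<theta> = x * (1 - of_real r / x * cis \<theta>)" using x by (simp add: algebra_simps)
      then have "norm (x - of_real r * cis \<theta>) = norm x * norm (1 - of_real r / x * cis \<theta>)" by (simp only: norm_mult)
      moreover have "norm (1 - of_real r / x * cis \<theta>) \<ge> 1 - norm (of_real r / x)"
      proof -
        have "norm (of_real r / x * cis \<theta>) = norm (of_real r / x)" by (simp only: norm_mult norm_cis mult_1_right)
        then show ?thesis using norm_triangle_ineq2[of 1 "of_real r / x * cis \<theta>"] by (simp only: norm_one)
      qed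
      moreover from this w have "norm (1 - of_real r / x * cis \<theta>) > 0" by linarith
      ultimately show ?thesis using x by (simp add: ln_mult)
    qed
    then show ?thesis using log_kernel_mean[OF w] by (simp add: measure_circ)
  qed
  have "(LINT y|lborel. ln (norm (x - y)) * indicat_real (ball 0 s) y) =
      (LINT \<theta>|circ. LINT r|rad. ln (norm (x - of_real r * cis \<theta>)) * indicat_real (ball 0 s) (of_real r * cis \<theta>))"
    by (rule integral_polar[OF i])
  also have "\<dots> = (LINT r|rad. LINT \<theta>|circ. ln (norm (x - of_real r * cis \<theta>)) * indicat_real (ball 0 s) (of_real r * cis \<theta>))"
    using ip by (rule circ_rad.Fubini_integral[symmetric])
  also have "\<dots> = (LINT r|rad. indicat_real {0<..<s} r *\<^sub>R (2 * pi * ln (norm x)))"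
  proof (rule integral_cong_AE)
    show "AE r in rad. (LINT \<theta>|circ. ln (norm (x - of_real r * cis \<theta>)) * indicat_real (ball 0 s) (of_real r * cis \<theta>))
       = indicat_real {0<..<s} r *\<^sub>R (2 * pi * ln (norm x))"
      unfolding rad_def
    proof (subst AE_density, simp, rule AE_I2, rule impI)
      fix r :: real assume "0 < ennreal r"
      then have r: "r > 0" by (simp add: ennreal_less_zero_iff)
      show "(LINT \<theta>|circ. ln (norm (x - of_real r * cis \<theta>)) * indicat_real (ball 0 s) (of_real r * cis \<theta>))
       = indicat_real {0<..<s} r *\<^sub>R (2 * pi * ln (norm x))"
        using r m[of r] s by (auto simp: indicator_def norm_mult)
    qed
  qed measurable
  also have "\<dots> = ((s\<^sup>2 - 0\<^sup>2) / 2) *\<^sub>R (2 * pi * ln (norm x))"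
    using integral_rad_interval[OF order_refl s(1)] by (rule has_bochner_integral_integral_eq)
  finally show ?thesis by (simp add: inv_laplacian_def)
qed

text \<open>Per unit of radius: at least 49/100 from the disk of radius \<open>s\<close>, with its
  explicit exterior potential; at most 12/1000 lost to the thin remainder \<open>A\<close>; at most
  251/1000 lost to the rotation. This leaves more than 22/100.\<close>

lemma radial_slope:
  assumes \<kappa>: "0 < \<kappa>" "\<kappa> \<le> 1 / 1000000"
    and U: "U \<in> sets borel" "ball 0 (1 - \<kappa>) \<subseteq> U" "U \<subseteq> ball 0 (1 + \<kappa>)"
    and \<Omega>: "\<bar>\<Omega> - 1/4\<bar> \<le> \<kappa>" and x0: "norm x0 \<le> \<kappa>"
    and r: "1 - \<kappa> \<le> r" "r \<le> r'" "r' \<le> 1 + \<kappa>"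
  shows "22 / 100 * (r' - r) \<le> (pot U (of_real r' * cis \<theta>) - \<Omega> / 2 * (norm (of_real r' * cis \<theta> - x0))\<^sup>2)
     - (pot U (of_real r * cis \<theta>) - \<Omega> / 2 * (norm (of_real r * cis \<theta> - x0))\<^sup>2)"
proof -
  \<comment> \<open>Small enough that all radii considered are strictly outside the disk, large
    enough that the remainder has area of order \<kappa>.\<close>
  define s where "s = 1 - 2 * \<kappa>"
  define A where "A = U - ball 0 s"
  have s: "0 \<le> s" "s < r" "s < 1" using \<kappa> r by (auto simp: s_def)
  have bU: "bounded U" using U(3) bounded_ball bounded_subset by blast
  have sub: "ball 0 s \<subseteq> U" using U(2) \<kappa> by (auto simp: s_def)
  have A: "bounded A" "A \<in> sets borel" using bU U(1) by (auto simp: A_def intro: bounded_subset)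
  have UA: "ball 0 s \<union> A = U" using sub by (auto simp: A_def)
  have pU: "pot U x = pot (ball 0 s) x + pot A x" for x
    using pot_Un[of "ball 0 s" A x] A by (simp add: UA) (auto simp: A_def)
  have mA: "measure lborel A \<le> 25 / 1000000"
  proof -
    have "A \<subseteq> ball 0 (1 + \<kappa>) - ball 0 s" using U(3) by (auto simp: A_def)
    then have "measure lborel A \<le> measure lborel (ball (0::complex) (1 + \<kappa>) - ball 0 s)"
      using emeasure_bounded_le(3)[of "ball (0::complex) (1 + \<kappa>) - ball 0 s"] A(2)
      by (intro measure_mono_fmeasurable) (auto simp: fmeasurable_def top.not_eq_extremum bounded_diff)
    also have "\<dots> = measure lborel (ball (0::complex) (1 + \<kappa>)) - measure lborel (ball (0::complex) s)"
      using s \<kappa> by (intro measure_Diff) (auto simp: emeasure_complex_ball)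
    also have "\<dots> = pi * ((1 + \<kappa>)\<^sup>2 - s\<^sup>2)"
      using s \<kappa> by (simp add: measure_complex_ball algebra_simps)
    also have "(1 + \<kappa>)\<^sup>2 - s\<^sup>2 = 3 * \<kappa> * (2 - \<kappa>)" by (simp add: s_def power2_eq_square algebra_simps)
    also have "pi * (3 * \<kappa> * (2 - \<kappa>)) \<le> 4 * (3 * \<kappa> * (2 - \<kappa>))"
      using pi_less_4 \<kappa> by (intro mult_right_mono) auto
    also have "\<dots> \<le> 24 * \<kappa>" using \<kappa> by (simp add: algebra_simps)
    finally show ?thesis using \<kappa> by linarith
  qed
  define d where "d = r' - r"
  have d: "d \<ge> 0" using r by (simp add: d_def)
  have rp: "r > 0" "r' > 0" using r \<kappa> by auto
  have 1: "pot (ball 0 s) (of_real r' * cis \<theta>) - pot (ball 0 s) (of_real r * cis \<theta>) \<ge> 49/100 * d"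
  proof -
    have pe: "pot (ball 0 s) (of_real u * cis \<theta>) = s\<^sup>2 / 2 * ln u" if "r \<le> u" for u
      using pot_ball_outside[of s "of_real u * cis \<theta>"] s that rp by (simp add: norm_mult)
    have e: "pot (ball 0 s) (of_real r' * cis \<theta>) - pot (ball 0 s) (of_real r * cis \<theta>) = s\<^sup>2 / 2 * (ln r' - ln r)"
      using pe[OF order_refl] pe[OF r(2)] by (simp add: right_diff_distrib)
    have "ln (r / r') \<le> r / r' - 1" using rp by (intro ln_le_minus_one) auto
    then have "ln r' - ln r \<ge> d / r'" using rp by (simp add: ln_div d_def field_simps)
    moreover have "d / r' \<ge> d / (1 + \<kappa>)" using d r rp by (intro divide_left_mono) auto
    moreover have "d / (1 + \<kappa>) \<ge> d * (1 - \<kappa>)"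
    proof -
      have "(1 - \<kappa>) * (1 + \<kappa>) \<le> 1" by (simp add: algebra_simps)
      then have "d * ((1 - \<kappa>) * (1 + \<kappa>)) \<le> d * 1" using d by (rule mult_left_mono)
      then show ?thesis using \<kappa> by (simp add: pos_le_divide_eq mult.assoc)
    qed
    ultimately have l: "ln r' - ln r \<ge> d * (1 - \<kappa>)" by linarith
    have "49/100 * d \<le> (999/1000)\<^sup>2 / 2 * (d * (999/1000))" using d by (simp add: power2_eq_square)
    also have "\<dots> \<le> s\<^sup>2 / 2 * (d * (1 - \<kappa>))"
      using \<kappa> d by (intro mult_mono divide_right_mono power_mono) (auto simp: s_def)
    also have "\<dots> \<le> s\<^sup>2 / 2 * (ln r' - ln r)" using l by (intro mult_left_mono) auto
    finally show ?thesis unfolding e .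
  qed
  have dist: "norm (of_real r' * cis \<theta> - of_real r * cis \<theta>) = d"
    using d by (simp add: d_def norm_mult flip: left_diff_distrib of_real_diff)
  have 2: "\<bar>pot A (of_real r' * cis \<theta>) - pot A (of_real r * cis \<theta>)\<bar> \<le> 12/1000 * d"
  proof -
    \<comment> \<open>The square root of the area bound 25 * 10^-6. This loss of order
      \<open>sqrt \<kappa>\<close> is why \<kappa> has to be as small as 10^-6.\<close>
    have "sqrt (measure lborel A) \<le> 5/1000"
      using mA by (intro real_le_lsqrt) (auto simp: power2_eq_square)
    moreover have "(2 * pi + 1) / pi \<le> 7/3" using pi_gt3 by (simp add: field_simps)
    ultimately have "(2 * pi + 1) / pi * sqrt (measure lborel A) * d \<le> 7/3 * (5/1000) * d"
      using d by (intro mult_mono) auto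
    then show ?thesis
      using pot_lipschitz[OF A, of "of_real r' * cis \<theta>" "of_real r * cis \<theta>"] d unfolding dist by linarith
  qed
  have 3: "\<Omega> / 2 * (norm (of_real r' * cis \<theta> - x0))\<^sup>2 - \<Omega> / 2 * (norm (of_real r * cis \<theta> - x0))\<^sup>2 \<le> 251/1000 * d"
  proof -
    define q where "q = Re (cnj x0 * cis \<theta>)"
    have q: "\<bar>q\<bar> \<le> \<kappa>" using abs_Re_le_cmod[of "cnj x0 * cis \<theta>"] x0 by (simp add: q_def norm_mult)
    have n: "(norm (of_real u * cis \<theta> - x0))\<^sup>2 = u\<^sup>2 * ((sin \<theta>)\<^sup>2 + (cos \<theta>)\<^sup>2) - 2 * u * q + (norm x0)\<^sup>2" for u
      unfolding cmod_power2 q_def by (simp add: power2_eq_square algebra_simps del: sin_cos_squared_add3)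
    have e: "\<Omega> / 2 * (norm (of_real r' * cis \<theta> - x0))\<^sup>2 - \<Omega> / 2 * (norm (of_real r * cis \<theta> - x0))\<^sup>2 = \<Omega> / 2 * (r' + r - 2 * q) * d"
      unfolding n by (simp add: d_def power2_eq_square algebra_simps diff_divide_distrib)
    have "\<Omega> / 2 * (r' + r - 2 * q) \<le> (1/4 + \<kappa>) / 2 * (2 + 4 * \<kappa>)"
      using \<Omega> r q \<kappa> by (intro mult_mono) auto
    also have "\<dots> \<le> (1/4 + 1/1000000) / 2 * (2 + 4 * (1/1000000))" using \<kappa> by (intro mult_mono) auto
    also have "\<dots> \<le> 251/1000" by simp
    finally show ?thesis unfolding e using d by (rule mult_right_mono)
  qed
  show ?thesis unfolding pU using 1 2 3 d unfolding d_def[symmetric] by linarith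
qed

section \<open>Two steady patches close to the unit disk\<close>

lemma AE_rad_pos: "AE r in rad. r > 0"
  unfolding rad_def by (subst AE_density) (auto simp: ennreal_less_zero_iff)

locale polar_set =
  fixes \<kappa> :: real and R :: "real \<Rightarrow> real" and U :: "complex set"
  assumes \<kappa>: "0 < \<kappa>" "\<kappa> \<le> 1 / 1000000"
    and R: "\<And>\<theta>. 1 - \<kappa> \<le> R \<theta>" "\<And>\<theta>. R \<theta> \<le> 1 + \<kappa>"
    and U_borel [measurable]: "U \<in> sets borel"
    and U_iff: "\<And>r \<theta>. r \<ge> 0 \<Longrightarrow> of_real r * cis \<theta> \<in> U \<longleftrightarrow> r < R \<theta>"
begin

lemma U_sub: "ball 0 (1 - \<kappa>) \<subseteq> U" "U \<subseteq> ball 0 (1 + \<kappa>)"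
proof -
  have e: "z \<in> U \<longleftrightarrow> norm z < R (Arg z)" for z
    using U_iff[of "norm z" "Arg z"] by (simp add: rcis_def[symmetric] rcis_cmod_Arg)
  show "ball 0 (1 - \<kappa>) \<subseteq> U" "U \<subseteq> ball 0 (1 + \<kappa>)"
    using less_le_trans[OF _ R(1)] less_le_trans[OF _ R(2)] by (auto simp: e)
qed

lemma bounded_U: "bounded U"
  using U_sub(2) bounded_ball bounded_subset by blast

lemma finite_patch: "finite_measure (patch U)"
  by (rule finite_measure_patch[OF bounded_U U_borel])

lemma R_pos: "R \<theta> > 0" "\<bar>R \<theta>\<bar> = R \<theta>"
  using R(1)[of \<theta>] \<kappa> by auto

text \<open>The patch differs from the unit disk only in an annulus of area at most 16 \<kappa>,
  where the kernel is bounded by 1; the disk itself contributes the error 41 \<kappa>.\<close>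

lemma kratio_near:
  assumes x: "1 - \<kappa> \<le> norm x" "norm x \<le> 1 + \<kappa>"
  shows "norm ((LINT w|patch U. kratio (x - w)) - (pi / 2) *\<^sub>R x\<^sup>2) \<le> 57 * \<kappa>"
proof -
  have [measurable]: "ball (0::complex) r \<in> sets borel" for r by simp
  define An where "An = ball (0::complex) (1 + \<kappa>) - ball 0 (1 - \<kappa>)"
  have An: "bounded An" "An \<in> sets borel" by (auto simp: An_def bounded_diff)
  have mAn: "measure lborel An \<le> 16 * \<kappa>"
  proof -
    have "measure lborel An = measure lborel (ball (0::complex) (1 + \<kappa>)) - measure lborel (ball (0::complex) (1 - \<kappa>))"
      unfolding An_def using \<kappa> by (intro measure_Diff) (auto simp: emeasure_complex_ball)
    also have "\<dots> = pi * (4 * \<kappa>)"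
      using \<kappa> by (simp add: measure_complex_ball power2_eq_square algebra_simps)
    also have "\<dots> \<le> 4 * (4 * \<kappa>)" using pi_less_4 \<kappa> by (intro mult_right_mono) auto
    finally show ?thesis by simp
  qed
  have i: "integrable lborel (\<lambda>w. indicat_real A w *\<^sub>R kratio (x - w))" if "bounded A" "A \<in> sets borel" for A
    using that by (intro integrable_bounded_mult_indicator[of _ _ 1]) (auto simp: norm_kratio_le)
  have "norm ((LINT w|patch U. kratio (x - w)) - (LINT w|lborel. indicat_real (ball 0 1) w *\<^sub>R kratio (x - w))) =
     norm (LINT w|lborel. indicat_real U w *\<^sub>R kratio (x - w) - indicat_real (ball 0 1) w *\<^sub>R kratio (x - w))"
    using i bounded_U by (subst integral_patch) (auto simp: Bochner_Integration.integral_diff)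
  also have "\<dots> \<le> (LINT w|lborel. indicat_real An w)"
  proof (rule integral_norm_bound[THEN order_trans], rule integral_mono)
    show "integrable lborel (\<lambda>w. norm (indicat_real U w *\<^sub>R kratio (x - w) - indicat_real (ball 0 1) w *\<^sub>R kratio (x - w)))"
      using i bounded_U by (intro integrable_norm Bochner_Integration.integrable_diff) auto
    show "integrable lborel (indicat_real An)" by (rule integrable_indicator_bounded[OF An])
    fix w
    show "norm (indicat_real U w *\<^sub>R kratio (x - w) - indicat_real (ball 0 1) w *\<^sub>R kratio (x - w)) \<le> indicat_real An w"
    proof (cases "w \<in> U \<longleftrightarrow> w \<in> ball 0 1")
      case False
      then have "w \<in> An" using U_sub \<kappa> by (auto simp: An_def)
      then show ?thesis using False norm_kratio_le[of "x - w"] by (auto simp: indicator_def)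
    qed (auto simp: indicator_def)
  qed
  also have "\<dots> = measure lborel An" by simp
  finally have 1: "norm ((LINT w|patch U. kratio (x - w)) - (LINT w|lborel. indicat_real (ball 0 1) w *\<^sub>R kratio (x - w))) \<le> 16 * \<kappa>"
    using mAn by linarith
  have 2: "norm ((LINT w|lborel. indicat_real (ball 0 1) w *\<^sub>R kratio (x - w)) - (pi / 2) *\<^sub>R x\<^sup>2) \<le> 41 * \<kappa>"
    using x \<kappa> by (intro ball_kratio_near_circle) auto
  show ?thesis using norm_triangle_le[OF add_mono[OF 1 2]] by simp
qed

end

locale two_patches = U: polar_set \<kappa> R U + V: polar_set \<kappa> S V for \<kappa> R S U V
begin

lemmas \<kappa> = U.\<kappa>

definition M :: "complex \<Rightarrow> real" where "M z = indicat_real U z - indicat_real V z"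

text \<open>The ray carries the measure r dr, hence half the difference of the squares.\<close>

definition m :: "real \<Rightarrow> real" where "m \<theta> = ((R \<theta>)\<^sup>2 - (S \<theta>)\<^sup>2) / 2"

lemma measurable_M [measurable]: "M \<in> borel_measurable borel"
  unfolding M_def by measurable

lemma abs_M_le: "\<bar>M z\<bar> \<le> 1"
  by (auto simp: M_def indicator_def)

lemma M_support: "M z \<noteq> 0 \<Longrightarrow> 1 - \<kappa> \<le> norm z \<and> norm z < 1 + \<kappa>"
proof -
  assume "M z \<noteq> 0"
  then have "z \<in> U \<union> V" "z \<notin> U \<inter> V" by (auto simp: M_def indicator_def)
  then show ?thesis using U.U_sub V.U_sub by (auto simp: subset_iff not_less[symmetric])
qed

lemma M_polar: "r > 0 \<Longrightarrow> M (of_real r * cis \<theta>) = indicat_real {0<..<R \<theta>} r - indicat_real {0<..<S \<theta>} r"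
  using U.U_iff[of r \<theta>] V.U_iff[of r \<theta>] by (auto simp: M_def indicator_def)

lemma M_between:
  assumes "r > 0" "M (of_real r * cis \<theta>) \<noteq> 0"
  shows "(S \<theta> \<le> r \<and> r < R \<theta> \<and> M (of_real r * cis \<theta>) = 1) \<or> (R \<theta> \<le> r \<and> r < S \<theta> \<and> M (of_real r * cis \<theta>) = -1)"
  using assms M_polar[OF assms(1), of \<theta>] by (auto simp: indicator_def split: if_splits)

lemma abs_M_polar: "r > 0 \<Longrightarrow> \<bar>M (of_real r * cis \<theta>)\<bar> = indicat_real {0<..<max (R \<theta>) (S \<theta>)} r - indicat_real {0<..<min (R \<theta>) (S \<theta>)} r"
  using M_polar[of r \<theta>] by (auto simp: indicator_def)

text \<open>On a fixed ray \<open>M\<close> has one sign: it is 1 or -1 between the two boundary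
  radii. So integrating its absolute value loses nothing against |m|, and all later errors can be
  measured in |m|.\<close>

lemma has_integral_M_rad: "has_bochner_integral rad (\<lambda>r. M (of_real r * cis \<theta>)) (m \<theta>)"
  and has_integral_abs_M_rad: "has_bochner_integral rad (\<lambda>r. \<bar>M (of_real r * cis \<theta>)\<bar>) \<bar>m \<theta>\<bar>"
proof -
  have h: "has_bochner_integral rad (\<lambda>r. indicat_real {0<..<b} r) (b\<^sup>2 / 2)" if "b \<ge> 0" for b
    using integral_rad_interval[OF order_refl that, of "1::real"] by simp
  have "has_bochner_integral rad (\<lambda>r. indicat_real {0<..<R \<theta>} r - indicat_real {0<..<S \<theta>} r) ((R \<theta>)\<^sup>2 / 2 - (S \<theta>)\<^sup>2 / 2)"
    using U.R_pos[of \<theta>] V.R_pos[of \<theta>] by (intro has_bochner_integral_diff h) auto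
  also have "?this \<longleftrightarrow> has_bochner_integral rad (\<lambda>r. M (of_real r * cis \<theta>)) ((R \<theta>)\<^sup>2 / 2 - (S \<theta>)\<^sup>2 / 2)"
    by (intro has_bochner_integral_cong_AE) (auto intro!: eventually_mono[OF AE_rad_pos] simp: M_polar)
  finally show "has_bochner_integral rad (\<lambda>r. M (of_real r * cis \<theta>)) (m \<theta>)"
    by (simp add: m_def diff_divide_distrib)
  let ?a = "max (R \<theta>) (S \<theta>)" and ?b = "min (R \<theta>) (S \<theta>)"
  have "has_bochner_integral rad (\<lambda>r. indicat_real {0<..<?a} r - indicat_real {0<..<?b} r) (?a\<^sup>2 / 2 - ?b\<^sup>2 / 2)"
    using U.R_pos[of \<theta>] V.R_pos[of \<theta>] by (intro has_bochner_integral_diff h) auto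
  also have "?this \<longleftrightarrow> has_bochner_integral rad (\<lambda>r. \<bar>M (of_real r * cis \<theta>)\<bar>) (?a\<^sup>2 / 2 - ?b\<^sup>2 / 2)"
    by (intro has_bochner_integral_cong_AE) (auto intro!: eventually_mono[OF AE_rad_pos] simp: abs_M_polar)
  also have "?a\<^sup>2 / 2 - ?b\<^sup>2 / 2 = \<bar>m \<theta>\<bar>"
  proof -
    have "R \<theta> \<le> S \<theta> \<Longrightarrow> (R \<theta>)\<^sup>2 \<le> (S \<theta>)\<^sup>2" "S \<theta> \<le> R \<theta> \<Longrightarrow> (S \<theta>)\<^sup>2 \<le> (R \<theta>)\<^sup>2"
      using U.R_pos[of \<theta>] V.R_pos[of \<theta>] by (auto intro: power_mono)
    then show ?thesis by (auto simp: m_def max_def min_def)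
  qed
  finally show "has_bochner_integral rad (\<lambda>r. \<bar>M (of_real r * cis \<theta>)\<bar>) \<bar>m \<theta>\<bar>" .
qed

text \<open>Nothing is assumed about \<open>R\<close> and \<open>S\<close> as functions of the
  angle; measurability comes from \<open>M\<close>, of which \<open>m\<close> is a parameter
  integral.\<close>

lemma measurable_m [measurable]: "m \<in> borel_measurable borel"
proof -
  have "m = (\<lambda>\<theta>. LINT r|rad. M (of_real r * cis \<theta>))"
    using has_integral_M_rad by (auto simp: has_bochner_integral_iff)
  also have "\<dots> \<in> borel_measurable borel" by measurable
  finally show ?thesis .
qed

lemma m_eq: "m \<theta> = (R \<theta> - S \<theta>) * ((R \<theta> + S \<theta>) / 2)"
  by (simp add: m_def power2_eq_square algebra_simps diff_divide_distrib)

lemma m_bounds: "\<bar>m \<theta>\<bar> \<le> \<bar>R \<theta> - S \<theta>\<bar> * (1 + \<kappa>)" "\<bar>R \<theta> - S \<theta>\<bar> * (1 - \<kappa>) \<le> \<bar>m \<theta>\<bar>"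
proof -
  have a: "\<bar>(R \<theta> + S \<theta>) / 2\<bar> = (R \<theta> + S \<theta>) / 2" using U.R_pos[of \<theta>] V.R_pos[of \<theta>] by simp
  have b: "1 - \<kappa> \<le> (R \<theta> + S \<theta>) / 2" "(R \<theta> + S \<theta>) / 2 \<le> 1 + \<kappa>" using U.R[of \<theta>] V.R[of \<theta>] by auto
  show "\<bar>m \<theta>\<bar> \<le> \<bar>R \<theta> - S \<theta>\<bar> * (1 + \<kappa>)" "\<bar>R \<theta> - S \<theta>\<bar> * (1 - \<kappa>) \<le> \<bar>m \<theta>\<bar>"
    unfolding m_eq abs_mult a
    by (rule mult_left_mono[OF b(2) abs_ge_zero], rule mult_left_mono[OF b(1) abs_ge_zero])
qed

lemma abs_m_le: "\<bar>m \<theta>\<bar> \<le> 1"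
proof -
  have "\<bar>R \<theta> - S \<theta>\<bar> \<le> 2 * \<kappa>" using U.R[of \<theta>] V.R[of \<theta>] by auto
  then have "\<bar>R \<theta> - S \<theta>\<bar> * (1 + \<kappa>) \<le> (1/4) * 2" using \<kappa> by (intro mult_mono) auto
  then show ?thesis using m_bounds(1)[of \<theta>] by linarith
qed

lemma integrable_M_mult:
  fixes f :: "complex \<Rightarrow> 'a :: {banach, second_countable_topology}"
  assumes [measurable]: "f \<in> borel_measurable borel" and B: "\<And>z. norm z < 2 \<Longrightarrow> norm (f z) \<le> B"
  shows "integrable lborel (\<lambda>z. M z *\<^sub>R f z)"
proof -
  have "integrable lborel (\<lambda>z. indicat_real (ball 0 2) z *\<^sub>R (M z *\<^sub>R f z))"
  proof (rule integrable_bounded_mult_indicator[of _ _ B])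
    fix z :: complex assume "z \<in> ball 0 2"
    then have "\<bar>M z\<bar> * norm (f z) \<le> 1 * B" using B[of z] abs_M_le[of z] by (intro mult_mono) auto
    then show "norm (M z *\<^sub>R f z) \<le> B" by simp
  qed auto
  also have "(\<lambda>z. indicat_real (ball 0 2) z *\<^sub>R (M z *\<^sub>R f z)) = (\<lambda>z. M z *\<^sub>R f z)"
    using M_support \<kappa> by (force simp: indicator_def fun_eq_iff)
  finally show ?thesis .
qed

lemma integrable_M_mult_rad:
  fixes f :: "complex \<Rightarrow> 'a :: {banach, second_countable_topology}"
  assumes [measurable]: "f \<in> borel_measurable borel"
    and c: "\<And>r. r > 0 \<Longrightarrow> M (of_real r * cis \<theta>) \<noteq> 0 \<Longrightarrow> norm (f (of_real r * cis \<theta>)) \<le> c"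
  shows "integrable rad (\<lambda>r. M (of_real r * cis \<theta>) *\<^sub>R f (of_real r * cis \<theta>))"
proof (rule Bochner_Integration.integrable_bound)
  show "integrable rad (\<lambda>r. \<bar>M (of_real r * cis \<theta>)\<bar> * \<bar>c\<bar>)"
    using has_integral_abs_M_rad[of \<theta>] by (intro integrable_mult_left) (auto simp: has_bochner_integral_iff)
  show "AE r in rad. norm (M (of_real r * cis \<theta>) *\<^sub>R f (of_real r * cis \<theta>)) \<le> norm (\<bar>M (of_real r * cis \<theta>)\<bar> * \<bar>c\<bar>)"
    using AE_rad_pos
  proof eventually_elim
    case (elim r)
    then show ?case using c[OF elim]
      by (cases "M (of_real r * cis \<theta>) = 0") (auto simp: abs_mult intro!: mult_left_mono)
  qed
qed measurable

text \<open>Collapses the mass on a ray to its total \<open>m \<theta>\<close>, for a function that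
  varies little across the annulus; \<open>polar_estimate\<close> then integrates over the
  angle.\<close>

lemma radial_estimate:
  fixes f :: "complex \<Rightarrow> 'a :: {banach, second_countable_topology}"
  assumes [measurable]: "f \<in> borel_measurable borel"
    and c: "\<And>r. r > 0 \<Longrightarrow> M (of_real r * cis \<theta>) \<noteq> 0 \<Longrightarrow> norm (f (of_real r * cis \<theta>) - g) \<le> c"
  shows "norm ((LINT r|rad. M (of_real r * cis \<theta>) *\<^sub>R f (of_real r * cis \<theta>)) - m \<theta> *\<^sub>R g) \<le> c * \<bar>m \<theta>\<bar>"
proof -
  note h = has_integral_M_rad[of \<theta>] has_integral_abs_M_rad[of \<theta>]
  have i1: "integrable rad (\<lambda>r. M (of_real r * cis \<theta>) *\<^sub>R f (of_real r * cis \<theta>))"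
  proof (rule integrable_M_mult_rad[of _ _ "c + norm g"])
    fix r :: real assume "r > 0" "M (of_real r * cis \<theta>) \<noteq> 0"
    from c[OF this] show "norm (f (of_real r * cis \<theta>)) \<le> c + norm g"
      using norm_triangle_sub[of "f (of_real r * cis \<theta>)" g] by linarith
  qed simp
  have i2: "integrable rad (\<lambda>r. M (of_real r * cis \<theta>) *\<^sub>R g)"
    using h by (intro integrable_scaleR_left) (auto simp: has_bochner_integral_iff)
  have "(LINT r|rad. M (of_real r * cis \<theta>) *\<^sub>R f (of_real r * cis \<theta>)) - m \<theta> *\<^sub>R g =
      (LINT r|rad. M (of_real r * cis \<theta>) *\<^sub>R f (of_real r * cis \<theta>) - M (of_real r * cis \<theta>) *\<^sub>R g)"
    using h i1 i2 by (auto simp: has_bochner_integral_iff)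
  also have "norm \<dots> \<le> (LINT r|rad. c * \<bar>M (of_real r * cis \<theta>)\<bar>)"
  proof (rule integral_norm_bound[THEN order_trans], rule integral_mono_AE)
    show "AE r in rad. norm (M (of_real r * cis \<theta>) *\<^sub>R f (of_real r * cis \<theta>) - M (of_real r * cis \<theta>) *\<^sub>R g)
        \<le> c * \<bar>M (of_real r * cis \<theta>)\<bar>"
      using AE_rad_pos
    proof eventually_elim
      case (elim r)
      show ?case
      proof (cases "M (of_real r * cis \<theta>) = 0")
        case False
        then show ?thesis using c[OF elim False]
          by (simp add: mult.commute[of c] mult_left_mono flip: scaleR_diff_right)
      qed simp
    qed
    show "integrable rad (\<lambda>r. c * \<bar>M (of_real r * cis \<theta>)\<bar>)"
      using h by (intro integrable_mult_right) (auto simp: has_bochner_integral_iff)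
  qed (use i1 i2 in \<open>auto intro!: integrable_norm\<close>)
  also have "\<dots> = c * \<bar>m \<theta>\<bar>" using h by (auto simp: has_bochner_integral_iff)
  finally show ?thesis .
qed

lemma polar_estimate:
  fixes f :: "complex \<Rightarrow> 'a :: {banach, second_countable_topology}"
  assumes f [measurable]: "f \<in> borel_measurable borel" and B: "\<And>z. norm z < 2 \<Longrightarrow> norm (f z) \<le> B"
    and c: "\<And>r \<theta>. r > 0 \<Longrightarrow> M (of_real r * cis \<theta>) \<noteq> 0 \<Longrightarrow> norm (f (of_real r * cis \<theta>) - g \<theta>) \<le> c \<theta>"
    and g: "integrable circ (\<lambda>\<theta>. m \<theta> *\<^sub>R g \<theta>)" and ci: "integrable circ (\<lambda>\<theta>. c \<theta> * \<bar>m \<theta>\<bar>)"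
  shows "norm ((LINT z|lborel. M z *\<^sub>R f z) - (LINT \<theta>|circ. m \<theta> *\<^sub>R g \<theta>)) \<le> (LINT \<theta>|circ. c \<theta> * \<bar>m \<theta>\<bar>)"
proof -
  have i: "integrable lborel (\<lambda>z. M z *\<^sub>R f z)"
    by (rule integrable_M_mult[OF f]) (rule B)
  have ip: "integrable (circ \<Otimes>\<^sub>M rad) (\<lambda>(\<theta>, r). M (of_real r * cis \<theta>) *\<^sub>R f (of_real r * cis \<theta>))"
    using i by (subst (asm) integrable_polar) auto
  have i2: "integrable circ (\<lambda>\<theta>. LINT r|rad. M (of_real r * cis \<theta>) *\<^sub>R f (of_real r * cis \<theta>))"
    using circ_rad.integrable_fst'[OF ip] by simp
  have "(LINT z|lborel. M z *\<^sub>R f z) - (LINT \<theta>|circ. m \<theta> *\<^sub>R g \<theta>) =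
     (LINT \<theta>|circ. (LINT r|rad. M (of_real r * cis \<theta>) *\<^sub>R f (of_real r * cis \<theta>)) - m \<theta> *\<^sub>R g \<theta>)"
    by (simp only: integral_polar[OF i] Bochner_Integration.integral_diff[OF i2 g])
  also have "norm \<dots> \<le> (LINT \<theta>|circ. c \<theta> * \<bar>m \<theta>\<bar>)"
    by (rule integral_norm_bound[THEN order_trans], rule integral_mono)
       (use i2 g ci radial_estimate[OF f c] in auto)
  finally show ?thesis .
qed

definition N2 :: real where "N2 = (LINT \<theta>|circ. (m \<theta>)\<^sup>2)"
definition L1 :: real where "L1 = (LINT \<theta>|circ. \<bar>m \<theta>\<bar>)"

lemma integrable_m: "integrable circ m" "integrable circ (\<lambda>\<theta>. \<bar>m \<theta>\<bar>)" "integrable circ (\<lambda>\<theta>. (m \<theta>)\<^sup>2)"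
  using abs_m_le by (auto intro!: integrable_circ_bounded[of _ 1] simp: abs_square_le_1)

text \<open>The Cauchy-Schwarz inequality, as nonnegativity of the variance of |m|.\<close>

lemma L1_N2: "L1 \<ge> 0" "N2 \<ge> 0" "L1\<^sup>2 \<le> 2 * pi * N2"
proof -
  show "L1 \<ge> 0" "N2 \<ge> 0" unfolding L1_def N2_def by (auto intro!: integral_nonneg_AE)
  define a where "a = L1 / (2 * pi)"
  have "0 \<le> (LINT \<theta>|circ. (\<bar>m \<theta>\<bar> - a)\<^sup>2)" by (auto intro!: integral_nonneg_AE)
  also have "(\<lambda>\<theta>. (\<bar>m \<theta>\<bar> - a)\<^sup>2) = (\<lambda>\<theta>. (m \<theta>)\<^sup>2 - 2 * a * \<bar>m \<theta>\<bar> + a\<^sup>2)"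
    by (auto simp: power2_eq_square algebra_simps)
  also have "(LINT \<theta>|circ. (m \<theta>)\<^sup>2 - 2 * a * \<bar>m \<theta>\<bar> + a\<^sup>2) = N2 - 2 * a * L1 + 2 * pi * a\<^sup>2"
    using integrable_m by (simp add: N2_def L1_def measure_circ)
  also have "\<dots> = N2 - L1\<^sup>2 / (2 * pi)" by (simp add: a_def power2_eq_square field_simps)
  finally show "L1\<^sup>2 \<le> 2 * pi * N2" by (simp add: field_simps)
qed

text \<open>On the support of \<open>M\<close> the function z^k is within 3 \<kappa> of cis (k
  \<theta>), so a vanishing moment makes the Fourier mode small relative to
  \<open>L1\<close>.\<close>

lemma fcoeff_small:
  assumes k: "k = 1 \<or> k = 2" and mom: "(LINT z|lborel. M z *\<^sub>R z ^ k) = 0"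
  shows "norm (fcoeff m k) \<le> 3 * \<kappa> * L1"
proof -
  have "norm ((LINT z|lborel. M z *\<^sub>R z ^ k) - (LINT \<theta>|circ. m \<theta> *\<^sub>R cis (real k * \<theta>))) \<le> (LINT \<theta>|circ. 3 * \<kappa> * \<bar>m \<theta>\<bar>)"
  proof (rule polar_estimate[of _ "2 ^ k"])
    show "norm (z ^ k) \<le> 2 ^ k" if "norm z < 2" for z :: complex
      using that by (auto simp: norm_power intro: power_mono)
    fix r \<theta> :: real assume r: "r > 0" "M (of_real r * cis \<theta>) \<noteq> 0"
    have b: "1 - \<kappa> \<le> r" "r \<le> 1 + \<kappa>" using M_support[OF r(2)] r(1) by (auto simp: norm_mult)
    have "(of_real r * cis \<theta>) ^ k - cis (real k * \<theta>) = of_real (r ^ k - 1) * cis (real k * \<theta>)"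
      by (simp add: power_mult_distrib Complex.DeMoivre algebra_simps)
    then have "norm ((of_real r * cis \<theta>) ^ k - cis (real k * \<theta>)) = \<bar>r ^ k - 1\<bar>"
      by (simp only: norm_mult norm_of_real norm_cis mult_1_right)
    also have "\<dots> \<le> 3 * \<kappa>"
    proof (cases "k = 1")
      case False
      then have e: "r ^ k - 1 = (r - 1) * (r + 1)" using k by (auto simp: power2_eq_square algebra_simps)
      have "\<bar>r - 1\<bar> * \<bar>r + 1\<bar> \<le> \<kappa> * 3" using b \<kappa> by (intro mult_mono) auto
      then show ?thesis unfolding e abs_mult by simp
    qed (use b \<kappa> in auto)
    finally show "norm ((of_real r * cis \<theta>) ^ k - cis (real k * \<theta>)) \<le> 3 * \<kappa>" .
  next
    show "integrable circ (\<lambda>\<theta>. m \<theta> *\<^sub>R cis (real k * \<theta>))"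
      using abs_m_le by (intro integrable_circ_bounded[of _ 1]) auto
  qed (use integrable_m in auto)
  then show ?thesis unfolding mom by (simp add: L1_def fcoeff_def scaleR_conv_of_real)
qed

section \<open>Replacing the kernel in the annulus by a convolution on the circle\<close>

definition K :: real where "K = - 2 * pi * (ln ((1 - \<kappa>) / (1 + \<kappa>)) + ln (1 - \<kappa>))"

lemma K_le: "0 \<le> K" "K \<le> 40 * \<kappa>"
proof -
  have 1: "- ln (1 - \<kappa>) \<le> 2 * \<kappa>"
  proof -
    have "1 \<le> (1 + 2 * \<kappa>) * (1 - \<kappa>)" using \<kappa> mult_mono[of \<kappa> "1/2" \<kappa> \<kappa>] by (simp add: algebra_simps)
    then have "1 / (1 - \<kappa>) \<le> 1 + 2 * \<kappa>" using \<kappa> by (simp add: pos_divide_le_eq)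
    moreover have "ln (1 / (1 - \<kappa>)) \<le> 1 / (1 - \<kappa>) - 1" using \<kappa> by (intro ln_le_minus_one) auto
    ultimately show ?thesis using \<kappa> by (simp add: ln_div)
  qed
  have 2: "ln (1 + \<kappa>) \<le> \<kappa>" using \<kappa> by (intro ln_add_one_self_le_self) auto
  have 3: "ln (1 - \<kappa>) \<le> 0" "0 \<le> ln (1 + \<kappa>)" using \<kappa> by auto
  have e: "K = 2 * pi * (ln (1 + \<kappa>) + 2 * (- ln (1 - \<kappa>)))" using \<kappa> by (simp add: K_def ln_div algebra_simps)
  show "0 \<le> K" unfolding e using 3 by (intro mult_nonneg_nonneg) auto
  have "K \<le> 2 * pi * (5 * \<kappa>)" unfolding e using 1 2 by (intro mult_left_mono) auto
  also have "\<dots> \<le> 2 * 4 * (5 * \<kappa>)" using pi_less_4 \<kappa> by (intro mult_right_mono) auto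
  finally show "K \<le> 40 * \<kappa>" by simp
qed

lemma log_error_facts:
  "integrable circ (\<lambda>t. log_error \<kappa> (t - \<theta>))" "(LINT t|circ. log_error \<kappa> (t - \<theta>)) = K"
  "integrable circ (\<lambda>t. log_error \<kappa> (\<theta> - t))" "(LINT t|circ. log_error \<kappa> (\<theta> - t)) = K"
  "AE t in circ. 0 \<le> log_error \<kappa> (t - \<theta>)"
proof -
  have k: "\<kappa> < 1" using \<kappa> by simp
  show 1: "integrable circ (\<lambda>t. log_error \<kappa> (t - \<theta>))" "(LINT t|circ. log_error \<kappa> (t - \<theta>)) = K"
    using integrable_log_error[OF \<kappa>(1) k] integral_log_error[OF \<kappa>(1) k] by (auto simp: K_def)
  have "log_error \<kappa> (\<theta> - t) = log_error \<kappa> (t - \<theta>)" for t using log_error_minus[of \<kappa> "t - \<theta>"] by simp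
  then show "integrable circ (\<lambda>t. log_error \<kappa> (\<theta> - t))" "(LINT t|circ. log_error \<kappa> (\<theta> - t)) = K"
    using 1 by simp_all
  show "AE t in circ. 0 \<le> log_error \<kappa> (t - \<theta>)"
    using AE_cis_neq_1[of \<theta>]
    by eventually_elim (rule order_trans[OF abs_ge_zero log_kernel_compare[OF \<kappa>(1) k, of 1 1]], use \<kappa> in auto)
qed

text \<open>Bounds, at every point of the ray \<theta> within the annulus, the error made by using
  \<open>G\<close> for the difference of the potentials.\<close>

definition H :: "real \<Rightarrow> real" where "H \<theta> = (LINT \<phi>|circ. log_error \<kappa> (\<phi> - \<theta>) * \<bar>m \<phi>\<bar>)"

definition G :: "real \<Rightarrow> real" where
  "G \<theta> = (LINT \<phi>|circ. ln (norm (1 - of_real ((1 - \<kappa>) / (1 + \<kappa>)) * cis (\<phi> - \<theta>))) * m \<phi>)"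

lemma integrable_log_error_m: "integrable circ (\<lambda>\<phi>. log_error \<kappa> (\<phi> - \<theta>) * \<bar>m \<phi>\<bar>)"
proof (rule Bochner_Integration.integrable_bound[OF log_error_facts(1)[of \<theta>]])
  show "AE \<phi> in circ. norm (log_error \<kappa> (\<phi> - \<theta>) * \<bar>m \<phi>\<bar>) \<le> norm (log_error \<kappa> (\<phi> - \<theta>))"
    using abs_m_le by (auto simp: abs_mult intro!: mult_left_le)
qed measurable

lemma measurable_H [measurable]: "H \<in> borel_measurable borel"
  and measurable_G [measurable]: "G \<in> borel_measurable borel"
  unfolding H_def G_def by measurable

lemma H_bounds: "0 \<le> H \<theta>" "H \<theta> \<le> K"
proof -
  show "0 \<le> H \<theta>" unfolding H_def
    using log_error_facts(5)[of \<theta>] by (intro integral_nonneg_AE) (auto elim!: eventually_mono)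
  have "H \<theta> \<le> (LINT \<phi>|circ. log_error \<kappa> (\<phi> - \<theta>))" unfolding H_def
    using log_error_facts(5)[of \<theta>] abs_m_le
    by (intro integral_mono_AE integrable_log_error_m log_error_facts) (auto elim!: eventually_mono intro!: mult_left_le)
  then show "H \<theta> \<le> K" by (simp add: log_error_facts)
qed

text \<open>Schur's test: a nonnegative symmetric kernel whose integral in each variable is
  \<open>K\<close>, together with 2 |m \<phi>| |m \<theta>| <= m \<phi>^2 + m \<theta>^2.\<close>

lemma log_error_energy: "(LINT \<theta>|circ. H \<theta> * \<bar>m \<theta>\<bar>) \<le> K * N2"
proof -
  have cc: "pair_sigma_finite circ circ" ..
  interpret cc: pair_sigma_finite circ circ by (rule cc)
  have ik: "integrable (circ \<Otimes>\<^sub>M circ) (\<lambda>(\<theta>, \<phi>). log_error \<kappa> (\<phi> - \<theta>))"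
  proof (rule cc.Fubini_integrable)
    have "(LINT \<phi>|circ. norm (log_error \<kappa> (\<phi> - \<theta>))) = K" for \<theta>
    proof -
      have "(LINT \<phi>|circ. norm (log_error \<kappa> (\<phi> - \<theta>))) = (LINT \<phi>|circ. log_error \<kappa> (\<phi> - \<theta>))"
        using log_error_facts(5)[of \<theta>] by (intro integral_cong_AE) (auto elim!: eventually_mono)
      then show ?thesis by (simp add: log_error_facts)
    qed
    then show "integrable circ (\<lambda>\<theta>. LINT \<phi>|circ. norm (case (\<theta>, \<phi>) of (\<theta>, \<phi>) \<Rightarrow> log_error \<kappa> (\<phi> - \<theta>)))"
      by simp
    show "AE \<theta> in circ. integrable circ (\<lambda>\<phi>. case (\<theta>, \<phi>) of (\<theta>, \<phi>) \<Rightarrow> log_error \<kappa> (\<phi> - \<theta>))"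
      using log_error_facts(1) by simp
  qed measurable
  have b: "\<bar>log_error \<kappa> (\<phi> - \<theta>) * (m a)\<^sup>2\<bar> \<le> \<bar>log_error \<kappa> (\<phi> - \<theta>)\<bar>" for \<theta> \<phi> a
    using abs_m_le[of a] by (simp add: abs_mult mult_left_le abs_square_le_1)
  have i1: "integrable (circ \<Otimes>\<^sub>M circ) (\<lambda>(\<theta>, \<phi>). log_error \<kappa> (\<phi> - \<theta>) * (m \<theta>)\<^sup>2)"
    by (rule Bochner_Integration.integrable_bound[OF ik]) (use b in \<open>auto simp: case_prod_unfold\<close>)
  have i2: "integrable (circ \<Otimes>\<^sub>M circ) (\<lambda>(\<theta>, \<phi>). log_error \<kappa> (\<phi> - \<theta>) * (m \<phi>)\<^sup>2)"
    by (rule Bochner_Integration.integrable_bound[OF ik]) (use b in \<open>auto simp: case_prod_unfold\<close>)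
  have j1: "(LINT \<phi>|circ. log_error \<kappa> (\<phi> - \<theta>) * (m \<theta>)\<^sup>2) = K * (m \<theta>)\<^sup>2" for \<theta>
    using log_error_facts(1,2)[of \<theta>] by simp
  have j2: "(LINT \<theta>|circ. LINT \<phi>|circ. log_error \<kappa> (\<phi> - \<theta>) * (m \<phi>)\<^sup>2) = K * N2"
  proof -
    have "(LINT \<theta>|circ. LINT \<phi>|circ. log_error \<kappa> (\<phi> - \<theta>) * (m \<phi>)\<^sup>2) = (LINT \<phi>|circ. LINT \<theta>|circ. log_error \<kappa> (\<phi> - \<theta>) * (m \<phi>)\<^sup>2)"
      using cc.Fubini_integral[OF i2] by simp
    also have "\<dots> = (LINT \<phi>|circ. K * (m \<phi>)\<^sup>2)"
      using log_error_facts(3,4) by (intro Bochner_Integration.integral_cong refl) simp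
    finally show ?thesis by (simp add: N2_def)
  qed
  have im: "integrable circ (\<lambda>\<phi>. log_error \<kappa> (\<phi> - \<theta>) * (m \<phi>)\<^sup>2)" for \<theta>
    by (rule Bochner_Integration.integrable_bound[OF log_error_facts(1)[of \<theta>]]) (use b in auto)
  have i3: "integrable circ (\<lambda>\<theta>. LINT \<phi>|circ. log_error \<kappa> (\<phi> - \<theta>) * (m \<phi>)\<^sup>2)"
    using cc.integrable_fst'[OF i2] by simp
  have "(LINT \<theta>|circ. H \<theta> * \<bar>m \<theta>\<bar>) \<le> (LINT \<theta>|circ. (K * (m \<theta>)\<^sup>2 + (LINT \<phi>|circ. log_error \<kappa> (\<phi> - \<theta>) * (m \<phi>)\<^sup>2)) / 2)"
  proof (rule integral_mono)
    fix \<theta>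
    have "H \<theta> * \<bar>m \<theta>\<bar> = (LINT \<phi>|circ. log_error \<kappa> (\<phi> - \<theta>) * \<bar>m \<phi>\<bar> * \<bar>m \<theta>\<bar>)" by (simp add: H_def)
    also have "\<dots> \<le> (LINT \<phi>|circ. (log_error \<kappa> (\<phi> - \<theta>) * (m \<theta>)\<^sup>2 + log_error \<kappa> (\<phi> - \<theta>) * (m \<phi>)\<^sup>2) / 2)"
    proof (rule integral_mono_AE)
      show "AE \<phi> in circ. log_error \<kappa> (\<phi> - \<theta>) * \<bar>m \<phi>\<bar> * \<bar>m \<theta>\<bar> \<le> (log_error \<kappa> (\<phi> - \<theta>) * (m \<theta>)\<^sup>2 + log_error \<kappa> (\<phi> - \<theta>) * (m \<phi>)\<^sup>2) / 2"
        using log_error_facts(5)[of \<theta>]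
      proof eventually_elim
        case (elim \<phi>)
        have "0 \<le> (\<bar>m \<phi>\<bar> - \<bar>m \<theta>\<bar>)\<^sup>2" by simp
        then have "\<bar>m \<phi>\<bar> * \<bar>m \<theta>\<bar> \<le> ((m \<theta>)\<^sup>2 + (m \<phi>)\<^sup>2) / 2" by (simp add: power2_diff)
        from mult_left_mono[OF this elim] show ?case by (simp add: distrib_left mult.assoc)
      qed
    qed (use integrable_log_error_m[of \<theta>] im[of \<theta>] log_error_facts(1)[of \<theta>] in auto)
    also have "\<dots> = (K * (m \<theta>)\<^sup>2 + (LINT \<phi>|circ. log_error \<kappa> (\<phi> - \<theta>) * (m \<phi>)\<^sup>2)) / 2"
      using im[of \<theta>] log_error_facts(1)[of \<theta>] by (simp add: log_error_facts(2))
    finally show "H \<theta> * \<bar>m \<theta>\<bar> \<le> (K * (m \<theta>)\<^sup>2 + (LINT \<phi>|circ. log_error \<kappa> (\<phi> - \<theta>) * (m \<phi>)\<^sup>2)) / 2" .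
  next
    show "integrable circ (\<lambda>\<theta>. H \<theta> * \<bar>m \<theta>\<bar>)"
    proof (rule integrable_circ_bounded[of _ "K * 1"])
      show "norm (H \<theta> * \<bar>m \<theta>\<bar>) \<le> K * 1" for \<theta>
        unfolding real_norm_def abs_mult abs_abs abs_of_nonneg[OF H_bounds(1)]
        by (intro mult_mono H_bounds abs_m_le K_le) auto
    qed measurable
  qed (use integrable_m i3 in auto)
  also have "\<dots> = K * N2"
    using integrable_m i3 by (simp add: j2) (simp add: N2_def)
  finally show ?thesis .
qed

text \<open>The mass of \<open>M\<close> on each ray sits in the annulus, where
  \<open>log_kernel_compare\<close> replaces the kernel by one that depends on the angles only.
  Hence neither \<open>G\<close> nor \<open>H\<close> involves the radius \<open>r\<close>.\<close>

lemma pot_diff_estimate: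
  assumes r: "1 - \<kappa> \<le> r" "r \<le> 1 + \<kappa>"
  shows "\<bar>2 * pi * (pot U (of_real r * cis \<theta>) - pot V (of_real r * cis \<theta>)) - G \<theta>\<bar> \<le> H \<theta>"
proof -
  define x where "x = of_real r * cis \<theta>"
  define l where "l y = ln (norm (x - y))" for y
  define L where "L \<phi> = ln (norm (1 - of_real ((1 - \<kappa>) / (1 + \<kappa>)) * cis (\<phi> - \<theta>)))" for \<phi>
  have lm [measurable]: "l \<in> borel_measurable borel" unfolding l_def by measurable
  have Lm [measurable]: "L \<in> borel_measurable borel" unfolding L_def by measurable
  have e: "M y *\<^sub>R l y = l y * indicat_real U y - l y * indicat_real V y" for y
    by (simp add: M_def algebra_simps)
  have iU: "integrable lborel (\<lambda>y. l y * indicat_real U y)" and iV: "integrable lborel (\<lambda>y. l y * indicat_real V y)"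
    unfolding l_def by (auto intro!: integrable_ln_norm U.bounded_U V.bounded_U)
  have i: "integrable lborel (\<lambda>y. M y *\<^sub>R l y)"
    unfolding e using iU iV by (rule Bochner_Integration.integrable_diff)
  have p: "2 * pi * (pot U x - pot V x) = (LINT y|lborel. M y *\<^sub>R l y)"
    unfolding e Bochner_Integration.integral_diff[OF iU iV] by (simp add: inv_laplacian_def l_def field_simps)
  have ip: "integrable (circ \<Otimes>\<^sub>M rad) (\<lambda>(\<phi>, s). M (of_real s * cis \<phi>) *\<^sub>R l (of_real s * cis \<phi>))"
    using i by (subst (asm) integrable_polar) auto
  have i2: "integrable circ (\<lambda>\<phi>. LINT s|rad. M (of_real s * cis \<phi>) *\<^sub>R l (of_real s * cis \<phi>))"
    using circ_rad.integrable_fst'[OF ip] by simp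
  have i3: "integrable circ (\<lambda>\<phi>. L \<phi> * m \<phi>)"
  proof (rule integrable_circ_bounded[of _ "- ln (1 - (1 - \<kappa>) / (1 + \<kappa>)) * 1"])
    fix \<phi>
    have "norm (of_real ((1 - \<kappa>) / (1 + \<kappa>)) * cis (\<phi> - \<theta>)) = (1 - \<kappa>) / (1 + \<kappa>)"
      using \<kappa> by (simp add: norm_mult del: of_real_divide)
    moreover have "(1 - \<kappa>) / (1 + \<kappa>) < 1" using \<kappa> by simp
    ultimately have "\<bar>L \<phi>\<bar> \<le> - ln (1 - (1 - \<kappa>) / (1 + \<kappa>))"
      unfolding L_def using abs_ln_norm_one_minus_le[of "of_real ((1 - \<kappa>) / (1 + \<kappa>)) * cis (\<phi> - \<theta>)"] by (simp only:)
    then show "norm (L \<phi> * m \<phi>) \<le> - ln (1 - (1 - \<kappa>) / (1 + \<kappa>)) * 1"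
      using abs_m_le[of \<phi>] unfolding real_norm_def abs_mult by (intro mult_mono) auto
  qed measurable
  have "\<bar>2 * pi * (pot U x - pot V x) - G \<theta>\<bar> =
      \<bar>LINT \<phi>|circ. (LINT s|rad. M (of_real s * cis \<phi>) *\<^sub>R l (of_real s * cis \<phi>)) - L \<phi> * m \<phi>\<bar>"
    unfolding p G_def L_def[symmetric] integral_polar[OF i] Bochner_Integration.integral_diff[OF i2 i3] ..
  also have "\<dots> \<le> (LINT \<phi>|circ. log_error \<kappa> (\<phi> - \<theta>) * \<bar>m \<phi>\<bar>)"
  proof (rule integral_abs_bound[THEN order_trans], rule integral_mono_AE)
    show "integrable circ (\<lambda>\<phi>. \<bar>(LINT s|rad. M (of_real s * cis \<phi>) *\<^sub>R l (of_real s * cis \<phi>)) - L \<phi> * m \<phi>\<bar>)"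
      by (intro integrable_abs Bochner_Integration.integrable_diff i2 i3)
    show "AE \<phi> in circ. \<bar>(LINT s|rad. M (of_real s * cis \<phi>) *\<^sub>R l (of_real s * cis \<phi>)) - L \<phi> * m \<phi>\<bar> \<le> log_error \<kappa> (\<phi> - \<theta>) * \<bar>m \<phi>\<bar>"
      using AE_cis_neq_1[of \<theta>]
    proof eventually_elim
      case (elim \<phi>)
      have "norm ((LINT s|rad. M (of_real s * cis \<phi>) *\<^sub>R l (of_real s * cis \<phi>)) - m \<phi> *\<^sub>R L \<phi>) \<le> log_error \<kappa> (\<phi> - \<theta>) * \<bar>m \<phi>\<bar>"
      proof (rule radial_estimate[OF lm])
        fix s :: real assume s: "s > 0" "M (of_real s * cis \<phi>) \<noteq> 0"
        have b: "1 - \<kappa> \<le> s" "s \<le> 1 + \<kappa>" using M_support[OF s(2)] s(1) by (auto simp: norm_mult)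
        have "\<kappa> < 1" using \<kappa> by simp
        from log_kernel_compare[OF \<kappa>(1) this r b elim]
        show "norm (l (of_real s * cis \<phi>) - L \<phi>) \<le> log_error \<kappa> (\<phi> - \<theta>)"
          unfolding l_def L_def x_def real_norm_def .
      qed
      then show ?case by (simp add: mult.commute)
    qed
  qed (rule integrable_log_error_m)
  finally show ?thesis unfolding x_def H_def .
qed

lemma integrable_H_m: "integrable circ (\<lambda>\<theta>. H \<theta> * \<bar>m \<theta>\<bar>)"
proof (rule integrable_circ_bounded[of _ "K * 1"])
  show "norm (H \<theta> * \<bar>m \<theta>\<bar>) \<le> K * 1" for \<theta>
    unfolding real_norm_def abs_mult abs_abs abs_of_nonneg[OF H_bounds(1)]
    by (intro mult_mono H_bounds abs_m_le K_le) auto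
qed measurable

section \<open>Energy estimates for two patches\<close>

lemma bounded_on_ball2:
  fixes f :: "complex \<Rightarrow> real"
  assumes "continuous_on UNIV f"
  obtains B where "\<And>z. norm z < 2 \<Longrightarrow> norm (f z) \<le> B"
proof -
  have "bounded (f ` cball 0 2)"
    by (intro compact_imp_bounded compact_continuous_image continuous_on_subset[OF assms]) auto
  then obtain B where "\<forall>y\<in>f ` cball 0 2. norm y \<le> B" by (auto simp: bounded_iff)
  then show ?thesis by (intro that[of B]) auto
qed

lemma moment_diff:
  assumes "(LINT z|patch U. z ^ k) = (LINT z|patch V. z ^ k)"
  shows "(LINT z|lborel. M z *\<^sub>R z ^ k) = 0"
proof -
  have i: "integrable lborel (\<lambda>z. indicat_real A z *\<^sub>R z ^ k)" if "A \<in> sets borel" "A \<subseteq> ball 0 (1 + \<kappa>)" for A :: "complex set"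
  proof (rule integrable_bounded_mult_indicator[of _ _ "2 ^ k"])
    show "bounded A" using that bounded_ball bounded_subset by blast
    fix z assume "z \<in> A"
    then have "norm z \<le> 2" using that \<kappa> by auto
    then show "norm (z ^ k) \<le> 2 ^ k" by (auto simp: norm_power intro: power_mono)
  qed (use that in auto)
  have "(LINT z|lborel. M z *\<^sub>R z ^ k) = (LINT z|lborel. indicat_real U z *\<^sub>R z ^ k) - (LINT z|lborel. indicat_real V z *\<^sub>R z ^ k)"
    unfolding M_def scaleR_diff_left using U.U_sub V.U_sub by (intro Bochner_Integration.integral_diff i) auto
  also have "\<dots> = 0"
    using assms by (subst (asm) (1 2) integral_patch) auto
  finally show ?thesis .
qed

text \<open>For a symmetric kernel the difference of the two energies is the integral of
  \<open>M\<close> against the sum of the two potentials. Near the circle each potential is (pi / 2)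
  z^2 up to 57 \<kappa>, and pi z^2 is annihilated by the equality of the second moments.\<close>

lemma kratio_energy_diff:
  assumes mom2: "(LINT z|lborel. M z *\<^sub>R z\<^sup>2) = 0"
  shows "norm ((LINT z|patch U. LINT w|patch U. kratio (z - w)) - (LINT z|patch V. LINT w|patch V. kratio (z - w))) \<le> 114 * \<kappa> * L1"
proof -
  interpret PU: finite_measure "patch U" by (rule U.finite_patch)
  interpret PV: finite_measure "patch V" by (rule V.finite_patch)
  interpret UV: pair_sigma_finite "patch U" "patch V" ..
  define gU gV where "gU z = (LINT w|patch U. kratio (z - w))" and "gV z = (LINT w|patch V. kratio (z - w))" for z
  have [measurable]: "gU \<in> borel_measurable borel" "gV \<in> borel_measurable borel"
    unfolding gU_def gV_def by measurable
  have bU: "norm (gU z) \<le> measure (patch U) UNIV" and bV: "norm (gV z) \<le> measure (patch V) UNIV" for z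
  proof -
    have "norm (gU z) \<le> (LINT w|patch U. 1)" unfolding gU_def
      by (rule integral_norm_bound[THEN order_trans], rule integral_mono)
         (auto intro!: PU.integrable_const_bound[of _ 1] simp: norm_kratio_le)
    then show "norm (gU z) \<le> measure (patch U) UNIV" by simp
    have "norm (gV z) \<le> (LINT w|patch V. 1)" unfolding gV_def
      by (rule integral_norm_bound[THEN order_trans], rule integral_mono)
         (auto intro!: PV.integrable_const_bound[of _ 1] simp: norm_kratio_le)
    then show "norm (gV z) \<le> measure (patch V) UNIV" by simp
  qed
  have iA: "integrable lborel (\<lambda>z. indicat_real A z *\<^sub>R g z)"
    if "bounded A" "A \<in> sets borel" "g = gU \<or> g = gV" for A g
    using that bU bV
    by (intro integrable_bounded_mult_indicator[of _ _ "max (measure (patch U) UNIV) (measure (patch V) UNIV)"])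
       (auto simp: le_max_iff_disj)
  have sym: "kratio (- z) = kratio z" for z by (simp add: kratio_def)
  have swap: "(LINT z|patch V. gU z) = (LINT z|patch U. gV z)"
  proof -
    have fp: "finite_measure (patch U \<Otimes>\<^sub>M patch V)"
      by (rule finite_measure_pair_measure) unfold_locales
    have "integrable (patch U \<Otimes>\<^sub>M patch V) (\<lambda>(w, z). kratio (z - w))"
      by (intro finite_measure.integrable_const_bound[OF fp, of _ 1]) (auto simp: norm_kratio_le)
    from UV.Fubini_integral[OF this]
    have "(LINT z|patch V. gU z) = (LINT w|patch U. LINT z|patch V. kratio (z - w))" unfolding gU_def by simp
    also have "\<dots> = (LINT z|patch U. gV z)"
      unfolding gV_def using sym[of "_ - _"] by (intro Bochner_Integration.integral_cong refl) (metis minus_diff_eq)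
    finally show ?thesis .
  qed
  have iM: "integrable lborel (\<lambda>z. M z *\<^sub>R g z)" if "g = gU \<or> g = gV" for g
    unfolding M_def scaleR_diff_left
    by (intro Bochner_Integration.integrable_diff iA U.bounded_U V.bounded_U that) auto
  have Mg: "(LINT z|lborel. M z *\<^sub>R g z) = (LINT z|patch U. g z) - (LINT z|patch V. g z)" if "g = gU \<or> g = gV" for g
  proof -
    have [measurable]: "g \<in> borel_measurable borel" using that by auto
    have "(LINT z|lborel. M z *\<^sub>R g z) = (LINT z|lborel. indicat_real U z *\<^sub>R g z) - (LINT z|lborel. indicat_real V z *\<^sub>R g z)"
      unfolding M_def scaleR_diff_left
      by (intro Bochner_Integration.integral_diff iA U.bounded_U V.bounded_U that) auto
    then show ?thesis by (subst (1 2) integral_patch) auto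
  qed
  define f where "f z = gU z + gV z - pi *\<^sub>R z\<^sup>2" for z
  have i2: "integrable lborel (\<lambda>z. M z *\<^sub>R (pi *\<^sub>R z\<^sup>2))"
    by (rule integrable_M_mult[of _ "pi * 4"]) (auto simp: norm_power intro!: power_mono[of _ 2 2, simplified])
  have "(LINT z|lborel. M z *\<^sub>R f z) = (LINT z|lborel. M z *\<^sub>R gU z) + (LINT z|lborel. M z *\<^sub>R gV z) - (LINT z|lborel. M z *\<^sub>R (pi *\<^sub>R z\<^sup>2))"
    unfolding f_def scaleR_diff_right scaleR_add_right using iM i2 by simp
  also have "(LINT z|lborel. M z *\<^sub>R (pi *\<^sub>R z\<^sup>2)) = pi *\<^sub>R (LINT z|lborel. M z *\<^sub>R z\<^sup>2)"
    by (simp only: scaleR_left_commute[of _ pi] integral_scaleR_right)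
  also have "\<dots> = 0" using mom2 by simp
  finally have e: "(LINT z|patch U. gU z) - (LINT z|patch V. gV z) = (LINT z|lborel. M z *\<^sub>R f z)"
    by (simp add: Mg swap)
  have "norm ((LINT z|lborel. M z *\<^sub>R f z) - (LINT \<theta>|circ. m \<theta> *\<^sub>R 0)) \<le> (LINT \<theta>|circ. 114 * \<kappa> * \<bar>m \<theta>\<bar>)"
  proof (rule polar_estimate)
    fix r \<theta> :: real assume r: "r > 0" "M (of_real r * cis \<theta>) \<noteq> 0"
    define z where "z = of_real r * cis \<theta>"
    have z: "1 - \<kappa> \<le> norm z" "norm z \<le> 1 + \<kappa>" using M_support[OF r(2)] by (auto simp: z_def)
    have "f z = (gU z - (pi / 2) *\<^sub>R z\<^sup>2) + (gV z - (pi / 2) *\<^sub>R z\<^sup>2)"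
      by (simp add: f_def scaleR_conv_of_real algebra_simps)
    also have "norm \<dots> \<le> 57 * \<kappa> + 57 * \<kappa>"
      unfolding gU_def gV_def by (intro norm_triangle_le add_mono U.kratio_near V.kratio_near z)
    finally show "norm (f (of_real r * cis \<theta>) - 0) \<le> 114 * \<kappa>" by (simp add: z_def)
  next
    fix z :: complex assume "norm z < 2"
    then have "norm (pi *\<^sub>R z\<^sup>2) \<le> pi * 4" using power_mono[of "norm z" 2 2] by (simp add: norm_power)
    then show "norm (f z) \<le> measure (patch U) UNIV + measure (patch V) UNIV + pi * 4"
      unfolding f_def using bU[of z] bV[of z] by (intro norm_triangle_le_diff add_mono norm_triangle_le) auto
  next
    show "f \<in> borel_measurable borel" unfolding f_def by measurable
  qed (use integrable_m in auto)
  then show ?thesis unfolding gU_def[symmetric] gV_def[symmetric] e by (simp add: L1_def)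
qed

text \<open>Each bracket in \<open>f\<close> vanishes on its own boundary and increases along rays.
  At a point of one patch outside the other, the brackets have opposite signs and their sizes add up
  to at least 22/100 times the gap between the boundaries.\<close>

lemma relative_energy_le:
  assumes \<Omega>: "\<bar>\<Omega> - 1/4\<bar> \<le> \<kappa>" "\<bar>\<Omega>' - 1/4\<bar> \<le> \<kappa>" and x0: "norm x0 \<le> \<kappa>"
    and stU: "\<And>\<theta>. pot U (of_real (R \<theta>) * cis \<theta>) - \<Omega> / 2 * (norm (of_real (R \<theta>) * cis \<theta> - x0))\<^sup>2 = CU"
    and stV: "\<And>\<theta>. pot V (of_real (S \<theta>) * cis \<theta>) - \<Omega>' / 2 * (norm (of_real (S \<theta>) * cis \<theta> - x0))\<^sup>2 = CV"
  defines "f \<equiv> \<lambda>z. (pot U z - \<Omega> / 2 * (norm (z - x0))\<^sup>2 - CU) - (pot V z - \<Omega>' / 2 * (norm (z - x0))\<^sup>2 - CV)"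
  shows "(LINT z|lborel. M z *\<^sub>R f z) \<le> - (21/100) * N2"
proof -
  have cf: "continuous_on UNIV f" unfolding f_def
    by (intro continuous_intros continuous_pot U.bounded_U V.bounded_U U.U_borel V.U_borel)
  have fm [measurable]: "f \<in> borel_measurable borel" using cf by (rule borel_measurable_continuous_onI)
  obtain B where B: "\<And>z. norm z < 2 \<Longrightarrow> norm (f z) \<le> B" using bounded_on_ball2[OF cf] by blast
  have i: "integrable lborel (\<lambda>z. M z *\<^sub>R f z)" by (rule integrable_M_mult[OF fm]) (rule B)
  have ip: "integrable (circ \<Otimes>\<^sub>M rad) (\<lambda>(\<theta>, r). M (of_real r * cis \<theta>) *\<^sub>R f (of_real r * cis \<theta>))"
    using i by (subst (asm) integrable_polar) auto
  have i2: "integrable circ (\<lambda>\<theta>. LINT r|rad. M (of_real r * cis \<theta>) *\<^sub>R f (of_real r * cis \<theta>))"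
    using circ_rad.integrable_fst'[OF ip] by simp
  have inner: "(LINT r|rad. M (of_real r * cis \<theta>) *\<^sub>R f (of_real r * cis \<theta>)) \<le> - (21/100) * (m \<theta>)\<^sup>2" for \<theta>
  proof -
    note h = has_integral_abs_M_rad[of \<theta>]
    have pw: "M (of_real r * cis \<theta>) *\<^sub>R f (of_real r * cis \<theta>) \<le> - (22/100 * \<bar>R \<theta> - S \<theta>\<bar>) * \<bar>M (of_real r * cis \<theta>)\<bar>"
      if r: "r > 0" for r
    proof (cases "M (of_real r * cis \<theta>) = 0")
      case False
      have b1: "1 - \<kappa> \<le> r" "r \<le> 1 + \<kappa>" using M_support[OF False] r by (auto simp: norm_mult)
      note sU = radial_slope[OF \<kappa> U.U_borel U.U_sub \<Omega>(1) x0, of _ _ \<theta>]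
      note sV = radial_slope[OF \<kappa> V.U_borel V.U_sub \<Omega>(2) x0, of _ _ \<theta>]
      define a b where "a t = pot U (of_real t * cis \<theta>) - \<Omega> / 2 * (norm (of_real t * cis \<theta> - x0))\<^sup>2"
        and "b t = pot V (of_real t * cis \<theta>) - \<Omega>' / 2 * (norm (of_real t * cis \<theta> - x0))\<^sup>2" for t
      have f: "f (of_real r * cis \<theta>) = (a r - a (R \<theta>)) - (b r - b (S \<theta>))"
        by (simp only: f_def a_def b_def stU[of \<theta>] stV[of \<theta>])
      from M_between[OF r False] show ?thesis
      proof
        assume c: "S \<theta> \<le> r \<and> r < R \<theta> \<and> M (of_real r * cis \<theta>) = 1"
        have "22/100 * (R \<theta> - r) \<le> a (R \<theta>) - a r"
          unfolding a_def by (rule sU) (use c b1 U.R[of \<theta>] in auto)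
        moreover have "22/100 * (r - S \<theta>) \<le> b r - b (S \<theta>)"
          unfolding b_def by (rule sV) (use c b1 V.R[of \<theta>] in auto)
        ultimately have "a r - a (R \<theta>) - (b r - b (S \<theta>)) \<le> - (22/100 * (R \<theta> - S \<theta>))"
          unfolding right_diff_distrib by linarith
        moreover have "\<bar>R \<theta> - S \<theta>\<bar> = R \<theta> - S \<theta>" "M (of_real r * cis \<theta>) = 1" using c by simp_all
        ultimately show ?thesis by (simp only: f real_scaleR_def abs_one mult_1_right mult_1_left)
      next
        assume c: "R \<theta> \<le> r \<and> r < S \<theta> \<and> M (of_real r * cis \<theta>) = -1"
        have "22/100 * (r - R \<theta>) \<le> a r - a (R \<theta>)"
          unfolding a_def by (rule sU) (use c b1 U.R[of \<theta>] in auto)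
        moreover have "22/100 * (S \<theta> - r) \<le> b (S \<theta>) - b r"
          unfolding b_def by (rule sV) (use c b1 V.R[of \<theta>] in auto)
        ultimately have "- (a r - a (R \<theta>) - (b r - b (S \<theta>))) \<le> - (22/100 * (S \<theta> - R \<theta>))"
          unfolding right_diff_distrib by linarith
        moreover have "\<bar>R \<theta> - S \<theta>\<bar> = S \<theta> - R \<theta>" "M (of_real r * cis \<theta>) = -1" using c by simp_all
        ultimately show ?thesis by (simp only: f real_scaleR_def abs_neg_one mult_1_right mult_minus1)
      qed
    qed simp
    have "(LINT r|rad. M (of_real r * cis \<theta>) *\<^sub>R f (of_real r * cis \<theta>)) \<le>
        (LINT r|rad. - (22/100 * \<bar>R \<theta> - S \<theta>\<bar>) * \<bar>M (of_real r * cis \<theta>)\<bar>)"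
    proof (rule integral_mono_AE)
      show "integrable rad (\<lambda>r. M (of_real r * cis \<theta>) *\<^sub>R f (of_real r * cis \<theta>))"
      proof (rule integrable_M_mult_rad[OF fm])
        fix r :: real assume "r > 0" "M (of_real r * cis \<theta>) \<noteq> 0"
        then show "norm (f (of_real r * cis \<theta>)) \<le> B" using M_support \<kappa> by (intro B) force
      qed
      show "integrable rad (\<lambda>r. - (22/100 * \<bar>R \<theta> - S \<theta>\<bar>) * \<bar>M (of_real r * cis \<theta>)\<bar>)"
        using h by (intro integrable_mult_right) (auto simp: has_bochner_integral_iff)
    qed (use AE_rad_pos pw in \<open>auto elim!: eventually_mono\<close>)
    also have "\<dots> = - (22/100 * \<bar>R \<theta> - S \<theta>\<bar>) * \<bar>m \<theta>\<bar>" using h by (simp add: has_bochner_integral_iff)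
    \<comment> \<open>Passing from |R - S| to |m| costs a factor 1 + \<kappa>, paid by lowering
      22/100 to 21/100.\<close>
    also have "\<dots> \<le> - (21/100) * (m \<theta>)\<^sup>2"
    proof -
      have "21/100 * \<bar>m \<theta>\<bar> \<le> 21/100 * (\<bar>R \<theta> - S \<theta>\<bar> * (1 + \<kappa>))" using m_bounds(1)[of \<theta>] by simp
      also have "\<dots> = \<bar>R \<theta> - S \<theta>\<bar> * (21/100 * (1 + \<kappa>))" by simp
      also have "\<dots> \<le> \<bar>R \<theta> - S \<theta>\<bar> * (22/100)" using \<kappa> by (intro mult_left_mono) auto
      finally have "21/100 * \<bar>m \<theta>\<bar> * \<bar>m \<theta>\<bar> \<le> 22/100 * \<bar>R \<theta> - S \<theta>\<bar> * \<bar>m \<theta>\<bar>"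
        by (intro mult_right_mono) auto
      then show ?thesis by (simp add: power2_eq_square abs_mult_self)
    qed
    finally show ?thesis .
  qed
  have "(LINT z|lborel. M z *\<^sub>R f z) = (LINT \<theta>|circ. LINT r|rad. M (of_real r * cis \<theta>) *\<^sub>R f (of_real r * cis \<theta>))"
    by (rule integral_polar[OF i])
  also have "\<dots> \<le> (LINT \<theta>|circ. - (21/100) * (m \<theta>)\<^sup>2)"
    by (intro integral_mono i2 integrable_mult_right integrable_m inner)
  finally show ?thesis by (simp add: N2_def)
qed

text \<open>The constant collects pi / 3 from the modes 3 and higher, 18 pi \<kappa>^2 from each of
  the modes 1 and 2, which the moments make small, and 40 \<kappa> from replacing the
  kernel.\<close>

lemma log_energy_lower:
  assumes "(LINT z|lborel. M z *\<^sub>R z ^ 1) = 0" "(LINT z|lborel. M z *\<^sub>R z ^ 2) = 0"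
  shows "2 * pi * (LINT z|lborel. M z *\<^sub>R (pot U z - pot V z)) \<ge> - (pi / 3 + 36 * pi * \<kappa>\<^sup>2 + 40 * \<kappa>) * N2"
proof -
  define f where "f z = 2 * pi * (pot U z - pot V z)" for z
  have cf: "continuous_on UNIV f" unfolding f_def
    by (intro continuous_intros continuous_pot U.bounded_U V.bounded_U U.U_borel V.U_borel)
  have fm: "f \<in> borel_measurable borel" using cf by (rule borel_measurable_continuous_onI)
  obtain B where B: "\<And>z. norm z < 2 \<Longrightarrow> norm (f z) \<le> B" using bounded_on_ball2[OF cf] by blast
  define \<rho> where "\<rho> = (1 - \<kappa>) / (1 + \<kappa>)"
  have \<rho>: "0 \<le> \<rho>" "\<rho> < 1" using \<kappa> by (auto simp: \<rho>_def)
  have GH: "\<bar>G \<theta>\<bar> \<le> - ln (1 - \<rho>) * (2 * pi)" for \<theta>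
  proof -
    have n: "norm (of_real \<rho> * cis (\<phi> - \<theta>)) = \<rho>" for \<phi> using \<rho> by (simp add: norm_mult)
    have b: "\<bar>ln (norm (1 - of_real \<rho> * cis (\<phi> - \<theta>))) * m \<phi>\<bar> \<le> - ln (1 - \<rho>) * 1" for \<phi>
      unfolding abs_mult using abs_ln_norm_one_minus_le[of "of_real \<rho> * cis (\<phi> - \<theta>)"] abs_m_le[of \<phi>] \<rho>
      by (intro mult_mono) (auto simp: n)
    have i: "integrable circ (\<lambda>\<phi>. ln (norm (1 - of_real \<rho> * cis (\<phi> - \<theta>))) * m \<phi>)"
      using b by (intro integrable_circ_bounded[of _ "- ln (1 - \<rho>) * 1"]) auto
    have "\<bar>G \<theta>\<bar> \<le> (LINT \<phi>|circ. - ln (1 - \<rho>) * 1)"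
      unfolding G_def \<rho>_def[symmetric]
      by (rule integral_abs_bound[THEN order_trans], rule integral_mono) (use i b in auto)
    then show ?thesis by (simp add: measure_circ mult.commute)
  qed
  have iG: "integrable circ (\<lambda>\<theta>. m \<theta> *\<^sub>R G \<theta>)"
  proof (rule integrable_circ_bounded[of _ "1 * (- ln (1 - \<rho>) * (2 * pi))"])
    show "norm (m \<theta> *\<^sub>R G \<theta>) \<le> 1 * (- ln (1 - \<rho>) * (2 * pi))" for \<theta>
      unfolding real_scaleR_def real_norm_def abs_mult by (intro mult_mono abs_m_le GH) auto
  qed measurable
  have 1: "norm ((LINT z|lborel. M z *\<^sub>R f z) - (LINT \<theta>|circ. m \<theta> *\<^sub>R G \<theta>)) \<le> (LINT \<theta>|circ. H \<theta> * \<bar>m \<theta>\<bar>)"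
  proof (rule polar_estimate[OF fm B _ iG integrable_H_m])
    fix r \<theta> :: real assume r: "r > 0" "M (of_real r * cis \<theta>) \<noteq> 0"
    have b: "1 - \<kappa> \<le> r" "r \<le> 1 + \<kappa>" using M_support[OF r(2)] r(1) by (auto simp: norm_mult)
    show "norm (f (of_real r * cis \<theta>) - G \<theta>) \<le> H \<theta>"
      using pot_diff_estimate[OF b, of \<theta>] by (simp add: f_def)
  qed
  have 2: "(LINT \<theta>|circ. m \<theta> *\<^sub>R G \<theta>) \<ge> - (pi / 3 * N2 + (norm (fcoeff m 1))\<^sup>2 + (norm (fcoeff m 2))\<^sup>2)"
    using log_energy_ge[OF measurable_m abs_m_le \<rho>] by (simp add: G_def \<rho>_def N2_def)
  have c: "(norm (fcoeff m k))\<^sup>2 \<le> 18 * pi * \<kappa>\<^sup>2 * N2" if "k = 1 \<or> k = 2" for k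
  proof -
    have "norm (fcoeff m k) \<le> 3 * \<kappa> * L1" using that assms by (intro fcoeff_small) auto
    then have "(norm (fcoeff m k))\<^sup>2 \<le> (3 * \<kappa> * L1)\<^sup>2" by (intro power_mono) auto
    also have "\<dots> = 9 * \<kappa>\<^sup>2 * L1\<^sup>2" by (simp add: power_mult_distrib)
    also have "\<dots> \<le> 9 * \<kappa>\<^sup>2 * (2 * pi * N2)" using L1_N2 by (intro mult_left_mono) auto
    finally show ?thesis by (simp add: algebra_simps)
  qed
  have 3: "(LINT \<theta>|circ. H \<theta> * \<bar>m \<theta>\<bar>) \<le> 40 * \<kappa> * N2"
    using log_error_energy mult_right_mono[OF K_le(2) L1_N2(2)] by linarith
  have "(LINT z|lborel. M z *\<^sub>R f z) = 2 * pi * (LINT z|lborel. M z *\<^sub>R (pot U z - pot V z))"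
  proof -
    have "M z *\<^sub>R f z = 2 * pi * (M z *\<^sub>R (pot U z - pot V z))" for z by (simp add: f_def)
    then show ?thesis by (simp only: integral_mult_right_zero)
  qed
  moreover have "(LINT z|lborel. M z *\<^sub>R f z) \<ge> - (pi / 3 * N2 + 18 * pi * \<kappa>\<^sup>2 * N2 + 18 * pi * \<kappa>\<^sup>2 * N2) - 40 * \<kappa> * N2"
  proof -
    have "(norm (fcoeff m 1))\<^sup>2 \<le> 18 * pi * \<kappa>\<^sup>2 * N2" "(norm (fcoeff m 2))\<^sup>2 \<le> 18 * pi * \<kappa>\<^sup>2 * N2"
      by (auto intro!: c)
    then show ?thesis using 1 2 3 unfolding real_norm_def by linarith
  qed
  ultimately show ?thesis by (simp add: algebra_simps)
qed

text \<open>The constant \<open>D\<close> may be subtracted because \<open>M\<close> has mean zero.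
  What remains of |z - x0|^2 is at most \<open>b\<close> on the boundary of the second patch, plus 4
  |m| for the distance from that boundary.\<close>

lemma quadratic_weight:
  assumes x0: "norm x0 \<le> \<kappa>" and b: "b \<ge> 0"
    and bd: "\<And>\<theta>. \<bar>(norm (of_real (S \<theta>) * cis \<theta> - x0))\<^sup>2 - D\<bar> \<le> b"
    and mom0: "(LINT z|lborel. M z) = 0"
  shows "\<bar>LINT z|lborel. M z *\<^sub>R (norm (z - x0))\<^sup>2\<bar> \<le> b * L1 + 4 * N2"
proof -
  have i0: "integrable lborel M" using integrable_M_mult[of "\<lambda>_. 1::real" 1] by simp
  have cq: "continuous_on UNIV (\<lambda>z. (norm (z - x0))\<^sup>2)" by (intro continuous_intros)
  obtain B where B: "\<And>z. norm z < 2 \<Longrightarrow> norm ((norm (z - x0))\<^sup>2) \<le> B" using bounded_on_ball2[OF cq] by blast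
  have iq: "integrable lborel (\<lambda>z. M z *\<^sub>R (norm (z - x0))\<^sup>2)" by (rule integrable_M_mult[of _ B]) (use B in auto)
  have e: "(LINT z|lborel. M z *\<^sub>R ((norm (z - x0))\<^sup>2 - D)) = (LINT z|lborel. M z *\<^sub>R (norm (z - x0))\<^sup>2)"
    using iq i0 mom0 by (simp add: right_diff_distrib)
  have "norm ((LINT z|lborel. M z *\<^sub>R ((norm (z - x0))\<^sup>2 - D)) - (LINT \<theta>|circ. m \<theta> *\<^sub>R 0)) \<le> (LINT \<theta>|circ. (b + 4 * \<bar>m \<theta>\<bar>) * \<bar>m \<theta>\<bar>)"
  proof (rule polar_estimate[of _ "B + \<bar>D\<bar>"])
    show "norm ((norm (z - x0))\<^sup>2 - D) \<le> B + \<bar>D\<bar>" if "norm z < 2" for z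
      using B[OF that] unfolding real_norm_def by linarith
    fix r \<theta> :: real assume r: "r > 0" "M (of_real r * cis \<theta>) \<noteq> 0"
    define z w where "z = of_real r * cis \<theta>" and "w = of_real (S \<theta>) * cis \<theta>"
    have nz: "norm z \<le> 1 + \<kappa>" using M_support[OF r(2)] by (simp add: z_def)
    have nw: "norm w \<le> 1 + \<kappa>" using V.R[of \<theta>] V.R_pos[of \<theta>] by (simp add: w_def norm_mult)
    have "z - w = of_real (r - S \<theta>) * cis \<theta>" by (simp add: z_def w_def algebra_simps)
    then have "norm (z - w) = \<bar>r - S \<theta>\<bar>" by (simp only: norm_mult norm_of_real norm_cis mult_1_right)
    also have "\<dots> \<le> \<bar>R \<theta> - S \<theta>\<bar>" using M_between[OF r] by auto
    finally have d: "norm (z - w) \<le> \<bar>R \<theta> - S \<theta>\<bar>" .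
    have "\<bar>(norm (z - x0))\<^sup>2 - (norm (w - x0))\<^sup>2\<bar> = \<bar>norm (z - x0) - norm (w - x0)\<bar> * \<bar>norm (z - x0) + norm (w - x0)\<bar>"
      by (simp add: power2_eq_square square_diff_square_factored abs_mult mult.commute)
    also have "\<dots> \<le> \<bar>R \<theta> - S \<theta>\<bar> * 3"
    proof (intro mult_mono)
      show "\<bar>norm (z - x0) - norm (w - x0)\<bar> \<le> \<bar>R \<theta> - S \<theta>\<bar>"
        using norm_triangle_ineq3[of "z - x0" "w - x0"] d by simp
      show "\<bar>norm (z - x0) + norm (w - x0)\<bar> \<le> 3"
        using norm_triangle_ineq4[of z x0] norm_triangle_ineq4[of w x0] nz nw x0 \<kappa> by simp
    qed auto
    also have "\<dots> \<le> 4 * \<bar>m \<theta>\<bar>"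
    proof -
      have "\<bar>R \<theta> - S \<theta>\<bar> * (3/4) \<le> \<bar>R \<theta> - S \<theta>\<bar> * (1 - \<kappa>)" using \<kappa> by (intro mult_left_mono) auto
      then show ?thesis using m_bounds(2)[of \<theta>] by linarith
    qed
    finally have "\<bar>(norm (z - x0))\<^sup>2 - (norm (w - x0))\<^sup>2\<bar> \<le> 4 * \<bar>m \<theta>\<bar>" .
    moreover have "\<bar>(norm (w - x0))\<^sup>2 - D\<bar> \<le> b" unfolding w_def by (rule bd)
    ultimately show "norm ((norm (of_real r * cis \<theta> - x0))\<^sup>2 - D - 0) \<le> b + 4 * \<bar>m \<theta>\<bar>"
      unfolding z_def real_norm_def diff_zero by linarith
  next
    show "integrable circ (\<lambda>\<theta>. (b + 4 * \<bar>m \<theta>\<bar>) * \<bar>m \<theta>\<bar>)"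
    proof (rule integrable_circ_bounded[of _ "(b + 4 * 1) * 1"])
      show "norm ((b + 4 * \<bar>m \<theta>\<bar>) * \<bar>m \<theta>\<bar>) \<le> (b + 4 * 1) * 1" for \<theta>
        unfolding real_norm_def abs_mult abs_abs using b abs_m_le[of \<theta>] by (intro mult_mono) auto
    qed measurable
  qed (auto)
  also have "(LINT \<theta>|circ. (b + 4 * \<bar>m \<theta>\<bar>) * \<bar>m \<theta>\<bar>) = b * L1 + 4 * N2"
  proof -
    have "(b + 4 * \<bar>m \<theta>\<bar>) * \<bar>m \<theta>\<bar> = b * \<bar>m \<theta>\<bar> + 4 * (m \<theta>)\<^sup>2" for \<theta>
      by (simp add: power2_eq_square distrib_right mult.assoc abs_mult_self)
    then show ?thesis using integrable_m by (simp add: L1_def N2_def)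
  qed
  finally show ?thesis by (simp only: e real_norm_def scaleR_zero_right Bochner_Integration.integral_zero diff_zero)
qed

text \<open>The hypothesis \<open>kr\<close> is the difference of the identities \<open>4 \<pi> \<Omega> Q = \<integral>\<integral> kratio (z - w)\<close> for the two
  patches; it makes \<open>\<Omega> - \<Omega>'\<close> small relative to \<open>Q\<close>.\<close>

lemma steady_patches_AE_eq:
  assumes \<Omega>: "\<bar>\<Omega> - 1/4\<bar> \<le> \<kappa>" "\<bar>\<Omega>' - 1/4\<bar> \<le> \<kappa>" and x0: "norm x0 \<le> \<kappa>"
    and stU: "\<And>\<theta>. pot U (of_real (R \<theta>) * cis \<theta>) - \<Omega> / 2 * (norm (of_real (R \<theta>) * cis \<theta> - x0))\<^sup>2 = CU"
    and stV: "\<And>\<theta>. pot V (of_real (S \<theta>) * cis \<theta>) - \<Omega>' / 2 * (norm (of_real (S \<theta>) * cis \<theta> - x0))\<^sup>2 = CV"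
    and mom: "\<And>k. k \<le> 2 \<Longrightarrow> (LINT z|patch U. z ^ k) = (LINT z|patch V. z ^ k)"
    and kr: "of_real (\<Omega> - \<Omega>') * Q = of_real (1 / (4 * pi)) *
       ((LINT z|patch U. LINT w|patch U. kratio (z - w)) - (LINT z|patch V. LINT w|patch V. kratio (z - w)))"
    and b: "0 \<le> b" "b \<le> norm Q"
    and bd: "\<And>\<theta>. \<bar>(norm (of_real (S \<theta>) * cis \<theta> - x0))\<^sup>2 - D\<bar> \<le> 6 * b"
  shows "AE \<theta> in circ. R \<theta> = S \<theta>"
proof -
  note mM = moment_diff[OF mom]
  have mom0: "(LINT z|lborel. M z) = 0"
  proof -
    have "complex_of_real (LINT z|lborel. M z) = (LINT z|lborel. complex_of_real (M z))" by (rule integral_complex_of_real[symmetric])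
    also have "\<dots> = 0" using mM[of 0] by (simp add: scaleR_conv_of_real)
    finally show ?thesis by simp
  qed
  define f where "f z = (pot U z - \<Omega> / 2 * (norm (z - x0))\<^sup>2 - CU) - (pot V z - \<Omega>' / 2 * (norm (z - x0))\<^sup>2 - CV)" for z
  define J where "J = (LINT z|lborel. M z *\<^sub>R (pot U z - pot V z))"
  define W where "W = (LINT z|lborel. M z *\<^sub>R (norm (z - x0))\<^sup>2)"
  have E: "(LINT z|lborel. M z *\<^sub>R f z) \<le> - (21/100) * N2"
    unfolding f_def by (rule relative_energy_le[OF \<Omega> x0 stU stV])
  have split: "(LINT z|lborel. M z *\<^sub>R f z) = J - (\<Omega> - \<Omega>') / 2 * W"
  proof -
    have c1: "continuous_on UNIV (\<lambda>z. pot U z - pot V z)"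
      by (intro continuous_intros continuous_pot U.bounded_U V.bounded_U U.U_borel V.U_borel)
    have c2: "continuous_on UNIV (\<lambda>z. (norm (z - x0))\<^sup>2)" by (intro continuous_intros)
    obtain B1 where B1: "\<And>z. norm z < 2 \<Longrightarrow> norm (pot U z - pot V z) \<le> B1" using bounded_on_ball2[OF c1] by blast
    obtain B2 where B2: "\<And>z. norm z < 2 \<Longrightarrow> norm ((norm (z - x0))\<^sup>2) \<le> B2" using bounded_on_ball2[OF c2] by blast
    have i1: "integrable lborel (\<lambda>z. M z *\<^sub>R (pot U z - pot V z))"
      by (rule integrable_M_mult[of _ B1]) (use c1 B1 in \<open>auto intro: borel_measurable_continuous_onI\<close>)
    have i2: "integrable lborel (\<lambda>z. M z *\<^sub>R (norm (z - x0))\<^sup>2)"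
      by (rule integrable_M_mult[of _ B2]) (use B2 in auto)
    have i3: "integrable lborel M" using integrable_M_mult[of "\<lambda>_. 1::real" 1] by simp
    have "M z *\<^sub>R f z = M z *\<^sub>R (pot U z - pot V z) - (\<Omega> - \<Omega>') / 2 * (M z *\<^sub>R (norm (z - x0))\<^sup>2) - (CU - CV) * M z" for z
      by (simp add: f_def algebra_simps diff_divide_distrib)
    then have "(LINT z|lborel. M z *\<^sub>R f z) = (LINT z|lborel. M z *\<^sub>R (pot U z - pot V z) - (\<Omega> - \<Omega>') / 2 * (M z *\<^sub>R (norm (z - x0))\<^sup>2) - (CU - CV) * M z)"
      by simp
    also have "\<dots> = J - (\<Omega> - \<Omega>') / 2 * W - (CU - CV) * (LINT z|lborel. M z)"
      unfolding J_def W_def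
      by (simp only: Bochner_Integration.integral_diff Bochner_Integration.integrable_diff integrable_mult_right i1 i2 i3 integral_mult_right_zero)
    finally show ?thesis by (simp add: mom0)
  qed
  have Jl: "2 * pi * J \<ge> - (pi / 3 + 36 * pi * \<kappa>\<^sup>2 + 40 * \<kappa>) * N2"
    unfolding J_def by (rule log_energy_lower[OF mM[of 1] mM[of 2]]) auto
  \<comment> \<open>Division by 2 pi turns pi / 3 into 1/6; the terms with \<kappa> fit into 17/100
    - 1/6 = 1/300.\<close>
  have Jl': "J \<ge> - (17/100) * N2"
  proof -
    have k2: "\<kappa>\<^sup>2 \<le> \<kappa> * (1 / 1000000)" using \<kappa> unfolding power2_eq_square by (intro mult_left_mono) auto
    have "36 * pi * \<kappa>\<^sup>2 \<le> 36 * pi * (1 / 1000000)" using k2 \<kappa> by (intro mult_left_mono) auto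
    moreover have "40 * \<kappa> \<le> 20 * pi * (1 / 1000000)" using pi_gt3 \<kappa> by linarith
    ultimately have "pi / 3 + 36 * pi * \<kappa>\<^sup>2 + 40 * \<kappa> \<le> 2 * pi * (17/100)" using pi_gt_zero by linarith
    then have "(pi / 3 + 36 * pi * \<kappa>\<^sup>2 + 40 * \<kappa>) * N2 \<le> 2 * pi * (17/100) * N2" using L1_N2 by (intro mult_right_mono) auto
    then have "- (2 * pi * (17/100) * N2) \<le> - ((pi / 3 + 36 * pi * \<kappa>\<^sup>2 + 40 * \<kappa>) * N2)" by (simp only: neg_le_iff_le)
    also have "\<dots> \<le> 2 * pi * J" using Jl by (simp only: mult_minus_left)
    finally have "2 * pi * (- (17/100) * N2) \<le> 2 * pi * J" by simp
    then show ?thesis by (rule mult_left_le_imp_le) simp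
  qed
  have W: "\<bar>W\<bar> \<le> 6 * b * L1 + 4 * N2"
    unfolding W_def by (rule quadratic_weight[OF x0 _ bd mom0]) (use b in auto)
  \<comment> \<open>Only the product of the velocity difference with \<open>b\<close> is of the
    order of \<open>m\<close>; the difference alone is merely known to be at most 2
    \<kappa>.\<close>
  have OQ: "\<bar>\<Omega> - \<Omega>'\<bar> * b \<le> 10 * \<kappa> * L1"
  proof -
    have "\<bar>\<Omega> - \<Omega>'\<bar> * b \<le> \<bar>\<Omega> - \<Omega>'\<bar> * norm Q" using b by (intro mult_left_mono) auto
    also have "\<dots> = norm (of_real (\<Omega> - \<Omega>') * Q)" by (simp only: norm_mult norm_of_real)
    also have "\<dots> = 1 / (4 * pi) * norm ((LINT z|patch U. LINT w|patch U. kratio (z - w)) - (LINT z|patch V. LINT w|patch V. kratio (z - w)))"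
      unfolding kr by (simp only: norm_mult norm_of_real) simp
    also have "\<dots> \<le> 1 / (4 * pi) * (114 * \<kappa> * L1)"
      using kratio_energy_diff mM[of 2] by (intro mult_left_mono) auto
    also have "\<dots> \<le> 1 / 12 * (114 * \<kappa> * L1)"
      using pi_gt3 \<kappa> L1_N2 by (intro mult_right_mono divide_left_mono) auto
    also have "\<dots> \<le> 10 * \<kappa> * L1" using \<kappa> L1_N2 by simp
    finally show ?thesis .
  qed
  \<comment> \<open>The part of \<open>W\<close> that is linear in \<open>L1\<close> carries the
    factor \<open>b\<close> and gains a second \<open>L1\<close> from \<open>OQ\<close>; the part
    with \<open>N2\<close> is already quadratic and only needs |\<Omega> - \<Omega>'| <= 2
    \<kappa>.\<close>
  have "\<bar>(\<Omega> - \<Omega>') / 2 * W\<bar> \<le> 300 * \<kappa> * N2"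
  proof -
    have "\<bar>(\<Omega> - \<Omega>') / 2 * W\<bar> = \<bar>\<Omega> - \<Omega>'\<bar> / 2 * \<bar>W\<bar>" by (simp add: abs_mult)
    also have "\<dots> \<le> \<bar>\<Omega> - \<Omega>'\<bar> / 2 * (6 * b * L1 + 4 * N2)" using W by (intro mult_left_mono) auto
    also have "\<dots> = 3 * (\<bar>\<Omega> - \<Omega>'\<bar> * b) * L1 + 2 * \<bar>\<Omega> - \<Omega>'\<bar> * N2" by (simp add: algebra_simps)
    also have "\<dots> \<le> 3 * (10 * \<kappa> * L1) * L1 + 2 * (2 * \<kappa>) * N2"
      using OQ L1_N2 \<Omega> by (intro add_mono mult_right_mono mult_left_mono) auto
    also have "3 * (10 * \<kappa> * L1) * L1 = 30 * \<kappa> * L1\<^sup>2" by (simp add: power2_eq_square)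
    also have "30 * \<kappa> * L1\<^sup>2 \<le> 30 * \<kappa> * (2 * pi * N2)" using L1_N2 \<kappa> by (intro mult_left_mono) auto
    also have "30 * \<kappa> * (2 * pi * N2) = (60 * \<kappa> * N2) * pi" by simp
    also have "(60 * \<kappa> * N2) * pi \<le> (60 * \<kappa> * N2) * 4" using pi_less_4 \<kappa> L1_N2 by (intro mult_left_mono) auto
    also have "(60 * \<kappa> * N2) * 4 + 2 * (2 * \<kappa>) * N2 \<le> 300 * \<kappa> * N2" using \<kappa> L1_N2 by simp
    finally show ?thesis by simp
  qed
  moreover have "300 * \<kappa> * N2 \<le> (1/1000) * N2" using \<kappa> L1_N2 by (intro mult_right_mono) auto
  \<comment> \<open>Since 17/100 + 1/1000 < 21/100.\<close>
  ultimately have "N2 \<le> 0" using E Jl' unfolding split by (simp add: abs_le_iff)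
  then have "N2 = 0" using L1_N2 by simp
  then have "AE \<theta> in circ. (m \<theta>)\<^sup>2 = 0"
    unfolding N2_def using integral_nonneg_eq_0_iff_AE[OF integrable_m(3)] by simp
  then show ?thesis
  proof eventually_elim
    case (elim \<theta>)
    then have "R \<theta> - S \<theta> = 0 \<or> R \<theta> + S \<theta> = 0" by (simp add: m_eq)
    then show ?case using U.R_pos[of \<theta>] V.R_pos[of \<theta>] by auto
  qed
qed

end

section \<open>The weak formulation for a rotating patch\<close>

text \<open>A \<open>C\<^sup>1\<close> function, from which all cutoffs are composed.\<close>

definition pos_sq :: "real \<Rightarrow> real" where "pos_sq t = (max 0 t)\<^sup>2"

lemma has_derivative_pos_sq: "(pos_sq has_real_derivative 2 * max 0 t) (at t)"
proof -
  consider "t < 0" | "t > 0" | "t = 0" by linarith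
  then show ?thesis
  proof cases
    case 1
    have "((\<lambda>_. 0) has_real_derivative 0) (at t)" by simp
    then have "(pos_sq has_real_derivative 0) (at t)"
      by (rule has_field_derivative_transform_within_open[where S="{..<0}"]) (use 1 in \<open>auto simp: pos_sq_def\<close>)
    then show ?thesis using 1 by simp
  next
    case 2
    have "((\<lambda>x. x\<^sup>2) has_real_derivative 2 * t) (at t)" by (auto intro!: derivative_eq_intros)
    then have "(pos_sq has_real_derivative 2 * t) (at t)"
      by (rule has_field_derivative_transform_within_open[where S="{0<..}"]) (use 2 in \<open>auto simp: pos_sq_def\<close>)
    then show ?thesis using 2 by simp
  next
    case 3
    have "(\<lambda>h. (pos_sq (0 + h) - pos_sq 0) / h) \<midarrow>0\<rightarrow> 0"
    proof (rule Lim_null_comparison)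
      have "\<bar>(pos_sq (0 + h) - pos_sq 0) / h\<bar> \<le> \<bar>h\<bar>" for h
        by (cases "h > 0") (auto simp: pos_sq_def power2_eq_square)
      then show "\<forall>\<^sub>F h in at 0. norm ((pos_sq (0 + h) - pos_sq 0) / h) \<le> \<bar>h\<bar>" by (intro always_eventually) simp
      show "((\<lambda>h. \<bar>h\<bar>) \<longlongrightarrow> 0) (at (0::real))" by (rule tendsto_rabs_zero) (rule tendsto_ident_at)
    qed
    then show ?thesis using 3 by (simp add: has_field_derivative_def[symmetric] DERIV_def)
  qed
qed

lemmas has_derivative_pos_sq' [derivative_intros] = DERIV_chain2[OF has_derivative_pos_sq]

lemma continuous_pos_sq [continuous_intros]: "continuous_on A f \<Longrightarrow> continuous_on A (\<lambda>x. pos_sq (f x))"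
  unfolding pos_sq_def by (intro continuous_intros)

text \<open>The time cutoff of the test functions. It is 1 at time 0, so that the time derivative
  and the initial data cancel in the weak equation.\<close>

definition \<eta> :: "real \<Rightarrow> real" where "\<eta> t = pos_sq (1 - t\<^sup>2)"
definition \<eta>' :: "real \<Rightarrow> real" where "\<eta>' t = - (4 * t * max 0 (1 - t\<^sup>2))"

lemma has_derivative_\<eta>: "(\<eta> has_real_derivative \<eta>' t) (at t)"
  unfolding \<eta>_def \<eta>'_def by (auto intro!: derivative_eq_intros)

lemma continuous_\<eta>: "continuous_on A \<eta>" "continuous_on A \<eta>'"
  unfolding \<eta>_def \<eta>'_def by (intro continuous_intros)+

lemma \<eta>_zero: "\<bar>t\<bar> \<ge> 1 \<Longrightarrow> \<eta> t = 0" "\<bar>t\<bar> \<ge> 1 \<Longrightarrow> \<eta>' t = 0" "\<eta> 0 = 1"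
proof -
  assume "\<bar>t\<bar> \<ge> 1"
  then have "1 \<le> t\<^sup>2" by (metis abs_ge_zero one_le_power power2_abs)
  then show "\<eta> t = 0" "\<eta>' t = 0" by (auto simp: \<eta>_def \<eta>'_def pos_sq_def)
qed (simp add: \<eta>_def pos_sq_def)

text \<open>The first value cancels the initial term; of the second, 8/15, only that it is nonzero
  matters.\<close>

lemma integral_\<eta>:
  "has_bochner_integral lborel (\<lambda>t. indicat_real {0..} t * \<eta>' t) (-1)"
  "has_bochner_integral lborel (\<lambda>t. indicat_real {0..} t * \<eta> t) (8/15)"
proof -
  have "has_bochner_integral lborel (\<lambda>t. \<eta>' t * indicat_real {0..1} t) (\<eta> 1 - \<eta> 0)"
  proof (rule has_bochner_integral_FTC_Icc_real)
    show "(\<eta> has_real_derivative \<eta>' x) (at x)" for x by (rule has_derivative_\<eta>)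
    show "isCont \<eta>' x" for x using continuous_\<eta>(2)[of UNIV] by (simp add: continuous_on_eq_continuous_at)
  qed simp
  also have "(\<lambda>t. \<eta>' t * indicat_real {0..1} t) = (\<lambda>t. indicat_real {0..} t * \<eta>' t)"
    using \<eta>_zero(2) by (auto simp: indicator_def fun_eq_iff)
  finally show "has_bochner_integral lborel (\<lambda>t. indicat_real {0..} t * \<eta>' t) (-1)"
    using \<eta>_zero(1)[of 1] \<eta>_zero(3) by simp
  have "has_bochner_integral lborel (\<lambda>t. (1 - t\<^sup>2)\<^sup>2 * indicat_real {0..1} t)
      ((1 - 2 * 1 ^ 3 / 3 + 1 ^ 5 / 5) - (0 - 2 * 0 ^ 3 / 3 + 0 ^ 5 / 5))"
    by (rule has_bochner_integral_FTC_Icc_real[where F="\<lambda>t. t - 2 * t ^ 3 / 3 + t ^ 5 / 5"])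
       (auto intro!: derivative_eq_intros simp: power2_eq_square algebra_simps eval_nat_numeral)
  also have "(\<lambda>t. (1 - t\<^sup>2)\<^sup>2 * indicat_real {0..1} t) = (\<lambda>t. indicat_real {0..} t * \<eta> t)"
    using \<eta>_zero(1) by (auto simp: indicator_def fun_eq_iff \<eta>_def pos_sq_def abs_square_le_1 max_def)
  finally show "has_bochner_integral lborel (\<lambda>t. indicat_real {0..} t * \<eta> t) (8/15)" by simp
qed

section \<open>Test functions carried by the rotation\<close>

lemma inner_mult_cis: "a \<bullet> (cis s * k) = (cis (- s) * a) \<bullet> k"
  by (simp add: inner_complex_def algebra_simps)

lemma inner_cis_cis: "(cis s * a) \<bullet> (cis s * b) = a \<bullet> b"
  by (simp only: inner_mult_cis mult.assoc[symmetric] cis_mult) simp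

lemma grad_pot_rotate:
  fixes x0 :: complex and s :: real
  assumes [measurable]: "D \<in> sets borel"
  defines "\<rho> \<equiv> \<lambda>z. x0 + cis s * (z - x0)"
  shows "grad_pot (\<rho> ` D) x = cis s * grad_pot D (x0 + cis (- s) * (x - x0))"
proof -
  define y where "y z = x0 + cis (- s) * (z - x0)" for z
  have yr: "y (\<rho> z) = z" "\<rho> (y z) = z" for z
    by (simp_all add: y_def \<rho>_def mult.assoc[symmetric] cis_mult)
  have mem: "x \<in> \<rho> ` D \<longleftrightarrow> y x \<in> D" for x
  proof
    assume "y x \<in> D"
    then have "\<rho> (y x) \<in> \<rho> ` D" by (rule imageI)
    then show "x \<in> \<rho> ` D" by (simp only: yr)
  qed (auto simp: yr)
  have ind: "indicat_real (\<rho> ` D) (\<rho> v) = indicat_real D v" for v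
    by (simp only: indicator_def mem yr)
  have [measurable]: "\<rho> ` D \<in> sets borel"
  proof -
    have "\<rho> ` D = y -` D \<inter> space borel" by (rule set_eqI) (simp only: mem vimage_eq Int_iff space_borel UNIV_I simp_thms)
    also have "\<dots> \<in> sets borel" unfolding y_def by measurable
    finally show ?thesis .
  qed
  define f where "f w = indicat_real (\<rho> ` D) w *\<^sub>R inverse (cnj (x - w))" for w
  have \<rho>': "\<rho> v = (x0 - cis s * x0) + cis s * v" for v by (simp add: \<rho>_def algebra_simps)
  have "(LINT w|lborel. f w) = (LINT v|lborel. f (\<rho> v))"
    unfolding \<rho>' by (rule integral_rotate(1)[symmetric]) (auto simp: f_def)
  also have "(\<lambda>v. f (\<rho> v)) = (\<lambda>v. cis s * (indicat_real D v *\<^sub>R inverse (cnj (y x - v))))"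
  proof
    fix v
    have "x - \<rho> v = cis s * (y x - v)"
      using yr(2)[of x] by (simp add: \<rho>_def algebra_simps)
    then have "inverse (cnj (x - \<rho> v)) = cis s * inverse (cnj (y x - v))"
      by (simp add: cis_cnj inverse_mult_distrib del: complex_cnj_diff)
    then show "f (\<rho> v) = cis s * (indicat_real D v *\<^sub>R inverse (cnj (y x - v)))"
      unfolding f_def ind by (simp only: mult_scaleR_right)
  qed
  finally have "(LINT w|lborel. f w) = cis s * (LINT v|lborel. indicat_real D v *\<^sub>R inverse (cnj (y x - v)))"
    by (simp only: integral_mult_right_zero)
  then show ?thesis
    unfolding grad_pot_def by (simp only: f_def[abs_def] y_def mult_scaleR_right)
qed

locale C1_test =
  fixes g :: "complex \<Rightarrow> real" and Dg :: "complex \<Rightarrow> complex"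
  assumes g: "\<And>z. (g has_derivative (\<lambda>k. Dg z \<bullet> k)) (at z)"
    and Dg: "continuous_on UNIV Dg"
    and supp: "bounded {z. g z \<noteq> 0}"
begin

lemma cont_g: "continuous_on UNIV g"
  using g by (meson continuous_at_imp_continuous_on has_derivative_continuous)

text \<open>The profile \<open>g\<close> is carried along by the rotation, so that the weak formulation sees only the
  velocity relative to the rotating frame.\<close>

definition \<Phi> :: "real \<Rightarrow> complex \<Rightarrow> real \<Rightarrow> complex \<Rightarrow> real" where
  "\<Phi> \<Omega> x0 t x = \<eta> t * g (x0 + cis (- (\<Omega> * t)) * (x - x0))"

lemma deriv_\<Phi>:
  fixes \<Omega> x0 t x
  defines "y \<equiv> x0 + cis (- (\<Omega> * t)) * (x - x0)"
  shows "((\<lambda>p. \<Phi> \<Omega> x0 (fst p) (snd p)) has_derivative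
     (\<lambda>p. fst p * (\<eta>' t * g y + \<eta> t * (Dg y \<bullet> (- \<i> * of_real \<Omega> * (y - x0)))) + (\<eta> t *\<^sub>R (cis (\<Omega> * t) * Dg y)) \<bullet> snd p)) (at (t, x))"
proof -
  have d1: "((\<lambda>p. \<eta> (fst p)) has_derivative (\<lambda>p. \<eta>' t * fst p)) (at (t, x))"
  proof -
    have 1: "(fst has_derivative fst) (at (t, x))" by (auto intro!: derivative_eq_intros)
    have "(\<eta> has_derivative (*) (\<eta>' t)) (at (fst (t, x)))"
      using has_derivative_\<eta>[of t] by (simp add: has_field_derivative_def)
    from has_derivative_compose[OF 1 this] show ?thesis .
  qed
  have d2: "((\<lambda>p. x0 + cis (- (\<Omega> * fst p)) * (snd p - x0)) has_derivative
      (\<lambda>p. - \<i> * of_real \<Omega> * (y - x0) * of_real (fst p) + cis (- (\<Omega> * t)) * snd p)) (at (t, x))"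
  proof -
    have "((\<lambda>s. cis (- (\<Omega> * s))) has_vector_derivative - \<i> * of_real \<Omega> * cis (- (\<Omega> * t))) (at t)"
      by (auto simp: cis_conv_exp has_field_derivative_def field_simps intro!: derivative_eq_intros has_vector_derivative_real_field)
    then have 1: "((\<lambda>s. cis (- (\<Omega> * s))) has_derivative (\<lambda>h. h *\<^sub>R (- \<i> * of_real \<Omega> * cis (- (\<Omega> * t))))) (at (fst (t, x)))"
      by (simp add: has_vector_derivative_def)
    have "(fst has_derivative fst) (at (t, x))" by (auto intro!: derivative_eq_intros)
    from has_derivative_compose[OF this 1]
    have 2: "((\<lambda>p. cis (- (\<Omega> * fst p))) has_derivative (\<lambda>p. fst p *\<^sub>R (- \<i> * of_real \<Omega> * cis (- (\<Omega> * t))))) (at (t, x))" .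
    have 3: "((\<lambda>p. snd p - x0) has_derivative snd) (at (t, x))" by (auto intro!: derivative_eq_intros)
    show ?thesis
      by (rule has_derivative_eq_rhs[OF has_derivative_add[OF has_derivative_const has_derivative_mult[OF 2 3]]])
         (simp add: y_def fun_eq_iff scaleR_conv_of_real algebra_simps)
  qed
  have d3: "((\<lambda>p. g (x0 + cis (- (\<Omega> * fst p)) * (snd p - x0))) has_derivative
      (\<lambda>p. Dg y \<bullet> (- \<i> * of_real \<Omega> * (y - x0) * of_real (fst p) + cis (- (\<Omega> * t)) * snd p))) (at (t, x))"
    using has_derivative_compose[OF d2, of g "\<lambda>k. Dg y \<bullet> k"] g[of y] by (simp add: y_def)
  have e: "Dg y \<bullet> (a * of_real s + cis (- (\<Omega> * t)) * k) = s * (Dg y \<bullet> a) + (cis (\<Omega> * t) * Dg y) \<bullet> k" for a s k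
    by (simp add: inner_add_right inner_mult_cis) (simp add: inner_complex_def algebra_simps)
  show ?thesis
    unfolding \<Phi>_def
    by (rule has_derivative_eq_rhs[OF has_derivative_mult[OF d1 d3]])
       (simp only: e fst_conv snd_conv y_def[symmetric], simp add: fun_eq_iff algebra_simps)
qed

lemma test_function_\<Phi>: "test_function (\<Phi> \<Omega> x0)"
  unfolding test_function_def
proof (intro conjI allI)
  have cp: "case_prod (\<Phi> \<Omega> x0) = (\<lambda>p. \<Phi> \<Omega> x0 (fst p) (snd p))" by (simp add: case_prod_unfold)
  show "case_prod (\<Phi> \<Omega> x0) differentiable (at p)" for p
    using deriv_\<Phi>[of \<Omega> x0 "fst p" "snd p"] unfolding cp differentiable_def by auto
  fix v :: "real \<times> complex"
  have "frechet_derivative (case_prod (\<Phi> \<Omega> x0)) (at p) v =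
     fst v * (\<eta>' (fst p) * g (x0 + cis (- (\<Omega> * fst p)) * (snd p - x0))
        + \<eta> (fst p) * (Dg (x0 + cis (- (\<Omega> * fst p)) * (snd p - x0)) \<bullet> (- \<i> * of_real \<Omega> * ((x0 + cis (- (\<Omega> * fst p)) * (snd p - x0)) - x0))))
     + (\<eta> (fst p) *\<^sub>R (cis (\<Omega> * fst p) * Dg (x0 + cis (- (\<Omega> * fst p)) * (snd p - x0)))) \<bullet> snd v" for p
    using deriv_\<Phi>[of \<Omega> x0 "fst p" "snd p"] unfolding cp
    by (subst frechet_derivative_at[symmetric]) (auto simp: prod.collapse)
  moreover have cY: "continuous_on UNIV (\<lambda>p::real \<times> complex. x0 + cis (- (\<Omega> * fst p)) * (snd p - x0))"
    unfolding cis_conv_exp by (intro continuous_intros)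
  have c1: "continuous_on UNIV (\<lambda>p::real \<times> complex. g (x0 + cis (- (\<Omega> * fst p)) * (snd p - x0)))"
    by (rule continuous_on_compose2[OF cont_g cY]) auto
  have c2: "continuous_on UNIV (\<lambda>p::real \<times> complex. Dg (x0 + cis (- (\<Omega> * fst p)) * (snd p - x0)))"
    by (rule continuous_on_compose2[OF Dg cY]) auto
  have cf: "continuous_on UNIV (fst :: real \<times> complex \<Rightarrow> real)" by (intro continuous_intros)
  have c3: "continuous_on UNIV (\<lambda>p::real \<times> complex. \<eta> (fst p))"
    by (rule continuous_on_compose2[OF continuous_\<eta>(1)[of UNIV] cf]) simp
  have c4: "continuous_on UNIV (\<lambda>p::real \<times> complex. \<eta>' (fst p))"
    by (rule continuous_on_compose2[OF continuous_\<eta>(2)[of UNIV] cf]) simp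
  have c5: "continuous_on UNIV (\<lambda>p::real \<times> complex. cis (\<Omega> * fst p))"
    unfolding cis_conv_exp by (intro continuous_intros)
  ultimately show "continuous_on UNIV (\<lambda>p. frechet_derivative (case_prod (\<Phi> \<Omega> x0)) (at p) v)"
    by (simp only:) (intro continuous_on_add continuous_on_mult continuous_on_inner continuous_on_scaleR continuous_on_diff
      continuous_on_const c1 c2 c3 c4 c5 cY)
next
  obtain B where B: "\<And>z. g z \<noteq> 0 \<Longrightarrow> norm z \<le> B" using supp by (auto simp: bounded_iff)
  have "{p. case_prod (\<Phi> \<Omega> x0) p \<noteq> 0} \<subseteq> {-1..1} \<times> cball x0 (B + norm x0)"
  proof (clarify)
    fix t x assume "\<Phi> \<Omega> x0 t x \<noteq> 0"
    then have h: "\<eta> t \<noteq> 0" "g (x0 + cis (- (\<Omega> * t)) * (x - x0)) \<noteq> 0" by (auto simp: \<Phi>_def)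
    have "\<bar>t\<bar> < 1" using \<eta>_zero(1)[of t] h by force
    moreover have "norm (x - x0) \<le> B + norm x0"
      using B[OF h(2)] norm_triangle_ineq4[of "x0 + cis (- (\<Omega> * t)) * (x - x0)" x0] by (simp add: norm_mult)
    ultimately show "t \<in> {-1..1} \<and> x \<in> cball x0 (B + norm x0)" by (auto simp: dist_norm norm_minus_commute)
  qed
  then show "bounded {p. case_prod (\<Phi> \<Omega> x0) p \<noteq> 0}"
    by (rule bounded_subset[rotated]) (intro bounded_Times, auto)
qed

text \<open>Rotating the space variable back by \<Omega> t makes the patch, its velocity and the
  profile \<open>g\<close> independent of time. The weak equation becomes one scalar relation
  between \<open>I\<close>, \<open>A\<close> and the time integrals of the cutoff.\<close>

lemma weak_steady:
  assumes V: "V_state D \<Omega> x0" and D [measurable]: "D \<in> sets borel"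
  shows "(LINT z|lborel. indicat_real D z * ((\<i> * (grad_pot D z - of_real \<Omega> * (z - x0))) \<bullet> Dg z)) = 0"
proof -
  have bD: "bounded D" using V by (simp add: V_state_def)
  define v where "v z = \<i> * (grad_pot D z - of_real \<Omega> * (z - x0))" for z
  define I where "I = (LINT z|lborel. indicat_real D z * g z)"
  define A where "A = (LINT z|lborel. indicat_real D z * (v z \<bullet> Dg z))"
  have cv: "continuous_on UNIV v" unfolding v_def by (intro continuous_intros continuous_grad_pot bD D)
  have [measurable]: "v \<in> borel_measurable borel" "g \<in> borel_measurable borel" "Dg \<in> borel_measurable borel"
    using cv cont_g Dg by (auto intro: borel_measurable_continuous_onI)
  have bnd: "\<exists>B. \<forall>z\<in>D. norm (f z) \<le> B" if "continuous_on UNIV f" for f :: "complex \<Rightarrow> real"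
  proof -
    obtain M where "D \<subseteq> cball 0 M" using bD by (auto simp: bounded_iff subset_iff)
    moreover have "bounded (f ` cball 0 M)"
      by (intro compact_imp_bounded compact_continuous_image continuous_on_subset[OF that]) auto
    ultimately show ?thesis by (auto simp: bounded_iff)
  qed
  have ig: "integrable lborel (\<lambda>z. indicat_real D z * g z)"
    using bnd[OF cont_g] integrable_bounded_mult_indicator[OF bD D, of g] by auto
  have cvg: "continuous_on UNIV (\<lambda>z. v z \<bullet> Dg z)" by (intro continuous_intros cv Dg)
  have iv: "integrable lborel (\<lambda>z. indicat_real D z * (v z \<bullet> Dg z))"
    using bnd[OF cvg] integrable_bounded_mult_indicator[OF bD D, of "\<lambda>z. v z \<bullet> Dg z"] by auto
  define \<rho> where "\<rho> t z = x0 + cis (\<Omega> * t) * (z - x0)" for t z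
  define y where "y t z = x0 + cis (- (\<Omega> * t)) * (z - x0)" for t z
  have yr: "y t (\<rho> t z) = z" "\<rho> t (y t z) = z" for t z
    by (simp_all add: y_def \<rho>_def mult.assoc[symmetric] cis_mult)
  have \<rho>': "(\<lambda>z. x0 + exp (\<i> * of_real (\<Omega> * t)) * (z - x0)) = \<rho> t" for t
    by (simp add: \<rho>_def cis_conv_exp fun_eq_iff)
  have mem: "x \<in> \<rho> t ` D \<longleftrightarrow> y t x \<in> D" for t x
  proof
    assume "y t x \<in> D"
    then have "\<rho> t (y t x) \<in> \<rho> t ` D" by (rule imageI)
    then show "x \<in> \<rho> t ` D" by (simp only: yr)
  qed (auto simp: yr)
  then have ind: "indicat_real (\<rho> t ` D) x = indicat_real D (y t x)" for t x
    by (simp add: indicator_def)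
  have vel: "velocity (indicat_real (\<rho> t ` D)) x = cis (\<Omega> * t) * (\<i> * grad_pot D (y t x))" for t x
  proof -
    have b: "bounded (\<rho> t ` D)"
    proof -
      obtain M where M: "\<And>z. z \<in> D \<Longrightarrow> norm (x0 - z) \<le> M" using bD by (metis bounded_any_center dist_norm)
      have "\<rho> t ` D \<subseteq> cball x0 M"
        using M by (auto simp: \<rho>_def dist_norm norm_mult norm_minus_commute)
      then show ?thesis using bounded_cball bounded_subset by blast
    qed
    have "\<rho> t ` D = y t -` D \<inter> space borel" by (rule set_eqI) (simp only: mem vimage_eq Int_iff space_borel UNIV_I simp_thms)
    also have "\<dots> \<in> sets borel" unfolding y_def by measurable
    finally have m: "\<rho> t ` D \<in> sets borel" .
    show ?thesis
      unfolding velocity_eq[OF b m] using grad_pot_rotate[OF D, of x0 "\<Omega> * t" x]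
      by (simp add: \<rho>_def[abs_def] y_def)
  qed
  have dt: "deriv (\<lambda>s. \<Phi> \<Omega> x0 s x) t = \<eta>' t * g (y t x) + \<eta> t * (Dg (y t x) \<bullet> (- \<i> * of_real \<Omega> * (y t x - x0)))" for t x
  proof (rule DERIV_imp_deriv)
    have "((\<lambda>s. (s, x)) has_derivative (\<lambda>s. (s, 0))) (at t)" by (auto intro!: derivative_eq_intros)
    from has_derivative_compose[OF this deriv_\<Phi>[of \<Omega> x0 t x]]
    show "((\<lambda>s. \<Phi> \<Omega> x0 s x) has_real_derivative \<eta>' t * g (y t x) + \<eta> t * (Dg (y t x) \<bullet> (- \<i> * of_real \<Omega> * (y t x - x0)))) (at t)"
      unfolding has_field_derivative_def y_def by (simp add: mult_commute_abs)
  qed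
  have gr: "grad (\<Phi> \<Omega> x0 t) x = \<eta> t *\<^sub>R (cis (\<Omega> * t) * Dg (y t x))" for t x
  proof -
    have "((\<lambda>k. (t, k)) has_derivative (\<lambda>k. (0, k))) (at x)" by (auto intro!: derivative_eq_intros)
    from has_derivative_compose[OF this deriv_\<Phi>[of \<Omega> x0 t x]]
    have "(\<Phi> \<Omega> x0 t has_derivative (\<lambda>k. (\<eta> t *\<^sub>R (cis (\<Omega> * t) * Dg (y t x))) \<bullet> k)) (at x)"
      unfolding y_def by simp
    then have "frechet_derivative (\<Phi> \<Omega> x0 t) (at x) = (\<lambda>k. (\<eta> t *\<^sub>R (cis (\<Omega> * t) * Dg (y t x))) \<bullet> k)"
      by (rule frechet_derivative_at[symmetric])
    then show ?thesis
      unfolding grad_def by (simp only:) (simp add: complex_eq_iff inner_complex_def)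
  qed
  have inner: "(LINT x|lborel. indicat_real (\<rho> t ` D) x * (deriv (\<lambda>s. \<Phi> \<Omega> x0 s x) t
      + velocity (indicat_real (\<rho> t ` D)) x \<bullet> grad (\<Phi> \<Omega> x0 t) x)) = \<eta>' t * I + \<eta> t * A" for t
  proof -
    define F where "F z = \<eta>' t * (indicat_real D z * g z) + \<eta> t * (indicat_real D z * (v z \<bullet> Dg z))" for z
    have "indicat_real (\<rho> t ` D) x * (deriv (\<lambda>s. \<Phi> \<Omega> x0 s x) t
      + velocity (indicat_real (\<rho> t ` D)) x \<bullet> grad (\<Phi> \<Omega> x0 t) x) = F ((x0 - cis (- (\<Omega> * t)) * x0) + cis (- (\<Omega> * t)) * x)" for x
    proof -
      have e: "(x0 - cis (- (\<Omega> * t)) * x0) + cis (- (\<Omega> * t)) * x = y t x" by (simp add: y_def algebra_simps)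
      have "velocity (indicat_real (\<rho> t ` D)) x \<bullet> grad (\<Phi> \<Omega> x0 t) x = \<eta> t * ((\<i> * grad_pot D (y t x)) \<bullet> Dg (y t x))"
        unfolding vel gr inner_scaleR_right inner_cis_cis ..
      moreover have "Dg (y t x) \<bullet> (- \<i> * of_real \<Omega> * (y t x - x0)) + (\<i> * grad_pot D (y t x)) \<bullet> Dg (y t x) = v (y t x) \<bullet> Dg (y t x)"
        by (simp add: v_def inner_complex_def algebra_simps)
      moreover have "i * (a * G + b * c + b * d) = a * (i * G) + b * (i * w)" if "c + d = w" for i a G b c d w :: real
        using that by (auto simp: algebra_simps)
      ultimately show ?thesis
        unfolding e F_def dt ind by (simp only:)
    qed
    then have "(LINT x|lborel. indicat_real (\<rho> t ` D) x * (deriv (\<lambda>s. \<Phi> \<Omega> x0 s x) t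
      + velocity (indicat_real (\<rho> t ` D)) x \<bullet> grad (\<Phi> \<Omega> x0 t) x)) = (LINT x|lborel. F ((x0 - cis (- (\<Omega> * t)) * x0) + cis (- (\<Omega> * t)) * x))"
      by simp
    also have "\<dots> = (LINT x|lborel. F x)" by (rule integral_rotate(1)) (auto simp: F_def)
    also have "\<dots> = \<eta>' t * I + \<eta> t * A" unfolding F_def I_def A_def using ig iv by simp
    finally show ?thesis .
  qed
  have "(LINT t:{0..}|lborel. (LINT x|lborel. indicat_real (\<rho> t ` D) x * (deriv (\<lambda>s. \<Phi> \<Omega> x0 s x) t
      + velocity (indicat_real (\<rho> t ` D)) x \<bullet> grad (\<Phi> \<Omega> x0 t) x))) + (LINT x|lborel. indicat_real D x * \<Phi> \<Omega> x0 0 x) = 0"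
    using V test_function_\<Phi>[of \<Omega> x0] unfolding V_state_def yudovich_solution_def \<rho>' by blast
  then have "(LINT t|lborel. (indicat_real {0..} t * \<eta>' t) * I + (indicat_real {0..} t * \<eta> t) * A) + I = 0"
    unfolding inner set_lebesgue_integral_def by (simp add: I_def \<Phi>_def \<eta>_zero distrib_left mult.assoc)
  \<comment> \<open>The term - I cancels the contribution of the initial data, and a nonzero
    multiple of \<open>A\<close> is left.\<close>
  moreover have "(LINT t|lborel. (indicat_real {0..} t * \<eta>' t) * I + (indicat_real {0..} t * \<eta> t) * A) = - I + 8/15 * A"
    using integral_\<eta> by (simp add: has_bochner_integral_iff)
  ultimately have "A = 0" by simp
  then show ?thesis by (simp add: A_def v_def)
qed

end

text \<open>Equal to \<open>1\<close> on \<open>cball 0 2\<close>.\<close>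

definition cutoff :: "complex \<Rightarrow> real" where "cutoff z = pos_sq (1 - pos_sq (z \<bullet> z - 4))"

lemma C1_test_cutoff:
  fixes p :: "complex \<Rightarrow> real"
  assumes p: "\<And>z. (p has_derivative (\<lambda>k. Dp z \<bullet> k)) (at z)" and Dp: "continuous_on UNIV Dp"
  shows "C1_test (\<lambda>z. p z * cutoff z)
    (\<lambda>z. cutoff z *\<^sub>R Dp z - (p z * (8 * max 0 (1 - pos_sq (z \<bullet> z - 4)) * max 0 (z \<bullet> z - 4))) *\<^sub>R z)"
proof
  have cp: "continuous_on UNIV p" using p by (meson continuous_at_imp_continuous_on has_derivative_continuous)
  have dcut: "(cutoff has_derivative (\<lambda>k. - ((8 * max 0 (1 - pos_sq (z \<bullet> z - 4)) * max 0 (z \<bullet> z - 4)) * (z \<bullet> k)))) (at z)" for z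
  proof -
    have 1: "((\<lambda>s. pos_sq (1 - pos_sq (s - 4))) has_real_derivative (2 * max 0 (1 - pos_sq (z \<bullet> z - 4))) * (- (2 * max 0 (z \<bullet> z - 4)))) (at (z \<bullet> z))"
      by (auto intro!: derivative_eq_intros)
    have 2: "((\<lambda>z. z \<bullet> z) has_derivative (\<lambda>k. z \<bullet> k + k \<bullet> z)) (at z)"
      by (auto intro!: derivative_eq_intros)
    from has_derivative_compose[OF 2 1[unfolded has_field_derivative_def]]
    have "((\<lambda>z. pos_sq (1 - pos_sq (z \<bullet> z - 4))) has_derivative
        (\<lambda>k. (2 * max 0 (1 - pos_sq (z \<bullet> z - 4))) * (- (2 * max 0 (z \<bullet> z - 4))) * (z \<bullet> k + k \<bullet> z))) (at z)" .
    then show ?thesis unfolding cutoff_def[abs_def]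
      by (rule has_derivative_eq_rhs) (auto simp: inner_commute fun_eq_iff)
  qed
  show "((\<lambda>z. p z * cutoff z) has_derivative
     (\<lambda>k. (cutoff z *\<^sub>R Dp z - (p z * (8 * max 0 (1 - pos_sq (z \<bullet> z - 4)) * max 0 (z \<bullet> z - 4))) *\<^sub>R z) \<bullet> k)) (at z)" for z
    by (rule has_derivative_eq_rhs[OF has_derivative_mult[OF p dcut]]) (simp add: inner_diff_left fun_eq_iff)
  show "continuous_on UNIV (\<lambda>z. cutoff z *\<^sub>R Dp z - (p z * (8 * max 0 (1 - pos_sq (z \<bullet> z - 4)) * max 0 (z \<bullet> z - 4))) *\<^sub>R z)"
    unfolding cutoff_def by (intro continuous_intros cp Dp)
  have "norm z \<le> 3" if "p z * cutoff z \<noteq> 0" for z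
  proof (rule ccontr)
    assume "\<not> norm z \<le> 3"
    then have "3 * 3 \<le> norm z * norm z" by (intro mult_mono) auto
    then have "1 \<le> max 0 (z \<bullet> z - 4)" by (simp add: dot_square_norm power2_eq_square)
    then have "1 \<le> pos_sq (z \<bullet> z - 4)" unfolding pos_sq_def by (intro one_le_power)
    then show False using that by (simp add: cutoff_def) (simp add: pos_sq_def)
  qed
  then show "bounded {z. p z * cutoff z \<noteq> 0}" by (auto simp: bounded_iff)
qed

text \<open>On the patch the cutoff is 1 and its gradient 0, so polynomials become admissible test
  functions.\<close>

lemma weak_steady_cutoff:
  assumes V: "V_state D \<Omega> x0" and D: "D \<in> sets borel" "D \<subseteq> cball 0 2"
    and p: "\<And>z. (p has_derivative (\<lambda>k. Dp z \<bullet> k)) (at z)" "continuous_on UNIV Dp"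
  shows "(LINT z|lborel. indicat_real D z * ((\<i> * (grad_pot D z - of_real \<Omega> * (z - x0))) \<bullet> Dp z)) = 0"
proof -
  define Dg where "Dg z = cutoff z *\<^sub>R Dp z - (p z * (8 * max 0 (1 - pos_sq (z \<bullet> z - 4)) * max 0 (z \<bullet> z - 4))) *\<^sub>R z" for z
  have "Dg z = Dp z" if "z \<in> D" for z
  proof -
    have "norm z * norm z \<le> 2 * 2" using that D by (intro mult_mono) auto
    then have "max 0 (z \<bullet> z - 4) = 0" by (simp add: dot_square_norm power2_eq_square)
    then show ?thesis by (simp add: Dg_def cutoff_def pos_sq_def)
  qed
  then have "(LINT z|lborel. indicat_real D z * ((\<i> * (grad_pot D z - of_real \<Omega> * (z - x0))) \<bullet> Dp z)) =
    (LINT z|lborel. indicat_real D z * ((\<i> * (grad_pot D z - of_real \<Omega> * (z - x0))) \<bullet> Dg z))"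
    by (intro Bochner_Integration.integral_cong) (auto simp: indicator_def)
  also have "\<dots> = 0"
    using C1_test.weak_steady[OF C1_test_cutoff[OF p] V D(1)] unfolding Dg_def .
  finally show ?thesis .
qed

text \<open>The kernel \<open>K\<close> of the velocity is antisymmetric, so the self-induced
  velocity has mean zero and the relation from the gradients of z reduces to \<Omega> times the
  first moment about \<open>x0\<close>. This is where \<Omega> must be nonzero.\<close>

lemma V_state_moments:
  assumes V: "V_state D \<Omega> x0" and D [measurable]: "D \<in> sets borel" and D2: "D \<subseteq> cball 0 2" and \<Omega>: "\<Omega> \<noteq> 0"
  shows "(LINT z|patch D. z - x0) = 0"
    and "(LINT z|patch D. LINT w|patch D. kratio (z - w)) = of_real (4 * pi * \<Omega>) * (LINT z|patch D. (z - x0)\<^sup>2)"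
proof -
  have bD: "bounded D" using D2 bounded_cball bounded_subset by blast
  interpret P: finite_measure "patch D" by (rule finite_measure_patch[OF bD D])
  interpret PP: pair_sigma_finite "patch D" "patch D" ..
  have ip: "integrable (patch D) f" if "continuous_on UNIV f" for f :: "complex \<Rightarrow> complex"
  proof -
    have [measurable]: "f \<in> borel_measurable borel" by (rule borel_measurable_continuous_onI[OF that])
    have "bounded (f ` cball 0 2)" by (intro compact_imp_bounded compact_continuous_image continuous_on_subset[OF that]) auto
    then obtain B where "\<And>z. z \<in> D \<Longrightarrow> norm (f z) \<le> B" using D2 by (force simp: bounded_iff)
    from integrable_bounded_mult_indicator[OF bD D _ this] show ?thesis
      by (subst integral_patch(2)) auto
  qed
  define G where "G = grad_pot D"
  have cG: "continuous_on UNIV G" unfolding G_def by (rule continuous_grad_pot[OF bD D])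
  have [measurable]: "G \<in> borel_measurable borel" by (rule borel_measurable_continuous_onI[OF cG])
  define v where "v z = \<i> * (G z - of_real \<Omega> * (z - x0))" for z
  have cv: "continuous_on UNIV v" unfolding v_def by (intro continuous_intros cG)
  have [measurable]: "v \<in> borel_measurable borel" by (rule borel_measurable_continuous_onI[OF cv])
  have st: "(LINT z|patch D. v z \<bullet> Dp z) = 0"
    if "\<And>z. (p has_derivative (\<lambda>k. Dp z \<bullet> k)) (at z)" and c: "continuous_on UNIV Dp" for p Dp
  proof -
    have [measurable]: "Dp \<in> borel_measurable borel" by (rule borel_measurable_continuous_onI[OF c])
    have [measurable]: "(\<lambda>z. v z \<bullet> Dp z) \<in> borel_measurable borel" by measurable
    show ?thesis using weak_steady_cutoff[OF V D D2 that] unfolding G_def[symmetric] v_def[symmetric]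
      by (subst integral_patch) auto
  qed
  have int0: "(LINT z|patch D. f z) = 0"
    if "continuous_on UNIV f" "(LINT z|patch D. Re (f z)) = 0" "(LINT z|patch D. Im (f z)) = 0" for f
    using that integral_Re[OF ip[OF that(1)]] integral_Im[OF ip[OF that(1)]] by (simp only: complex_eq_iff zero_complex.sel)
  have 1: "(LINT z|patch D. v z) = 0"
  proof -
    have "(LINT z|patch D. v z \<bullet> 1) = 0"
      by (rule st[where p=Re]) (auto intro!: derivative_eq_intros continuous_intros simp: inner_complex_def)
    moreover have "(LINT z|patch D. v z \<bullet> \<i>) = 0"
      by (rule st[where p=Im]) (auto intro!: derivative_eq_intros continuous_intros simp: inner_complex_def)
    ultimately show ?thesis by (intro int0 cv) (simp_all only: inner_complex_def complex.sel one_complex.sel imaginary_unit.sel mult_1_right mult_zero_right add_0 add_0_right)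
  qed
  \<comment> \<open>The two test functions are the real and imaginary part of z^2 / 2, with
    gradients cnj z and \<i> cnj z; their relations are the two parts of one complex
    relation.\<close>
  have 2: "(LINT z|patch D. v z * z) = 0"
  proof -
    have "(LINT z|patch D. v z \<bullet> cnj z) = 0"
      by (rule st[where p="\<lambda>z. (Re z * Re z - Im z * Im z) / 2"])
         (auto intro!: derivative_eq_intros continuous_intros simp: inner_complex_def fun_eq_iff)
    moreover have "(LINT z|patch D. v z \<bullet> (\<i> * cnj z)) = 0"
      by (rule st[where p="\<lambda>z. Re z * Im z"])
         (auto intro!: derivative_eq_intros continuous_intros simp: inner_complex_def fun_eq_iff)
    moreover have "v z \<bullet> cnj z = Re (v z * z)" "v z \<bullet> (\<i> * cnj z) = Im (v z * z)" for z
      by (simp_all add: inner_complex_def)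
    moreover have "continuous_on UNIV (\<lambda>z. v z * z)" by (intro continuous_intros cv)
    ultimately show ?thesis by (intro int0) (simp_all only:)
  qed
  define K where "K z w = inverse (cnj (z - w))" for z w :: complex
  have [measurable]: "(\<lambda>p. K (fst p) (snd p)) \<in> borel_measurable (borel \<Otimes>\<^sub>M borel)" unfolding K_def by measurable
  have Km [measurable]: "K z \<in> borel_measurable borel" for z unfolding K_def by measurable
  have Gz: "G z = of_real (1 / (2 * pi)) * (LINT w|patch D. K z w)" for z
    unfolding G_def grad_pot_def by (subst integral_patch) (auto simp: K_def scaleR_conv_of_real)
  have iK: "integrable (patch D) (K z)" for z
    using integrable_inverse_kernel[OF bD D, of z] by (subst integral_patch) (auto simp: K_def)
  define C where "C = (2 * pi + 1) * sqrt (measure lborel D)"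
  have nK: "(LINT w|patch D. norm (K z w)) \<le> C" for z
  proof -
    have "(LINT w|patch D. norm (K z w)) = (LINT w|lborel. 1 / norm (z - w) * indicat_real D w)"
      by (subst integral_patch) (auto simp: K_def norm_inverse divide_inverse mult.commute simp del: complex_cnj_diff)
    also have "\<dots> \<le> C" unfolding C_def
      by (rule integral_inverse_norm_le[OF D emeasure_bounded_le(1)[OF bD D]]) simp
    finally show ?thesis .
  qed
  have iKK: "integrable (patch D \<Otimes>\<^sub>M patch D) (\<lambda>(z, w). f z * K z w)"
    if c: "continuous_on UNIV f" for f :: "complex \<Rightarrow> complex"
  proof -
    have [measurable]: "f \<in> borel_measurable borel" by (rule borel_measurable_continuous_onI[OF c])
    have i: "integrable (patch D) (\<lambda>z. norm (f z) * C)" using ip[OF c] by auto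
    show ?thesis
    proof (rule PP.Fubini_integrable)
      show "(\<lambda>(z, w). f z * K z w) \<in> borel_measurable (patch D \<Otimes>\<^sub>M patch D)"
        by (simp add: case_prod_unfold)
      show "integrable (patch D) (\<lambda>z. LINT w|patch D. norm (case (z, w) of (z, w) \<Rightarrow> f z * K z w))"
      proof (rule Bochner_Integration.integrable_bound[OF i])
        show "(\<lambda>z. LINT w|patch D. norm (case (z, w) of (z, w) \<Rightarrow> f z * K z w)) \<in> borel_measurable (patch D)"
          by measurable
        show "AE z in patch D. norm (LINT w|patch D. norm (case (z, w) of (z, w) \<Rightarrow> f z * K z w)) \<le> norm (norm (f z) * C)"
        proof (rule AE_I2)
          fix z
          have "0 \<le> (LINT w|patch D. norm (K z w))" by simp
          then show "norm (LINT w|patch D. norm (case (z, w) of (z, w) \<Rightarrow> f z * K z w)) \<le> norm (norm (f z) * C)"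
            using nK[of z] by (simp add: norm_mult abs_mult mult_left_mono)
        qed
      qed
      show "AE z in patch D. integrable (patch D) (\<lambda>w. case (z, w) of (z, w) \<Rightarrow> f z * K z w)"
        using iK by simp
    qed
  qed
  have anti: "K w z = - K z w" for z w unfolding K_def by (simp flip: inverse_minus_eq)
  \<comment> \<open>Renaming the variables. Fubini's theorem applies because the kernel has
    integrals bounded uniformly in the point.\<close>
  have sw: "(LINT z|patch D. LINT w|patch D. f w * K z w) = - (LINT z|patch D. LINT w|patch D. f z * K z w)"
    if c: "continuous_on UNIV f" for f :: "complex \<Rightarrow> complex"
  proof -
    have "(LINT z|patch D. LINT w|patch D. f w * K z w) = (LINT z|patch D. LINT w|patch D. - (f w * K w z))"
      by (subst anti) simp
    also have "\<dots> = - (LINT z|patch D. LINT w|patch D. f w * K w z)" by simp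
    also have "(LINT z|patch D. LINT w|patch D. f w * K w z) = (LINT w|patch D. LINT z|patch D. f w * K w z)"
      by (rule PP.Fubini_integral[OF iKK[OF c]])
    finally show ?thesis .
  qed
  have f: "(LINT z|patch D. f z * G z) = of_real (1 / (2 * pi)) * (LINT z|patch D. LINT w|patch D. f z * K z w)" for f
    by (simp only: Gz integral_mult_right_zero mult.left_commute[of "f _"])
  have G0: "(LINT z|patch D. G z) = 0"
    using sw[of "\<lambda>_. 1"] f[of "\<lambda>_. 1"] by simp
  have ic: "integrable (patch D) G" "integrable (patch D) (\<lambda>z. z - x0)" "integrable (patch D) (\<lambda>z. G z * z)"
    "integrable (patch D) (\<lambda>z. (z - x0) * z)" "integrable (patch D) (\<lambda>z. (z - x0)\<^sup>2)"
    by (intro ip continuous_intros cG)+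
  show c: "(LINT z|patch D. z - x0) = 0"
  proof -
    have "(LINT z|patch D. v z) = \<i> * ((LINT z|patch D. G z) - of_real \<Omega> * (LINT z|patch D. z - x0))"
      unfolding v_def integral_mult_right_zero
      using ic by (subst Bochner_Integration.integral_diff) (auto simp del: integral_mult_right_zero simp: integral_mult_right_zero)
    then show ?thesis using 1 G0 \<Omega> by simp
  qed
  have Gq: "(LINT z|patch D. z * G z) = of_real \<Omega> * (LINT z|patch D. (z - x0)\<^sup>2)"
  proof -
    have "(LINT z|patch D. v z * z) = (LINT z|patch D. \<i> * (z * G z - of_real \<Omega> * ((z - x0)\<^sup>2 + (z - x0) * x0)))"
      by (simp add: v_def algebra_simps power2_eq_square)
    also have "\<dots> = \<i> * ((LINT z|patch D. z * G z) - of_real \<Omega> * ((LINT z|patch D. (z - x0)\<^sup>2) + (LINT z|patch D. z - x0) * x0))"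
      unfolding integral_mult_right_zero using ic
      by (subst Bochner_Integration.integral_diff, simp add: mult.commute, intro integrable_mult_right Bochner_Integration.integrable_add integrable_mult_left, simp_all only:)
         (subst integral_mult_right_zero, subst Bochner_Integration.integral_add, simp_all only: integral_mult_left_zero integrable_mult_left)
    finally show ?thesis using 2 c by simp
  qed
  \<comment> \<open>\<open>kratio (z - w)\<close> is (z - w) \<open>K z w\<close>, and by
    \<open>sw\<close> both halves contribute equally. The factor 2 meets the 1 / (2 pi) in
    \<open>G\<close> and gives 4 pi.\<close>
  have "(LINT z|patch D. LINT w|patch D. kratio (z - w)) = (LINT z|patch D. LINT w|patch D. z * K z w - w * K z w)"
    by (simp add: kratio_def K_def divide_inverse left_diff_distrib del: complex_cnj_diff)
  also have "\<dots> = (LINT z|patch D. (LINT w|patch D. z * K z w) - (LINT w|patch D. w * K z w))"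
  proof (intro Bochner_Integration.integral_cong refl Bochner_Integration.integral_diff)
    show "integrable (patch D) (\<lambda>w. z * K z w)" for z using iK by simp
    show "integrable (patch D) (\<lambda>w. w * K z w)" for z
    proof (rule Bochner_Integration.integrable_bound[OF integrable_mult_right[OF iK, of "2" z]])
      show "AE w in patch D. norm (w * K z w) \<le> norm (2 * K z w)"
        unfolding patch_def using D2 by (subst AE_density) (auto simp: norm_mult indicator_def subset_iff split: if_splits intro!: mult_right_mono AE_I2)
    qed measurable
  qed
  also have "\<dots> = (LINT z|patch D. LINT w|patch D. z * K z w) - (LINT z|patch D. LINT w|patch D. w * K z w)"
  proof (rule Bochner_Integration.integral_diff)
    have c: "continuous_on UNIV (\<lambda>z::complex. z)" by (intro continuous_intros)
    show "integrable (patch D) (\<lambda>z. LINT w|patch D. z * K z w)"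
      using PP.integrable_fst'[OF iKK[OF c]] by simp
    have "integrable (patch D \<Otimes>\<^sub>M patch D) (\<lambda>(z, w). w * K w z)"
      using PP.integrable_product_swap[OF iKK[OF c]] by (simp add: case_prod_unfold)
    from PP.integrable_fst'[OF this] have "integrable (patch D) (\<lambda>z. LINT w|patch D. w * K w z)" by simp
    then show "integrable (patch D) (\<lambda>z. LINT w|patch D. w * K z w)"
      by (subst anti) simp
  qed
  also have "\<dots> = 2 * (LINT z|patch D. LINT w|patch D. z * K z w)"
    using sw[of "\<lambda>z. z"] by (simp add: continuous_on_id)
  also have "\<dots> = of_real (4 * pi) * (LINT z|patch D. z * G z)"
    by (simp add: f)
  finally show "(LINT z|patch D. LINT w|patch D. kratio (z - w)) = of_real (4 * pi * \<Omega>) * (LINT z|patch D. (z - x0)\<^sup>2)"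
    by (simp add: Gq)
qed

section \<open>The stream function on the boundary\<close>

lemma periodic_cis_eq:
  fixes F :: "real \<Rightarrow> 'a"
  assumes per: "\<And>x. F (x + 2 * pi) = F x" and e: "cis a = cis b"
  shows "F a = F b"
proof -
  interpret periodic_fun_simple F "2 * pi" by standard (rule per)
  obtain n :: int where "a = b + 2 * pi * n" using e sin_cos_eq_iff[of a b] by (auto simp: complex_eq_iff)
  then show ?thesis using plus_of_int[of b n] by (simp add: mult.commute)
qed

lemma periodic_eq_Arg_cis:
  fixes F :: "real \<Rightarrow> 'a"
  assumes per: "\<And>x. F (x + 2 * pi) = F x"
  shows "F \<theta> = F (Arg (cis \<theta>))" and "Arg (cis \<theta>) \<in> {-pi..pi}"
proof -
  show "F \<theta> = F (Arg (cis \<theta>))" by (rule periodic_cis_eq[of F, OF per]) (simp add: cis_Arg)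
  show "Arg (cis \<theta>) \<in> {-pi..pi}" using Arg_bounded[of "cis \<theta>"] by auto
qed

lemma periodic_continuous_bounded:
  fixes u :: "real \<Rightarrow> real"
  assumes c: "continuous_on UNIV u" and per: "\<And>x. u (x + 2 * pi) = u x"
  shows "\<exists>B. \<forall>x. \<bar>u x\<bar> \<le> B"
proof -
  have "bounded (u ` {-pi..pi})" by (intro compact_imp_bounded compact_continuous_image continuous_on_subset[OF c]) auto
  then obtain B where B: "\<forall>x\<in>u ` {-pi..pi}. norm x \<le> B" unfolding bounded_iff by blast
  have "\<bar>u x\<bar> \<le> B" for x
    using B periodic_eq_Arg_cis[of u, OF per, of x] by auto
  then show ?thesis by blast
qed

text \<open>\<open>Arg\<close> jumps across the negative axis. Near \<open>z\<close> it is replaced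
  by a continuous branch that differs from it by a multiple of 2 pi, which a periodic
  \<open>F\<close> does not notice.\<close>

lemma periodic_Arg_local:
  fixes F :: "real \<Rightarrow> 'a"
  assumes per: "\<And>x. F (x + 2 * pi) = F x" and z: "z \<noteq> 0" and w: "w / z \<notin> \<real>\<^sub>\<le>\<^sub>0"
  shows "F (Arg w) = F (Arg z + Im (Ln (w / z)))"
proof (rule periodic_cis_eq[of F, OF per])
  have wz: "w / z \<noteq> 0" using w by auto
  then have "Im (Ln (w / z)) = Arg (w / z)" by (simp add: Arg_eq_Im_Ln)
  then have "cis (Im (Ln (w / z))) = sgn (w / z)" by (simp only: cis_Arg[OF wz])
  then have "cis (Arg z + Im (Ln (w / z))) = sgn (z * (w / z))"
    unfolding cis_mult[symmetric] sgn_mult by (simp only: cis_Arg[OF z])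
  also have "\<dots> = cis (Arg w)" using wz by (simp add: cis_Arg)
  finally show "cis (Arg w) = cis (Arg z + Im (Ln (w / z)))" ..
qed

lemma open_slit:
  fixes z :: complex
  shows "z \<noteq> 0 \<Longrightarrow> open {w. w / z \<notin> \<real>\<^sub>\<le>\<^sub>0}" "z \<noteq> 0 \<Longrightarrow> z \<in> {w. w / z \<notin> \<real>\<^sub>\<le>\<^sub>0}"
proof -
  assume z: "z \<noteq> 0"
  have "open ((\<lambda>w. w / z) -` (- \<real>\<^sub>\<le>\<^sub>0))"
    using z by (intro open_vimage open_Compl closed_nonpos_Reals_complex continuous_intros) auto
  then show "open {w. w / z \<notin> \<real>\<^sub>\<le>\<^sub>0}" by (simp add: vimage_def)
  show "z \<in> {w. w / z \<notin> \<real>\<^sub>\<le>\<^sub>0}" using z by simp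
qed

lemma isCont_periodic_Arg:
  fixes F :: "real \<Rightarrow> 'a :: topological_space"
  assumes per: "\<And>x. F (x + 2 * pi) = F x" and c: "continuous_on UNIV F" and z: "z \<noteq> 0"
  shows "isCont (\<lambda>w. F (Arg w)) z"
proof -
  have "eventually (\<lambda>w. F (Arg w) = F (Arg z + Im (Ln (w / z)))) (nhds z)"
    using open_slit[OF z] periodic_Arg_local[of F, OF per z] unfolding eventually_nhds by blast
  moreover have "isCont (\<lambda>w. Arg z + Im (Ln (w / z))) z"
    using z by (intro continuous_intros) auto
  then have "isCont (\<lambda>w. F (Arg z + Im (Ln (w / z)))) z"
    by (rule isCont_o2) (use c in \<open>simp add: continuous_on_eq_continuous_at\<close>)
  ultimately show ?thesis by (simp add: isCont_cong)
qed

text \<open>The gradient of the polar angle is \<i> z / |z|^2.\<close>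

lemma has_derivative_periodic_Arg:
  fixes F :: "real \<Rightarrow> real"
  assumes per: "\<And>x. F (x + 2 * pi) = F x" and F: "\<And>x. (F has_real_derivative h x) (at x)" and z: "z \<noteq> 0"
  shows "((\<lambda>w. F (Arg w)) has_derivative (\<lambda>k. (h (Arg z) / (z \<bullet> z)) * ((\<i> * z) \<bullet> k))) (at z)"
proof -
  have "((\<lambda>w. Ln (w / z)) has_field_derivative 1 / z) (at z)"
    using z by (auto intro!: derivative_eq_intros)
  then have "((\<lambda>w. Arg z + Im (Ln (w / z))) has_derivative (\<lambda>k. Im ((1 / z) * k))) (at z)"
    unfolding has_field_derivative_def by (intro derivative_eq_intros bounded_linear.has_derivative[OF bounded_linear_Im]) auto
  moreover have "Im ((1 / z) * k) = ((\<i> * z) \<bullet> k) / (z \<bullet> z)" for k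
  proof -
    have "(1 / z) * k = (k * cnj z) / (z * cnj z)" using z by simp
    also have "z * cnj z = of_real (z \<bullet> z)" by (simp add: complex_eq_iff inner_complex_def)
    finally have "(1 / z) * k = (k * cnj z) / of_real (z \<bullet> z)" .
    then show ?thesis by (simp add: inner_complex_def Im_divide_of_real)
  qed
  ultimately have 1: "((\<lambda>w. Arg z + Im (Ln (w / z))) has_derivative (\<lambda>k. ((\<i> * z) \<bullet> k) / (z \<bullet> z))) (at z)"
    by simp
  have 2: "(F has_derivative (*) (h (Arg z))) (at (Arg z + Im (Ln (z / z))))"
    using F[of "Arg z"] z by (simp add: has_field_derivative_def)
  have "((\<lambda>w. F (Arg z + Im (Ln (w / z)))) has_derivative (\<lambda>k. (h (Arg z) / (z \<bullet> z)) * ((\<i> * z) \<bullet> k))) (at z)"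
    using has_derivative_compose[OF 1 2] by simp
  then show ?thesis
    by (rule has_derivative_transform_within_open[OF _ open_slit[OF z]]) (simp add: periodic_Arg_local[of F, OF per z])
qed

text \<open>Evaluated at \<open>\<bar>z\<bar>\<^sup>2\<close>, this removes a neighbourhood of the origin, where \<open>Arg\<close> is singular.\<close>

definition annulus_cutoff :: "real \<Rightarrow> real" where "annulus_cutoff s = pos_sq (1 - 16 * pos_sq (1 / 2 - s))"
definition annulus_cutoff' :: "real \<Rightarrow> real" where "annulus_cutoff' s = 64 * max 0 (1 - 16 * pos_sq (1 / 2 - s)) * max 0 (1 / 2 - s)"

lemma has_derivative_annulus_cutoff: "(annulus_cutoff has_real_derivative annulus_cutoff' s) (at s)"
  unfolding annulus_cutoff_def[abs_def] annulus_cutoff'_def by (auto intro!: derivative_eq_intros)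

lemma continuous_annulus_cutoff [continuous_intros]:
  "continuous_on A f \<Longrightarrow> continuous_on A (\<lambda>x. annulus_cutoff (f x))" "continuous_on A f \<Longrightarrow> continuous_on A (\<lambda>x. annulus_cutoff' (f x))"
  unfolding annulus_cutoff_def annulus_cutoff'_def by (intro continuous_intros; assumption)+

lemma annulus_cutoff_eq: "s \<le> 1 / 4 \<Longrightarrow> annulus_cutoff s = 0" "s \<le> 1 / 4 \<Longrightarrow> annulus_cutoff' s = 0" "s \<ge> 1 / 2 \<Longrightarrow> annulus_cutoff s = 1" "s \<ge> 1 / 2 \<Longrightarrow> annulus_cutoff' s = 0"
proof -
  assume "s \<le> 1 / 4"
  then have "(1 / 4) * (1 / 4) \<le> max 0 (1 / 2 - s) * max 0 (1 / 2 - s)" by (intro mult_mono) auto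
  then have "1 \<le> 16 * pos_sq (1 / 2 - s)" by (simp add: pos_sq_def power2_eq_square)
  then show "annulus_cutoff s = 0" "annulus_cutoff' s = 0" by (simp_all add: annulus_cutoff_def annulus_cutoff'_def) (simp add: pos_sq_def)
qed (auto simp: annulus_cutoff_def annulus_cutoff'_def pos_sq_def)

lemma antiderivative_exists:
  fixes g :: "real \<Rightarrow> real"
  assumes "continuous_on UNIV g"
  shows "\<exists>F. \<forall>x. (F has_real_derivative g x) (at x)"
  using einterval_antiderivative[of "-\<infinity>" \<infinity> g] assms
  by (auto simp: continuous_on_eq_continuous_at has_real_derivative_iff_has_vector_derivative)

lemma integral_circ_eq_0_imp:
  fixes u :: "real \<Rightarrow> real"
  assumes c: "continuous_on UNIV u" and pos: "\<And>x. u x \<ge> 0" and int: "(LINT \<theta>|circ. u \<theta>) = 0" and \<theta>: "\<theta> \<in> {- pi..pi}"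
  shows "u \<theta> = 0"
proof -
  obtain Q where Q: "\<And>x. (Q has_real_derivative u x) (at x)" using antiderivative_exists[OF c] by blast
  have "Q pi - Q (- pi) = 0"
    using int c Q by (subst (asm) integral_circ_FTC[of Q]) (auto simp: has_real_derivative_iff_has_vector_derivative)
  moreover have "(u has_integral (Q pi - Q (- pi))) {- pi..pi}"
    using Q by (intro fundamental_theorem_of_calculus) (auto simp: has_real_derivative_iff_has_vector_derivative intro: has_vector_derivative_at_within)
  ultimately have "integral (cbox (- pi) pi) u = 0" by (simp add: integral_unique)
  then show ?thesis
    using \<theta> pos integral_cbox_eq_0_iff[of "- pi" pi u] continuous_on_subset[OF c] pi_gt_zero by (auto simp: not_le)
qed

text \<open>The test function is \<open>F (Arg z)\<close> near the boundary, where \<open>F' = h\<close> is the deviation of the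
  boundary values \<open>f\<close> from their mean; the weak formulation then says \<open>\<integral> h f = 0\<close>.\<close>

lemma (in polar_set) boundary_const:
  assumes V: "V_state U \<Omega> x0" and cR: "continuous_on UNIV R" and perR: "\<And>\<theta>. R (\<theta> + 2 * pi) = R \<theta>"
  obtains C where "\<And>\<theta>. pot U (of_real (R \<theta>) * cis \<theta>) - \<Omega> / 2 * (norm (of_real (R \<theta>) * cis \<theta> - x0))\<^sup>2 = C"
proof -
  define \<Phi> where "\<Phi> z = pot U z - \<Omega> / 2 * (norm (z - x0))\<^sup>2" for z
  define G where "G z = grad_pot U z - of_real \<Omega> * (z - x0)" for z
  have d\<Phi>: "(\<Phi> has_derivative (\<lambda>k. G z \<bullet> k)) (at z)" for z
  proof -
    have 1: "((\<lambda>z. (z - x0) \<bullet> (z - x0)) has_derivative (\<lambda>k. (z - x0) \<bullet> k + k \<bullet> (z - x0))) (at z)"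
      by (auto intro!: derivative_eq_intros)
    have "((\<lambda>z. pot U z - \<Omega> / 2 * ((z - x0) \<bullet> (z - x0))) has_derivative
        (\<lambda>k. grad_pot U z \<bullet> k - \<Omega> / 2 * ((z - x0) \<bullet> k + k \<bullet> (z - x0)))) (at z)"
      by (intro has_derivative_diff has_derivative_pot[OF bounded_U U_borel] has_derivative_mult_right 1)
    then show ?thesis unfolding \<Phi>_def[abs_def] power2_norm_eq_inner
      by (rule has_derivative_eq_rhs)
         (simp add: G_def inner_diff_left scaleR_conv_of_real[symmetric] inner_commute[of _ "z - x0"] fun_eq_iff)
  qed
  have cG: "continuous_on UNIV G" unfolding G_def by (intro continuous_intros continuous_grad_pot bounded_U U_borel)
  have c\<Phi>: "continuous_on UNIV \<Phi>" using d\<Phi> by (meson continuous_at_imp_continuous_on has_derivative_continuous)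
  have ccis: "continuous_on A (\<lambda>x. cis (g x))" if "continuous_on A g" for A :: "'b::topological_space set" and g
    unfolding cis_conv_exp by (intro continuous_intros that)
  define f where "f \<theta> = \<Phi> (of_real (R \<theta>) * cis \<theta>)" for \<theta>
  have cf: "continuous_on UNIV f" unfolding f_def
    by (intro continuous_on_compose2[OF c\<Phi>] continuous_intros cR ccis) auto
  have perf: "f (\<theta> + 2 * pi) = f \<theta>" for \<theta> by (simp add: f_def perR flip: cis_mult)
  define m where "m = (LINT \<theta>|circ. f \<theta>) / (2 * pi)"
  define h where "h \<theta> = f \<theta> - m" for \<theta>
  have ch: "continuous_on UNIV h" unfolding h_def by (intro continuous_intros cf)
  have perh: "h (\<theta> + 2 * pi) = h \<theta>" for \<theta> by (simp add: h_def perf)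
  have ic: "integrable circ u" if u: "continuous_on UNIV u" "\<And>\<theta>. u (\<theta> + 2 * pi) = u \<theta>" for u :: "real \<Rightarrow> real"
  proof -
    obtain B where "\<And>x. \<bar>u x\<bar> \<le> B" using periodic_continuous_bounded[of u, OF u] by blast
    then show ?thesis by (intro integrable_circ_bounded[of _ B] borel_measurable_continuous_onI[OF u(1)]) auto
  qed
  obtain F where F: "\<And>x. (F has_real_derivative h x) (at x)" using antiderivative_exists[OF ch] by blast
  have cF: "continuous_on UNIV F" using F by (meson DERIV_continuous continuous_at_imp_continuous_on)
  have int_h: "(LINT \<theta>|circ. h \<theta>) = 0"
    using ic[OF cf perf] by (simp add: h_def m_def measure_circ)
  \<comment> \<open>Over one period \<open>F\<close> grows by the integral of \<open>h\<close>,
    which vanishes because the mean was subtracted. Without this, \<open>F (Arg z)\<close> would not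
    be a test function.\<close>
  have perF: "F (\<theta> + 2 * pi) = F \<theta>" for \<theta>
  proof -
    have "((\<lambda>x. F (x + 2 * pi) - F x) has_real_derivative 0) (at x)" for x
      using perh by (auto intro!: derivative_eq_intros DERIV_chain2[OF F])
    then have "F (\<theta> + 2 * pi) - F \<theta> = F (- pi + 2 * pi) - F (- pi)"
      by (intro DERIV_isconst_all) auto
    also have "\<dots> = (LINT \<theta>|circ. h \<theta>)"
      using F ch by (subst integral_circ_FTC[of F]) (auto simp: has_real_derivative_iff_has_vector_derivative)
    finally show ?thesis using int_h by simp
  qed
  define p where "p z = annulus_cutoff (z \<bullet> z) * F (Arg z)" for z :: complex
  define Dp where "Dp z = (2 * annulus_cutoff' (z \<bullet> z) * F (Arg z)) *\<^sub>R z + (annulus_cutoff (z \<bullet> z) * h (Arg z) / (z \<bullet> z)) *\<^sub>R (\<i> * z)" for z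
  have op: "open {z :: complex. z \<bullet> z < 1 / 4}" by (intro open_Collect_less continuous_intros)
  have dp: "(p has_derivative (\<lambda>k. Dp z \<bullet> k)) (at z)" for z
  proof (cases "z \<bullet> z < 1 / 4")
    case True
    have "((\<lambda>_. 0) has_derivative (\<lambda>k. Dp z \<bullet> k)) (at z)" using True by (simp add: Dp_def annulus_cutoff_eq)
    then show ?thesis by (rule has_derivative_transform_within_open[OF _ op]) (use True in \<open>auto simp: p_def annulus_cutoff_eq\<close>)
  next
    case False
    then have z: "z \<noteq> 0" by auto
    have 1: "((\<lambda>z. annulus_cutoff (z \<bullet> z)) has_derivative (\<lambda>k. annulus_cutoff' (z \<bullet> z) * (z \<bullet> k + k \<bullet> z))) (at z)"
    proof -
      have 2: "((\<lambda>z. z \<bullet> z) has_derivative (\<lambda>k. z \<bullet> k + k \<bullet> z)) (at z)" by (auto intro!: derivative_eq_intros)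
      from has_derivative_compose[OF 2 has_derivative_annulus_cutoff[unfolded has_field_derivative_def]] show ?thesis .
    qed
    show ?thesis unfolding p_def[abs_def]
    proof (rule has_derivative_eq_rhs[OF has_derivative_mult[OF 1 has_derivative_periodic_Arg[OF perF F z]]], rule ext)
      fix k
      have "z \<bullet> k + k \<bullet> z = 2 * (z \<bullet> k)" by (simp add: inner_commute)
      then show "annulus_cutoff (z \<bullet> z) * (h (Arg z) / (z \<bullet> z) * ((\<i> * z) \<bullet> k)) + annulus_cutoff' (z \<bullet> z) * (z \<bullet> k + k \<bullet> z) * F (Arg z) = Dp z \<bullet> k"
        by (simp add: Dp_def inner_add_left)
    qed
  qed
  have cDp: "continuous_on UNIV Dp"
  proof (intro continuous_at_imp_continuous_on ballI)
    fix z
    show "isCont Dp z"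
    proof (cases "z \<bullet> z < 1 / 4")
      case True
      then have "eventually (\<lambda>z. Dp z = 0) (nhds z)"
        using op unfolding eventually_nhds by (intro exI[of _ "{z. z \<bullet> z < 1 / 4}"]) (auto simp: Dp_def annulus_cutoff_eq)
      then show ?thesis by (simp add: isCont_cong)
    next
      case False
      then have z: "z \<noteq> 0" by auto
      have "continuous_on UNIV (\<lambda>z::complex. annulus_cutoff (z \<bullet> z))" "continuous_on UNIV (\<lambda>z::complex. annulus_cutoff' (z \<bullet> z))"
        by (intro continuous_intros)+
      then have k: "isCont (\<lambda>z::complex. annulus_cutoff (z \<bullet> z)) z" "isCont (\<lambda>z::complex. annulus_cutoff' (z \<bullet> z)) z"
        by (auto simp: continuous_on_eq_continuous_at)
      show ?thesis unfolding Dp_def[abs_def] using z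
        by (intro continuous_intros k isCont_periodic_Arg perF perh cF ch z) auto
    qed
  qed
  have U2: "U \<subseteq> cball 0 2" using U_sub(2) \<kappa> by force
  define H where "H z = indicat_real U z * ((\<i> * G z) \<bullet> Dp z)" for z
  have H0: "(LINT z|lborel. H z) = 0"
    using weak_steady_cutoff[OF V U_borel U2 dp cDp] by (simp add: H_def G_def)
  have ciGD: "continuous_on UNIV (\<lambda>z. (\<i> * G z) \<bullet> Dp z)" by (intro continuous_intros cG cDp)
  have iH: "integrable lborel H"
  proof -
    have "bounded ((\<lambda>z. (\<i> * G z) \<bullet> Dp z) ` cball 0 2)"
      by (intro compact_imp_bounded compact_continuous_image continuous_on_subset[OF ciGD]) auto
    then obtain B where "\<And>z. z \<in> U \<Longrightarrow> norm ((\<i> * G z) \<bullet> Dp z) \<le> B" using U2 by (force simp: bounded_iff)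
    from integrable_bounded_mult_indicator[OF bounded_U U_borel borel_measurable_continuous_onI[OF ciGD] this]
    show ?thesis by (simp add: H_def[abs_def])
  qed
  have Hm [measurable]: "H \<in> borel_measurable borel" using iH by auto
  \<comment> \<open>\<open>P\<close> is the \<theta>-derivative of F \<theta> \<Phi> (r cis
    \<theta>), so it integrates to 0 over each circle. \<open>X\<close> collects the terms that
    contain the derivative of the cutoff and inherits this.\<close>
  define P where "P \<theta> r = h \<theta> * \<Phi> (of_real r * cis \<theta>) + F \<theta> * (G (of_real r * cis \<theta>) \<bullet> (r *\<^sub>R (\<i> * cis \<theta>)))" for \<theta> r
  define X where "X \<theta> r = 2 * r * annulus_cutoff' (r\<^sup>2) * P \<theta> r" for \<theta> r
  \<comment> \<open>(3/4)^2 = 9/16 is above 1/2, where the cutoff is already constant, and 3/4 is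
    below all boundary radii.\<close>
  have X0: "X \<theta> r = 0" if "r \<ge> 3 / 4" for \<theta> r
  proof -
    have "(3 / 4) * (3 / 4) \<le> r * r" using that by (intro mult_mono) auto
    then show ?thesis by (simp add: X_def annulus_cutoff_eq power2_eq_square)
  qed
  define J where "J \<theta> = (LINT r|lborel. X \<theta> r * indicat_real {0..3 / 4} r)" for \<theta>
  have cP: "continuous_on A (\<lambda>x. P (u x) (v x))" if u: "continuous_on A u" and v: "continuous_on A v" for A :: "'b::topological_space set" and u v
  proof -
    have 1: "continuous_on A (\<lambda>x. of_real (v x) * cis (u x))" by (intro continuous_intros ccis that)
    show ?thesis unfolding P_def
      by (intro continuous_intros ccis that continuous_on_compose2[OF c\<Phi> 1] continuous_on_compose2[OF cG 1]
          continuous_on_compose2[OF ch u] continuous_on_compose2[OF cF u]) auto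
  qed
  have cX: "continuous_on A (\<lambda>x. X (u x) (v x))" if u: "continuous_on A u" and v: "continuous_on A v" for A :: "'b::topological_space set" and u v
    unfolding X_def by (intro continuous_intros that cP)
  \<comment> \<open>Integration by parts along the ray: the radial derivative of cutoff times h
    times \<Phi> is r H + X, so the boundary value h f appears and \<open>X\<close> is left over as
    \<open>J\<close>.\<close>
  have inner: "(LINT r|rad. H (of_real r * cis \<theta>)) = h \<theta> * f \<theta> - J \<theta>" for \<theta>
  proof -
    define N where "N r = annulus_cutoff (r\<^sup>2) * h \<theta> * (G (of_real r * cis \<theta>) \<bullet> cis \<theta>)
      - 2 * r * annulus_cutoff' (r\<^sup>2) * F \<theta> * (G (of_real r * cis \<theta>) \<bullet> (r *\<^sub>R (\<i> * cis \<theta>)))" for r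
    define L where "L r = annulus_cutoff (r\<^sup>2) * h \<theta> * \<Phi> (of_real r * cis \<theta>)" for r
    have R34: "3 / 4 \<le> R \<theta>" "0 \<le> R \<theta>" using R(1)[of \<theta>] \<kappa> by auto
    have dL: "(L has_real_derivative N r + X \<theta> r) (at r)" for r
    proof -
      have 1: "((\<lambda>r. annulus_cutoff (r\<^sup>2)) has_real_derivative 2 * r * annulus_cutoff' (r\<^sup>2)) (at r)"
      proof -
        have "((\<lambda>r. r\<^sup>2) has_real_derivative 2 * r) (at r)" by (auto intro!: derivative_eq_intros)
        from DERIV_chain2[OF has_derivative_annulus_cutoff this] show ?thesis by (simp add: mult_ac)
      qed
      have "((\<lambda>r. of_real r * cis \<theta>) has_derivative (\<lambda>s. s *\<^sub>R cis \<theta>)) (at r)"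
        by (auto intro!: derivative_eq_intros simp: scaleR_conv_of_real)
      from has_derivative_compose[OF this d\<Phi>]
      have 2: "((\<lambda>r. \<Phi> (of_real r * cis \<theta>)) has_real_derivative (G (of_real r * cis \<theta>) \<bullet> cis \<theta>)) (at r)"
        by (simp add: has_field_derivative_def mult_commute_abs)
      show ?thesis unfolding L_def[abs_def]
        by (rule DERIV_cong[OF DERIV_mult[OF DERIV_cmult_right[OF 1] 2]])
           (simp add: N_def X_def P_def algebra_simps)
    qed
    have cN: "continuous_on UNIV (\<lambda>r. N r + X \<theta> r)"
    proof -
      have 1: "continuous_on UNIV (\<lambda>r. of_real r * cis \<theta>)" by (intro continuous_intros)
      show ?thesis unfolding N_def
        by (intro continuous_intros cX continuous_on_compose2[OF cG 1]) auto
    qed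
    have hL: "has_bochner_integral lborel (\<lambda>r. (N r + X \<theta> r) * indicat_real {0..R \<theta>} r) (L (R \<theta>) - L 0)"
      using dL cN R34 by (intro has_bochner_integral_FTC_Icc_real) (auto simp: continuous_on_eq_continuous_at)
    have hX: "integrable lborel (\<lambda>r. X \<theta> r * indicat_real {0..3 / 4} r)"
    proof (rule borel_integrable_atLeastAtMost)
      show "isCont (X \<theta>) r" for r using cX[of UNIV "\<lambda>_. \<theta>" "\<lambda>r. r"] by (auto simp: continuous_on_eq_continuous_at)
    qed
    have "AE r in lborel. r \<noteq> R \<theta>" by (rule AE_lborel_singleton)
    then have "AE r in lborel. (indicator {0..} r * r) *\<^sub>R H (of_real r * cis \<theta>)
        = (N r + X \<theta> r) * indicat_real {0..R \<theta>} r - X \<theta> r * indicat_real {0..3 / 4} r"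
    proof eventually_elim
      case (elim r)
      consider "r < 0" | "r = 0" | "r > R \<theta>" | "0 < r" "r < R \<theta>" using elim by linarith
      then show ?case
      proof cases
        case 2
        then show ?thesis using R34 by (simp add: N_def annulus_cutoff_eq)
      next
        case 3
        then have "of_real r * cis \<theta> \<notin> U" using U_iff[of r \<theta>] R34 by simp
        then show ?thesis using 3 R34 X0[of r \<theta>] by (simp add: H_def)
      next
        case 4
        define e where "e = cis \<theta>"
        define z where "z = of_real r * e"
        have z: "z \<in> U" using U_iff[of r \<theta>] 4 by (simp add: z_def e_def)
        have ca: "cis (Arg z) = cis \<theta>" using 4 by (simp add: z_def e_def cis_Arg sgn_mult)
        have a: "F (Arg z) = F \<theta>" "h (Arg z) = h \<theta>"
          using periodic_cis_eq[of F, OF perF ca] periodic_cis_eq[of h, OF perh ca] by auto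
        have zz: "z \<bullet> z = r\<^sup>2" using 4 by (simp add: dot_square_norm z_def e_def norm_mult)
        have zr: "z = r *\<^sub>R e" by (simp add: z_def scaleR_conv_of_real)
        have iz: "\<i> * z = r *\<^sub>R (\<i> * e)" by (simp add: zr)
        have s: "(\<i> * g) \<bullet> e = - (g \<bullet> (\<i> * e))" "(\<i> * g) \<bullet> (\<i> * e) = g \<bullet> e" for g
          by (simp_all add: inner_complex_def)
        have H: "H z = (2 * annulus_cutoff' (r\<^sup>2) * F \<theta>) * (r * - (G z \<bullet> (\<i> * e))) + (annulus_cutoff (r\<^sup>2) * h \<theta> / r\<^sup>2) * (r * (G z \<bullet> e))"
          using z unfolding H_def Dp_def zz a iz by (simp only: inner_add_right inner_scaleR_right zr s) simp
        have "r * H z = N r"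
          unfolding H N_def e_def[symmetric] z_def[symmetric] inner_scaleR_right
          using 4 by (simp add: field_simps power2_eq_square)
        then show ?thesis using 4 X0[of r \<theta>] by (auto simp: z_def e_def indicator_def)
      qed (use X0 R34 in auto)
    qed
    moreover have "(\<lambda>r. (N r + X \<theta> r) * indicat_real {0..R \<theta>} r - X \<theta> r * indicat_real {0..3 / 4} r) \<in> borel_measurable lborel"
      using hL hX by (auto simp: has_bochner_integral_iff)
    ultimately have "(LINT r|lborel. (indicator {0..} r * r) *\<^sub>R H (of_real r * cis \<theta>))
        = (LINT r|lborel. (N r + X \<theta> r) * indicat_real {0..R \<theta>} r - X \<theta> r * indicat_real {0..3 / 4} r)"
      by (intro integral_cong_AE) auto
    also have "\<dots> = (L (R \<theta>) - L 0) - J \<theta>"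
      unfolding J_def using hL hX by (subst Bochner_Integration.integral_diff) (auto simp: has_bochner_integral_iff)
    also have "L (R \<theta>) = h \<theta> * f \<theta>"
    proof -
      have "(3 / 4) * (3 / 4) \<le> R \<theta> * R \<theta>" using R34 by (intro mult_mono) auto
      then show ?thesis by (simp add: L_def f_def annulus_cutoff_eq power2_eq_square)
    qed
    also have "L 0 = 0" by (simp add: L_def annulus_cutoff_eq)
    finally show ?thesis by (subst integral_rad) auto
  qed
  have Jint: "integrable circ J" "(LINT \<theta>|circ. J \<theta>) = 0"
  proof -
    interpret CL: pair_sigma_finite circ "lborel :: real measure" ..
    define Y where "Y p = X (fst p) (snd p) * indicat_real {0..3 / 4} (snd p)" for p
    have cX2: "continuous_on UNIV (\<lambda>p. X (fst p) (snd p))" by (intro cX continuous_intros)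
    have "bounded ((\<lambda>p. X (fst p) (snd p)) ` ({-pi..pi} \<times> {0..3 / 4}))"
      by (intro compact_imp_bounded compact_continuous_image continuous_on_subset[OF cX2] compact_Times) auto
    then obtain B where "\<forall>x\<in>(\<lambda>p. X (fst p) (snd p)) ` ({-pi..pi} \<times> {0..3 / 4}). norm x \<le> B"
      unfolding bounded_iff by blast
    then have B: "norm (X \<theta> r) \<le> B" if "\<theta> \<in> {-pi..pi}" "r \<in> {0..3 / 4}" for \<theta> r using that by force
    have perX: "X (\<theta> + 2 * pi) = X \<theta>" for \<theta>
      by (simp add: X_def P_def fun_eq_iff perF perh flip: cis_mult)
    have B': "norm (X \<theta> r) \<le> B" if "r \<in> {0..3 / 4}" for \<theta> r
    proof -
      have "X \<theta> = X (Arg (cis \<theta>))" by (rule periodic_cis_eq[of X, OF perX]) (simp add: cis_Arg)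
      moreover have "Arg (cis \<theta>) \<in> {-pi..pi}" using Arg_bounded[of "cis \<theta>"] by auto
      ultimately show ?thesis using B that by metis
    qed
    have "emeasure (circ \<Otimes>\<^sub>M lborel) (UNIV \<times> {0..3 / 4 :: real}) = ennreal (2 * pi) * ennreal (3 / 4)"
      by (subst lborel.emeasure_pair_measure_Times) (auto simp: emeasure_circ_UNIV)
    also have "\<dots> < \<infinity>" by (simp flip: ennreal_mult)
    finally have iI: "integrable (circ \<Otimes>\<^sub>M lborel) (indicat_real (UNIV \<times> {0..3 / 4 :: real}))"
      by (intro integrable_real_indicator) auto
    have [measurable]: "(\<lambda>p. X (fst p) (snd p)) \<in> borel_measurable (borel \<Otimes>\<^sub>M borel)"
      unfolding borel_prod by (rule borel_measurable_continuous_onI[OF cX2])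
    have iY: "integrable (circ \<Otimes>\<^sub>M lborel) Y"
    proof (rule Bochner_Integration.integrable_bound[OF integrable_mult_right[OF iI, of B]])
      show "Y \<in> borel_measurable (circ \<Otimes>\<^sub>M lborel)" unfolding Y_def by measurable
      show "AE p in circ \<Otimes>\<^sub>M lborel. norm (Y p) \<le> norm (B * indicat_real (UNIV \<times> {0..3 / 4}) p)"
        using B' by (intro AE_I2) (auto simp: Y_def indicator_def mem_Times_iff intro: order.trans[OF _ abs_ge_self])
    qed
    then have iY': "integrable (circ \<Otimes>\<^sub>M lborel) (\<lambda>(\<theta>, r). X \<theta> r * indicat_real {0..3 / 4} r)"
      by (simp add: Y_def[abs_def] case_prod_unfold)
    show "integrable circ J" using CL.integrable_fst'[OF iY] by (simp add: J_def[abs_def] Y_def)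
    have sw: "(LINT \<theta>|circ. J \<theta>) = (LINT r|lborel. LINT \<theta>|circ. X \<theta> r * indicat_real {0..3 / 4} r)"
      unfolding J_def by (rule CL.Fubini_integral[OF iY', symmetric])
    have "(LINT \<theta>|circ. X \<theta> r) = 0" for r
    proof -
      have "((\<lambda>\<theta>. F \<theta> * \<Phi> (of_real r * cis \<theta>)) has_real_derivative P \<theta> r) (at \<theta>)" for \<theta>
      proof -
        have "(cis has_vector_derivative \<i> * cis \<theta>) (at \<theta>)"
          by (auto simp: cis_conv_exp[abs_def] has_field_derivative_def field_simps intro!: derivative_eq_intros has_vector_derivative_real_field)
        then have "((\<lambda>\<theta>. of_real r * cis \<theta>) has_derivative (\<lambda>s. s *\<^sub>R (r *\<^sub>R (\<i> * cis \<theta>)))) (at \<theta>)"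
          unfolding has_vector_derivative_def by (auto intro!: derivative_eq_intros simp: scaleR_conv_of_real)
        from has_derivative_compose[OF this d\<Phi>]
        have 2: "((\<lambda>\<theta>. \<Phi> (of_real r * cis \<theta>)) has_real_derivative (G (of_real r * cis \<theta>) \<bullet> (r *\<^sub>R (\<i> * cis \<theta>)))) (at \<theta>)"
          unfolding has_field_derivative_def inner_scaleR_right by (rule has_derivative_eq_rhs) (simp add: fun_eq_iff mult_ac)
        show ?thesis by (rule DERIV_cong[OF DERIV_mult[OF F 2]]) (simp add: P_def mult.commute)
      qed
      then have "(LINT \<theta>|circ. P \<theta> r) = F pi * \<Phi> (of_real r * cis pi) - F (- pi) * \<Phi> (of_real r * cis (- pi))"
        by (intro integral_circ_FTC cP continuous_intros) (simp add: has_real_derivative_iff_has_vector_derivative)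
      also have "F pi = F (- pi)" using perF[of "- pi"] by simp
      also have "cis (- pi) = cis pi" by (simp add: complex_eq_iff)
      finally show ?thesis by (simp add: X_def)
    qed
    then show "(LINT \<theta>|circ. J \<theta>) = 0" by (simp add: sw)
  qed
  have chf: "continuous_on UNIV (\<lambda>\<theta>. h \<theta> * f \<theta>)" by (intro continuous_intros ch cf)
  have "0 = (LINT \<theta>|circ. h \<theta> * f \<theta> - J \<theta>)"
    using integral_polar[OF iH] H0 by (simp add: inner)
  also have "\<dots> = (LINT \<theta>|circ. h \<theta> * f \<theta>) - 0"
    using Jint ic[OF chf] by (subst Bochner_Integration.integral_diff) (auto simp: perh perf)
  finally have hf: "(LINT \<theta>|circ. h \<theta> * f \<theta>) = 0" by simp
  \<comment> \<open>Replacing f by its deviation h costs nothing, as h has mean zero; so the square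
    integral of h vanishes.\<close>
  have "(LINT \<theta>|circ. h \<theta> * h \<theta>) = (LINT \<theta>|circ. h \<theta> * f \<theta> - m * h \<theta>)"
    by (simp add: h_def algebra_simps)
  also have "\<dots> = 0"
    using ic[OF chf] ic[OF ch perh] by (subst Bochner_Integration.integral_diff) (auto simp: perh perf hf int_h)
  finally have hh: "(LINT \<theta>|circ. h \<theta> * h \<theta>) = 0" .
  have chh: "continuous_on UNIV (\<lambda>\<theta>. h \<theta> * h \<theta>)" by (intro continuous_intros ch)
  have h0: "h \<theta> = 0" if "\<theta> \<in> {- pi..pi}" for \<theta>
    using integral_circ_eq_0_imp[OF chh _ hh that] by simp
  have "f \<theta> = m" for \<theta>
  proof -
    have "h \<theta> = h (Arg (cis \<theta>))" by (rule periodic_cis_eq[of h, OF perh]) (simp add: cis_Arg)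
    also have "\<dots> = 0" using Arg_bounded[of "cis \<theta>"] by (intro h0) auto
    finally show ?thesis by (simp add: h_def)
  qed
  then show thesis by (intro that[of m]) (simp add: f_def \<Phi>_def)
qed

section \<open>The region inside a polar curve\<close>

lemma AE_circ_eq_imp_eq:
  fixes u v :: "real \<Rightarrow> real"
  assumes c: "continuous_on UNIV u" "continuous_on UNIV v" and e: "AE \<theta> in circ. u \<theta> = v \<theta>" and \<theta>: "\<theta> \<in> {- pi..pi}"
  shows "u \<theta> = v \<theta>"
proof -
  have cd: "continuous_on UNIV (\<lambda>\<theta>. (u \<theta> - v \<theta>)\<^sup>2)" by (intro continuous_intros c)
  then have [measurable]: "(\<lambda>\<theta>. (u \<theta> - v \<theta>)\<^sup>2) \<in> borel_measurable borel" by (rule borel_measurable_continuous_onI)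
  have "(LINT \<theta>|circ. (u \<theta> - v \<theta>)\<^sup>2) = (LINT \<theta>|circ. 0)"
    using e by (intro integral_cong_AE) auto
  then have "(u \<theta> - v \<theta>)\<^sup>2 = 0" by (intro integral_circ_eq_0_imp[OF cd _ _ \<theta>]) auto
  then show ?thesis by simp
qed

lemma Arg_of_real_cis:
  fixes F :: "real \<Rightarrow> 'a"
  assumes "\<And>x. F (x + 2 * pi) = F x" and "r > 0"
  shows "F (Arg (of_real r * cis \<theta>)) = F \<theta>"
  by (rule periodic_cis_eq[of F, OF assms(1)]) (use assms(2) in \<open>simp add: cis_Arg sgn_mult\<close>)

text \<open>The regions below and above the graph are open and disjoint and cover the complement of
  the curve, so a component stays in one of them. The lower region is bounded; from the upper one
  the outward ray escapes to infinity.\<close>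

lemma inside_polar_curve:
  fixes R :: "real \<Rightarrow> real"
  assumes cR: "continuous_on UNIV R" and per: "\<And>x. R (x + 2 * pi) = R x" and pos: "\<rho> > 0" "\<And>x. \<rho> \<le> R x"
  defines "C \<equiv> (\<lambda>\<theta>. R \<theta> *\<^sub>R Complex (cos \<theta>) (sin \<theta>)) ` {-pi..pi}"
  shows "C = {z. norm z = R (Arg z)}" and "inside C = {z. norm z < R (Arg z)}" and "open {z. norm z < R (Arg z)}"
proof -
  have Rpos: "R x > 0" for x using pos(1) pos(2)[of x] by linarith
  have cis: "R \<theta> *\<^sub>R Complex (cos \<theta>) (sin \<theta>) = of_real (R \<theta>) * cis \<theta>" for \<theta>
    by (simp add: complex_eq_iff)
  have RA: "R (Arg (of_real r * cis \<theta>)) = R \<theta>" if "r > 0" for r \<theta> by (rule Arg_of_real_cis[of R, OF per that])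
  show C: "C = {z. norm z = R (Arg z)}"
  proof (intro equalityI subsetI)
    fix z assume "z \<in> C"
    then obtain \<theta> where z: "z = of_real (R \<theta>) * cis \<theta>" unfolding C_def cis by auto
    have "norm z = R \<theta>" using Rpos[of \<theta>] by (simp add: z norm_mult)
    moreover have "R (Arg z) = R \<theta>" unfolding z by (rule RA[OF Rpos])
    ultimately show "z \<in> {z. norm z = R (Arg z)}" by simp
  next
    fix z assume "z \<in> {z. norm z = R (Arg z)}"
    then have "z = of_real (R (Arg z)) * cis (Arg z)" using rcis_cmod_Arg[of z] by (simp add: rcis_def)
    moreover have "Arg z \<in> {-pi..pi}" using Arg_bounded[of z] by auto
    ultimately show "z \<in> C" unfolding C_def cis by (rule image_eqI)
  qed
  have cont: "isCont (\<lambda>z. R (Arg z) - norm z) z" if "z \<noteq> 0" for z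
    by (intro continuous_intros isCont_periodic_Arg[of R, OF per cR that])
  have tl: "((\<lambda>z. R (Arg z) - norm z) \<longlongrightarrow> R (Arg z) - norm z) (nhds z)" if "z \<noteq> 0" for z
    using cont[OF that] tendsto_at_iff_tendsto_nhds[of "\<lambda>z. R (Arg z) - norm z" z] by (simp only: continuous_at)
  show oU: "open {z. norm z < R (Arg z)}"
    unfolding open_contains_ball
  proof
    fix z assume "z \<in> {z. norm z < R (Arg z)}"
    then have z: "0 < R (Arg z) - norm z" by simp
    show "\<exists>e>0. ball z e \<subseteq> {z. norm z < R (Arg z)}"
    proof (cases "z = 0")
      case True
      have "ball 0 \<rho> \<subseteq> {z. norm z < R (Arg z)}" using less_le_trans[OF _ pos(2)] by (simp add: subset_iff)
      then show ?thesis using pos(1) True by blast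
    next
      case False
      from order_tendstoD(1)[OF tl[OF False] z] show ?thesis
        by (auto simp: eventually_nhds_metric dist_commute subset_iff)
    qed
  qed
  have oW: "open {z. norm z > R (Arg z)}"
    unfolding open_contains_ball
  proof
    fix z assume "z \<in> {z. norm z > R (Arg z)}"
    then have z: "0 > R (Arg z) - norm z" by simp
    then have z0: "z \<noteq> 0" using Rpos[of "Arg z"] by auto
    from order_tendstoD(2)[OF tl[OF z0] z] show "\<exists>e>0. ball z e \<subseteq> {z. norm z > R (Arg z)}"
      by (auto simp: eventually_nhds_metric dist_commute subset_iff)
  qed
  obtain B where B: "\<And>x. \<bar>R x\<bar> \<le> B" using periodic_continuous_bounded[of R, OF cR per] by blast
  show "inside C = {z. norm z < R (Arg z)}"
  proof (intro equalityI subsetI)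
    fix z assume "z \<in> {z. norm z < R (Arg z)}"
    then have z: "norm z < R (Arg z)" by simp
    then have zC: "z \<notin> C" by (simp add: C)
    define T where "T = connected_component_set (- C) z"
    have "connected T" unfolding T_def by (rule connected_connected_component)
    moreover have "T \<subseteq> - C" unfolding T_def by (rule connected_component_subset)
    then have "T \<subseteq> {z. norm z < R (Arg z)} \<union> {z. norm z > R (Arg z)}" unfolding C by auto
    moreover have "{z. norm z < R (Arg z)} \<inter> {z. norm z > R (Arg z)} \<inter> T = {}" by auto
    ultimately have "{z. norm z < R (Arg z)} \<inter> T = {} \<or> {z. norm z > R (Arg z)} \<inter> T = {}"
      using connectedD[OF _ oU oW] by blast
    moreover have "z \<in> T" using zC by (simp add: T_def)
    ultimately have "{z. norm z > R (Arg z)} \<inter> T = {}" using z by blast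
    with \<open>T \<subseteq> {z. norm z < R (Arg z)} \<union> _\<close> have "T \<subseteq> {z. norm z < R (Arg z)}" by blast
    also have "\<dots> \<subseteq> cball 0 B"
    proof (clarsimp)
      fix w show "norm w < R (Arg w) \<Longrightarrow> norm w \<le> B" using B[of "Arg w"] by linarith
    qed
    finally have "bounded T" using bounded_cball bounded_subset by blast
    then show "z \<in> inside C" using zC by (simp add: inside_def T_def)
  next
    fix z assume z: "z \<in> inside C"
    show "z \<in> {z. norm z < R (Arg z)}"
    proof (rule ccontr)
      assume "z \<notin> {z. norm z < R (Arg z)}"
      moreover have "z \<notin> C" using z by (simp add: inside_def)
      ultimately have zW: "norm z > R (Arg z)" by (simp add: C)
      then have n: "norm z > 0" using Rpos[of "Arg z"] by linarith
      \<comment> \<open>The ray from \<open>z\<close> away from the origin: the angle, hence the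
        boundary radius, is constant along it while the modulus grows.\<close>
      define L where "L = (\<lambda>t. of_real t * z) ` {1..}"
      have "connected L" unfolding L_def
        by (intro connected_continuous_image continuous_intros connected_Ici)
      moreover have "z \<in> L" unfolding L_def by (rule image_eqI[of _ _ 1]) auto
      moreover have "L \<subseteq> - C"
      proof
        fix w assume "w \<in> L"
        then obtain t where t: "t \<ge> 1" "w = of_real t * z" by (auto simp: L_def)
        have "w = of_real (t * norm z) * cis (Arg z)"
          using rcis_cmod_Arg[of z] by (simp add: t(2) rcis_def mult.assoc)
        then have "R (Arg w) = R (Arg z)" using RA[of "t * norm z" "Arg z"] t n by simp
        moreover have "norm z \<le> norm w" using t n by (simp add: norm_mult)
        ultimately show "w \<in> - C" using zW by (simp add: C)
      qed
      ultimately have "L \<subseteq> connected_component_set (- C) z"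
        by (intro connected_component_maximal)
      then have "bounded L" using z bounded_subset by (auto simp: inside_def)
      then obtain b where b: "\<And>w. w \<in> L \<Longrightarrow> norm w \<le> b" unfolding bounded_iff by blast
      define t where "t = max 1 ((b + 1) / norm z)"
      have "norm (of_real t * z) \<le> b" by (rule b) (auto simp: L_def t_def)
      moreover have "(b + 1) / norm z * norm z \<le> \<bar>t\<bar> * norm z"
        by (intro mult_right_mono) (auto simp: t_def)
      ultimately show False using n by (simp add: norm_mult)
    qed
  qed
qed

text \<open>The supremum of an unbounded set of reals is unspecified, so the sets in the norm must be
  shown to be bounded.\<close>

lemma C1_holder_norm_bound:
  assumes h: "C1_holder_torus (1 / 2) R" and n: "C1_holder_norm (1 / 2) (\<lambda>\<theta>. R \<theta> - 1) \<le> \<delta>"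
  shows "\<bar>R \<theta> - 1\<bar> \<le> \<delta>" and "continuous_on UNIV R" and "R (\<theta> + 2 * pi) = R \<theta>"
proof -
  have per: "R (x + 2 * pi) = R x" and diff: "R differentiable (at x)" for x using h by (auto simp: C1_holder_torus_def)
  obtain C where C: "\<And>x y. \<bar>deriv R x - deriv R y\<bar> \<le> C * \<bar>x - y\<bar> powr (1 / 2)" using h by (auto simp: C1_holder_torus_def)
  show cR: "continuous_on UNIV R" using diff
    by (simp add: continuous_at_imp_continuous_on differentiable_imp_continuous_within)
  have dR: "(R has_real_derivative deriv R x) (at x)" for x
    using diff by (simp add: DERIV_deriv_iff_real_differentiable)
  have d1: "deriv (\<lambda>\<theta>. R \<theta> - 1) = deriv R"
    by (rule ext, rule DERIV_imp_deriv) (auto intro!: derivative_eq_intros dR)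
  have perd: "deriv R (x + 2 * pi) = deriv R x" for x
  proof -
    have "((\<lambda>x. R (x + 2 * pi)) has_real_derivative deriv R (x + 2 * pi)) (at x)"
      using dR[of "x + 2 * pi"] by (simp add: DERIV_shift)
    then show ?thesis unfolding per by (metis DERIV_imp_deriv)
  qed
  \<comment> \<open>The Hoelder estimate against the angle 0, used over one period only, where
    distances are at most pi.\<close>
  have bd: "\<bar>deriv R x\<bar> \<le> \<bar>deriv R 0\<bar> + \<bar>C\<bar> * pi powr (1 / 2)" for x
  proof -
    define y where "y = Arg (cis x)"
    have y: "deriv R x = deriv R y" "\<bar>y\<bar> \<le> pi" using periodic_eq_Arg_cis[of "deriv R", OF perd, of x] by (auto simp: y_def)
    have "\<bar>deriv R y - deriv R 0\<bar> \<le> C * \<bar>y\<bar> powr (1 / 2)" using C[of y 0] by simp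
    also have "\<dots> \<le> \<bar>C\<bar> * pi powr (1 / 2)" using y by (intro mult_mono powr_mono2) auto
    finally show ?thesis using y by linarith
  qed
  obtain B where B: "\<And>x. \<bar>R x\<bar> \<le> B" using periodic_continuous_bounded[of R, OF cR per] by blast
  have b1: "bdd_above (range (\<lambda>x. \<bar>R x - 1\<bar>))"
  proof (intro bdd_aboveI2)
    show "\<bar>R x - 1\<bar> \<le> B + 1" for x using B[of x] by linarith
  qed
  have b2: "bdd_above (range (\<lambda>x. \<bar>deriv R x\<bar>))" using bd by (intro bdd_aboveI2)
  have b3: "bdd_above ((\<lambda>(x, y). \<bar>deriv R x - deriv R y\<bar> / \<bar>x - y\<bar> powr (1 / 2)) ` {(x, y). x \<noteq> y})"
  proof (intro bdd_aboveI2, clarify)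
    fix x y :: real assume "x \<noteq> y"
    then show "\<bar>deriv R x - deriv R y\<bar> / \<bar>x - y\<bar> powr (1 / 2) \<le> C" using C[of x y] by (simp add: divide_le_eq)
  qed
  have "0 \<le> (SUP x. \<bar>deriv R x\<bar>)" by (rule cSUP_upper2[OF b2]) auto
  moreover have "0 \<le> (SUP (x, y)\<in>{(x, y). x \<noteq> y}. \<bar>deriv R x - deriv R y\<bar> / \<bar>x - y\<bar> powr (1 / 2))"
    by (rule cSUP_upper2[OF b3, of "(0, 1)"]) auto
  moreover have "\<bar>R \<theta> - 1\<bar> \<le> (SUP x. \<bar>R x - 1\<bar>)" by (rule cSUP_upper[OF _ b1]) auto
  ultimately show "\<bar>R \<theta> - 1\<bar> \<le> \<delta>" using n unfolding C1_holder_norm_def d1 by linarith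
  show "R (\<theta> + 2 * pi) = R \<theta>" by (rule per)
qed

section \<open>Comparison with an ellipse\<close>

text \<open>As \<open>K\<close> is positive, the two roots have opposite signs; \<open>S\<close> is
  the positive one, and the only sign change on r >= 0 happens there.\<close>

lemma quadratic_sign:
  fixes P N K r :: real
  assumes P: "P > 0" and K: "K > 0" and r: "r \<ge> 0"
  defines "S \<equiv> (N + sqrt (N\<^sup>2 + P * K)) / P"
  shows "S > 0" and "P * r\<^sup>2 - 2 * r * N - K < 0 \<longleftrightarrow> r < S" and "P * r\<^sup>2 - 2 * r * N - K = 0 \<longleftrightarrow> r = S"
proof -
  define s where "s = sqrt (N\<^sup>2 + P * K)"
  have PK: "P * K > 0" using P K by simp
  have s2: "s\<^sup>2 = N\<^sup>2 + P * K" using PK by (simp add: s_def)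
  have "sqrt (N\<^sup>2) < s" unfolding s_def using PK by (intro real_sqrt_less_mono) simp
  then have s: "\<bar>N\<bar> < s" by simp
  then show "S > 0" using P by (simp add: S_def s_def[symmetric])
  have "P * (P * r\<^sup>2 - 2 * r * N - K) = (P * r - N)\<^sup>2 - s\<^sup>2"
    unfolding s2 by (simp add: power2_eq_square algebra_simps)
  also have "\<dots> = (P * r - N - s) * (P * r - N + s)" by (simp add: power2_eq_square algebra_simps)
  finally have e: "P * (P * r\<^sup>2 - 2 * r * N - K) = (P * r - N - s) * (P * r - N + s)" .
  have "P * r \<ge> 0" using P r by simp
  then have pos: "P * r - N + s > 0" using s by linarith
  have S: "P * S = N + s" using P by (simp add: S_def s_def)
  have "P * r\<^sup>2 - 2 * r * N - K < 0 \<longleftrightarrow> P * (P * r\<^sup>2 - 2 * r * N - K) < 0" using P by (simp only: mult_less_0_iff) auto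
  also have "\<dots> \<longleftrightarrow> P * r - N - s < 0" unfolding e using pos by (auto simp: mult_less_0_iff)
  also have "\<dots> \<longleftrightarrow> P * r < P * S" unfolding S by linarith
  finally show "P * r\<^sup>2 - 2 * r * N - K < 0 \<longleftrightarrow> r < S" using P by simp
  have "P * r\<^sup>2 - 2 * r * N - K = 0 \<longleftrightarrow> P * (P * r\<^sup>2 - 2 * r * N - K) = 0" using P by (simp only: mult_eq_0_iff) auto
  also have "\<dots> \<longleftrightarrow> P * r - N - s = 0" unfolding e using pos by auto
  also have "\<dots> \<longleftrightarrow> P * r = P * S" unfolding S by linarith
  finally show "P * r\<^sup>2 - 2 * r * N - K = 0 \<longleftrightarrow> r = S" using P by simp
qed

context ellipse begin

lemma norm_Tinv_le: "norm (Tinv z) * (\<alpha> - norm \<beta>) \<le> norm (z - c)"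
  and norm_Tinv_ge: "norm (z - c) \<le> norm (Tinv z) * (\<alpha> + norm \<beta>)"
proof -
  have "z - c = of_real \<alpha> * Tinv z + \<beta> * cnj (Tinv z)" using T_Tinv[of z] by (simp add: T_def algebra_simps)
  then show "norm (Tinv z) * (\<alpha> - norm \<beta>) \<le> norm (z - c)" "norm (z - c) \<le> norm (Tinv z) * (\<alpha> + norm \<beta>)"
    using norm_linear_ge[of "Tinv z"] norm_linear_le[of "Tinv z"] by (simp_all only: mult.commute)
qed

text \<open>On the ray \<theta> the function |Tinv z|^2 - 1 is quadratic in the radius. Its constant
  term is negative because the origin lies inside the ellipse, so \<open>quadratic_sign\<close>
  gives a single crossing, continuous in \<theta>.\<close>

lemma radial_function:
  assumes 0: "norm (Tinv 0) < 1"
  obtains S where "continuous_on UNIV S" and "\<And>r \<theta>. r \<ge> 0 \<Longrightarrow> of_real r * cis \<theta> \<in> E \<longleftrightarrow> r < S \<theta>"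
    and "\<And>r \<theta>. r \<ge> 0 \<Longrightarrow> norm (Tinv (of_real r * cis \<theta>)) = 1 \<longleftrightarrow> r = S \<theta>" and "\<And>\<theta>. S \<theta> > 0"
proof -
  define L where "L u = (of_real \<alpha> * u - \<beta> * cnj u) / of_real Dt" for u
  have TL: "Tinv (of_real r * e) = r *\<^sub>R L e - L c" for r e
    by (simp add: Tinv_def L_def scaleR_conv_of_real algebra_simps diff_divide_distrib add_divide_distrib)
  define P where "P \<theta> = L (cis \<theta>) \<bullet> L (cis \<theta>)" for \<theta>
  define N where "N \<theta> = L (cis \<theta>) \<bullet> L c" for \<theta>
  define K where "K = 1 - L c \<bullet> L c"
  define S where "S \<theta> = (N \<theta> + sqrt ((N \<theta>)\<^sup>2 + P \<theta> * K)) / P \<theta>" for \<theta>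
  have n: "(norm (Tinv (of_real r * cis \<theta>)))\<^sup>2 - 1 = P \<theta> * r\<^sup>2 - 2 * r * N \<theta> - K" for r \<theta>
  proof -
    have "(r *\<^sub>R a - b) \<bullet> (r *\<^sub>R a - b) = a \<bullet> a * r\<^sup>2 - 2 * r * (a \<bullet> b) + b \<bullet> b" for a b :: complex
      by (simp add: inner_diff_left inner_diff_right inner_commute[of b a] power2_eq_square algebra_simps)
    then show ?thesis unfolding TL power2_norm_eq_inner by (simp only: P_def N_def K_def)
  qed
  have lt: "norm w < 1 \<longleftrightarrow> (norm w)\<^sup>2 - 1 < 0" "norm w = 1 \<longleftrightarrow> (norm w)\<^sup>2 - 1 = 0" for w :: complex
  proof -
    have "(norm w)\<^sup>2 - 1 = (norm w - 1) * (norm w + 1)" by (simp add: power2_eq_square algebra_simps)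
    moreover have "norm w + 1 > 0" using norm_ge_zero[of w] by linarith
    ultimately show "norm w < 1 \<longleftrightarrow> (norm w)\<^sup>2 - 1 < 0" "norm w = 1 \<longleftrightarrow> (norm w)\<^sup>2 - 1 = 0"
      by (auto simp: mult_less_0_iff)
  qed
  have K: "K > 0" using 0 n[of 0 0] lt(1)[of "Tinv 0"] by simp
  have P: "P \<theta> > 0" for \<theta>
  proof -
    have "L (cis \<theta>) \<noteq> 0"
    proof
      assume "L (cis \<theta>) = 0"
      then have "of_real \<alpha> * cis \<theta> = \<beta> * cnj (cis \<theta>)" using Dt_pos by (simp add: L_def)
      then have "norm (of_real \<alpha> * cis \<theta>) = norm (\<beta> * cnj (cis \<theta>))" by (rule arg_cong)
      then show False using \<alpha>_pos \<beta>_less by (simp add: norm_mult)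
    qed
    then show ?thesis by (simp add: P_def)
  qed
  show thesis
  proof (rule that[of S])
    have cL: "continuous_on UNIV (\<lambda>\<theta>. L (cis \<theta>))" unfolding L_def cis_conv_exp using Dt_pos by (intro continuous_intros) auto
    show "continuous_on UNIV S" unfolding S_def N_def[abs_def] P_def[abs_def]
      using P by (intro continuous_intros cL) (auto simp: P_def less_imp_neq)
    show "of_real r * cis \<theta> \<in> E \<longleftrightarrow> r < S \<theta>" if "r \<ge> 0" for r \<theta>
      unfolding mem_E_iff lt(1) n S_def by (rule quadratic_sign(2)[OF P K that])
    show "norm (Tinv (of_real r * cis \<theta>)) = 1 \<longleftrightarrow> r = S \<theta>" if "r \<ge> 0" for r \<theta>
      unfolding lt(2) n S_def by (rule quadratic_sign(3)[OF P K that])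
    show "S \<theta> > 0" for \<theta> unfolding S_def by (rule quadratic_sign(1)[OF P K order.refl])
  qed
qed

text \<open>Starting the parameter of the circle at \<psi> = Arg \<beta> / 2 aligns \<beta> cnj w
  with \<alpha> w, and the map takes the normal form with semi-axes \<alpha> + |\<beta>| and
  \<alpha> - |\<beta>|.\<close>

lemma T_sphere: "T ` sphere 0 1 = ellipse_curve c (Arg \<beta> / 2) (\<alpha> + norm \<beta>) (\<alpha> - norm \<beta>)"
proof -
  define \<psi> where "\<psi> = Arg \<beta> / 2"
  have \<beta>: "\<beta> = of_real (norm \<beta>) * (cis \<psi> * cis \<psi>)"
    using rcis_cmod_Arg[of \<beta>] by (simp add: rcis_def cis_mult \<psi>_def)
  have T: "T (cis \<psi> * cis s) = c + cis \<psi> * Complex ((\<alpha> + norm \<beta>) * cos s) ((\<alpha> - norm \<beta>) * sin s)" for s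
  proof -
    have "\<beta> * cnj (cis \<psi> * cis s) = of_real (norm \<beta>) * (cis \<psi> * cis \<psi>) * cnj (cis \<psi> * cis s)"
      using \<beta> by (rule arg_cong)
    also have "\<dots> = of_real (norm \<beta>) * (cis \<psi> * cnj (cis s)) * (cis \<psi> * cnj (cis \<psi>))" by (simp add: mult_ac)
    also have "cis \<psi> * cnj (cis \<psi>) = 1" by (simp add: cis_cnj cis_mult)
    finally have b: "\<beta> * cnj (cis \<psi> * cis s) = cis \<psi> * (of_real (norm \<beta>) * cnj (cis s))" by (simp add: mult_ac)
    have "Complex ((\<alpha> + norm \<beta>) * cos s) ((\<alpha> - norm \<beta>) * sin s) = of_real \<alpha> * cis s + of_real (norm \<beta>) * cnj (cis s)"
      by (simp add: complex_eq_iff algebra_simps)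
    then show ?thesis unfolding T_def b by (simp add: distrib_left mult.left_commute)
  qed
  have "sphere 0 1 = range (\<lambda>s. cis \<psi> * cis s)"
  proof (intro equalityI subsetI)
    fix w :: complex assume "w \<in> sphere 0 1"
    then have "w = cis (Arg w)" using rcis_cmod_Arg[of w] by (simp add: rcis_def)
    also have "\<dots> = cis \<psi> * cis (Arg w - \<psi>)" by (simp add: cis_mult)
    finally show "w \<in> range (\<lambda>s. cis \<psi> * cis s)" by blast
  qed (auto simp: norm_mult)
  then show ?thesis unfolding ellipse_curve_def \<psi>_def[symmetric] by (simp add: image_image T)
qed

end

section \<open>Moments of a nearly circular patch\<close>

lemma integral_patch_ball_power:
  assumes "k > 0"
  shows "(LINT z|patch (ball 0 r). z ^ k) = (0::complex)"
proof -
  define u where "u = cis (pi / k)"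
  have uk: "u ^ k = - 1" using assms by (simp add: u_def Complex.DeMoivre)
  have [measurable]: "ball (0::complex) r \<in> sets borel" by simp
  have nu: "norm u = 1" by (simp add: u_def)
  have ind: "indicat_real (ball 0 r) (u * z) = indicat_real (ball 0 r) z" for z
    by (simp add: indicator_def norm_mult nu)
  have e: "(LINT z|patch (ball 0 r). z ^ k) = (LINT z|lborel. indicat_real (ball 0 r) z *\<^sub>R z ^ k)"
    by (subst integral_patch) auto
  have "(LINT z|lborel. indicat_real (ball 0 r) z *\<^sub>R z ^ k) = (LINT z|lborel. indicat_real (ball 0 r) (0 + u * z) *\<^sub>R (0 + u * z) ^ k)"
    by (rule integral_rotate(1)[symmetric]) (auto simp: nu)
  also have "\<dots> = - (LINT z|lborel. indicat_real (ball 0 r) z *\<^sub>R z ^ k)"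
    by (simp add: power_mult_distrib uk ind)
  finally show ?thesis unfolding e by simp
qed

context polar_set begin

lemma area_bounds: "pi * (1 - \<kappa>)\<^sup>2 \<le> measure lborel U" "measure lborel U \<le> pi * (1 + \<kappa>)\<^sup>2"
proof -
  have f: "emeasure lborel A \<noteq> \<infinity>" if "bounded A" "A \<in> sets borel" for A :: "complex set"
    using emeasure_bounded_le[OF that] by simp
  have "measure lborel (ball (0::complex) (1 - \<kappa>)) \<le> measure lborel U"
    by (rule measure_mono_fmeasurable[OF U_sub(1)]) (use f[OF bounded_U U_borel] in \<open>auto simp: fmeasurable_def less_top\<close>)
  then show "pi * (1 - \<kappa>)\<^sup>2 \<le> measure lborel U" using \<kappa> by (simp add: measure_complex_ball)
  have "measure lborel U \<le> measure lborel (ball (0::complex) (1 + \<kappa>))"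
    by (rule measure_mono_fmeasurable[OF U_sub(2)]) (use f[of "ball 0 (1 + \<kappa>)"] in \<open>auto simp: fmeasurable_def less_top\<close>)
  then show "measure lborel U \<le> pi * (1 + \<kappa>)\<^sup>2" using \<kappa> by (simp add: measure_complex_ball)
qed

lemma integrable_patch_continuous:
  fixes f :: "complex \<Rightarrow> complex"
  assumes "continuous_on UNIV f"
  shows "integrable (patch U) f"
proof -
  have [measurable]: "f \<in> borel_measurable borel" by (rule borel_measurable_continuous_onI[OF assms])
  have "bounded (f ` cball 0 2)" by (intro compact_imp_bounded compact_continuous_image continuous_on_subset[OF assms]) auto
  moreover have "U \<subseteq> cball 0 2" using U_sub(2) \<kappa> by force
  ultimately obtain B where "\<And>z. z \<in> U \<Longrightarrow> norm (f z) \<le> B" by (force simp: bounded_iff)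
  from integrable_bounded_mult_indicator[OF bounded_U U_borel _ this] show ?thesis
    by (subst integral_patch(2)) auto
qed

text \<open>The inscribed disk has vanishing moments. The rest has area at most 4 pi \<kappa>, and
  there |z^k| <= 2; finally 8 pi \<kappa> <= 32 \<kappa>.\<close>

lemma small_moment:
  assumes k: "k = 1 \<or> k = 2"
  shows "norm (LINT z|patch U. z ^ k :: complex) \<le> 32 * \<kappa>"
proof -
  have B: "ball (0::complex) (1 - \<kappa>) \<in> sets borel" "bounded (ball (0::complex) (1 - \<kappa>))" by auto
  have nz: "norm (z ^ k) \<le> 2" if "norm z \<le> 1 + \<kappa>" for z :: complex
  proof -
    have "norm (z ^ k) \<le> (1 + \<kappa>) ^ 2"
      using power_mono[OF that norm_ge_zero, of k] power_increasing[of k 2 "1 + \<kappa>"] k \<kappa> unfolding norm_power by linarith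
    also have "\<dots> \<le> (1 + 1/1000000) ^ 2" using \<kappa> by (intro power_mono) auto
    also have "\<dots> \<le> 2" by (simp add: power2_eq_square)
    finally show ?thesis .
  qed
  have i1: "integrable lborel (\<lambda>z. indicat_real U z *\<^sub>R z ^ k :: complex)"
    using U_sub(2) nz by (intro integrable_bounded_mult_indicator[OF bounded_U U_borel, of _ 2]) force+
  have i2: "integrable lborel (\<lambda>z. indicat_real (ball 0 (1 - \<kappa>)) z *\<^sub>R z ^ k :: complex)"
    using nz \<kappa> by (intro integrable_bounded_mult_indicator[OF B(2,1), of _ 2]) force+
  have i3: "integrable lborel (\<lambda>z. indicat_real U z * 2)" "integrable lborel (\<lambda>z::complex. indicat_real (ball 0 (1 - \<kappa>)) z * 2)"
    by (intro integrable_mult_left integrable_indicator_bounded bounded_U U_borel B)+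
  have "(LINT z|patch U. z ^ k) = (LINT z|lborel. indicat_real U z *\<^sub>R z ^ k) - (LINT z|lborel. indicat_real (ball 0 (1 - \<kappa>)) z *\<^sub>R z ^ k)"
    using integral_patch_ball_power[of k "1 - \<kappa>"] integral_patch(1)[OF B(1), of "\<lambda>z. z ^ k"]
      integral_patch(1)[OF U_borel, of "\<lambda>z. z ^ k"] k by auto
  also have "\<dots> = (LINT z|lborel. indicat_real U z *\<^sub>R z ^ k - indicat_real (ball 0 (1 - \<kappa>)) z *\<^sub>R z ^ k)"
    using i1 i2 by (rule Bochner_Integration.integral_diff[symmetric])
  also have "norm \<dots> \<le> (LINT z|lborel. indicat_real U z * 2 - indicat_real (ball 0 (1 - \<kappa>)) z * 2)"
  proof (rule Bochner_Integration.integral_norm_bound_integral)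
    show "norm (indicat_real U z *\<^sub>R z ^ k - indicat_real (ball 0 (1 - \<kappa>)) z *\<^sub>R z ^ k) \<le> indicat_real U z * 2 - indicat_real (ball 0 (1 - \<kappa>)) z * 2"
      for z :: complex
      using U_sub nz[of z] by (auto simp: indicator_def subset_iff intro: less_imp_le)
  qed (intro Bochner_Integration.integrable_diff i1 i2 i3)+
  also have "\<dots> = 2 * (measure lborel U - pi * (1 - \<kappa>)\<^sup>2)"
    using i3 \<kappa> by (subst Bochner_Integration.integral_diff) (auto simp: measure_complex_ball)
  also have "\<dots> \<le> 2 * (pi * (1 + \<kappa>)\<^sup>2 - pi * (1 - \<kappa>)\<^sup>2)" using area_bounds(2) by simp
  also have "\<dots> = pi * (8 * \<kappa>)" by (simp add: power2_eq_square algebra_simps)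
  also have "\<dots> \<le> 4 * (8 * \<kappa>)" using \<kappa> pi_less_4 by (intro mult_right_mono) auto
  finally show ?thesis by simp
qed

text \<open>The parallel axis theorem: equal area, centroid and central second moment give equal
  moments about the origin, which is what the comparison of the patches uses.\<close>

lemma centered_moments:
  assumes c: "(LINT z|patch U. z - c) = 0"
  shows "(LINT z|patch U. z) = of_real (measure lborel U) * c"
    and "(LINT z|patch U. z\<^sup>2) = (LINT z|patch U. (z - c)\<^sup>2) + of_real (measure lborel U) * c\<^sup>2"
proof -
  have const: "(LINT z|patch U. a) = of_real (measure lborel U) * a" for a :: complex
    by (simp add: measure_patch scaleR_conv_of_real)
  have i: "integrable (patch U) (\<lambda>z. z)" "integrable (patch U) (\<lambda>z. a)" "integrable (patch U) (\<lambda>z. z - a)"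
    "integrable (patch U) (\<lambda>z. (z - a)\<^sup>2)" for a :: complex
    by (intro integrable_patch_continuous continuous_intros)+
  have i': "integrable (patch U) (\<lambda>z. (z - c) * (2 * c))" by (intro integrable_patch_continuous continuous_intros)
  show "(LINT z|patch U. z) = of_real (measure lborel U) * c"
    using c i by (simp add: const del: integral_const lebesgue_integral_const)
  have "(LINT z|patch U. z\<^sup>2) = (LINT z|patch U. (z - c)\<^sup>2 + ((z - c) * (2 * c) + c\<^sup>2))"
    by (simp add: power2_eq_square algebra_simps)
  also have "\<dots> = (LINT z|patch U. (z - c)\<^sup>2) + ((LINT z|patch U. (z - c) * (2 * c)) + (LINT z|patch U. c\<^sup>2))"
    by (simp only: Bochner_Integration.integral_add[OF i(4) Bochner_Integration.integrable_add[OF i' i(2)]]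
        Bochner_Integration.integral_add[OF i' i(2)])
  also have "\<dots> = (LINT z|patch U. (z - c)\<^sup>2) + of_real (measure lborel U) * c\<^sup>2"
    unfolding integral_mult_left_zero c const by simp
  finally show "(LINT z|patch U. z\<^sup>2) = (LINT z|patch U. (z - c)\<^sup>2) + of_real (measure lborel U) * c\<^sup>2" .
qed

end

text \<open>Two tolerances are used. The patch is within \<delta> of the unit circle; the ellipse
  built from its moments is only within a multiple of \<delta>. With \<kappa> = 100 \<delta> = 10^-6
  both lie in the annulus that \<open>two_patches\<close> allows.\<close>

lemma V_state_is_ellipse:
  fixes R :: "real \<Rightarrow> real"
  assumes V: "V_state D \<Omega> x0" and cR: "continuous_on UNIV R" and per: "\<And>x. R (x + 2 * pi) = R x"
    and R: "\<And>\<theta>. \<bar>R \<theta> - 1\<bar> \<le> 1 / 10 ^ 8" and \<Omega>: "\<bar>\<Omega> - 1 / 4\<bar> \<le> 1 / 10 ^ 8"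
    and fr: "frontier D = (\<lambda>\<theta>. R \<theta> *\<^sub>R Complex (cos \<theta>) (sin \<theta>)) ` {-pi..pi}" and ins: "D = inside (frontier D)"
  shows "is_ellipse D"
proof -
  define \<delta> :: real where "\<delta> = 1 / 10 ^ 8"
  define \<kappa> :: real where "\<kappa> = 1 / 10 ^ 6"
  have R\<delta>: "1 - \<delta> \<le> R \<theta>" "R \<theta> \<le> 1 + \<delta>" for \<theta> using R[of \<theta>] unfolding \<delta>_def by linarith+
  have Rpos: "1 / 2 \<le> R \<theta>" for \<theta> using R\<delta>(1)[of \<theta>] by (simp add: \<delta>_def)
  note pc = inside_polar_curve[of R "1 / 2", OF cR per _ Rpos, folded fr]
  have frD: "frontier D = {z. norm z = R (Arg z)}" by (rule pc(1)) simp
  have D: "D = {z. norm z < R (Arg z)}" using pc(2) ins by simp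
  have oD: "open D" unfolding D by (rule pc(3)) simp
  have Db: "D \<in> sets borel" using oD by simp
  have D_iff: "of_real r * cis \<theta> \<in> D \<longleftrightarrow> r < R \<theta>" if "r \<ge> 0" for r \<theta>
  proof (cases "r = 0")
    case True
    then show ?thesis using Rpos[of "Arg 0"] Rpos[of \<theta>] by (auto simp: D)
  next
    case False
    then have "R (Arg (of_real r * cis \<theta>)) = R \<theta>" using that by (intro Arg_of_real_cis[of R, OF per]) auto
    then show ?thesis using that unfolding D mem_Collect_eq by (simp only: norm_mult norm_of_real norm_cis abs_of_nonneg mult_1_right)
  qed
  interpret d: polar_set \<delta> R D
    by standard (use R\<delta> Db D_iff in \<open>auto simp: \<delta>_def\<close>)
  interpret U: polar_set \<kappa> R D
  proof
    show "1 - \<kappa> \<le> R \<theta>" "R \<theta> \<le> 1 + \<kappa>" for \<theta> using R\<delta>[of \<theta>] by (simp_all add: \<delta>_def \<kappa>_def)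
  qed (use Db D_iff in \<open>auto simp: \<kappa>_def\<close>)
  have D2: "D \<subseteq> cball 0 2" using U.U_sub(2) by (auto simp: \<kappa>_def subset_iff)
  have \<Omega>0: "\<Omega> \<noteq> 0" using \<Omega> by auto
  define A where "A = measure lborel D"
  have A: "A \<ge> 19 / 10" "pi * (1 - \<delta>)\<^sup>2 \<le> A" "A \<le> pi * (1 + \<delta>)\<^sup>2"
  proof -
    show 1: "pi * (1 - \<delta>)\<^sup>2 \<le> A" "A \<le> pi * (1 + \<delta>)\<^sup>2" using d.area_bounds by (simp_all add: A_def)
    \<comment> \<open>The crude bound 2 <= pi is sufficient.\<close>
    have "2 * (19 / 20) \<le> pi * (1 - \<delta>)\<^sup>2"
      by (intro mult_mono pi_ge_two) (simp_all add: \<delta>_def power2_eq_square)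
    then show "A \<ge> 19 / 10" using 1 by simp
  qed
  define Q where "Q = (LINT z|patch D. (z - x0)\<^sup>2)"
  note cent = V_state_moments(1)[OF V Db D2 \<Omega>0]
  have KD: "(LINT z|patch D. LINT w|patch D. kratio (z - w)) = of_real (4 * pi * \<Omega>) * Q"
    using V_state_moments(2)[OF V Db D2 \<Omega>0] by (simp add: Q_def)
  have m1: "(LINT z|patch D. z) = of_real A * x0" and m2: "(LINT z|patch D. z\<^sup>2) = Q + of_real A * x0\<^sup>2"
    using d.centered_moments[OF cent] by (simp_all add: A_def Q_def)
  \<comment> \<open>The first moment is A x0 and at most 32 \<delta>; 32 / 1.9 < 17.\<close>
  have x0: "norm x0 \<le> 17 * \<delta>"
  proof -
    have "A * norm x0 \<le> 32 * \<delta>" using d.small_moment[of 1] A by (simp add: m1 norm_mult)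
    moreover have "19 / 10 * norm x0 \<le> A * norm x0" using A by (intro mult_right_mono) auto
    ultimately show ?thesis using d.\<kappa> by linarith
  qed
  define p where "p = Q / of_real A"
  have Qp: "Q = of_real A * p" using A by (simp add: p_def)
  \<comment> \<open>As before, 32 / 1.9 < 17 bounds p + x0^2; the square of \<open>x0\<close> is
    negligible.\<close>
  have p: "norm p \<le> 18 * \<delta>"
  proof -
    have "(LINT z|patch D. z\<^sup>2) = of_real A * (p + x0\<^sup>2)" by (simp add: m2 Qp distrib_left)
    then have "A * norm (p + x0\<^sup>2) \<le> 32 * \<delta>" using d.small_moment[of 2] A by (simp add: norm_mult)
    moreover have "19 / 10 * norm (p + x0\<^sup>2) \<le> A * norm (p + x0\<^sup>2)" using A by (intro mult_right_mono) auto
    moreover have "norm p \<le> norm (p + x0\<^sup>2) + (norm x0)\<^sup>2"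
      using norm_triangle_ineq4[of "p + x0\<^sup>2" "x0\<^sup>2"] by (simp add: norm_power)
    moreover have "(norm x0)\<^sup>2 \<le> (17 * \<delta>)\<^sup>2" using x0 by (intro power_mono) auto
    moreover have "(17 * \<delta>)\<^sup>2 \<le> \<delta> / 10" by (simp add: \<delta>_def power2_eq_square)
    ultimately show ?thesis using d.\<kappa> by linarith
  qed
  (* \<alpha>\<^sup>2 is the positive root of X\<^sup>2 - a X - |p|\<^sup>2, so that \<alpha>\<^sup>2 - |\<beta>|\<^sup>2 = a and \<alpha> \<beta> = p:
     the ellipse has the area and the second moment of D *)
  define a where "a = A / pi"
  have a: "1 - 2 * \<delta> \<le> a" "a \<le> 1 + 3 * \<delta>"
  proof -
    have "(1 - \<delta>)\<^sup>2 \<le> a" "a \<le> (1 + \<delta>)\<^sup>2" using A by (simp_all add: a_def field_simps)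
    moreover have "1 - 2 * \<delta> \<le> (1 - \<delta>)\<^sup>2" "(1 + \<delta>)\<^sup>2 \<le> 1 + 3 * \<delta>" by (simp_all add: \<delta>_def power2_eq_square)
    ultimately show "1 - 2 * \<delta> \<le> a" "a \<le> 1 + 3 * \<delta>" by linarith+
  qed
  have apos: "a > 9 / 10" using a by (simp add: \<delta>_def)
  define t where "t = sqrt (a\<^sup>2 + 4 * (norm p)\<^sup>2)"
  have t2: "t\<^sup>2 = a\<^sup>2 + 4 * (norm p)\<^sup>2" by (simp add: t_def)
  have ta: "a \<le> t" unfolding t_def by (rule real_le_rsqrt) simp
  have tb: "t \<le> a + 2 * norm p" unfolding t_def
    by (rule real_le_lsqrt) (use apos in \<open>auto simp: power2_eq_square algebra_simps\<close>)
  define \<alpha> where "\<alpha> = sqrt ((a + t) / 2)"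
  have \<alpha>2: "\<alpha>\<^sup>2 = (a + t) / 2" unfolding \<alpha>_def using ta apos by (subst real_sqrt_pow2) auto
  have \<alpha>b: "a \<le> \<alpha>\<^sup>2" "\<alpha>\<^sup>2 \<le> a + norm p" using ta tb by (auto simp: \<alpha>2)
  have \<alpha>0: "\<alpha> > 0" unfolding \<alpha>_def using ta apos by simp
  have \<alpha>: "1 - 2 * \<delta> \<le> \<alpha>" "\<alpha> \<le> 1 + 21 * \<delta>"
  proof -
    have "(1 - 2 * \<delta>)\<^sup>2 \<le> 1 - 2 * \<delta>" by (simp add: \<delta>_def power2_eq_square)
    then have "(1 - 2 * \<delta>)\<^sup>2 \<le> \<alpha>\<^sup>2" using a \<alpha>b by linarith
    then show "1 - 2 * \<delta> \<le> \<alpha>" using \<alpha>0 by (simp add: power2_le_iff_abs_le)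
    have "1 + 21 * \<delta> \<le> (1 + 21 * \<delta>)\<^sup>2" by (simp add: \<delta>_def power2_eq_square)
    then have "\<alpha>\<^sup>2 \<le> (1 + 21 * \<delta>)\<^sup>2" using a \<alpha>b p by linarith
    then show "\<alpha> \<le> 1 + 21 * \<delta>" by (rule power2_le_imp_le) (simp add: \<delta>_def)
  qed
  define \<beta> where "\<beta> = p / of_real \<alpha>"
  have n\<beta>: "norm \<beta> = norm p / \<alpha>" using \<alpha>0 by (simp add: \<beta>_def norm_divide)
  have \<beta>: "norm \<beta> \<le> 19 * \<delta>"
  proof -
    have "18 * \<delta> \<le> 19 * \<delta> * (1 - 2 * \<delta>)" by (simp add: \<delta>_def)
    also have "\<dots> \<le> 19 * \<delta> * \<alpha>" using \<alpha> by (intro mult_left_mono) (auto simp: \<delta>_def)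
    finally show ?thesis using p \<alpha>0 by (simp add: n\<beta> pos_divide_le_eq)
  qed
  interpret E: ellipse x0 \<alpha> \<beta>
    by standard (use \<alpha>0 \<alpha> \<beta> in \<open>auto simp: \<delta>_def\<close>)
  have Dt: "E.Dt = a"
  proof -
    have "(norm p)\<^sup>2 = \<alpha>\<^sup>2 * (\<alpha>\<^sup>2 - a)" unfolding \<alpha>2 using t2 by (simp add: power2_eq_square algebra_simps)
    then have "(norm \<beta>)\<^sup>2 = \<alpha>\<^sup>2 - a" using \<alpha>0 by (simp add: n\<beta> power_divide)
    then show ?thesis by (simp add: E.Dt_def)
  qed
  have areaE: "measure lborel E.E = A" using E.area by (simp add: Dt a_def)
  have p\<beta>: "p = of_real \<alpha> * \<beta>" using \<alpha>0 by (simp add: \<beta>_def)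
  have Q\<beta>: "Q = of_real (pi * \<alpha> * a) * \<beta>" unfolding Qp p\<beta> by (simp add: a_def)
  have QE: "(LINT z|patch E.E. (z - x0)\<^sup>2) = Q" using E.second_moment by (simp add: Q\<beta> Dt)
  have bA: "\<alpha> - norm \<beta> > 1 - 21 * \<delta> - \<delta>" "\<alpha> + norm \<beta> < 1 + 40 * \<delta> + \<delta>" using \<alpha> \<beta> by (auto simp: \<delta>_def)
  have T0: "norm (E.Tinv 0) < 1"
  proof (rule ccontr)
    assume "\<not> norm (E.Tinv 0) < 1"
    then have "1 * (\<alpha> - norm \<beta>) \<le> norm (E.Tinv 0) * (\<alpha> - norm \<beta>)" using bA by (intro mult_right_mono) (auto simp: \<delta>_def)
    then show False using E.norm_Tinv_le[of 0] x0 bA by (simp add: \<delta>_def)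
  qed
  obtain S where cS: "continuous_on UNIV S" and E_iff: "\<And>r \<theta>. r \<ge> 0 \<Longrightarrow> of_real r * cis \<theta> \<in> E.E \<longleftrightarrow> r < S \<theta>"
    and S1: "\<And>r \<theta>. r \<ge> 0 \<Longrightarrow> norm (E.Tinv (of_real r * cis \<theta>)) = 1 \<longleftrightarrow> r = S \<theta>" and Spos: "\<And>\<theta>. S \<theta> > 0"
    by (rule E.radial_function[OF T0], rule that) blast+
  \<comment> \<open>The centre is off by 17 \<delta>, the semi-axes differ from 1 by at most 41
    \<delta>, and the sum is well below \<kappa> = 100 \<delta>.\<close>
  have S: "1 - \<kappa> \<le> S \<theta>" "S \<theta> \<le> 1 + \<kappa>" for \<theta>
  proof -
    have "norm (E.Tinv (of_real (1 - \<kappa>) * cis \<theta>)) < 1"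
    proof (rule ccontr)
      define w where "w = of_real (1 - \<kappa>) * cis \<theta>"
      assume "\<not> norm (E.Tinv (of_real (1 - \<kappa>) * cis \<theta>)) < 1"
      then have "1 * (\<alpha> - norm \<beta>) \<le> norm (E.Tinv w) * (\<alpha> - norm \<beta>)" unfolding w_def using bA by (intro mult_right_mono) (auto simp: \<delta>_def)
      also have "\<dots> \<le> norm (w - x0)" by (rule E.norm_Tinv_le)
      also have "\<dots> \<le> norm w + norm x0" by (rule norm_triangle_ineq4)
      also have "norm w = 1 - \<kappa>" by (simp add: w_def norm_mult \<kappa>_def)
      finally show False using x0 bA by (simp add: \<delta>_def \<kappa>_def)
    qed
    then have "1 - \<kappa> < S \<theta>" using E_iff[of "1 - \<kappa>" \<theta>] by (simp add: E.mem_E_iff \<kappa>_def)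
    then show "1 - \<kappa> \<le> S \<theta>" by simp
    show "S \<theta> \<le> 1 + \<kappa>"
    proof (rule ccontr)
      define w where "w = of_real (1 + \<kappa>) * cis \<theta>"
      assume "\<not> S \<theta> \<le> 1 + \<kappa>"
      then have "norm (E.Tinv w) < 1" using E_iff[of "1 + \<kappa>" \<theta>] by (simp add: E.mem_E_iff \<kappa>_def w_def)
      then have "norm (E.Tinv w) * (\<alpha> + norm \<beta>) \<le> 1 * (\<alpha> + norm \<beta>)" using bA \<alpha>0 by (intro mult_right_mono) auto
      moreover have "norm (w - x0) \<le> norm (E.Tinv w) * (\<alpha> + norm \<beta>)" by (rule E.norm_Tinv_ge)
      moreover have "norm w - norm x0 \<le> norm (w - x0)" by (rule norm_triangle_ineq2)
      moreover have "norm w = 1 + \<kappa>" by (simp add: w_def norm_mult \<kappa>_def)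
      ultimately show False using x0 bA by (simp add: \<delta>_def \<kappa>_def)
    qed
  qed
  interpret W: polar_set \<kappa> S E.E
    by standard (use S E_iff E.measurable_E in \<open>auto simp: \<kappa>_def\<close>)
  interpret two_patches \<kappa> R S D E.E ..
  obtain CU where CU: "\<And>\<theta>. pot D (of_real (R \<theta>) * cis \<theta>) - \<Omega> / 2 * (norm (of_real (R \<theta>) * cis \<theta> - x0))\<^sup>2 = CU"
    by (rule U.boundary_const[OF V cR per], rule that) blast
  have ES: "norm (E.Tinv (of_real (S \<theta>) * cis \<theta>)) = 1" for \<theta> using S1[of "S \<theta>" \<theta>] Spos[of \<theta>] by simp
  have m1E: "(LINT z|patch E.E. z) = of_real A * x0" and m2E: "(LINT z|patch E.E. z\<^sup>2) = Q + of_real A * x0\<^sup>2"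
    using W.centered_moments[OF E.first_moment] by (simp_all add: areaE QE)
  \<comment> \<open>|Q| is A \<alpha> |\<beta>| with A \<alpha> >= 1: the second moment controls the
    eccentricity.\<close>
  have b: "norm \<beta> \<le> norm Q"
  proof -
    have "(19 / 10) * (1 - 2 * \<delta>) \<le> A * \<alpha>" using A \<alpha> by (intro mult_mono) (auto simp: \<delta>_def)
    then have "1 \<le> A * \<alpha>" by (simp add: \<delta>_def)
    then have "1 * norm \<beta> \<le> A * \<alpha> * norm \<beta>" by (intro mult_right_mono) auto
    then show ?thesis using A \<alpha>0 unfolding Qp p\<beta> by (simp add: norm_mult)
  qed
  have "AE \<theta> in circ. R \<theta> = S \<theta>"
  proof (rule steady_patches_AE_eq[OF _ _ _ CU])
    show "\<bar>\<Omega> - 1 / 4\<bar> \<le> \<kappa>" using \<Omega> by (simp add: \<kappa>_def)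
    show "\<bar>E.\<Omega>E - 1 / 4\<bar> \<le> \<kappa>"
    proof -
      \<comment> \<open>The deficit of Kirchhoff's velocity from the value 1/4 of the disk; its
        numerator is at most |p|.\<close>
      define y where "y = (\<alpha>\<^sup>2 - a) / (4 * \<alpha>\<^sup>2)"
      have "E.\<Omega>E - 1 / 4 = - y" using \<alpha>0 by (simp add: y_def E.\<Omega>E_def Dt field_simps)
      moreover have "0 \<le> y" using \<alpha>b by (simp add: y_def)
      moreover have "y \<le> 18 * \<delta> / (4 * (9 / 10))"
        unfolding y_def using \<alpha>b p apos by (intro frac_le) (auto simp: \<delta>_def)
      then have "y \<le> 5 * \<delta>" by simp
      moreover have "\<kappa> = 100 * \<delta>" by (simp add: \<delta>_def \<kappa>_def)
      ultimately show ?thesis using d.\<kappa> by linarith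
    qed
    show "norm x0 \<le> \<kappa>" using x0 by (simp add: \<delta>_def \<kappa>_def)
    show "pot E.E (of_real (S \<theta>) * cis \<theta>) - E.\<Omega>E / 2 * (norm (of_real (S \<theta>) * cis \<theta> - x0))\<^sup>2 =
      E.Dt / (2 * pi) * ((LINT w|lborel. ln (norm (1 - w)) * indicat_real (ball (0::complex) 1) w) + pi * ln \<alpha>) - E.\<Omega>E / 2 * (\<alpha>\<^sup>2 + (norm \<beta>)\<^sup>2)" for \<theta>
      using E.steady[OF ES[of \<theta>]] unfolding E.T_Tinv .
    show "(LINT z|patch D. z ^ k) = (LINT z|patch E.E. z ^ k)" if k2: "k \<le> 2" for k
    proof -
      consider "k = 0" | "k = 1" | "k = 2" using k2 by linarith
      then show ?thesis
      proof cases
        case 1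
        then show ?thesis using Db by (simp add: measure_patch areaE A_def)
      qed (simp_all add: m1 m1E m2 m2E)
    qed
    show "of_real (\<Omega> - E.\<Omega>E) * Q = of_real (1 / (4 * pi)) *
       ((LINT z|patch D. LINT w|patch D. kratio (z - w)) - (LINT z|patch E.E. LINT w|patch E.E. kratio (z - w)))"
    proof -
      have "of_real E.\<Omega>E * Q = of_real (1 / (4 * pi)) * (of_real (E.Dt\<^sup>2 * pi\<^sup>2) * (\<beta> / of_real \<alpha>))"
        using \<alpha>0 by (simp add: Q\<beta> E.\<Omega>E_def Dt field_simps power2_eq_square)
      moreover have "of_real \<Omega> * Q = of_real (1 / (4 * pi)) * (of_real (4 * pi * \<Omega>) * Q)" by simp
      ultimately show ?thesis unfolding KD E.kratio_double_integral of_real_diff left_diff_distrib right_diff_distrib by (simp only:)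
    qed
    show "0 \<le> norm \<beta>" "norm \<beta> \<le> norm Q" by (simp, rule b)
    show "\<bar>(norm (of_real (S \<theta>) * cis \<theta> - x0))\<^sup>2 - (\<alpha>\<^sup>2 + (norm \<beta>)\<^sup>2)\<bar> \<le> 6 * norm \<beta>" for \<theta>
    proof -
      define w where "w = of_real (S \<theta>) * cis \<theta>"
      have w: "norm (E.Tinv w) = 1" using ES[of \<theta>] by (simp add: w_def)
      have l: "\<alpha> - norm \<beta> \<le> norm (w - x0)" "norm (w - x0) \<le> \<alpha> + norm \<beta>"
        using E.norm_Tinv_le[of w] E.norm_Tinv_ge[of w] by (simp_all add: w)
      \<comment> \<open>The squared distance to the centre lies between the squares of the
        semi-axes, hence within 2 \<alpha> |\<beta>| of \<alpha>^2 + |\<beta>|^2; with \<alpha> <= 3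
        this is 6 |\<beta>|.\<close>
      have "(norm (w - x0))\<^sup>2 \<le> (\<alpha> + norm \<beta>)\<^sup>2" using l by (intro power_mono) auto
      moreover have "(\<alpha> - norm \<beta>)\<^sup>2 \<le> (norm (w - x0))\<^sup>2" using l bA by (intro power_mono) (auto simp: \<delta>_def)
      moreover have "\<alpha> * norm \<beta> \<le> 3 * norm \<beta>" using \<alpha> by (intro mult_right_mono) (auto simp: \<delta>_def)
      ultimately show ?thesis unfolding w_def[symmetric] power2_sum power2_diff by linarith
    qed
  qed
  \<comment> \<open>Both radii are continuous, so equality almost everywhere is equality everywhere;
    then the boundary curves agree, and with them the enclosed regions.\<close>
  then have RS: "R \<theta> = S \<theta>" if "\<theta> \<in> {- pi..pi}" for \<theta> using AE_circ_eq_imp_eq[OF cR cS _ that] by blast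
  have "frontier D = E.T ` sphere 0 1"
  proof (intro equalityI subsetI)
    fix z assume "z \<in> frontier D"
    then have "norm z = R (Arg z)" by (simp add: frD)
    also have "\<dots> = S (Arg z)" using Arg_bounded[of z] by (intro RS) auto
    finally have "norm (E.Tinv (of_real (norm z) * cis (Arg z))) = 1" using S1[OF norm_ge_zero] by blast
    then have "norm (E.Tinv z) = 1" using rcis_cmod_Arg[of z] by (simp add: rcis_def)
    then show "z \<in> E.T ` sphere 0 1" using E.T_Tinv[of z] by (intro image_eqI[of _ _ "E.Tinv z"]) auto
  next
    fix z assume "z \<in> E.T ` sphere 0 1"
    then have "norm (E.Tinv z) = 1" using E.Tinv_T by auto
    then have "norm (E.Tinv (of_real (norm z) * cis (Arg z))) = 1" using rcis_cmod_Arg[of z] by (simp add: rcis_def)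
    then have "norm z = S (Arg z)" using S1[OF norm_ge_zero] by blast
    also have "\<dots> = R (Arg z)" using Arg_bounded[of z] by (intro RS[symmetric]) auto
    finally show "z \<in> frontier D" by (simp add: frD)
  qed
  then have "D = inside (ellipse_curve x0 (Arg \<beta> / 2) (\<alpha> + norm \<beta>) (\<alpha> - norm \<beta>))"
    using ins by (simp add: E.T_sphere)
  moreover have "\<alpha> + norm \<beta> > 0" "\<alpha> - norm \<beta> > 0" using \<alpha>0 E.\<beta>_less by (auto intro: add_pos_nonneg)
  ultimately show ?thesis unfolding is_ellipse_def by blast
qed

theorem theorem1p1:
  shows "\<exists>\<delta>\<^sub>0>0. \<forall>\<delta>. 0 < \<delta> \<and> \<delta> \<le> \<delta>\<^sub>0 \<longrightarrow>
    (\<forall>(D :: complex set) (\<Omega> :: real) (x\<^sub>0 :: complex) (R :: real \<Rightarrow> real).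
       V_state D \<Omega> x\<^sub>0 \<longrightarrow>
       C1_holder_torus (1 / 2) R \<longrightarrow>
       (\<forall>\<theta>. R \<theta> > 0) \<longrightarrow>
       frontier D = (\<lambda>\<theta>. R \<theta> *\<^sub>R Complex (cos \<theta>) (sin \<theta>)) ` {-pi..pi} \<longrightarrow>
       D = inside (frontier D) \<longrightarrow>
       C1_holder_norm (1 / 2) (\<lambda>\<theta>. R \<theta> - 1) \<le> \<delta> \<longrightarrow>
       \<bar>\<Omega> - 1 / 4\<bar> \<le> \<delta> \<longrightarrow>
       is_disk D \<or> is_ellipse D)"
\<comment> \<open>The second alternative always holds, since a circle is an ellipse with equal
  semi-axes.\<close>
proof (intro exI[of _ "1 / 10 ^ 8"] conjI allI impI disjI2)
  fix \<delta> \<Omega> :: real and D x\<^sub>0 and R :: "real \<Rightarrow> real"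
  assume \<delta>: "0 < \<delta> \<and> \<delta> \<le> 1 / 10 ^ 8" and V: "V_state D \<Omega> x\<^sub>0" and h: "C1_holder_torus (1 / 2) R"
    and fr: "frontier D = (\<lambda>\<theta>. R \<theta> *\<^sub>R Complex (cos \<theta>) (sin \<theta>)) ` {-pi..pi}" "D = inside (frontier D)"
    and n: "C1_holder_norm (1 / 2) (\<lambda>\<theta>. R \<theta> - 1) \<le> \<delta>" and \<Omega>: "\<bar>\<Omega> - 1 / 4\<bar> \<le> \<delta>"
  note R = C1_holder_norm_bound[OF h n]
  show "is_ellipse D"
  proof (rule V_state_is_ellipse[OF V R(2,3) _ _ fr])
    show "\<bar>R \<theta> - 1\<bar> \<le> 1 / 10 ^ 8" for \<theta> using R(1)[of \<theta>] \<delta> by linarith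
    show "\<bar>\<Omega> - 1 / 4\<bar> \<le> 1 / 10 ^ 8" using \<Omega> \<delta> by linarith
  qed
qed simp

end
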